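(* Let $\varphi(t)$ be a smooth one-parameter family of $G_2$-structures on a smooth 7-manifold $M$ evolving by the general flow $$\frac{\partial}{\partial t}\varphi_{ijk} = h^l_i\varphi_{ljk} + h^l_j\varphi_{ilk} + h^l_k\varphi_{ijl} + X^l\psi_{lijk},$$ where $h=h(t)$ is a symmetric 2-tensor, $X=X(t)$ is a vector field, and $h^l_i = g^{lm}h_{im}$. Then the torsion form $\tau_1$ (regarded as the 2-form $(\tau_1)_{ij}$) and the torsion form $\tau_2$ evolve by $$\begin{aligned}\frac{\partial}{\partial t}(\tau_1)_{ij} ={}& \pi_7\big(\tfrac12[h,\tau_3]+\tfrac12\{h,\tau_1\}+\tfrac14\{h,\tau_2\}\big)_{ij} + \pi_{14}\big(\{h,\tau_1\}\big)_{ij}\\ &+ \tfrac14\tau_0X_{ij} + \pi_7\big(-\tfrac12\{X,\tau_3\}-\tfrac12[X,\tau_1]+\tfrac1{12}[X,\tau_2]\big)_{ij} + \pi_{14}\big(-\tfrac13[X,\tau_1]\big)_{ij}\\ &- \tfrac16g^{pq}(\nabla_ph_{qk})g^{kl}\varphi_{lij} + \tfrac16(\nabla_k\mathrm{Tr}_g(h))g^{kl}\varphi_{lij} + \tfrac16(\nabla_pX_q)g^{pa}g^{qb}\varphi_{abk}g^{kl}\varphi_{lij}\end{aligned}$$ and $$\begin{aligned}\frac{\partial}{\partial t}(\tau_2)_{ij} ={}& \pi_7\big(\{h,\tau_2\}\big)_{ij} + \pi_{14}\big(-[h,\tau_3]+\{h,\tau_1\}+\tfrac12\{h,\tau_2\}\big)_{ij}\\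 &+ \pi_7\big(-\tfrac13[X,\tau_2]\big)_{ij} + \pi_{14}\big(\{X,\tau_3\}+\tfrac13[X,\tau_1]\big)_{ij}\\ &- (\nabla_kh_{li})g^{ka}g^{lb}\varphi_{abj} + (\nabla_kh_{lj})g^{ka}g^{lb}\varphi_{abi}\\ &- \tfrac13g^{pq}(\nabla_ph_{qk})g^{kl}\varphi_{lij} + \tfrac13(\nabla_k\mathrm{Tr}_g(h))g^{kl}\varphi_{lij}\\ &- \nabla_iX_j + \nabla_jX_i + \tfrac13(\nabla_pX_q)g^{pa}g^{qb}\varphi_{abk}g^{kl}\varphi_{lij}.\end{aligned}$$ Here, inside $[\cdot,\cdot]$ and $\{\cdot,\cdot\}$, $X$ and $\tau_1$ denote the skew-symmetric 2-tensors $X_{ab}$ and $(\tau_1)_{ab}$ defined in the context, while $X_q=g_{qk}X^k$.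
   Context: Index notation in local coordinates $x^1,\dots,x^7$, with the summation convention; forms are written $\alpha=\frac{1}{k!}\alpha_{i_1\cdots i_k}dx^{i_1}\wedge\cdots\wedge dx^{i_k}$. A $G_2$-structure on a smooth 7-manifold $M$ is a smooth 3-form $\varphi$ which at each point is equivalent, under a linear isomorphism $T_xM\cong\mathbb{R}^7$, to $e^{123}+e^{145}+e^{167}+e^{246}-e^{257}-e^{347}-e^{356}$. It determines a unique Riemannian metric $g$ and orientation (volume form $\mathsf{vol}$) by the convention $(u\lrcorner\varphi)\wedge(v\lrcorner\varphi)\wedge\varphi=-6\,g(u,v)\,\mathsf{vol}$. Let $\psi=*\varphi$ (Hodge star) and $\nabla$ the Levi-Civita connection of $g$. In the flow, all of these are determined by $\varphi(t)$ at time $t$. Decomposition of forms: $\Omega^2=\Omega^2_7\oplus\Omega^2_{14}$ (orthogonal), where $\Omega^2_7=\{\beta: \beta_{ij}=X^k\varphi_{kij}\text{ for some vector field }X\}$ and $\Omega^2_{14}=\{\beta:\beta_{ij}g^{ia}g^{jb}\varphi_{abk}=0\}$; $\pi_7,\pi_{14}$ are the projections, given by $\pi_7(\beta)_{ab}=\frac13\beta_{ab}-\frac16\beta_{ij}g^{il}g^{jm}\psi_{lmab}$ and $\pi_{14}(\beta)_{ab}=\frac23\beta_{ab}+\frac16\beta_{ij}g^{il}g^{jm}\psi_{lmab}$. Also $\Omega^3_{27}=\{\frac12 h_{im}g^{ml}\varphi_{ljk}\,dx^i\wedge dx^j\wedge dx^k: h_{ij}=h_{ji},\ g^{ij}h_{ij}=0\}$.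 Torsion forms: the function $\tau_0$, 1-form $\tau_1$, $\tau_2\in\Omega^2_{14}$, $\tau_3\in\Omega^3_{27}$ are uniquely defined by $d\varphi=\tau_0\psi+3\tau_1\wedge\varphi+*\tau_3$ and $d\psi=4\tau_1\wedge\psi+*\tau_2$. In components: $\tau_1=(\tau_1)_l\,dx^l$, also regarded as the skew 2-tensor $(\tau_1)_{ab}=(\tau_1)_lg^{lk}\varphi_{kab}$; $\tau_2=\frac12(\tau_2)_{ab}dx^a\wedge dx^b$; $\tau_3=\frac12(\tau_3)_{im}g^{ml}\varphi_{ljk}dx^i\wedge dx^j\wedge dx^k$ with $(\tau_3)_{im}$ symmetric and traceless. A vector field $X^k$ is also regarded as the skew 2-tensor $X_{ab}=X^l\varphi_{lab}$. For 2-tensors: $\mathrm{Tr}_g(A)=g^{ij}A_{ij}$, $[A,B]_{pq}=A_{pl}g^{lm}B_{mq}-B_{pl}g^{lm}A_{mq}$, $\{A,B\}_{pq}=A_{pl}g^{lm}B_{mq}+B_{pl}g^{lm}A_{mq}$. *)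

theory Defs
  imports "HOL-Analysis.Analysis"
begin

text \<open>\<open>Ck_on k S f\<close> is the usual notion of a map of class \<open>C\<^sup>k\<close> only for open \<open>S\<close>;
  it is applied to open sets throughout.\<close>

primrec Ck_on :: "nat \<Rightarrow> 'a::euclidean_space set \<Rightarrow> ('a \<Rightarrow> 'b::real_normed_vector) \<Rightarrow> bool" where
  "Ck_on 0 S f \<longleftrightarrow> continuous_on S f"
| "Ck_on (Suc k) S f \<longleftrightarrow>
     (\<forall>x\<in>S. f differentiable (at x)) \<and>
     (\<forall>b\<in>Basis. Ck_on k S (\<lambda>x. frechet_derivative f (at x) b))"

definition smooth_on :: "'a::euclidean_space set \<Rightarrow> ('a \<Rightarrow> 'b::real_normed_vector) \<Rightarrow> bool" where
  "smooth_on S f \<longleftrightarrow> (\<forall>k. Ck_on k S f)"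

text \<open>A chart is a domain together with a coordinate map that is only relevant on the domain.\<close>

type_synonym 'm chart = "'m set \<times> ('m \<Rightarrow> real^7)"

definition chart_image :: "'m chart \<Rightarrow> (real^7) set" where
  "chart_image c = snd c ` fst c"

definition transition :: "'m chart \<Rightarrow> 'm chart \<Rightarrow> real^7 \<Rightarrow> real^7" where
  "transition c c' = snd c' \<circ> inv_into (fst c) (snd c)"

definition smooth_manifold7 :: "'m topology \<Rightarrow> 'm chart set \<Rightarrow> bool" where
  "smooth_manifold7 M \<A> \<longleftrightarrow>
     Hausdorff_space M \<and> second_countable M \<and>
     (\<Union>c\<in>\<A>. fst c) = topspace M \<and>
     (\<forall>c\<in>\<A>. openin M (fst c) \<and> open (chart_image c) \<and>
        homeomorphic_map (subtopology M (fst c)) (top_of_set (chart_image c)) (snd c)) \<and>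
     (\<forall>c\<in>\<A>. \<forall>c'\<in>\<A>. smooth_on (snd c ` (fst c \<inter> fst c')) (transition c c'))"

text \<open>The components of a covariant tensor of rank \<open>k\<close> are a function on index lists, of which only
  the values on lists of length \<open>k\<close> matter: \<open>T [i, j]\<close> is \<open>T\<^sub>i\<^sub>j\<close>.  The index type \<open>7\<close> has the seven
  elements \<open>1, \<dots>, 7\<close> (and \<open>7 = 0\<close>).  Forms follow the convention
  \<open>\<alpha> = (1/k!) \<alpha>\<^bsub>i1\<dots>ik\<^esub> dx\<^bsup>i1\<^esup> \<and> \<dots> \<and> dx\<^bsup>ik\<^esup>\<close>.
  A field on a manifold is given by its components at each point of each coordinate domain.\<close>

type_synonym tensor = "7 list \<Rightarrow> real"
type_synonym local_field = "real^7 \<Rightarrow> tensor"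
type_synonym 'm field = "'m chart \<Rightarrow> local_field"
type_synonym 'm vfield = "'m chart \<Rightarrow> real^7 \<Rightarrow> real^7"

definition pd :: "7 \<Rightarrow> (real^7 \<Rightarrow> real) \<Rightarrow> real^7 \<Rightarrow> real" where
  "pd i f x = frechet_derivative f (at x) (axis i 1)"

definition pullback :: "nat \<Rightarrow> real^7^7 \<Rightarrow> tensor \<Rightarrow> tensor" where
  "pullback k L T J = (\<Sum>I | length I = k. (\<Prod>n<k. L $ (I ! n) $ (J ! n)) * T I)"

definition tensor_field :: "'m chart set \<Rightarrow> nat \<Rightarrow> 'm field \<Rightarrow> bool" where
  "tensor_field \<A> k T \<longleftrightarrow>
     (\<forall>c\<in>\<A>. \<forall>I. length I = k \<longrightarrow> smooth_on (chart_image c) (\<lambda>x. T c x I)) \<and>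
     (\<forall>c\<in>\<A>. \<forall>c'\<in>\<A>. \<forall>p \<in> fst c \<inter> fst c'. \<forall>J. length J = k \<longrightarrow>
        T c' (snd c' p) J =
          pullback k (jacobian (transition c' c) (at (snd c' p))) (T c (snd c p)) J)"

definition vector_field :: "'m chart set \<Rightarrow> 'm vfield \<Rightarrow> bool" where
  "vector_field \<A> X \<longleftrightarrow>
     (\<forall>c\<in>\<A>. smooth_on (chart_image c) (X c)) \<and>
     (\<forall>c\<in>\<A>. \<forall>c'\<in>\<A>. \<forall>p \<in> fst c \<inter> fst c'.
        X c' (snd c' p) = jacobian (transition c c') (at (snd c p)) *v X c (snd c p))"

definition alternating :: "nat \<Rightarrow> tensor \<Rightarrow> bool" where
  "alternating k T \<longleftrightarrow>
     (\<forall>I m n. length I = k \<and> m < n \<and> n < k \<longrightarrow> T (I[m := I ! n, n := I ! m]) = - T I)"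

definition symmetric2 :: "tensor \<Rightarrow> bool" where
  "symmetric2 T \<longleftrightarrow> (\<forall>i j. T [i, j] = T [j, i])"

definition form_field :: "'m chart set \<Rightarrow> nat \<Rightarrow> 'm field \<Rightarrow> bool" where
  "form_field \<A> k \<alpha> \<longleftrightarrow>
     tensor_field \<A> k \<alpha> \<and> (\<forall>c\<in>\<A>. \<forall>x\<in>chart_image c. alternating k (\<alpha> c x))"

definition symmetric_field :: "'m chart set \<Rightarrow> 'm field \<Rightarrow> bool" where
  "symmetric_field \<A> T \<longleftrightarrow>
     tensor_field \<A> 2 T \<and> (\<forall>c\<in>\<A>. \<forall>x\<in>chart_image c. symmetric2 (T c x))"

text \<open>Wedge product of a \<open>k\<close>-form with an \<open>l\<close>-form as a sum over \<open>(k, l)\<close>-shuffles: \<open>S\<close> is the set of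
  positions given to the first factor, and the exponent is the number of inversions of the
  shuffle.  For alternating arguments this is \<open>1/(k! l!)\<close> times the signed sum over all permutations.\<close>

definition wedge :: "nat \<Rightarrow> tensor \<Rightarrow> tensor \<Rightarrow> tensor" where
  "wedge k \<alpha> \<beta> I =
     (\<Sum>S | S \<subseteq> {..<length I} \<and> card S = k.
        (-1) ^ card {(a, b). a \<in> S \<and> b < a \<and> b \<notin> S} * \<alpha> (nths I S) * \<beta> (nths I (- S)))"

definition interior :: "real^7 \<Rightarrow> tensor \<Rightarrow> tensor" where
  "interior u \<alpha> I = (\<Sum>i\<in>UNIV. u $ i * \<alpha> (i # I))"

definition extd :: "local_field \<Rightarrow> local_field" where
  "extd \<alpha> x I = (\<Sum>n<length I. (-1) ^ n * pd (I ! n) (\<lambda>y. \<alpha> y (nths I (- {n}))) x)"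

definition gmat :: "tensor \<Rightarrow> real^7^7" where
  "gmat g = (\<chi> i j. g [i, j])"

definition ginv :: "tensor \<Rightarrow> 7 \<Rightarrow> 7 \<Rightarrow> real" where
  "ginv g i j = matrix_inv (gmat g) $ i $ j"

text \<open>\<open>(*\<alpha>)\<^sub>J = (1/k!) g\<^bsup>i1 m1\<^esup> \<dots> g\<^bsup>ik mk\<^esup> \<alpha>\<^bsub>m1\<dots>mk\<^esub> vol\<^bsub>i1\<dots>ik J\<^esub>\<close>, so that \<open>\<alpha> \<and> *\<beta> = \<langle>\<alpha>, \<beta>\<rangle> vol\<close>.\<close>

definition hodge :: "nat \<Rightarrow> tensor \<Rightarrow> tensor \<Rightarrow> tensor \<Rightarrow> tensor" where
  "hodge k g vol \<alpha> J =
     (1 / fact k) * (\<Sum>I | length I = k. \<Sum>K | length K = k.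
        (\<Prod>n<k. ginv g (I ! n) (K ! n)) * \<alpha> K * vol (I @ J))"

definition christoffel :: "local_field \<Rightarrow> real^7 \<Rightarrow> 7 \<Rightarrow> 7 \<Rightarrow> 7 \<Rightarrow> real" where
  "christoffel g x k i j = (1/2) * (\<Sum>l\<in>UNIV. ginv (g x) k l *
     (pd i (\<lambda>y. g y [j, l]) x + pd j (\<lambda>y. g y [i, l]) x - pd l (\<lambda>y. g y [i, j]) x))"

text \<open>\<open>nabla g T x p I\<close> is \<open>\<nabla>\<^sub>p T\<^sub>I\<close> at the point \<open>x\<close>.\<close>

definition nabla :: "local_field \<Rightarrow> local_field \<Rightarrow> real^7 \<Rightarrow> 7 \<Rightarrow> 7 list \<Rightarrow> real" where
  "nabla g T x p I =
     pd p (\<lambda>y. T y I) x -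
     (\<Sum>n<length I. \<Sum>m\<in>UNIV. christoffel g x m p (I ! n) * T x (I[n := m]))"

definition cov :: "7 \<Rightarrow> tensor" where
  "cov a I = (if I = [a] then 1 else 0)"

definition e3 :: "7 \<Rightarrow> 7 \<Rightarrow> 7 \<Rightarrow> tensor" where
  "e3 a b c = wedge 1 (cov a) (wedge 1 (cov b) (cov c))"

definition phi0 :: tensor where
  "phi0 I = e3 1 2 3 I + e3 1 4 5 I + e3 1 6 7 I + e3 2 4 6 I
            - e3 2 5 7 I - e3 3 4 7 I - e3 3 5 6 I"

definition G2_structure :: "'m chart set \<Rightarrow> 'm field \<Rightarrow> bool" where
  "G2_structure \<A> \<phi> \<longleftrightarrow> form_field \<A> 3 \<phi> \<and>
     (\<forall>c\<in>\<A>. \<forall>x\<in>chart_image c. \<exists>L :: real^7^7. invertible L \<and>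
        (\<forall>I. length I = 3 \<longrightarrow> \<phi> c x I = pullback 3 L phi0 I))"

text \<open>With this sign convention, the form \<open>phi0\<close> has the Euclidean metric and
  \<open>vol = - e\<^sup>1 \<and> \<dots> \<and> e\<^sup>7\<close>.\<close>

definition G2_metric_volume :: "'m chart set \<Rightarrow> 'm field \<Rightarrow> 'm field \<Rightarrow> 'm field \<Rightarrow> bool" where
  "G2_metric_volume \<A> \<phi> g vol \<longleftrightarrow>
     symmetric_field \<A> g \<and> form_field \<A> 7 vol \<and>
     (\<forall>c\<in>\<A>. \<forall>x\<in>chart_image c.
        (\<forall>u. u \<noteq> 0 \<longrightarrow> u \<bullet> (gmat (g c x) *v u) > 0) \<and>
        (vol c x [1, 2, 3, 4, 5, 6, 7])\<^sup>2 = det (gmat (g c x)) \<and>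
        (\<forall>u v I. length I = 7 \<longrightarrow>
           wedge 4 (wedge 2 (interior u (\<phi> c x)) (interior v (\<phi> c x))) (\<phi> c x) I
             = - 6 * (u \<bullet> (gmat (g c x) *v v)) * vol c x I))"

text \<open>The tensors of rank two below are meant at index lists \<open>I = [p, q]\<close>.\<close>

definition trace_g :: "tensor \<Rightarrow> tensor \<Rightarrow> real" where
  "trace_g g A = (\<Sum>i\<in>UNIV. \<Sum>j\<in>UNIV. ginv g i j * A [i, j])"

definition comm :: "tensor \<Rightarrow> tensor \<Rightarrow> tensor \<Rightarrow> tensor" where
  "comm g A B I = (\<Sum>l\<in>UNIV. \<Sum>m\<in>UNIV.
     A [I ! 0, l] * ginv g l m * B [m, I ! 1] - B [I ! 0, l] * ginv g l m * A [m, I ! 1])"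

definition acomm :: "tensor \<Rightarrow> tensor \<Rightarrow> tensor \<Rightarrow> tensor" where
  "acomm g A B I = (\<Sum>l\<in>UNIV. \<Sum>m\<in>UNIV.
     A [I ! 0, l] * ginv g l m * B [m, I ! 1] + B [I ! 0, l] * ginv g l m * A [m, I ! 1])"

definition contract_psi :: "tensor \<Rightarrow> tensor \<Rightarrow> tensor \<Rightarrow> tensor" where
  "contract_psi g \<psi> \<beta> I = (\<Sum>i\<in>UNIV. \<Sum>j\<in>UNIV. \<Sum>l\<in>UNIV. \<Sum>m\<in>UNIV.
     \<beta> [i, j] * ginv g i l * ginv g j m * \<psi> [l, m, I ! 0, I ! 1])"

definition pi7 :: "tensor \<Rightarrow> tensor \<Rightarrow> tensor \<Rightarrow> tensor" where
  "pi7 g \<psi> \<beta> I = (1/3) * \<beta> I - (1/6) * contract_psi g \<psi> \<beta> I"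

definition pi14 :: "tensor \<Rightarrow> tensor \<Rightarrow> tensor \<Rightarrow> tensor" where
  "pi14 g \<psi> \<beta> I = (2/3) * \<beta> I + (1/6) * contract_psi g \<psi> \<beta> I"

definition covector_skew :: "tensor \<Rightarrow> tensor \<Rightarrow> tensor \<Rightarrow> tensor" where
  "covector_skew g \<phi> \<alpha> I = (\<Sum>l\<in>UNIV. \<Sum>k\<in>UNIV. \<alpha> [l] * ginv g l k * \<phi> [k, I ! 0, I ! 1])"

definition vector_skew :: "tensor \<Rightarrow> real^7 \<Rightarrow> tensor" where
  "vector_skew \<phi> X I = (\<Sum>l\<in>UNIV. X $ l * \<phi> [l, I ! 0, I ! 1])"

definition lower :: "tensor \<Rightarrow> real^7 \<Rightarrow> tensor" where
  "lower g X I = (\<Sum>k\<in>UNIV. g [I ! 0, k] * X $ k)"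

definition raise1 :: "tensor \<Rightarrow> tensor \<Rightarrow> 7 \<Rightarrow> 7 \<Rightarrow> real" where
  "raise1 g h l i = (\<Sum>m\<in>UNIV. ginv g l m * h [i, m])"

text \<open>For symmetric \<open>h\<close> these are the components of the 3-form
  \<open>(1/2) h\<^bsub>im\<^esub> g\<^bsup>ml\<^esup> \<phi>\<^bsub>ljk\<^esub> dx\<^sup>i \<and> dx\<^sup>j \<and> dx\<^sup>k\<close>: its coefficients are skew in \<open>j, k\<close>, so that
  skew-symmetrising them in \<open>i, j, k\<close> leaves the three cyclic terms.\<close>

definition sym_to_3form :: "tensor \<Rightarrow> tensor \<Rightarrow> tensor \<Rightarrow> tensor" where
  "sym_to_3form g \<phi> h I = (\<Sum>l\<in>UNIV.
       raise1 g h l (I ! 0) * \<phi> [l, I ! 1, I ! 2]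
     + raise1 g h l (I ! 1) * \<phi> [I ! 0, l, I ! 2]
     + raise1 g h l (I ! 2) * \<phi> [I ! 0, I ! 1, l])"

text \<open>\<open>\<tau>0\<close> is a tensor field of rank \<open>0\<close>, with component at \<open>[]\<close>, and \<open>\<tau>3\<close> is the symmetric
  traceless 2-tensor; the torsion 3-form is \<open>sym_to_3form g \<phi> \<tau>3\<close>.\<close>

definition torsion_forms ::
  "'m chart set \<Rightarrow> 'm field \<Rightarrow> 'm field \<Rightarrow> 'm field \<Rightarrow>
   'm field \<Rightarrow> 'm field \<Rightarrow> 'm field \<Rightarrow> 'm field \<Rightarrow> bool" where
  "torsion_forms \<A> \<phi> g vol \<tau>0 \<tau>1 \<tau>2 \<tau>3 \<longleftrightarrow>
     tensor_field \<A> 0 \<tau>0 \<and> form_field \<A> 1 \<tau>1 \<and> form_field \<A> 2 \<tau>2 \<and> symmetric_field \<A> \<tau>3 \<and>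
     (\<forall>c\<in>\<A>. \<forall>x\<in>chart_image c.
        (\<forall>k. (\<Sum>i\<in>UNIV. \<Sum>j\<in>UNIV. \<Sum>a\<in>UNIV. \<Sum>b\<in>UNIV.
             \<tau>2 c x [i, j] * ginv (g c x) i a * ginv (g c x) j b * \<phi> c x [a, b, k]) = 0) \<and>
        trace_g (g c x) (\<tau>3 c x) = 0 \<and>
        (\<forall>I. length I = 4 \<longrightarrow>
           extd (\<phi> c) x I =
             \<tau>0 c x [] * hodge 3 (g c x) (vol c x) (\<phi> c x) I
             + 3 * wedge 1 (\<tau>1 c x) (\<phi> c x) I
             + hodge 3 (g c x) (vol c x) (sym_to_3form (g c x) (\<phi> c x) (\<tau>3 c x)) I) \<and>
        (\<forall>I. length I = 5 \<longrightarrow>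
           extd (\<lambda>y. hodge 3 (g c y) (vol c y) (\<phi> c y)) x I =
             4 * wedge 1 (\<tau>1 c x) (hodge 3 (g c x) (vol c x) (\<phi> c x)) I
             + hodge 2 (g c x) (vol c x) (\<tau>2 c x) I))"

definition smooth_G2_family :: "'m chart set \<Rightarrow> real set \<Rightarrow> (real \<Rightarrow> 'm field) \<Rightarrow> bool" where
  "smooth_G2_family \<A> T \<phi> \<longleftrightarrow>
     (\<forall>t\<in>T. G2_structure \<A> (\<phi> t)) \<and>
     (\<forall>c\<in>\<A>. \<forall>I. length I = 3 \<longrightarrow>
        smooth_on (T \<times> chart_image c) (\<lambda>(t, x). \<phi> t c x I))"

definition G2_flow ::
  "'m chart set \<Rightarrow> real set \<Rightarrow> (real \<Rightarrow> 'm field) \<Rightarrow> (real \<Rightarrow> 'm field) \<Rightarrow> (real \<Rightarrow> 'm field) \<Rightarrow>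
   (real \<Rightarrow> 'm field) \<Rightarrow> (real \<Rightarrow> 'm vfield) \<Rightarrow> bool" where
  "G2_flow \<A> T \<phi> g vol h X \<longleftrightarrow>
     (\<forall>t\<in>T. \<forall>c\<in>\<A>. \<forall>x\<in>chart_image c. \<forall>i j k.
        ((\<lambda>s. \<phi> s c x [i, j, k]) has_real_derivative
          (\<Sum>l\<in>UNIV.
               raise1 (g t c x) (h t c x) l i * \<phi> t c x [l, j, k]
             + raise1 (g t c x) (h t c x) l j * \<phi> t c x [i, l, k]
             + raise1 (g t c x) (h t c x) l k * \<phi> t c x [i, j, l]
             + X t c x $ l * hodge 3 (g t c x) (vol t c x) (\<phi> t c x) [l, i, j, k])) (at t))"

end

theory Submission
  imports Defs "HOL-Combinatorics.List_Permutation"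
begin

text \<open>
  The torsion forms are read off from \<open>\<beta> = d\<psi>\<close>: contracting the first three indices of \<open>\<beta>\<close> with \<open>\<phi>\<close>
  gives \<open>-48 \<tau>\<^sub>1 + 6 \<tau>\<^sub>2\<close>, so it suffices to differentiate \<open>\<beta>\<close>.  Write \<open>act A\<close> for the derivation of
  covariant tensors induced by an endomorphism \<open>A\<close>.  The flow is \<open>\<phi>' = act A \<phi>\<close> with
  \<open>A = h - (1/3) X \<lrcorner> \<phi>\<close> (one index raised), and since \<open>g\<close> and \<open>\<psi>\<close> depend naturally on \<open>\<phi>\<close>, also
  \<open>g' = act A g\<close> and \<open>\<psi>' = act A \<psi>\<close>.  In space, \<open>\<partial>\<^sub>p \<phi> = act (K\<^sub>p + \<Gamma>\<^sub>p) \<phi>\<close> for endomorphisms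
  \<open>K\<^sub>p\<close> that are skew with respect to \<open>g\<close>, and likewise for \<open>\<psi>\<close>; thus \<open>K\<close> is the intrinsic torsion.
  Exchanging \<open>\<partial>\<^sub>t\<close> and \<open>d\<close> yields \<open>\<beta>' = act A \<beta> + \<Omega>\<close>, where \<open>\<Omega>\<close> is the skew-symmetrisation over \<open>p\<close> of
  \<open>act (\<nabla>\<^sub>p A - A\<^sub>p\<^sup>q K\<^sub>q) \<psi>\<close>.  The term \<open>act A\<close> commutes with the contractions and projections, and
  the contraction of \<open>\<Omega>\<close> with \<open>\<phi>\<close> is computed in a frame in which \<open>\<phi>\<close> and \<open>g\<close> are standard, where
  \<open>K\<close> is eliminated in favour of the torsion forms.
\<close>

text \<open>Joint regularity in time and space is assumed of \<phi> alone; metric, volume form and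
  torsion forms are given time by time, so their differentiability in time has to be produced. The
  volume form is a ninth root of a determinant polynomial in \<phi>, and g and \<psi> are rational
  in \<phi> and this root, hence jointly C^2; the torsion forms are then algebraic in \<phi>, g,
  \<psi> and the first space derivatives of \<psi>. An endomorphism A with \<phi>' = act A \<phi> is
  determined only up to the stabiliser algebra g2. This is harmless, since g2 also annihilates g and
  \<psi>, and it is useful: any C_p with \<partial>_p \<phi> = act C_p \<phi> acts on g as the
  Christoffel symbols do, so that the difference of the two is skew and can serve as K_p. The 1/3 in
  A arises because X \<lrcorner> \<phi>, as a skew endomorphism, acts on \<phi> as -3 X \<lrcorner>
  \<psi>. While d\<psi> determines tau_1 and tau_2, the symmetric part of the torsion comes from
  d\<phi>, which brings tau_0 and tau_3 into the right-hand sides.\<close>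

lemma finite_lists_UNIV [simp]: "finite {I :: 'a::finite list. length I = k}"
  using finite_lists_length_eq[of "UNIV :: 'a set" k] by simp

section \<open>Sums over index lists\<close>

lemma sum_rotate3: "(\<Sum>l\<in>A. \<Sum>m\<in>B. \<Sum>a\<in>C. f l m a) = (\<Sum>a\<in>C. \<Sum>l\<in>A. \<Sum>m\<in>B. f l m a)"
proof -
  have "(\<Sum>l\<in>A. \<Sum>m\<in>B. \<Sum>a\<in>C. f l m a) = (\<Sum>l\<in>A. \<Sum>a\<in>C. \<Sum>m\<in>B. f l m a)"
    by (rule sum.cong[OF refl], rule sum.swap)
  also have "\<dots> = (\<Sum>a\<in>C. \<Sum>l\<in>A. \<Sum>m\<in>B. f l m a)" by (rule sum.swap)
  finally show ?thesis .
qed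

lemma sum_rotate4: "(\<Sum>l\<in>A. \<Sum>m\<in>B. \<Sum>a\<in>C. \<Sum>b\<in>D. f l m a b) = (\<Sum>b\<in>D. \<Sum>l\<in>A. \<Sum>m\<in>B. \<Sum>a\<in>C. f l m a b)"
proof -
  have "(\<Sum>l\<in>A. \<Sum>m\<in>B. \<Sum>a\<in>C. \<Sum>b\<in>D. f l m a b) = (\<Sum>l\<in>A. \<Sum>b\<in>D. \<Sum>m\<in>B. \<Sum>a\<in>C. f l m a b)"
    by (rule sum.cong[OF refl], rule sum_rotate3)
  also have "\<dots> = (\<Sum>b\<in>D. \<Sum>l\<in>A. \<Sum>m\<in>B. \<Sum>a\<in>C. f l m a b)" by (rule sum.swap)
  finally show ?thesis .
qed

lemma sum_lists_0: "(\<Sum>I | length I = 0. f I) = f ([] :: 'a list)"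
proof -
  have "{I :: 'a list. length I = 0} = {[]}" by auto
  then show ?thesis by simp
qed

lemma sum_lists_Suc:
  "(\<Sum>I | length I = Suc k. f I) = (\<Sum>x\<in>UNIV. \<Sum>I | length I = k. f (x # I))"
  for f :: "'a::finite list \<Rightarrow> 'b::comm_monoid_add"
proof -
  have *: "{I :: 'a list. length I = Suc k} = (\<lambda>(x, I). x # I) ` (UNIV \<times> {I. length I = k})"
    by (auto simp: image_iff length_Suc_conv)
  show ?thesis
    unfolding * by (subst sum.reindex) (auto simp: inj_on_def sum.cartesian_product comp_def case_prod_beta)
qed

section \<open>Pullback, naturality of the Hodge star and of contractions\<close>

fun pb :: "real^7^7 \<Rightarrow> tensor \<Rightarrow> tensor" where
  "pb L T [] = T []"
| "pb L T (x # J) = (\<Sum>a\<in>UNIV. L $ a $ x * pb L (\<lambda>P. T (a # P)) J)"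

text \<open>Peeling off one index at a time replaces products over positions, so the laws of
  pullback follow by induction on the index list; the degree is read off from J.\<close>

lemma pullback_eq_pb: "length J = k \<Longrightarrow> pullback k L T J = pb L T J"
proof (induction J arbitrary: k T)
  case Nil
  then show ?case by (auto simp: pullback_def sum_lists_0[simplified])
next
  case (Cons x J)
  then obtain m where k: "k = Suc m" "length J = m" by auto
  have "pullback k L T (x # J) = (\<Sum>a\<in>UNIV. L $ a $ x * pullback m L (\<lambda>P. T (a # P)) J)"
    by (simp add: pullback_def k sum_lists_Suc prod.lessThan_Suc_shift sum_distrib_left mult.assoc del: prod.lessThan_Suc)
  then show ?case using Cons.IH[OF k(2)] by simp
qed

lemma pb_cong: "(\<And>I. length I = length J \<Longrightarrow> T I = S I) \<Longrightarrow> pb L T J = pb L S J"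
proof (induction J arbitrary: T S)
  case (Cons x J)
  have "pb L (\<lambda>P. T (a # P)) J = pb L (\<lambda>P. S (a # P)) J" for a
    by (rule Cons.IH) (simp add: Cons.prems)
  then show ?case by simp
qed simp

lemma pb_add: "pb L (\<lambda>I. T I + S I) J = pb L T J + pb L S J"
  by (induction J arbitrary: T S) (auto simp: sum.distrib algebra_simps)

lemma pb_scale: "pb L (\<lambda>I. c * T I) J = c * pb L T J"
  by (induction J arbitrary: T) (auto simp: sum_distrib_left algebra_simps)

lemma pb_scale_right: "pb L (\<lambda>I. T I * c) J = pb L T J * c"
  using pb_scale[of L c T J] by (simp add: mult.commute)

lemma pb_uminus: "pb L (\<lambda>I. - T I) J = - pb L T J"
  using pb_scale[of L "-1" T J] by simp

lemma pb_diff: "pb L (\<lambda>I. T I - S I) J = pb L T J - pb L S J"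
  using pb_add[of L T "\<lambda>I. - S I" J] by (simp add: pb_uminus)

lemma pb_zero: "pb L (\<lambda>I. 0) J = 0"
  using pb_scale[of L 0 "\<lambda>I. 0" J] by simp

lemma pb_sum: "pb L (\<lambda>I. \<Sum>i\<in>A. T i I) J = (\<Sum>i\<in>A. pb L (T i) J)"
  by (induction A rule: infinite_finite_induct) (auto simp: pb_zero pb_add)

lemma pb_pb: "pb L (pb M T) J = pb (M ** L) T J"
proof (induction J arbitrary: T)
  case (Cons x J)
  have "pb L (pb M T) (x # J) =
      (\<Sum>a\<in>UNIV. L $ a $ x * (\<Sum>b\<in>UNIV. M $ b $ a * pb (M ** L) (\<lambda>P. T (b # P)) J))"
    by (simp add: pb_sum pb_scale Cons.IH)
  also have "\<dots> = (\<Sum>b\<in>UNIV. (\<Sum>a\<in>UNIV. M $ b $ a * L $ a $ x) * pb (M ** L) (\<lambda>P. T (b # P)) J)"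
    unfolding sum_distrib_left sum_distrib_right by (subst sum.swap) (simp add: algebra_simps)
  finally show ?case by (simp add: matrix_matrix_mult_def)
qed auto

lemma pb_id: "pb (mat 1) T J = T J"
proof (induction J arbitrary: T)
  case (Cons x J)
  have "(\<Sum>a\<in>UNIV. mat 1 $ a $ x * T (a # J)) = (\<Sum>a\<in>UNIV. if a = x then T (x # J) else 0)"
    by (rule sum.cong) (auto simp: mat_def)
  then show ?case by (simp add: Cons.IH)
qed auto

lemma pb_inverse: "M ** L = mat 1 \<Longrightarrow> pb L (pb M T) J = T J"
  by (simp add: pb_pb pb_id)

lemma pb_append: "pb L T (I @ J) = pb L (\<lambda>P. pb L (\<lambda>Q. T (P @ Q)) J) I"
  by (induction I arbitrary: T) auto

text \<open>Each matrix entry in a full contraction may be charged to either factor. In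
  \<open>hodge_pb\<close> this moves a change of frame from the raised form to the volume form,
  where it cancels.\<close>

lemma sum_pb_adjoint:
  "(\<Sum>I | length I = k. pb A \<alpha> I * \<beta> I) = (\<Sum>I | length I = k. \<alpha> I * pb (transpose A) \<beta> I)"
proof (induction k arbitrary: \<alpha> \<beta>)
  case (Suc k)
  have "(\<Sum>I | length I = Suc k. pb A \<alpha> I * \<beta> I)
      = (\<Sum>x\<in>UNIV. \<Sum>a\<in>UNIV. A $ a $ x * (\<Sum>I | length I = k. pb A (\<lambda>P. \<alpha> (a # P)) I * \<beta> (x # I)))"
    unfolding sum_lists_Suc pb.simps sum_distrib_right sum_distrib_left
    by (subst (2) sum.swap) (simp add: mult.assoc)
  also have "\<dots> = (\<Sum>a\<in>UNIV. \<Sum>x\<in>UNIV. A $ a $ x *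
      (\<Sum>I | length I = k. \<alpha> (a # I) * pb (transpose A) (\<lambda>P. \<beta> (x # P)) I))"
    unfolding Suc.IH by (rule sum.swap)
  also have "\<dots> = (\<Sum>I | length I = Suc k. \<alpha> I * pb (transpose A) \<beta> I)"
    unfolding sum_lists_Suc pb.simps sum_distrib_right sum_distrib_left
    by (subst (2) sum.swap) (simp add: transpose_def algebra_simps)
  finally show ?case .
qed (simp add: sum_lists_0[simplified])

text \<open>Raising all indices is itself a pullback, by the transposed inverse Gram matrix, which
  brings the Hodge star under the calculus of \<open>pb\<close>.\<close>

lemma hodge_eq_pb:
  "hodge k g vol \<alpha> J =
     (1 / fact k) * (\<Sum>I | length I = k. pb (transpose (matrix_inv (gmat g))) \<alpha> I * vol (I @ J))"
proof -
  have "pb (transpose (matrix_inv (gmat g))) \<alpha> I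
      = (\<Sum>K | length K = k. (\<Prod>n<k. ginv g (I ! n) (K ! n)) * \<alpha> K)" if "length I = k" for I
    unfolding pullback_eq_pb[OF that, symmetric] pullback_def
    by (simp add: ginv_def transpose_def)
  then show ?thesis unfolding hodge_def by (simp add: sum_distrib_right cong: conj_cong)
qed

lemma matrix_inv:
  assumes "invertible (A :: real^'n^'n)"
  shows "A ** matrix_inv A = mat 1" "matrix_inv A ** A = mat 1"
proof -
  have "\<exists>B. A ** B = mat 1 \<and> B ** A = mat 1" using assms unfolding invertible_def by blast
  from someI_ex[OF this] show "A ** matrix_inv A = mat 1" "matrix_inv A ** A = mat 1"
    unfolding matrix_inv_def by auto
qed

lemma matrix_inv_eqI:
  assumes "A ** B = mat 1" shows "matrix_inv A = (B :: real^'n^'n)"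
proof -
  have BA: "B ** A = mat 1" using assms by (simp add: matrix_left_right_inverse)
  then have "invertible A" using assms invertible_def by blast
  then have "matrix_inv A = B ** A ** matrix_inv A" by (simp add: BA)
  also have "\<dots> = B" using matrix_inv[OF \<open>invertible A\<close>] by (simp add: matrix_mul_assoc[symmetric])
  finally show ?thesis .
qed

lemma matrix_inv_congruence:
  fixes G L M :: "real^'n^'n::finite"
  assumes "invertible G" "L ** M = mat 1"
  shows "matrix_inv (transpose L ** G ** L) = M ** matrix_inv G ** transpose M"
proof (rule matrix_inv_eqI)
  have M_L: "transpose L ** transpose M = mat 1"
    by (metis assms(2) matrix_left_right_inverse matrix_transpose_mul transpose_mat)
  have "transpose L ** G ** L ** (M ** matrix_inv G ** transpose M)
      = transpose L ** (G ** (L ** M) ** matrix_inv G) ** transpose M"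
    by (simp add: matrix_mul_assoc)
  also have "\<dots> = mat 1"
    using M_L assms by (simp add: matrix_inv)
  finally show "transpose L ** G ** L ** (M ** matrix_inv G ** transpose M) = mat 1" .
qed

text \<open>The inverse metric transforms by M on both sides. One M cancels the L in the pulled-back
  form; the other is moved by adjointness to the first k slots of the volume form and cancels the L
  there, which leaves L on the free slots. The volume form is pulled back as a tensor, so no
  determinant appears.\<close>

lemma hodge_pb:
  assumes g: "gmat g' = transpose L ** gmat g ** L" and G: "invertible (gmat g)"
    and L: "L ** M = mat 1" and J: "length J + k = 7"
    and vol: "\<And>I. length I = 7 \<Longrightarrow> vol' I = pb L vol I"
    and \<alpha>: "\<And>I. length I = k \<Longrightarrow> \<alpha>' I = pb L \<alpha> I"
  shows "hodge k g' vol' \<alpha>' J = pb L (hodge k g vol \<alpha>) J"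
proof -
  define N where "N = transpose (matrix_inv (gmat g))"
  have M_L: "M ** L = mat 1" using L by (simp add: matrix_left_right_inverse)
  have L_Mt: "transpose L ** transpose M = mat 1"
    using M_L by (metis matrix_transpose_mul transpose_mat)
  have N': "L ** transpose (matrix_inv (gmat g')) = N ** transpose M"
    unfolding g matrix_inv_congruence[OF G L] N_def
    by (simp add: matrix_transpose_mul matrix_mul_assoc L)
  have a: "pb (transpose (matrix_inv (gmat g'))) \<alpha>' I = pb (transpose M) (pb N \<alpha>) I"
    if "length I = k" for I
  proof -
    have "pb (transpose (matrix_inv (gmat g'))) \<alpha>' I
        = pb (transpose (matrix_inv (gmat g'))) (pb L \<alpha>) I"
      using \<alpha> that by (intro pb_cong) auto
    then show ?thesis by (simp add: pb_pb N')
  qed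
  have "(\<Sum>I | length I = k. pb (transpose (matrix_inv (gmat g'))) \<alpha>' I * vol' (I @ J))
      = (\<Sum>I | length I = k. pb (transpose M) (pb N \<alpha>) I * pb L vol (I @ J))"
    using J by (intro sum.cong) (auto simp: a vol)
  also have "\<dots> = (\<Sum>I | length I = k. pb N \<alpha> I * pb M (\<lambda>I. pb L vol (I @ J)) I)"
    by (subst sum_pb_adjoint) simp
  also have "\<dots> = (\<Sum>I | length I = k. pb N \<alpha> I * pb L (\<lambda>Q. vol (I @ Q)) J)"
    unfolding pb_append by (simp add: pb_inverse[OF L])
  also have "\<dots> = pb L (\<lambda>J. \<Sum>I | length I = k. pb N \<alpha> I * vol (I @ J)) J"
    by (simp add: pb_sum pb_scale)
  finally show ?thesis
    unfolding hodge_eq_pb N_def[symmetric] pb_scale by simp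
qed

text \<open>Two-list tensors are contracted in their first slots, so multiple contractions are
  nested ones. In this shape one naturality lemma and one derivative lemma serve all the
  contractions of the theorem.\<close>

definition ctr :: "tensor \<Rightarrow> (7 list \<Rightarrow> tensor) \<Rightarrow> 7 list \<Rightarrow> tensor" where
  "ctr g R I J = (\<Sum>l\<in>UNIV. \<Sum>m\<in>UNIV. ginv g l m * R (l # I) (m # J))"

definition pb2 :: "real^7^7 \<Rightarrow> (7 list \<Rightarrow> tensor) \<Rightarrow> 7 list \<Rightarrow> tensor" where
  "pb2 L R I J = pb L (\<lambda>P. pb L (R P) J) I"

lemma sum_mult_mat: "(\<Sum>a\<in>UNIV. (mat 1 :: real^'n^'n) $ a $ b * f a) = f b"
    "(\<Sum>a\<in>UNIV. (mat 1 :: real^'n^'n) $ b $ a * f a) = f b"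
proof -
  have "(\<Sum>a\<in>UNIV. (mat 1 :: real^'n^'n) $ a $ b * f a) = (\<Sum>a\<in>UNIV. if a = b then f b else 0)"
    by (rule sum.cong) (auto simp: mat_def)
  then show "(\<Sum>a\<in>UNIV. (mat 1 :: real^'n^'n) $ a $ b * f a) = f b" by simp
  have "(\<Sum>a\<in>UNIV. (mat 1 :: real^'n^'n) $ b $ a * f a) = (\<Sum>a\<in>UNIV. if a = b then f b else 0)"
    by (rule sum.cong) (auto simp: mat_def)
  then show "(\<Sum>a\<in>UNIV. (mat 1 :: real^'n^'n) $ b $ a * f a) = f b" by simp
qed

lemma ctr_pb:
  assumes g: "gmat g' = transpose L ** gmat g ** L" and G: "invertible (gmat g)"
    and L: "L ** M = mat 1"
    and R: "\<And>P Q. length P = Suc (length I) \<Longrightarrow> length Q = Suc (length J) \<Longrightarrow> R' P Q = pb2 L R P Q"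
  shows "ctr g' R' I J = pb2 L (ctr g R) I J"
proof -
  have L_Mt: "transpose M ** transpose L = mat 1"
    using L by (metis matrix_transpose_mul transpose_mat)
  have "L ** matrix_inv (gmat g') ** transpose L
      = (L ** M) ** matrix_inv (gmat g) ** (transpose M ** transpose L)"
    unfolding g matrix_inv_congruence[OF G L] by (simp add: matrix_mul_assoc)
  then have inv: "L ** matrix_inv (gmat g') ** transpose L = matrix_inv (gmat g)"
    by (simp add: L L_Mt)
  have inv': "(\<Sum>l\<in>UNIV. \<Sum>m\<in>UNIV. L $ a $ l * ginv g' l m * L $ b $ m) = ginv g a b" for a b
    unfolding ginv_def inv[symmetric] matrix_matrix_mult_def transpose_def
    by (simp add: sum_distrib_left sum_distrib_right mult.assoc) (rule sum.swap)
  define S where "S a b = pb L (\<lambda>P. pb L (\<lambda>Q. R (a # P) (b # Q)) J) I" for a b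
  have "ctr g' R' I J = (\<Sum>l\<in>UNIV. \<Sum>m\<in>UNIV. ginv g' l m *
      (\<Sum>b\<in>UNIV. L $ b $ m * (\<Sum>a\<in>UNIV. L $ a $ l * S a b)))"
    by (simp add: ctr_def R pb2_def S_def pb_sum pb_scale)
  also have "\<dots> = (\<Sum>l\<in>UNIV. \<Sum>m\<in>UNIV. \<Sum>b\<in>UNIV. \<Sum>a\<in>UNIV. L $ a $ l * ginv g' l m * L $ b $ m * S a b)"
    by (simp only: sum_distrib_left mult_ac)
  also have "\<dots> = (\<Sum>l\<in>UNIV. \<Sum>m\<in>UNIV. \<Sum>a\<in>UNIV. \<Sum>b\<in>UNIV. L $ a $ l * ginv g' l m * L $ b $ m * S a b)"
    by (intro sum.cong[OF refl] sum.swap)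
  also have "\<dots> = (\<Sum>a\<in>UNIV. \<Sum>b\<in>UNIV. \<Sum>l\<in>UNIV. \<Sum>m\<in>UNIV. L $ a $ l * ginv g' l m * L $ b $ m * S a b)"
    by (rule trans[OF sum_rotate3]) (rule sum.cong[OF refl sum_rotate3])
  also have "\<dots> = (\<Sum>a\<in>UNIV. \<Sum>b\<in>UNIV. ginv g a b * S a b)"
    by (simp add: inv'[symmetric] sum_distrib_right)
  also have "\<dots> = pb2 L (ctr g R) I J"
    unfolding pb2_def ctr_def S_def by (simp add: pb_sum pb_scale)
  finally show ?thesis .
qed

section \<open>The derivation induced by an endomorphism\<close>

fun act :: "(7 \<Rightarrow> 7 \<Rightarrow> real) \<Rightarrow> tensor \<Rightarrow> tensor" where
  "act A T [] = 0"
| "act A T (x # J) = (\<Sum>m\<in>UNIV. A x m * T (m # J)) + act A (\<lambda>P. T (x # P)) J"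

lemma act_cong: "(\<And>I. length I = length J \<Longrightarrow> T I = S I) \<Longrightarrow> act A T J = act A S J"
proof (induction J arbitrary: T S)
  case (Cons x J)
  have "act A (\<lambda>P. T (x # P)) J = act A (\<lambda>P. S (x # P)) J"
    by (rule Cons.IH) (simp add: Cons.prems)
  then show ?case by (simp add: Cons.prems)
qed simp

lemma act_add: "act A (\<lambda>I. T I + S I) J = act A T J + act A S J"
  by (induction J arbitrary: T S) (auto simp: sum.distrib algebra_simps)

lemma act_scale: "act A (\<lambda>I. c * T I) J = c * act A T J"
  by (induction J arbitrary: T) (auto simp: sum_distrib_left algebra_simps)

lemma act_zero: "act A (\<lambda>I. 0) J = 0"
  using act_scale[of A 0 "\<lambda>I. 0" J] by simp

lemma act_sum: "act A (\<lambda>I. \<Sum>i\<in>B. T i I) J = (\<Sum>i\<in>B. act A (T i) J)"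
  by (induction B rule: infinite_finite_induct) (auto simp: act_zero act_add)

lemma act_add_left: "act (\<lambda>i m. A i m + B i m) T J = act A T J + act B T J"
  by (induction J arbitrary: T) (auto simp: sum.distrib algebra_simps)

lemma act_scale_left: "act (\<lambda>i m. c * A i m) T J = c * act A T J"
  by (induction J arbitrary: T) (auto simp: sum_distrib_left algebra_simps)

lemma act_diff_left: "act (\<lambda>i m. A i m - B i m) T J = act A T J - act B T J"
  using act_add_left[of A "\<lambda>i m. (-1) * B i m" T J] unfolding act_scale_left by simp

lemma act_sum_left: "act (\<lambda>i m. \<Sum>k\<in>S. A k i m) T J = (\<Sum>k\<in>S. act (A k) T J)"
  using act_scale_left[of 0]
  by (induction S rule: infinite_finite_induct) (auto simp: act_add_left)

text \<open>The first index of an endomorphism names the slot on which \<open>act\<close> works and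
  transforms covariantly, by M; the second is summed and transforms by the inverse L.\<close>

definition conj_by :: "real^7^7 \<Rightarrow> real^7^7 \<Rightarrow> (7 \<Rightarrow> 7 \<Rightarrow> real) \<Rightarrow> 7 \<Rightarrow> 7 \<Rightarrow> real" where
  "conj_by M L A b c = (\<Sum>i\<in>UNIV. \<Sum>m\<in>UNIV. M $ i $ b * A i m * L $ c $ m)"

lemma pb_act:
  assumes M_L: "M ** L = mat 1"
  shows "pb M (act A T) J = act (conj_by M L A) (pb M T) J"
proof (induction J arbitrary: T)
  case (Cons x J)
  have L_M: "(\<Sum>c\<in>UNIV. L $ c $ m * M $ k $ c) = (mat 1 :: real^7^7) $ k $ m" for k m
    unfolding M_L[symmetric] matrix_matrix_mult_def by (simp add: mult.commute)
  define S where "S m = pb M (\<lambda>P. T (m # P)) J" for m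
  have "(\<Sum>c\<in>UNIV. conj_by M L A x c * pb M T (c # J))
      = (\<Sum>c\<in>UNIV. \<Sum>i\<in>UNIV. \<Sum>m\<in>UNIV. \<Sum>k\<in>UNIV. M $ i $ x * A i m * (L $ c $ m * M $ k $ c) * S k)"
    by (simp only: pb.simps conj_by_def S_def sum_distrib_left sum_distrib_right mult_ac)
  also have "\<dots> = (\<Sum>i\<in>UNIV. \<Sum>m\<in>UNIV. \<Sum>k\<in>UNIV. \<Sum>c\<in>UNIV. M $ i $ x * A i m * (L $ c $ m * M $ k $ c) * S k)"
    by (rule sum_rotate4[symmetric])
  also have "\<dots> = (\<Sum>i\<in>UNIV. \<Sum>m\<in>UNIV. M $ i $ x * A i m * (\<Sum>k\<in>UNIV. (mat 1 :: real^7^7) $ k $ m * S k))"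
    by (simp add: L_M[symmetric] sum_distrib_left sum_distrib_right mult.assoc)
  also have "\<dots> = (\<Sum>i\<in>UNIV. M $ i $ x * (\<Sum>m\<in>UNIV. A i m * S m))"
    by (simp add: sum_mult_mat sum_distrib_left mult.assoc)
  finally have 1: "(\<Sum>c\<in>UNIV. conj_by M L A x c * pb M T (c # J))
      = (\<Sum>i\<in>UNIV. M $ i $ x * (\<Sum>m\<in>UNIV. A i m * S m))" .
  have 2: "act (conj_by M L A) (\<lambda>P. pb M T (x # P)) J
      = (\<Sum>i\<in>UNIV. M $ i $ x * act (conj_by M L A) (pb M (\<lambda>P. T (i # P))) J)"
    by (simp add: act_sum act_scale)
  show ?case
    by (simp only: pb.simps act.simps(2) 1[unfolded pb.simps] 2[unfolded pb.simps] pb_add pb_sum pb_scale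
        Cons.IH S_def sum.distrib distrib_left)
qed auto

section \<open>Skew-symmetrisation over a direction index, and shuffles\<close>

text \<open>With \<open>D p J\<close> the p-th partial derivative of a form this is the exterior
  derivative; with \<open>D p J\<close> a product it is the wedge with a 1-form. The first index
  either is the direction or stays behind, and then the direction has to pass it, at the cost of a
  sign.\<close>

fun alt1 :: "(7 \<Rightarrow> tensor) \<Rightarrow> tensor" where
  "alt1 D [] = 0"
| "alt1 D (x # I) = D x I - alt1 (\<lambda>p J. D p (x # J)) I"

lemma alt1_eq_sum: "alt1 D I = (\<Sum>n<length I. (-1) ^ n * D (I ! n) (nths I (- {n})))"
proof (induction I arbitrary: D)
  case (Cons x I)
  have 1: "nths (x # I) (- {0}) = I"
    by (simp add: nths_Cons nths_all)
  have 2: "nths (x # I) (- {Suc n}) = x # nths I (- {n})" for n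
    by (simp add: nths_Cons Compl_eq)
  show ?case
    unfolding length_Cons sum.lessThan_Suc_shift
    by (simp add: 1 2 Cons.IH sum_negf)
qed auto

lemma extd_eq_alt1: "extd \<alpha> x I = alt1 (\<lambda>p J. pd p (\<lambda>y. \<alpha> y J) x) I"
  by (simp add: alt1_eq_sum extd_def)

lemma alt1_cong: "(\<And>p J. Suc (length J) = length I \<Longrightarrow> D p J = E p J) \<Longrightarrow> alt1 D I = alt1 E I"
proof (induction I arbitrary: D E)
  case (Cons x I)
  have "alt1 (\<lambda>p J. D p (x # J)) I = alt1 (\<lambda>p J. E p (x # J)) I"
    by (rule Cons.IH) (simp add: Cons.prems)
  then show ?case by (simp add: Cons.prems)
qed simp

lemma alt1_add: "alt1 (\<lambda>p J. D p J + E p J) I = alt1 D I + alt1 E I"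
  by (induction I arbitrary: D E) auto

lemma alt1_scale: "alt1 (\<lambda>p J. c * D p J) I = c * alt1 D I"
  by (induction I arbitrary: D) (auto simp: algebra_simps)

lemma alt1_zero: "alt1 (\<lambda>p J. 0) I = 0"
  using alt1_scale[of 0 "\<lambda>_ _. 0" I] by simp

lemma alt1_sum: "alt1 (\<lambda>p J. \<Sum>i\<in>B. D i p J) I = (\<Sum>i\<in>B. alt1 (D i) I)"
  by (induction B rule: infinite_finite_induct) (auto simp: alt1_add alt1_zero)

definition pbd :: "real^7^7 \<Rightarrow> (7 \<Rightarrow> tensor) \<Rightarrow> 7 \<Rightarrow> tensor" where
  "pbd L D p J = (\<Sum>a\<in>UNIV. L $ a $ p * pb L (D a) J)"

lemma pb_alt1: "pb L (alt1 D) I = alt1 (pbd L D) I"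
proof (induction I arbitrary: D)
  case (Cons x I)
  have "pb L (alt1 D) (x # I) = (\<Sum>a\<in>UNIV. L $ a $ x * (pb L (D a) I - alt1 (pbd L (\<lambda>p J. D p (a # J))) I))"
    by (simp add: pb_diff Cons.IH)
  also have "\<dots> = pbd L D x I - alt1 (\<lambda>p J. \<Sum>a\<in>UNIV. L $ a $ x * pbd L (\<lambda>p J. D p (a # J)) p J) I"
    by (simp only: alt1_sum alt1_scale pbd_def[of L D x I] right_diff_distrib sum_subtractf)
  also have "(\<lambda>p J. \<Sum>a\<in>UNIV. L $ a $ x * pbd L (\<lambda>p J. D p (a # J)) p J) = (\<lambda>p J. pbd L D p (x # J))"
    unfolding pbd_def fun_eq_iff pb.simps sum_distrib_left
    by (intro allI, subst sum.swap) (simp add: algebra_simps)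
  finally show ?case by simp
qed auto


text \<open>An index given to the second factor precedes all \<open>Suc k\<close> indices of the
  first factor that are still to come, and each of them makes one inversion with it.\<close>

fun shuffle :: "nat \<Rightarrow> tensor \<Rightarrow> tensor \<Rightarrow> tensor" where
  "shuffle 0 \<alpha> \<beta> I = \<alpha> [] * \<beta> I"
| "shuffle (Suc k) \<alpha> \<beta> [] = 0"
| "shuffle (Suc k) \<alpha> \<beta> (x # I) = shuffle k (\<lambda>P. \<alpha> (x # P)) \<beta> I + (-1) ^ Suc k * shuffle (Suc k) \<alpha> (\<lambda>P. \<beta> (x # P)) I"

lemma shuffle_scale: "shuffle k (\<lambda>P. c * \<alpha> P) \<beta> I = c * shuffle k \<alpha> \<beta> I"
    "shuffle k \<alpha> (\<lambda>P. c * \<beta> P) I = c * shuffle k \<alpha> \<beta> I"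
  by (induction k \<alpha> \<beta> I rule: shuffle.induct) (auto simp: algebra_simps)

lemma shuffle_add_left:
  "shuffle k (\<lambda>P. \<alpha> P + \<alpha>' P) \<beta> I = shuffle k \<alpha> \<beta> I + shuffle k \<alpha>' \<beta> I"
  by (induction k \<alpha> \<beta> I arbitrary: \<alpha>' rule: shuffle.induct) (simp_all add: distrib_left distrib_right)

lemma shuffle_add_right:
  "shuffle k \<alpha> (\<lambda>P. \<beta> P + \<beta>' P) I = shuffle k \<alpha> \<beta> I + shuffle k \<alpha> \<beta>' I"
  by (induction k \<alpha> \<beta> I arbitrary: \<beta>' rule: shuffle.induct) (simp_all add: distrib_left distrib_right)

lemma shuffle_sum: "shuffle k (\<lambda>P. \<Sum>i\<in>B. \<alpha> i P) \<beta> I = (\<Sum>i\<in>B. shuffle k (\<alpha> i) \<beta> I)"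
    "shuffle k \<alpha>' (\<lambda>P. \<Sum>i\<in>B. \<beta>' i P) I = (\<Sum>i\<in>B. shuffle k \<alpha>' (\<beta>' i) I)"
  using shuffle_scale(1)[of k 0 "\<lambda>_. 0" \<beta> I] shuffle_scale(2)[of k \<alpha>' 0 "\<lambda>_. 0" I]
  by (induction B rule: infinite_finite_induct) (auto simp: shuffle_add_left shuffle_add_right)

lemma shuffle_pb: "shuffle k (pb L \<alpha>) (pb L \<beta>) I = pb L (shuffle k \<alpha> \<beta>) I"
proof (induction I arbitrary: k \<alpha> \<beta>)
  case Nil
  then show ?case by (cases k) auto
next
  case (Cons x I)
  show ?case
  proof (cases k)
    case (Suc m)
    then show ?thesis
      by (simp add: shuffle_sum shuffle_scale Cons.IH pb_add pb_diff pb_scale pb_uminus sum.distrib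
          sum_distrib_left algebra_simps sum_negf sum_subtractf)
  qed (simp add: pb_scale sum_distrib_left algebra_simps)
qed

subsection \<open>Wedge products and shuffles\<close>

text \<open>The sets S are split by whether they contain position 0. If so, shifting down loses no
  inversion; if not, position 0 is inverted with every element of S, which gives
  \<open>Suc k\<close> further inversions.\<close>

lemma wedge_Cons_Suc:
  "wedge (Suc k) \<alpha> \<beta> (x # I) =
     wedge k (\<lambda>P. \<alpha> (x # P)) \<beta> I + (-1) ^ Suc k * wedge (Suc k) \<alpha> (\<lambda>P. \<beta> (x # P)) I"
proof -
  define n where "n = length I"
  define inv where "inv S = {(a, b). a \<in> S \<and> b < a \<and> b \<notin> S}" for S :: "nat set"
  define F where "F S = (-1) ^ card (inv S) * \<alpha> (nths (x # I) S) * \<beta> (nths (x # I) (- S))" for S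
  let ?U = "{S. S \<subseteq> {..<Suc n} \<and> card S = Suc k}"
  let ?A = "{S. S \<subseteq> {..<n} \<and> card S = k}"
  let ?B = "{S. S \<subseteq> {..<n} \<and> card S = Suc k}"
  have fin: "finite S" if "S \<subseteq> {..<n}" for S using that finite_subset by auto
  have split: "?U = (\<lambda>S. insert 0 (Suc ` S)) ` ?A \<union> (`) Suc ` ?B"
  proof (intro set_eqI iffI)
    fix S assume S: "S \<in> ?U"
    define S' where "S' = {j. Suc j \<in> S}"
    have S'n: "S' \<subseteq> {..<n}" using S by (auto simp: S'_def)
    show "S \<in> (\<lambda>S. insert 0 (Suc ` S)) ` ?A \<union> (`) Suc ` ?B"
    proof (cases "0 \<in> S")
      case True
      have eq: "S = insert 0 (Suc ` S')"
      proof (rule set_eqI)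
        fix y show "y \<in> S \<longleftrightarrow> y \<in> insert 0 (Suc ` S')"
          using True by (cases y) (auto simp: S'_def)
      qed
      have "card S' = k"
        using S arg_cong[OF eq, of card] fin[OF S'n] by (simp add: card_image)
      then show ?thesis using eq S'n by auto
    next
      case False
      have eq: "S = Suc ` S'"
      proof (rule set_eqI)
        fix y show "y \<in> S \<longleftrightarrow> y \<in> Suc ` S'"
          using False by (cases y) (auto simp: S'_def)
      qed
      have "card S' = Suc k"
        using S arg_cong[OF eq, of card] by (simp add: card_image)
      then show ?thesis using eq S'n by auto
    qed
  next
    fix S assume "S \<in> (\<lambda>S. insert 0 (Suc ` S)) ` ?A \<union> (`) Suc ` ?B"
    then show "S \<in> ?U"
      by (auto simp: card_image fin)
  qed
  have inj1: "inj_on (\<lambda>S. insert 0 (Suc ` S)) ?A"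
  proof (rule inj_onI)
    fix S S' :: "nat set" assume eq: "insert 0 (Suc ` S) = insert 0 (Suc ` S')"
    have "y \<in> S \<longleftrightarrow> Suc y \<in> insert 0 (Suc ` S)" for S y by auto
    then show "S = S'" using eq by blast
  qed
  have inj2: "inj_on ((`) Suc) ?B"
    by (rule inj_onI) (simp add: inj_image_eq_iff)
  have i1: "inv (insert 0 (Suc ` S)) = map_prod Suc Suc ` inv S" for S
  proof (rule set_eqI)
    fix z :: "nat \<times> nat"
    obtain a b where z: "z = (a, b)" by force
    show "z \<in> inv (insert 0 (Suc ` S)) \<longleftrightarrow> z \<in> map_prod Suc Suc ` inv S"
      unfolding z inv_def by (cases a; cases b) (auto simp: image_iff)
  qed
  have i2: "inv (Suc ` S) = map_prod Suc Suc ` inv S \<union> (\<lambda>a. (Suc a, 0)) ` S" for S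
  proof (rule set_eqI)
    fix z :: "nat \<times> nat"
    obtain a b where z: "z = (a, b)" by force
    show "z \<in> inv (Suc ` S) \<longleftrightarrow> z \<in> map_prod Suc Suc ` inv S \<union> (\<lambda>a. (Suc a, 0)) ` S"
      unfolding z inv_def by (cases a; cases b) (auto simp: image_iff)
  qed
  have injp: "inj_on (map_prod Suc Suc) A" for A :: "(nat \<times> nat) set"
    by (auto simp: inj_on_def)
  have fininv: "finite (inv S)" if "S \<subseteq> {..<n}" for S
    by (rule finite_subset[of _ "{..<n} \<times> {..<n}"]) (use that in \<open>auto simp: inv_def\<close>)
  have c1: "card (inv (insert 0 (Suc ` S))) = card (inv S)" for S
    unfolding i1 by (rule card_image[OF injp])
  have c2: "card (inv (Suc ` S)) = card (inv S) + card S" if "S \<subseteq> {..<n}" for S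
  proof -
    have "card (inv (Suc ` S)) = card (map_prod Suc Suc ` inv S) + card ((\<lambda>a. (Suc a, 0::nat)) ` S)"
      unfolding i2 by (rule card_Un_disjoint) (use fininv[OF that] fin[OF that] in auto)
    also have "card ((\<lambda>a. (Suc a, 0::nat)) ` S) = card S"
      by (rule card_image) (auto simp: inj_on_def)
    finally show ?thesis by (simp add: card_image[OF injp])
  qed
  have n1: "nths (x # I) (insert 0 (Suc ` S)) = x # nths I S"
    "nths (x # I) (- insert 0 (Suc ` S)) = nths I (- S)"
    "nths (x # I) (Suc ` S) = nths I S"
    "nths (x # I) (- (Suc ` S)) = x # nths I (- S)" for S
    by (auto simp: nths_Cons image_iff intro!: arg_cong[where f = "nths I"])
  have "wedge (Suc k) \<alpha> \<beta> (x # I) = sum F ?U"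
    by (simp add: wedge_def F_def inv_def n_def)
  also have "\<dots> = sum F ((\<lambda>S. insert 0 (Suc ` S)) ` ?A) + sum F ((`) Suc ` ?B)"
    unfolding split by (rule sum.union_disjoint) auto
  also have "sum F ((\<lambda>S. insert 0 (Suc ` S)) ` ?A) = wedge k (\<lambda>P. \<alpha> (x # P)) \<beta> I"
    unfolding sum.reindex[OF inj1] wedge_def by (simp add: F_def n1 c1 n_def[symmetric]) (simp add: inv_def)
  also have "sum F ((`) Suc ` ?B) = (-1) ^ Suc k * wedge (Suc k) \<alpha> (\<lambda>P. \<beta> (x # P)) I"
    unfolding sum.reindex[OF inj2] wedge_def n_def[symmetric] sum_distrib_left
  proof (rule sum.cong[OF refl])
    fix S assume "S \<in> ?B"
    then show "(F \<circ> (`) Suc) S = (-1) ^ Suc k * ((-1) ^ card {(a, b). a \<in> S \<and> b < a \<and> b \<notin> S} *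
        \<alpha> (nths I S) * \<beta> (x # nths I (- S)))"
      by (simp add: F_def n1 c2 power_add) (simp add: inv_def)
  qed
  finally show ?thesis .
qed

lemma wedge_0: "wedge 0 \<alpha> \<beta> I = \<alpha> [] * \<beta> I"
proof -
  have *: "{S. S \<subseteq> {..<length I} \<and> card S = 0} = {{}}"
    by (auto dest: finite_subset[OF _ finite_lessThan])
  show ?thesis unfolding wedge_def * by (simp add: nths_all)
qed

lemma wedge_eq_shuffle: "wedge k \<alpha> \<beta> I = shuffle k \<alpha> \<beta> I"
proof (induction k \<alpha> \<beta> I rule: shuffle.induct)
  case (2 k \<alpha> \<beta>)
  then show ?case by (simp add: wedge_def)
qed (simp_all only: wedge_0 shuffle.simps wedge_Cons_Suc)

lemma shuffle_cong:
  assumes "\<And>P. length P = k \<Longrightarrow> \<alpha> P = \<alpha>' P" "\<And>P. length P + k = length I \<Longrightarrow> \<beta> P = \<beta>' P"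
  shows "shuffle k \<alpha> \<beta> I = shuffle k \<alpha>' \<beta>' I"
  using assms
proof (induction k \<alpha> \<beta> I arbitrary: \<alpha>' \<beta>' rule: shuffle.induct)
  case (3 k \<alpha> \<beta> x I)
  have "shuffle k (\<lambda>P. \<alpha> (x # P)) \<beta> I = shuffle k (\<lambda>P. \<alpha>' (x # P)) \<beta>' I"
    by (rule "3.IH"(1)) (auto intro: "3.prems")
  moreover have "shuffle (Suc k) \<alpha> (\<lambda>P. \<beta> (x # P)) I = shuffle (Suc k) \<alpha>' (\<lambda>P. \<beta>' (x # P)) I"
    by (rule "3.IH"(2)) (auto intro: "3.prems")
  ultimately show ?case by simp
qed auto

lemma wedge1_eq_alt1: "wedge 1 \<alpha> \<beta> I = alt1 (\<lambda>p J. \<alpha> [p] * \<beta> J) I"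
proof -
  have "shuffle (Suc 0) \<alpha> \<beta> I = alt1 (\<lambda>p J. \<alpha> [p] * \<beta> J) I"
    by (induction I arbitrary: \<beta>) auto
  then show ?thesis by (simp add: wedge_eq_shuffle)
qed

subsection \<open>Alternating tensors\<close>

lemma alternatingD:
  assumes T: "alternating k T" and I: "length I = k" and mn: "m < k" "n < k" "m \<noteq> n"
  shows "T (I[m := I ! n, n := I ! m]) = - T I"
proof (cases "m < n")
  case True
  then show ?thesis using assms unfolding alternating_def by blast
next
  case False
  then have "T (I[n := I ! m, m := I ! n]) = - T I"
    using assms unfolding alternating_def by auto
  then show ?thesis using mn by (simp add: list_update_swap)
qed

lemma alternating_repeat:
  assumes "alternating k T" "length I = k" "\<not> distinct I"
  shows "T I = 0"
proof -
  obtain m n where mn: "m < k" "n < k" "m \<noteq> n" "I ! m = I ! n"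
    using assms by (auto simp: distinct_conv_nth)
  then have "I[m := I ! n, n := I ! m] = I" by (metis list_update_id)
  then show ?thesis using alternatingD[OF assms(1,2) mn(1-3)] by simp
qed

text \<open>As D has no repetition, precomposing the permutation with a transposition of two entries
  swaps two positions of the permuted list, so the sign is collected one transposition at a
  time.\<close>

lemma alternating_permute:
  assumes T: "alternating k T" and D: "distinct D" "length D = k" and f: "f permutes set D"
  shows "T (map f D) = of_int (sign f) * T D"
  using finite_set f
proof (induction rule: permutes_rev_induct)
  case (swap a b p)
  obtain m n where mn: "m < k" "n < k" "D ! m = a" "D ! n = b"
    using swap D by (metis in_set_conv_nth)
  then have "m \<noteq> n" using swap by auto
  have "map (p \<circ> Transposition.transpose a b) D = (map p D)[m := map p D ! n, n := map p D ! m]"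
  proof (rule nth_equalityI)
    fix i assume "i < length (map (p \<circ> Transposition.transpose a b) D)"
    then show "map (p \<circ> Transposition.transpose a b) D ! i =
        (map p D)[m := map p D ! n, n := map p D ! m] ! i"
      using mn D by (cases "i = m"; cases "i = n")
        (auto simp: Transposition.transpose_def nth_eq_iff_index_eq nth_list_update)
  qed simp
  then have "T (map (p \<circ> Transposition.transpose a b) D) = - T (map p D)"
    using alternatingD[OF T _ mn(1,2) \<open>m \<noteq> n\<close>, of "map p D"] D by simp
  moreover have "sign (p \<circ> Transposition.transpose a b) = - sign p"
    using swap by (subst sign_compose)
      (auto simp: sign_swap_id permutation_swap_id intro: permutes_imp_permutation[of "set D"])
  ultimately show ?case by (simp only: swap.IH of_int_minus mult_minus_left)
qed simp

text \<open>In the type \<open>7\<close> the numeral 7 equals 0. This numbering puts that element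
  last, as in the labelling 1, ..., 7 of coordinates, and is the order by which index lists are
  sorted.\<close>

definition ix :: "7 \<Rightarrow> nat" where
  "ix i = (if i = 1 then 1 else if i = 2 then 2 else if i = 3 then 3 else if i = 4 then 4
     else if i = 5 then 5 else if i = 6 then 6 else 7)"

lemma ix_simps [simp]:
  "ix 1 = 1" "ix 2 = 2" "ix 3 = 3" "ix 4 = 4" "ix 5 = 5" "ix 6 = 6" "ix 0 = 7"
  by (simp_all add: ix_def)

lemma UNIV_7: "(UNIV :: 7 set) = {1, 2, 3, 4, 5, 6, 0}"
proof -
  have "card {1, 2, 3, 4, 5, 6, 0 :: 7} = 7" by simp
  then show ?thesis using card_subset_eq[of "UNIV :: 7 set" "{1, 2, 3, 4, 5, 6, 0}"] by simp
qed

lemma forall_7: "(\<forall>i::7. P i) \<longleftrightarrow> P 1 \<and> P 2 \<and> P 3 \<and> P 4 \<and> P 5 \<and> P 6 \<and> P 0"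
proof -
  have "(\<forall>i::7. P i) \<longleftrightarrow> (\<forall>i\<in>UNIV. P i)" by simp
  then show ?thesis unfolding UNIV_7 by simp
qed

lemma sum_7: "sum f (UNIV :: 7 set) = f 1 + f 2 + f 3 + f 4 + f 5 + f 6 + f 0"
  unfolding UNIV_7 by (simp add: add_ac)

lemma inj_ix: "inj ix"
proof -
  have "\<forall>i j. ix i = ix j \<longrightarrow> i = j" unfolding forall_7 by simp
  then show ?thesis by (auto simp: inj_def)
qed

definition idl :: "7 list" where "idl = [1, 2, 3, 4, 5, 6, 0]"

lemma idl_facts: "distinct idl" "length idl = 7" "set idl = UNIV" "idl ! (ix r - 1) = r" "ix r - 1 < 7"
    "[1, 2, 3, 4, 5, 6, 7] = idl"
proof -
  have "\<forall>r. idl ! (ix r - 1) = r \<and> ix r - 1 < 7" unfolding forall_7 by (simp add: idl_def)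
  then show "idl ! (ix r - 1) = r" "ix r - 1 < 7" by auto
  show "distinct idl" "length idl = 7" "[1, 2, 3, 4, 5, 6, 7] = idl" by (simp_all add: idl_def)
  show "set idl = UNIV" unfolding UNIV_7 by (simp add: idl_def)
qed


text \<open>Sorting a repetition-free list permutes its entries, and both tensors see this only
  through the same sign; on lists with a repetition both vanish. Thus a k-form is known from its
  increasing components.\<close>

lemma alternating_eqI:
  assumes T: "alternating k T" and S: "alternating k S"
    and eq: "\<And>I. length I = k \<Longrightarrow> sorted_wrt (\<lambda>a b. ix a < ix b) I \<Longrightarrow> T I = S I"
    and I: "length I = k"
  shows "T I = S I"
proof (cases "distinct I")
  case True
  define D where "D = sort_key ix I"
  have D: "distinct D" "length D = k" "set D = set I" using True I by (auto simp: D_def)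
  have "sorted (map ix D)" by (simp add: D_def)
  moreover have "distinct (map ix D)"
    using D inj_ix by (simp add: distinct_map inj_on_def inj_def)
  ultimately have "sorted_wrt (<) (map ix D)" by (simp only: strict_sorted_iff)
  then have sD: "sorted_wrt (\<lambda>a b. ix a < ix b) D" by (simp only: sorted_wrt_map)
  \<comment> \<open>The permutation of the entries that carries the sorted list back to I, position
    by position, and fixes all other indices.\<close>
  define f where "f a = (if a \<in> set D then I ! (THE i. i < k \<and> D ! i = a) else a)" for a
  have f1: "f (D ! i) = I ! i" if "i < k" for i
  proof -
    have "(THE j. j < k \<and> D ! j = D ! i) = i"
      using that D by (intro the_equality) (auto simp: nth_eq_iff_index_eq)
    moreover have "D ! i \<in> set D" using that D(2) by simp
    ultimately show ?thesis by (simp add: f_def)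
  qed
  have map_f: "map f D = I"
    by (rule nth_equalityI) (simp_all add: D(2) I f1)
  have img: "f ` set D = set D" using arg_cong[OF map_f, of set] D(3) by simp
  have "f permutes set D"
  proof (rule bij_imp_permutes)
    show "bij_betw f (set D) (set D)"
      unfolding bij_betw_def using img finite_surj_inj[of "set D" f] by simp
  qed (simp add: f_def)
  note p = this
  show ?thesis
    using alternating_permute[OF T D(1,2) p] alternating_permute[OF S D(1,2) p] eq[OF D(2) sD] map_f
    by simp
next
  case False
  then show ?thesis using alternating_repeat[OF T I] alternating_repeat[OF S I] by simp
qed

text \<open>The sum over all index lists collapses to rearrangements of \<open>idl\<close>, since
  lists with a repetition contribute 0; what remains is the Leibniz formula.\<close>

lemma pb_top_form:
  assumes T: "alternating 7 T"
  shows "pb L T idl = det L * T idl"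
proof -
  have *: "(\<Prod>n<7. L $ f (idl ! n) $ (idl ! n)) = (\<Prod>r\<in>UNIV. L $ f r $ r)" for f
  proof -
    have "(\<Prod>r\<in>UNIV. L $ f r $ r) = (\<Prod>r\<leftarrow>idl. L $ f r $ r)"
      using prod.distinct_set_conv_list[of idl "\<lambda>r. L $ f r $ r"] idl_facts by simp
    also have "\<dots> = (\<Prod>n<7. L $ f (idl ! n) $ (idl ! n))"
      by (simp add: idl_def lessThan_Suc numeral_eq_Suc algebra_simps)
    finally show ?thesis ..
  qed
  have inj: "inj_on (\<lambda>f. map f idl) {f. f permutes UNIV}"
    by (rule inj_onI) (auto simp: map_eq_conv idl_facts)
  have sub: "(\<lambda>f. map f idl) ` {f. f permutes UNIV} \<subseteq> {I. length I = 7}"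
    by (auto simp: idl_facts)
  have rep: "T I = 0" if "I \<in> {I. length I = 7} - (\<lambda>f. map f idl) ` {f. f permutes UNIV}" for I
  proof (rule alternating_repeat[OF T])
    show "\<not> distinct I"
    proof
      assume d: "distinct I"
      \<comment> \<open>\<open>idl\<close> carries r at position \<open>ix r - 1\<close>, so this is
        the only candidate for \<open>map f idl = I\<close>.\<close>
      define f where "f r = I ! (ix r - 1)" for r
      have l: "length I = 7" using that by auto
      have "inj f"
      proof (rule injI)
        fix r s assume "f r = f s"
        then have "ix r - 1 = ix s - 1"
          unfolding f_def using d l idl_facts(5) by (simp add: nth_eq_iff_index_eq)
        then show "r = s" using idl_facts(4) by metis
      qed
      then have "f permutes UNIV"
        by (intro bij_imp_permutes) (auto simp: bij_betw_def finite_UNIV_inj_surj)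
      moreover have "map f idl = I"
      proof (rule nth_equalityI)
        fix i assume "i < length (map f idl)"
        then have "i < 7" by (simp add: idl_facts)
        then have "ix (idl ! i) - 1 = i"
          by (auto simp: idl_def numeral_eq_Suc less_Suc_eq)
        then show "map f idl ! i = I ! i" using \<open>i < 7\<close> by (simp add: f_def idl_facts)
      qed (simp add: l idl_facts)
      ultimately show False using that by auto
    qed
  qed (use that in auto)
  have "pb L T idl = (\<Sum>I | length I = 7. (\<Prod>n<7. L $ (I ! n) $ (idl ! n)) * T I)"
    by (simp add: pullback_eq_pb[symmetric, of idl 7] idl_facts pullback_def)
  also have "\<dots> = (\<Sum>I\<in>(\<lambda>f. map f idl) ` {f. f permutes UNIV}. (\<Prod>n<7. L $ (I ! n) $ (idl ! n)) * T I)"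
    by (rule sum.mono_neutral_right[OF _ sub]) (use rep in auto)
  also have "\<dots> = (\<Sum>f | f permutes UNIV. (\<Prod>r\<in>UNIV. L $ f r $ r) * (of_int (sign f) * T idl))"
    unfolding sum.reindex[OF inj]
    by (intro sum.cong) (auto simp: * alternating_permute[OF T] idl_facts)
  also have "\<dots> = det (transpose L) * T idl"
    by (simp add: det_def transpose_def sum_distrib_right sum_distrib_left mult_ac)
  finally show ?thesis by simp
qed

text \<open>Swapping the same two positions in J and in the summation list leaves the product of
  matrix entries unchanged, so the sign can be taken from T.\<close>

lemma pb_alternating:
  assumes T: "alternating k T"
  shows "alternating k (pb L T)"
  unfolding alternating_def
proof (intro allI impI, elim conjE)
  fix J :: "7 list" and m n assume J: "length J = k" and mn: "m < n" "n < k"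
  define sw where "sw I = I[m := I ! n, n := I ! m]" for I :: "7 list"
  define \<sigma> where "\<sigma> = Transposition.transpose m n"
  have len: "length (sw I) = length I" for I by (simp add: sw_def)
  have sw_nth: "sw I ! i = I ! \<sigma> i" if "i < k" "length I = k" for i I
    using that mn by (auto simp: sw_def \<sigma>_def Transposition.transpose_def nth_list_update)
  have \<sigma>k: "\<sigma> i < k \<longleftrightarrow> i < k" for i using mn by (auto simp: \<sigma>_def Transposition.transpose_def)
  have sw_sw: "sw (sw I) = I" if "length I = k" for I
    by (rule nth_equalityI) (use that \<sigma>k in \<open>auto simp: len sw_nth \<sigma>_def\<close>)
  have bij: "bij_betw sw {I. length I = k} {I. length I = k}"
    by (rule bij_betw_byWitness[where f' = sw]) (auto simp: len sw_sw)
  have \<sigma>bij: "bij_betw \<sigma> {..<k} {..<k}"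
    by (rule bij_betw_byWitness[where f' = \<sigma>]) (auto simp: \<sigma>k, auto simp: \<sigma>_def)
  have "pb L T (sw J) = (\<Sum>I | length I = k. (\<Prod>i<k. L $ (I ! i) $ (sw J ! i)) * T I)"
    using J by (simp add: pullback_eq_pb[symmetric, of "sw J" k] len pullback_def)
  also have "\<dots> = (\<Sum>I | length I = k. (\<Prod>i<k. L $ (sw I ! i) $ (sw J ! i)) * T (sw I))"
    by (rule sum.reindex_bij_betw[OF bij, symmetric])
  also have "\<dots> = (\<Sum>I | length I = k. (\<Prod>i<k. L $ (I ! i) $ (J ! i)) * - T I)"
  proof (rule sum.cong[OF refl])
    fix I :: "7 list" assume "I \<in> {I. length I = k}"
    then have I: "length I = k" by simp
    have "(\<Prod>i<k. L $ (sw I ! i) $ (sw J ! i)) = (\<Prod>i<k. L $ (I ! \<sigma> i) $ (J ! \<sigma> i))"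
      by (rule prod.cong) (auto simp: sw_nth I J)
    also have "\<dots> = (\<Prod>i<k. L $ (I ! i) $ (J ! i))"
      by (rule prod.reindex_bij_betw[OF \<sigma>bij])
    moreover have "T (sw I) = - T I"
      unfolding sw_def using alternatingD[OF T I, of m n] mn by auto
    ultimately show "(\<Prod>i<k. L $ (sw I ! i) $ (sw J ! i)) * T (sw I)
        = (\<Prod>i<k. L $ (I ! i) $ (J ! i)) * - T I" by simp
  qed
  also have "\<dots> = - pb L T J"
    using J by (simp add: pullback_eq_pb[symmetric, of J k] pullback_def sum_negf)
  finally show "pb L T (J[m := J ! n, n := J ! m]) = - pb L T J" unfolding sw_def .
qed

lemma hodge_alternating:
  assumes vol: "alternating 7 vol" and k: "k + l = 7"
  shows "alternating l (hodge k g vol \<alpha>)"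
  unfolding alternating_def
proof (intro allI impI, elim conjE)
  fix J :: "7 list" and m n assume J: "length J = l" and mn: "m < n" "n < l"
  have "vol (I @ J[m := J ! n, n := J ! m]) = - vol (I @ J)" if "length I = k" for I
    using alternatingD[OF vol, of "I @ J" "k + m" "k + n"] J k mn that
    by (simp add: nth_append list_update_append)
  then show "hodge k g vol \<alpha> (J[m := J ! n, n := J ! m]) = - hodge k g vol \<alpha> J"
    by (simp add: hodge_eq_pb sum_negf)
qed

subsection \<open>The standard form\<close>

lemma alternating_3_iff:
  "alternating 3 T \<longleftrightarrow> (\<forall>i j k. T [j, i, k] = - T [i, j, k] \<and> T [i, k, j] = - T [i, j, k])"
proof
  assume T: "alternating 3 T"
  show "\<forall>i j k. T [j, i, k] = - T [i, j, k] \<and> T [i, k, j] = - T [i, j, k]"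
  proof (intro allI conjI)
    fix i j k
    show "T [j, i, k] = - T [i, j, k]" using alternatingD[OF T, of "[i, j, k]" 0 1] by simp
    show "T [i, k, j] = - T [i, j, k]" using alternatingD[OF T, of "[i, j, k]" 1 2] by (simp add: numeral_2_eq_2)
  qed
next
  assume *: "\<forall>i j k. T [j, i, k] = - T [i, j, k] \<and> T [i, k, j] = - T [i, j, k]"
  have s1: "T [j, i, k] = - T [i, j, k]" and s2: "T [i, k, j] = - T [i, j, k]" for i j k using * by blast+
  have s3: "T [k, j, i] = - T [i, j, k]" for i j k using s1[of i j k] s2[of j i k] s1[of j k i] by simp
  show "alternating 3 T"
    unfolding alternating_def
  proof (intro allI impI, elim conjE)
    fix I :: "7 list" and m n :: nat assume "length I = 3" and mn: "m < n" "n < 3"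
    then obtain i j k where I: "I = [i, j, k]" by (auto simp: length_Suc_conv numeral_eq_Suc)
    have "m = 0 \<and> n = 1 \<or> m = 0 \<and> n = 2 \<or> m = 1 \<and> n = 2" using mn by auto
    then show "T (I[m := I ! n, n := I ! m]) = - T I"
      using s1[of i j k] s2[of i k j] s3[of i j k] by (auto simp: I numeral_2_eq_2)
  qed
qed

lemma alternating_3D:
  assumes "alternating 3 T"
  shows "T [j, i, k] = - T [i, j, k]" "T [i, k, j] = - T [i, j, k]" "T [i, i, k] = 0" "T [i, k, k] = 0"
proof -
  show 1: "T [j, i, k] = - T [i, j, k]" and 2: "T [i, k, j] = - T [i, j, k]" for i j k
    using assms unfolding alternating_3_iff by blast+
  show "T [i, i, k] = 0" "T [i, k, k] = 0" using 1[of i i k] 2[of i k k] by simp_all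
qed

lemma alternating_4D:
  assumes T: "alternating 4 T"
  shows "T [j, i, k, l] = - T [i, j, k, l]" "T [i, k, j, l] = - T [i, j, k, l]" "T [i, j, l, k] = - T [i, j, k, l]"
    "T [i, i, k, l] = 0" "T [i, k, k, l] = 0" "T [i, j, k, k] = 0"
proof -
  show 1: "T [j, i, k, l] = - T [i, j, k, l]" for i j k l using alternatingD[OF T, of "[i, j, k, l]" 0 1] by simp
  show 2: "T [i, k, j, l] = - T [i, j, k, l]" for i j k l using alternatingD[OF T, of "[i, j, k, l]" 1 2] by (simp add: numeral_eq_Suc)
  show 3: "T [i, j, l, k] = - T [i, j, k, l]" for i j k l using alternatingD[OF T, of "[i, j, k, l]" 2 3] by (simp add: numeral_eq_Suc)
  show "T [i, i, k, l] = 0" "T [i, k, k, l] = 0" "T [i, j, k, k] = 0"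
    using 1[of i i k l] 2[of i k k l] 3[of i j k k] by simp_all
qed

lemma alternating_7D:
  assumes T: "alternating 7 T"
  shows "T [b, a, c, d, e, f, g] = - T [a, b, c, d, e, f, g]"
    "T [a, c, b, d, e, f, g] = - T [a, b, c, d, e, f, g]"
    "T [a, b, d, c, e, f, g] = - T [a, b, c, d, e, f, g]"
    "T [a, b, c, e, d, f, g] = - T [a, b, c, d, e, f, g]"
    "T [a, b, c, d, f, e, g] = - T [a, b, c, d, e, f, g]"
    "T [a, b, c, d, e, g, f] = - T [a, b, c, d, e, f, g]"
  using alternatingD[OF T, of "[a, b, c, d, e, f, g]" 0 1] alternatingD[OF T, of "[a, b, c, d, e, f, g]" 1 2]
    alternatingD[OF T, of "[a, b, c, d, e, f, g]" 2 3] alternatingD[OF T, of "[a, b, c, d, e, f, g]" 3 4]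
    alternatingD[OF T, of "[a, b, c, d, e, f, g]" 4 5] alternatingD[OF T, of "[a, b, c, d, e, f, g]" 5 6]
  by (simp_all add: numeral_eq_Suc)

lemma alternating_7_repeat:
  assumes T: "alternating 7 T"
  shows "T [a, a, c, d, e, f, g] = 0" "T [a, b, b, d, e, f, g] = 0" "T [a, b, c, c, e, f, g] = 0"
    "T [a, b, c, d, d, f, g] = 0" "T [a, b, c, d, e, e, g] = 0" "T [a, b, c, d, e, f, f] = 0"
  by (rule alternating_repeat[OF T]; simp)+

text \<open>A determinant of unit rows is the Levi-Civita symbol, which makes alternation a property
  of \<open>det\<close>. The minus sign is the orientation that the convention attaches to
  \<open>phi0\<close>.\<close>

definition vol0 :: tensor where
  "vol0 I = - det (\<chi> r. axis (I ! (ix r - 1)) 1 :: real^7^7)"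

lemma vol0_idl: "vol0 idl = - 1"
proof -
  have "(\<chi> r. axis (idl ! (ix r - 1)) 1 :: real^7^7) = mat 1"
    unfolding idl_facts(4) by (simp add: vec_eq_iff mat_def axis_def)
  then show ?thesis by (simp add: vol0_def)
qed

lemma vol0_alternating: "alternating 7 vol0"
  unfolding alternating_def
proof (intro allI impI, elim conjE)
  fix I :: "7 list" and m n :: nat assume I: "length I = 7" and mn: "m < n" "n < 7"
  define A where "A I = (\<chi> r. axis (I ! (ix r - 1)) 1 :: real^7^7)" for I
  define a b where "a = idl ! m" and "b = idl ! n"
  have pos: "ix (idl ! i) - 1 = i" if "i < 7" for i
    using that by (auto simp: idl_def numeral_eq_Suc less_Suc_eq)
  have m_iff: "ix r - 1 = m \<longleftrightarrow> r = a" and n_iff: "ix r - 1 = n \<longleftrightarrow> r = b" for r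
    using idl_facts(4)[of r] pos mn by (auto simp: a_def b_def)
  have ma: "ix a - 1 = m" and nb: "ix b - 1 = n" using m_iff n_iff by blast+
  have "I[m := I ! n, n := I ! m] ! (ix r - 1) = I ! (ix (Transposition.transpose a b r) - 1)" for r
  proof (cases "r = a \<or> r = b")
    case True
    then show ?thesis using ma nb mn I by (auto simp: nth_list_update)
  next
    case False
    then have "ix r - 1 \<noteq> m" "ix r - 1 \<noteq> n" using m_iff n_iff by blast+
    then show ?thesis using False by (simp add: Transposition.transpose_def del: One_nat_def)
  qed
  then have "A (I[m := I ! n, n := I ! m]) = (\<chi> r. A I $ Transposition.transpose a b r)"
    unfolding A_def by (simp del: One_nat_def)
  moreover have "sign (Transposition.transpose a b) = - 1"
    using m_iff[of a] n_iff[of b] mn by (auto simp: sign_swap_id)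
  ultimately show "vol0 (I[m := I ! n, n := I ! m]) = - vol0 I"
    unfolding vol0_def A_def[symmetric]
    by (simp add: det_permute_rows permutes_swap_id)
qed

text \<open>The only increasing list of length 7 is \<open>idl\<close>, so top forms are
  proportional; the sign compensates \<open>vol0 idl = - 1\<close>.\<close>

lemma alternating_7_eq:
  assumes T: "alternating 7 T" and I: "length I = 7"
  shows "T I = - T idl * vol0 I"
proof -
  have alt: "alternating 7 (\<lambda>I. - T idl * vol0 I)"
    using vol0_alternating unfolding alternating_def by auto
  show ?thesis
  proof (rule alternating_eqI[OF T alt _ I])
    fix J :: "7 list" assume J: "length J = 7" "sorted_wrt (\<lambda>a b. ix a < ix b) J"
    have "sorted_wrt (<) (map ix J)" using J by (simp add: sorted_wrt_map)
    moreover have "sorted_wrt (<) (map ix idl)" by (simp add: idl_def)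
    moreover have "set (map ix J) = set (map ix idl)"
    proof -
      have "distinct J" using calculation(1) by (metis distinct_map strict_sorted_iff)
      then have "card (set J) = CARD(7)" using J by (simp add: distinct_card)
      then have "set J = UNIV" by (simp add: card_eq_UNIV_imp_eq_UNIV)
      then show ?thesis by (simp add: idl_facts)
    qed
    ultimately have "map ix J = map ix idl" using strict_sorted_equal by metis
    then have "J = idl" using inj_ix by (simp add: inj_map_eq_map)
    then show "T J = - T idl * vol0 J" by (simp add: vol0_idl)
  qed
qed

text \<open>Alternating tensors at explicit indices are evaluated by sorting the indices.\<close>

lemma vol0_sort [simp]:
  "ix b < ix a \<Longrightarrow> vol0 [a, b, c, d, e, f, g] = - vol0 [b, a, c, d, e, f, g]"
  "ix c < ix b \<Longrightarrow> vol0 [a, b, c, d, e, f, g] = - vol0 [a, c, b, d, e, f, g]"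
  "ix d < ix c \<Longrightarrow> vol0 [a, b, c, d, e, f, g] = - vol0 [a, b, d, c, e, f, g]"
  "ix e < ix d \<Longrightarrow> vol0 [a, b, c, d, e, f, g] = - vol0 [a, b, c, e, d, f, g]"
  "ix f < ix e \<Longrightarrow> vol0 [a, b, c, d, e, f, g] = - vol0 [a, b, c, d, f, e, g]"
  "ix g < ix f \<Longrightarrow> vol0 [a, b, c, d, e, f, g] = - vol0 [a, b, c, d, e, g, f]"
  "vol0 [1, 2, 3, 4, 5, 6, 0] = - 1"
  by (rule alternating_7D[OF vol0_alternating])+ (use vol0_idl in \<open>simp add: idl_def\<close>)

lemmas vol0_repeat [simp] = alternating_7_repeat[OF vol0_alternating]

lemma e3_eq:
  "e3 a b c [i, j, k] = cov a [i] * (cov b [j] * cov c [k] - cov b [k] * cov c [j])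
     - cov a [j] * (cov b [i] * cov c [k] - cov b [k] * cov c [i])
     + cov a [k] * (cov b [i] * cov c [j] - cov b [j] * cov c [i])"
  unfolding e3_def wedge1_eq_alt1 by (simp add: algebra_simps)

lemma phi0_alternating: "alternating 3 phi0"
  unfolding alternating_3_iff phi0_def e3_eq by (simp add: algebra_simps)

lemma phi0_sort [simp]:
  "ix j < ix i \<Longrightarrow> phi0 [i, j, k] = - phi0 [j, i, k]"
  "ix k < ix j \<Longrightarrow> phi0 [i, j, k] = - phi0 [i, k, j]"
  "phi0 [i, i, k] = 0" "phi0 [i, k, k] = 0"
  by (rule alternating_3D[OF phi0_alternating])+

lemma phi0_values [simp]:
    "phi0 [1, 2, 3] = 1" "phi0 [1, 2, 4] = 0" "phi0 [1, 2, 5] = 0" "phi0 [1, 2, 6] = 0"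
    "phi0 [1, 2, 0] = 0" "phi0 [1, 3, 4] = 0" "phi0 [1, 3, 5] = 0" "phi0 [1, 3, 6] = 0"
    "phi0 [1, 3, 0] = 0" "phi0 [1, 4, 5] = 1" "phi0 [1, 4, 6] = 0" "phi0 [1, 4, 0] = 0"
    "phi0 [1, 5, 6] = 0" "phi0 [1, 5, 0] = 0" "phi0 [1, 6, 0] = 1" "phi0 [2, 3, 4] = 0"
    "phi0 [2, 3, 5] = 0" "phi0 [2, 3, 6] = 0" "phi0 [2, 3, 0] = 0" "phi0 [2, 4, 5] = 0"
    "phi0 [2, 4, 6] = 1" "phi0 [2, 4, 0] = 0" "phi0 [2, 5, 6] = 0" "phi0 [2, 5, 0] = -1"
    "phi0 [2, 6, 0] = 0" "phi0 [3, 4, 5] = 0" "phi0 [3, 4, 6] = 0" "phi0 [3, 4, 0] = -1"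
    "phi0 [3, 5, 6] = -1" "phi0 [3, 5, 0] = 0" "phi0 [3, 6, 0] = 0" "phi0 [4, 5, 6] = 0"
    "phi0 [4, 5, 0] = 0" "phi0 [4, 6, 0] = 0" "phi0 [5, 6, 0] = 0"
  by (simp_all add: phi0_def e3_eq cov_def)

lemma interior_phi0:
    "interior u phi0 [1, 2] = u $ 3" "interior u phi0 [1, 3] = -u $ 2" "interior u phi0 [1, 4] = u $ 5"
    "interior u phi0 [1, 5] = -u $ 4" "interior u phi0 [1, 6] = u $ 0" "interior u phi0 [1, 0] = -u $ 6"
    "interior u phi0 [2, 3] = u $ 1" "interior u phi0 [2, 4] = u $ 6" "interior u phi0 [2, 5] = -u $ 0"
    "interior u phi0 [2, 6] = -u $ 4" "interior u phi0 [2, 0] = u $ 5" "interior u phi0 [3, 4] = -u $ 0"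
    "interior u phi0 [3, 5] = -u $ 6" "interior u phi0 [3, 6] = u $ 5" "interior u phi0 [3, 0] = u $ 4"
    "interior u phi0 [4, 5] = u $ 1" "interior u phi0 [4, 6] = u $ 2" "interior u phi0 [4, 0] = -u $ 3"
    "interior u phi0 [5, 6] = -u $ 3" "interior u phi0 [5, 0] = -u $ 2" "interior u phi0 [6, 0] = u $ 1"
  by (simp_all add: interior_def sum_7)

text \<open>Each of the seven nonzero components of \<open>phi0\<close> occurs in 3! orders, and the
  signs of the two factors agree.\<close>

lemma sum_phi0:
  assumes F: "alternating 3 F"
  shows "(\<Sum>I | length I = 3. phi0 I * F I) = 6 * (F [1,2,3] + F [1,4,5] + F [1,6,0] + F [2,4,6]
    - F [2,5,0] - F [3,4,0] - F [3,5,6])"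
proof -
  have sort: "ix j < ix i \<Longrightarrow> F [i, j, k] = - F [j, i, k]"
    "ix k < ix j \<Longrightarrow> F [i, j, k] = - F [i, k, j]" for i j k
    by (rule alternating_3D[OF F])+
  show ?thesis
    by (simp add: numeral_3_eq_3 sum_lists_Suc sum_lists_0[simplified] sum_7 sort)
qed

definition eucl :: tensor where "eucl I = (if I ! 0 = I ! 1 then 1 else 0)"

lemma eucl_simp [simp]: "eucl [i, j] = (if i = j then 1 else 0)"
  by (simp add: eucl_def)

lemma gmat_eucl [simp]: "gmat eucl = mat 1"
  by (simp add: gmat_def mat_def)

lemma matrix_inv_mat_1 [simp]: "matrix_inv (mat 1 :: real^'n^'n) = mat 1"
  by (rule matrix_inv_eqI) simp

lemma ginv_eucl [simp]: "ginv eucl i j = (if i = j then 1 else 0)"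
  unfolding ginv_def gmat_eucl matrix_inv_mat_1 by (simp add: mat_def)

definition psi0 :: tensor where "psi0 = hodge 3 eucl vol0 phi0"

lemma psi0_alternating: "alternating 4 psi0"
  unfolding psi0_def by (rule hodge_alternating[OF vol0_alternating]) simp

lemma psi0_sort [simp]:
  "ix j < ix i \<Longrightarrow> psi0 [i, j, k, l] = - psi0 [j, i, k, l]"
  "ix k < ix j \<Longrightarrow> psi0 [i, j, k, l] = - psi0 [i, k, j, l]"
  "ix l < ix k \<Longrightarrow> psi0 [i, j, k, l] = - psi0 [i, j, l, k]"
  "psi0 [i, i, k, l] = 0" "psi0 [i, k, k, l] = 0" "psi0 [i, j, k, k] = 0"
  by (rule alternating_4D[OF psi0_alternating])+

lemma hodge_3_eucl:
  assumes \<alpha>: "alternating 3 \<alpha>"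
  shows "hodge 3 eucl vol0 \<alpha> J = (\<Sum>I | length I = 3. \<alpha> I * vol0 (I @ J)) / 6"
  unfolding hodge_eq_pb by (simp add: pb_id fact_numeral)

lemma psi0_eq:
  "psi0 [i, j, k, l] = vol0 [1,2,3,i,j,k,l] + vol0 [1,4,5,i,j,k,l] + vol0 [1,6,0,i,j,k,l] + vol0 [2,4,6,i,j,k,l]
    - vol0 [2,5,0,i,j,k,l] - vol0 [3,4,0,i,j,k,l] - vol0 [3,5,6,i,j,k,l]"
proof -
  have "alternating 3 (\<lambda>I. vol0 (I @ [i, j, k, l]))"
    unfolding alternating_3_iff append.simps
    by (intro allI conjI) (rule alternating_7D[OF vol0_alternating])+
  from sum_phi0[OF this] show ?thesis
    by (simp add: psi0_def hodge_3_eucl[OF phi0_alternating])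
qed

lemma psi0_values [simp]:
    "psi0 [1, 2, 3, 4] = 0" "psi0 [1, 2, 3, 5] = 0" "psi0 [1, 2, 3, 6] = 0"
    "psi0 [1, 2, 3, 0] = 0" "psi0 [1, 2, 4, 5] = 0" "psi0 [1, 2, 4, 6] = 0"
    "psi0 [1, 2, 4, 0] = 1" "psi0 [1, 2, 5, 6] = 1" "psi0 [1, 2, 5, 0] = 0"
    "psi0 [1, 2, 6, 0] = 0" "psi0 [1, 3, 4, 5] = 0" "psi0 [1, 3, 4, 6] = 1"
    "psi0 [1, 3, 4, 0] = 0" "psi0 [1, 3, 5, 6] = 0" "psi0 [1, 3, 5, 0] = -1"
    "psi0 [1, 3, 6, 0] = 0" "psi0 [1, 4, 5, 6] = 0" "psi0 [1, 4, 5, 0] = 0"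
    "psi0 [1, 4, 6, 0] = 0" "psi0 [1, 5, 6, 0] = 0" "psi0 [2, 3, 4, 5] = -1"
    "psi0 [2, 3, 4, 6] = 0" "psi0 [2, 3, 4, 0] = 0" "psi0 [2, 3, 5, 6] = 0"
    "psi0 [2, 3, 5, 0] = 0" "psi0 [2, 3, 6, 0] = -1" "psi0 [2, 4, 5, 6] = 0"
    "psi0 [2, 4, 5, 0] = 0" "psi0 [2, 4, 6, 0] = 0" "psi0 [2, 5, 6, 0] = 0"
    "psi0 [3, 4, 5, 6] = 0" "psi0 [3, 4, 5, 0] = 0" "psi0 [3, 4, 6, 0] = 0"
    "psi0 [3, 5, 6, 0] = 0" "psi0 [4, 5, 6, 0] = -1"
  by (simp_all add: psi0_eq)

text \<open>The basic contraction identity of G2 geometry, checked over all index values. It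
  expresses \<psi> by \<phi> and g without the volume form, which is how the variation of \<psi> is
  obtained later.\<close>

lemma phi0_phi0_one:
  "(\<Sum>m\<in>UNIV. phi0 [i, j, m] * phi0 [k, l, m]) =
     (if i = k \<and> j = l then 1 else 0) - (if i = l \<and> j = k then 1 else 0) - psi0 [i, j, k, l]"
proof -
  have "\<forall>i j k l. (\<Sum>m\<in>UNIV. phi0 [i, j, m] * phi0 [k, l, m]) =
     (if i = k \<and> j = l then 1 else 0) - (if i = l \<and> j = k then 1 else 0) - psi0 [i, j, k, l]"
    unfolding forall_7 sum_7 by simp
  then show ?thesis by blast
qed

lemma phi0_phi0_two: "(\<Sum>j\<in>UNIV. \<Sum>m\<in>UNIV. phi0 [i, j, m] * phi0 [k, j, m]) = (if i = k then 6 else 0)"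
proof -
  have "\<forall>i k. (\<Sum>j\<in>UNIV. \<Sum>m\<in>UNIV. phi0 [i, j, m] * phi0 [k, j, m]) = (if i = k then 6 else 0)"
    unfolding forall_7 sum_7 by simp
  then show ?thesis by blast
qed

text \<open>This calibrates the conventions: the value +6 at the increasing list, against the factor
  -6 in the definition of g and vol, makes the standard volume form negative on
  \<open>idl\<close>.\<close>

lemma phi0_top: "shuffle 4 (shuffle 2 (interior u phi0) (interior v phi0)) phi0 idl = 6 * (u \<bullet> v)"
  by (simp add: idl_def numeral_eq_Suc interior_phi0 inner_vec_def sum_7 del: phi0_sort)

subsection \<open>Naturality of the tensor operations\<close>

lemma pb2_mult: "pb2 L (\<lambda>P Q. \<alpha> P * \<beta> Q) I J = pb L \<alpha> I * pb L \<beta> J"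
  by (simp add: pb2_def pb_scale pb_scale_right)

lemma pb_rev2: "pb L (\<lambda>P. A (rev P)) [l, i] = pb L A [i, l]"
  by (simp add: sum_distrib_left) (subst sum.swap, simp add: mult_ac)

lemma ctr_eucl [simp]: "ctr eucl R I J = (\<Sum>l\<in>UNIV. R (l # I) (l # J))"
proof -
  have "(\<Sum>m\<in>UNIV. ginv eucl l m * R (l # I) (m # J)) = (\<Sum>m\<in>UNIV. if m = l then R (l # I) (l # J) else 0)" for l
    by (rule sum.cong) auto
  then show ?thesis by (simp add: ctr_def)
qed

text \<open>The contraction of the overview, taken over all ordered triples without dividing by
  3!.\<close>

definition phi_contract :: "tensor \<Rightarrow> tensor \<Rightarrow> tensor \<Rightarrow> tensor" where
  "phi_contract g \<phi> \<beta> J = ctr g (ctr g (ctr g (\<lambda>P Q. \<phi> P * \<beta> Q))) [] J"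

lemma contract_psi_ctr: "contract_psi g \<psi> \<beta> [a, b] = ctr g (ctr g (\<lambda>P Q. \<beta> P * \<psi> Q)) [] [a, b]"
proof -
  have "contract_psi g \<psi> \<beta> [a, b] = (\<Sum>j\<in>UNIV. \<Sum>i\<in>UNIV. \<Sum>l\<in>UNIV. \<Sum>m\<in>UNIV.
     \<beta> [i, j] * ginv g i l * ginv g j m * \<psi> [l, m, a, b])"
    unfolding contract_psi_def by (subst sum.swap) simp
  also have "\<dots> = (\<Sum>j\<in>UNIV. \<Sum>m\<in>UNIV. \<Sum>i\<in>UNIV. \<Sum>l\<in>UNIV.
     \<beta> [i, j] * ginv g i l * ginv g j m * \<psi> [l, m, a, b])"
    by (intro sum.cong[OF refl] sum_rotate3)
  finally show ?thesis by (simp add: ctr_def sum_distrib_left mult_ac)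
qed

lemma covector_skew_ctr: "covector_skew g \<phi> \<alpha> [i, j] = ctr g (\<lambda>P Q. \<alpha> P * \<phi> Q) [] [i, j]"
  by (simp add: covector_skew_def ctr_def mult_ac)

lemma comm_ctr: "comm g A B [i, j] = ctr g (\<lambda>P Q. A (rev P) * B Q) [i] [j] - ctr g (\<lambda>P Q. B (rev P) * A Q) [i] [j]"
  by (simp add: comm_def ctr_def sum_subtractf mult_ac)

lemma acomm_ctr: "acomm g A B [i, j] = ctr g (\<lambda>P Q. A (rev P) * B Q) [i] [j] + ctr g (\<lambda>P Q. B (rev P) * A Q) [i] [j]"
  by (simp add: acomm_def ctr_def sum.distrib mult_ac)

lemma trace_ctr: "trace_g g A = ctr g (\<lambda>P Q. A (P @ Q)) [] []"
  by (simp add: trace_g_def ctr_def)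


definition up :: "tensor \<Rightarrow> tensor \<Rightarrow> 7 \<Rightarrow> 7 \<Rightarrow> real" where
  "up g a i m = (\<Sum>l\<in>UNIV. a [i, l] * ginv g l m)"

text \<open>In use, g is the Euclidean metric and g' the metric in the chart. The inverse M is a
  parameter of its own because it also carries chart tensors to the frame.\<close>

locale congruence =
  fixes L M :: "real^7^7" and g g' :: tensor
  assumes L_M: "L ** M = mat 1" and G: "invertible (gmat g)"
    and g': "gmat g' = transpose L ** gmat g ** L"
begin

lemma M_L: "M ** L = mat 1" using L_M by (simp add: matrix_left_right_inverse)

lemmas ctr_pb' = ctr_pb[OF g' G L_M]

lemma phi_contract_pb:
  assumes \<phi>: "\<And>I. length I = 3 \<Longrightarrow> \<phi>' I = pb L \<phi> I"
    and \<beta>: "\<And>I. length I = 3 + length J \<Longrightarrow> \<beta>' I = pb L \<beta> I"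
  shows "phi_contract g' \<phi>' \<beta>' J = pb L (phi_contract g \<phi> \<beta>) J"
proof -
  have "phi_contract g' \<phi>' \<beta>' J = pb2 L (ctr g (ctr g (ctr g (\<lambda>P Q. \<phi> P * \<beta> Q)))) [] J"
    unfolding phi_contract_def
    by (intro ctr_pb') (simp add: pb2_mult \<phi> \<beta>)
  then show ?thesis by (simp add: pb2_def phi_contract_def[abs_def])
qed

lemma contract_psi_pb:
  assumes \<psi>: "\<And>I. length I = 4 \<Longrightarrow> \<psi>' I = pb L \<psi> I"
    and \<beta>: "\<And>i j. \<beta>' [i, j] = pb L \<beta> [i, j]"
  shows "contract_psi g' \<psi>' \<beta>' [a, b] = pb L (contract_psi g \<psi> \<beta>) [a, b]"
proof -
  have \<beta>2: "\<beta>' P = pb L \<beta> P" if "length P = 2" for P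
    using that \<beta> by (auto simp: numeral_2_eq_2 length_Suc_conv)
  have "contract_psi g' \<psi>' \<beta>' [a, b] = pb2 L (ctr g (ctr g (\<lambda>P Q. \<beta> P * \<psi> Q))) [] [a, b]"
    unfolding contract_psi_ctr
    by (intro ctr_pb') (simp add: pb2_mult \<psi> \<beta>2)
  also have "\<dots> = pb L (contract_psi g \<psi> \<beta>) [a, b]"
    unfolding pb2_def pb.simps contract_psi_ctr ..
  finally show ?thesis .
qed

lemma pi_pb:
  assumes \<psi>: "\<And>I. length I = 4 \<Longrightarrow> \<psi>' I = pb L \<psi> I"
    and \<beta>: "\<And>i j. \<beta>' [i, j] = pb L \<beta> [i, j]"
  shows "pi7 g' \<psi>' \<beta>' [a, b] = pb L (pi7 g \<psi> \<beta>) [a, b]"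
    "pi14 g' \<psi>' \<beta>' [a, b] = pb L (pi14 g \<psi> \<beta>) [a, b]"
proof -
  have c: "contract_psi g' \<psi>' \<beta>' [a, b] = pb L (contract_psi g \<psi> \<beta>) [a, b]"
    by (rule contract_psi_pb[OF \<psi> \<beta>])
  show "pi7 g' \<psi>' \<beta>' [a, b] = pb L (pi7 g \<psi> \<beta>) [a, b]"
    "pi14 g' \<psi>' \<beta>' [a, b] = pb L (pi14 g \<psi> \<beta>) [a, b]"
    unfolding pi7_def[abs_def] pi14_def[abs_def] c \<beta>
    by (simp_all only: pb_diff pb_add pb_scale)
qed

lemma covector_skew_pb:
  assumes \<phi>: "\<And>I. length I = 3 \<Longrightarrow> \<phi>' I = pb L \<phi> I" and \<alpha>: "\<And>k. \<alpha>' [k] = pb L \<alpha> [k]"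
  shows "covector_skew g' \<phi>' \<alpha>' [a, b] = pb L (covector_skew g \<phi> \<alpha>) [a, b]"
proof -
  have \<alpha>1: "\<alpha>' P = pb L \<alpha> P" if "length P = Suc 0" for P
    using that \<alpha> by (auto simp: length_Suc_conv)
  have "covector_skew g' \<phi>' \<alpha>' [a, b] = pb2 L (ctr g (\<lambda>P Q. \<alpha> P * \<phi> Q)) [] [a, b]"
    unfolding covector_skew_ctr
    by (intro ctr_pb') (simp add: pb2_mult \<phi> \<alpha>1)
  also have "\<dots> = pb L (covector_skew g \<phi> \<alpha>) [a, b]"
    unfolding pb2_def pb.simps covector_skew_ctr ..
  finally show ?thesis .
qed

lemma comm_pb:
  assumes A: "\<And>i j. A' [i, j] = pb L A [i, j]" and B: "\<And>i j. B' [i, j] = pb L B [i, j]"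
  shows "comm g' A' B' [a, b] = pb L (comm g A B) [a, b]"
    "acomm g' A' B' [a, b] = pb L (acomm g A B) [a, b]"
proof -
  have *: "ctr g' (\<lambda>P Q. A' (rev P) * B' Q) [a] [b] = pb2 L (ctr g (\<lambda>P Q. A (rev P) * B Q)) [a] [b]"
    if A: "\<And>i j. A' [i, j] = pb L A [i, j]" and B: "\<And>i j. B' [i, j] = pb L B [i, j]" for A A' B B'
  proof (rule ctr_pb')
    fix P Q :: "7 list" assume "length P = Suc (length [a])" "length Q = Suc (length [b])"
    then obtain p q r s where "P = [p, q]" "Q = [r, s]" by (auto simp: length_Suc_conv)
    then show "A' (rev P) * B' Q = pb2 L (\<lambda>P Q. A (rev P) * B Q) P Q"
      by (simp only: pb2_mult pb_rev2 B) (simp only: rev.simps append.simps A)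
  qed
  show "comm g' A' B' [a, b] = pb L (comm g A B) [a, b]"
    unfolding comm_ctr *[OF A B] *[OF B A] pb2_def pb.simps
    by (simp add: comm_ctr sum_subtractf right_diff_distrib)
  show "acomm g' A' B' [a, b] = pb L (acomm g A B) [a, b]"
    unfolding acomm_ctr *[OF A B] *[OF B A] pb2_def pb.simps
    by (simp add: acomm_ctr sum.distrib distrib_left)
qed

lemma trace_pb:
  assumes A: "\<And>i j. A' [i, j] = pb L A [i, j]"
  shows "trace_g g' A' = trace_g g A"
proof -
  have "ctr g' (\<lambda>P Q. A' (P @ Q)) [] [] = pb2 L (ctr g (\<lambda>P Q. A (P @ Q))) [] []"
  proof (rule ctr_pb')
    fix P Q :: "7 list" assume "length P = Suc (length ([]::7 list))" "length Q = Suc (length ([]::7 list))"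
    then obtain p q where "P = [p]" "Q = [q]" by (auto simp: length_Suc_conv)
    then show "A' (P @ Q) = pb2 L (\<lambda>P Q. A (P @ Q)) P Q" by (simp add: A pb2_def)
  qed
  then show ?thesis by (simp add: trace_ctr pb2_def)
qed

lemma up_pb:
  assumes a: "\<And>i j. a' [i, j] = pb L a [i, j]"
  shows "conj_by M L (up g' a') b c = up g a b c"
proof -
  define A where "A = (\<chi> i j. a [i, j])"
  define A' where "A' = (\<chi> i j. a' [i, j])"
  have A': "A' = transpose L ** A ** L"
    unfolding A'_def A_def vec_eq_iff matrix_matrix_mult_def transpose_def
    by (simp add: a sum_distrib_left sum_distrib_right mult_ac) (intro allI, subst sum.swap, simp add: mult_ac)
  have inv: "matrix_inv (gmat g') = M ** matrix_inv (gmat g) ** transpose M"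
    unfolding g' by (rule matrix_inv_congruence[OF G L_M])
  have tt: "transpose M ** transpose L = mat 1"
    using L_M by (metis matrix_transpose_mul transpose_mat)
  have u': "up g' a' i m = (A' ** matrix_inv (gmat g')) $ i $ m" for i m
    by (simp add: up_def A'_def matrix_matrix_mult_def ginv_def)
  have u: "up g a i m = (A ** matrix_inv (gmat g)) $ i $ m" for i m
    by (simp add: up_def A_def matrix_matrix_mult_def ginv_def)
  have "conj_by M L (up g' a') b c = (transpose M ** (A' ** matrix_inv (gmat g')) ** transpose L) $ b $ c"
    unfolding conj_by_def u' matrix_matrix_mult_def[of _ "transpose L"] matrix_matrix_mult_def[of "transpose M"]
    by (simp add: transpose_def sum_distrib_right) (rule sum.swap)
  also have "transpose M ** (A' ** matrix_inv (gmat g')) ** transpose L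
      = (transpose M ** transpose L) ** A ** (L ** M) ** matrix_inv (gmat g) ** (transpose M ** transpose L)"
    unfolding A' inv by (simp only: matrix_mul_assoc)
  finally show ?thesis by (simp add: tt L_M u)
qed

end

subsection \<open>Adapted frames\<close>

text \<open>One matrix standardises the 3-form, the metric and the volume form together; everything
  pointwise is transported through it to \<open>phi0\<close>, \<open>eucl\<close> and
  \<open>vol0\<close>.\<close>

definition g2_frame :: "real^7^7 \<Rightarrow> tensor \<Rightarrow> tensor \<Rightarrow> tensor \<Rightarrow> bool" where
  "g2_frame L P G V \<longleftrightarrow> invertible L \<and> (\<forall>I. length I = 3 \<longrightarrow> P I = pb L phi0 I) \<and>
     gmat G = transpose L ** L \<and> (\<forall>I. length I = 7 \<longrightarrow> V I = pb L vol0 I)"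

lemma interior_pb:
  assumes "\<And>I. length I = Suc (length J) \<Longrightarrow> P I = pb L T I"
  shows "interior u P J = pb L (interior (L *v u) T) J"
proof -
  have "interior u P J = (\<Sum>i\<in>UNIV. u $ i * (\<Sum>a\<in>UNIV. L $ a $ i * pb L (\<lambda>P. T (a # P)) J))"
    by (simp add: interior_def assms)
  also have "\<dots> = (\<Sum>a\<in>UNIV. (\<Sum>i\<in>UNIV. L $ a $ i * u $ i) * pb L (\<lambda>P. T (a # P)) J)"
    unfolding sum_distrib_left sum_distrib_right by (subst sum.swap) (simp add: mult_ac)
  finally show ?thesis
    by (simp add: interior_def[abs_def] matrix_vector_mult_def pb_sum pb_scale)
qed

text \<open>In the frame of the 3-form let v be the top component of the volume form. The defining
  relation makes the metric there -1/v times the identity, and vol^2 = det g becomes v^2 = (-1/v)^7.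
  Hence v^9 = -1, so v = -1 and the metric is Euclidean.\<close>

lemma g2_frameI:
  assumes L: "invertible L" and P: "\<And>I. length I = 3 \<Longrightarrow> P I = pullback 3 L phi0 I"
    and V: "alternating 7 V" and det: "(V idl)\<^sup>2 = det (gmat G)"
    and rel: "\<And>u v I. length I = 7 \<Longrightarrow>
      wedge 4 (wedge 2 (interior u P) (interior v P)) P I = - 6 * (u \<bullet> (gmat G *v v)) * V I"
  shows "g2_frame L P G V"
proof -
  obtain M where L_M: "L ** M = mat 1" and M_L: "M ** L = mat 1" using L by (auto simp: invertible_def)
  have P': "P I = pb L phi0 I" if "length I = 3" for I
    using P[OF that] pullback_eq_pb[OF that] by simp
  define V0 where "V0 = pb M V"
  define v where "v = V0 idl"
  define B where "B u v = shuffle 4 (shuffle 2 (interior u phi0) (interior v phi0)) phi0" for u v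
  have V_idl: "V idl = det L * v"
    using pb_top_form[OF V, of M] det_mul[of L M] by (simp add: v_def V0_def L_M)
  have B_eq: "pb L (B (L *v u) (L *v w)) I = - 6 * (u \<bullet> (gmat G *v w)) * V I" if "length I = 7" for u w I
  proof -
    have "shuffle 4 (shuffle 2 (interior u P) (interior w P)) P I
        = shuffle 4 (shuffle 2 (pb L (interior (L *v u) phi0)) (pb L (interior (L *v w) phi0))) (pb L phi0) I"
      using that by (intro shuffle_cong) (auto intro!: interior_pb P')
    also have "\<dots> = pb L (B (L *v u) (L *v w)) I"
      by (simp add: B_def shuffle_pb[symmetric] cong: shuffle_cong)
    finally show ?thesis using rel[OF that, of u w] by (simp add: wedge_eq_shuffle[abs_def])
  qed
  \<comment> \<open>The defining relation is moved to the frame by M and evaluated at the increasing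
    list, where its left side is known from \<open>phi0_top\<close>.\<close>
  have key: "u \<bullet> w = - v * ((M *v u) \<bullet> (gmat G *v (M *v w)))" for u w
  proof -
    have 1: "pb M (pb L (B u w)) idl = B u w idl" by (rule pb_inverse[OF L_M])
    have 2: "pb M (pb L (B u w)) idl = pb M (\<lambda>I. - 6 * ((M *v u) \<bullet> (gmat G *v (M *v w))) * V I) idl"
      using B_eq[of _ "M *v u" "M *v w"]
      by (intro pb_cong) (simp add: matrix_vector_mul_assoc L_M idl_facts)
    have 3: "pb M (\<lambda>I. - 6 * ((M *v u) \<bullet> (gmat G *v (M *v w))) * V I) idl
        = - 6 * ((M *v u) \<bullet> (gmat G *v (M *v w))) * v"
      by (simp only: pb_scale v_def V0_def)
    have 4: "B u w idl = 6 * (u \<bullet> w)" unfolding B_def by (rule phi0_top)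
    have "6 * (u \<bullet> w) = - 6 * ((M *v u) \<bullet> (gmat G *v (M *v w))) * v"
      using 1 2 3 4 by linarith
    moreover have "6 * a = - 6 * b * v \<Longrightarrow> a = - v * b" for a b by (simp add: mult.commute)
    ultimately show ?thesis by blast
  qed
  define N where "N = transpose M ** gmat G ** M"
  have N_eq: "- v * N $ i $ j = (if i = j then 1 else 0)" for i j
  proof -
    have "N $ i $ j = (N *v axis j 1) $ i"
      by (simp add: matrix_vector_mult_basis column_def)
    also have "\<dots> = (transpose M *v (gmat G *v (M *v axis j 1))) \<bullet> axis i 1"
      by (simp only: N_def matrix_vector_mul_assoc matrix_mul_assoc cart_eq_inner_axis)
    also have "\<dots> = (M *v axis i 1) \<bullet> (gmat G *v (M *v axis j 1))"
      unfolding transpose_matrix_vector dot_lmul_matrix by (rule inner_commute)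
    finally have "- v * N $ i $ j = axis i (1::real) \<bullet> axis j 1" using key[of "axis i 1" "axis j 1"] by simp
    then show ?thesis by (simp add: inner_axis_axis)
  qed
  have v0: "v \<noteq> 0" using N_eq[of 1 1] by auto
  have N: "N = (\<chi> i j. if i = j then - 1 / v else 0)"
  proof -
    have "N $ i $ j = (if i = j then - 1 / v else 0)" for i j
    proof -
      have "N $ i $ j = (- v * N $ i $ j) / (- v)" using v0 by simp
      then show ?thesis unfolding N_eq by auto
    qed
    then show ?thesis by (simp add: vec_eq_iff)
  qed
  have detN: "det N = (- 1 / v) ^ 7"
    unfolding N by (subst det_diagonal) simp_all
  have tL_tM: "transpose L ** transpose M = mat 1"
    using M_L by (metis matrix_transpose_mul transpose_mat)
  have "transpose L ** N ** L = (transpose L ** transpose M) ** gmat G ** (M ** L)"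
    unfolding N_def by (simp only: matrix_mul_assoc)
  then have G_eq: "gmat G = transpose L ** N ** L" by (simp add: tL_tM M_L)
  have dL: "det L \<noteq> 0" using L by (simp add: invertible_det_nz)
  have "(det L * v)\<^sup>2 = (det L)\<^sup>2 * (- 1 / v) ^ 7"
    using det unfolding V_idl G_eq by (simp add: det_mul detN power2_eq_square)
  then have "(det L)\<^sup>2 * v\<^sup>2 = (det L)\<^sup>2 * (- 1 / v) ^ 7" by (simp only: power_mult_distrib)
  then have v2: "v\<^sup>2 = (- 1 / v) ^ 7" using dL by (simp only: mult_cancel_left power_eq_0_iff) simp
  \<comment> \<open>Clearing denominators gives an odd power, whose real root is unique; this fixes
    the sign of v.\<close>
  have "v ^ 9 = v\<^sup>2 * v ^ 7" by (simp add: power_add[symmetric])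
  also have "\<dots> = (- 1 / v * v) ^ 7" unfolding v2 power_mult_distrib ..
  also have "\<dots> = (- 1) ^ 9" using v0 by simp
  finally have "v ^ 9 = (- 1) ^ 9" .
  then have v1: "v = - 1"
    using odd_real_root_unique[of 9 v "- 1"] odd_real_root_unique[of 9 "- 1" "- 1"] by simp
  have N1: "N = mat 1" unfolding N v1 by (simp add: mat_def vec_eq_iff)
  have "V I = pb L vol0 I" if I: "length I = 7" for I
  proof -
    have "V0 J = vol0 J" if "length J = 7" for J
      using alternating_7_eq[OF pb_alternating[OF V, of M] that] v1 by (simp add: V0_def v_def)
    then have "pb L V0 I = pb L vol0 I" using I by (intro pb_cong) simp
    then show ?thesis by (simp add: V0_def pb_inverse[OF M_L])
  qed
  then show ?thesis
    unfolding g2_frame_def using L P' G_eq N1 by simp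
qed

lemma g2_frame_congruence:
  assumes "g2_frame L P G V" "L ** M = mat 1"
  shows "congruence L M eucl G"
  using assms unfolding congruence_def g2_frame_def
  by (auto simp: invertible_def intro: exI[of _ "mat 1"])

lemma g2_frame_psi:
  assumes "g2_frame L P G V" "length J = 4"
  shows "hodge 3 G V P J = pb L psi0 J"
proof -
  obtain M where "L ** M = mat 1" using assms by (auto simp: g2_frame_def invertible_def)
  then interpret congruence L M eucl G using assms g2_frame_congruence by blast
  show ?thesis unfolding psi0_def
    using assms by (intro hodge_pb[OF g' G L_M]) (auto simp: g2_frame_def)
qed

subsection \<open>Identities in an adapted frame\<close>

lemma sum_if_eq: "(\<Sum>m\<in>UNIV. (if l = m then 1 else 0) * f m) = (f (l::7) :: real)"
    "(\<Sum>m\<in>UNIV. f m * (if l = m then 1 else 0)) = f l"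
    "(\<Sum>m\<in>UNIV. (if m = l then 1 else 0) * f m) = f l"
    "(\<Sum>m\<in>UNIV. f m * (if m = l then 1 else 0)) = f l"
  by (simp_all add: if_distrib if_distribR cong: if_cong)

lemma contract_psi_eucl: "contract_psi eucl \<psi> \<beta> [i, j] = (\<Sum>k\<in>UNIV. \<Sum>l\<in>UNIV. \<beta> [k, l] * \<psi> [k, l, i, j])"
  unfolding contract_psi_ctr by (simp, rule sum.swap)

lemma phi_contract_eucl: "phi_contract eucl \<phi> \<beta> J = (\<Sum>I | length I = 3. \<phi> I * \<beta> (I @ J))"
proof -
  have "(\<Sum>I | length I = 3. \<phi> I * \<beta> (I @ J)) = (\<Sum>n\<in>UNIV. \<Sum>m\<in>UNIV. \<Sum>l\<in>UNIV. \<phi> [n, m, l] * \<beta> (n # m # l # J))"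
    by (simp add: numeral_3_eq_3 sum_lists_Suc sum_lists_0[simplified])
  also have "\<dots> = (\<Sum>l\<in>UNIV. \<Sum>n\<in>UNIV. \<Sum>m\<in>UNIV. \<phi> [n, m, l] * \<beta> (n # m # l # J))"
    by (rule sum_rotate3)
  also have "\<dots> = (\<Sum>l\<in>UNIV. \<Sum>m\<in>UNIV. \<Sum>n\<in>UNIV. \<phi> [n, m, l] * \<beta> (n # m # l # J))"
    by (rule sum.cong[OF refl], rule sum.swap)
  finally show ?thesis by (simp add: phi_contract_def)
qed

lemma act_4: "act A T [a, b, c, d] =
   (\<Sum>m\<in>UNIV. A a m * T [m, b, c, d] + A b m * T [a, m, c, d] + A c m * T [a, b, m, d] + A d m * T [a, b, c, m])"
  by (simp add: sum.distrib)

lemma act_4_swap: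
  assumes T: "alternating 4 T"
  shows "act A T [j, i, k, l] = - act A T [i, j, k, l]" "act A T [i, k, j, l] = - act A T [i, j, k, l]"
    "act A T [i, j, l, k] = - act A T [i, j, k, l]"
proof -
  show "act A T [j, i, k, l] = - act A T [i, j, k, l]"
    unfolding act_4 sum_negf[symmetric]
  proof (rule sum.cong[OF refl])
    fix m
    have "T [m, i, k, l] = - T [i, m, k, l]"
      "T [j, m, k, l] = - T [m, j, k, l]"
      "T [j, i, m, l] = - T [i, j, m, l]"
      "T [j, i, k, m] = - T [i, j, k, m]"
      by (rule alternating_4D[OF T])+
    then show "A j m * T [m, i, k, l] + A i m * T [j, m, k, l] + A k m * T [j, i, m, l] + A l m * T [j, i, k, m]
      = - (A i m * T [m, j, k, l] + A j m * T [i, m, k, l] + A k m * T [i, j, m, l] + A l m * T [i, j, k, m])" by simp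
  qed
  show "act A T [i, k, j, l] = - act A T [i, j, k, l]"
    unfolding act_4 sum_negf[symmetric]
  proof (rule sum.cong[OF refl])
    fix m
    have "T [m, k, j, l] = - T [m, j, k, l]"
      "T [i, m, j, l] = - T [i, j, m, l]"
      "T [i, k, m, l] = - T [i, m, k, l]"
      "T [i, k, j, m] = - T [i, j, k, m]"
      by (rule alternating_4D[OF T])+
    then show "A i m * T [m, k, j, l] + A k m * T [i, m, j, l] + A j m * T [i, k, m, l] + A l m * T [i, k, j, m]
      = - (A i m * T [m, j, k, l] + A j m * T [i, m, k, l] + A k m * T [i, j, m, l] + A l m * T [i, j, k, m])" by simp
  qed
  show "act A T [i, j, l, k] = - act A T [i, j, k, l]"
    unfolding act_4 sum_negf[symmetric]
  proof (rule sum.cong[OF refl])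
    fix m
    have "T [m, j, l, k] = - T [m, j, k, l]"
      "T [i, m, l, k] = - T [i, m, k, l]"
      "T [i, j, m, k] = - T [i, j, k, m]"
      "T [i, j, l, m] = - T [i, j, m, l]"
      by (rule alternating_4D[OF T])+
    then show "A i m * T [m, j, l, k] + A j m * T [i, m, l, k] + A l m * T [i, j, m, k] + A k m * T [i, j, l, m]
      = - (A i m * T [m, j, k, l] + A j m * T [i, m, k, l] + A k m * T [i, j, m, l] + A l m * T [i, j, k, m])" by simp
  qed
qed

lemma phi_contract_alt1:
  assumes D: "\<And>p i j k l. D p [j, i, k, l] = - D p [i, j, k, l]" "\<And>p i j k l. D p [i, k, j, l] = - D p [i, j, k, l]"
    "\<And>p i j k l. D p [i, j, l, k] = - D p [i, j, k, l]"
  shows "phi_contract eucl phi0 (alt1 D) [i, j] = 6 * (alt1 D [1,2,3,i,j] + alt1 D [1,4,5,i,j] + alt1 D [1,6,0,i,j]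
    + alt1 D [2,4,6,i,j] - alt1 D [2,5,0,i,j] - alt1 D [3,4,0,i,j] - alt1 D [3,5,6,i,j])"
proof -
  have "alternating 3 (\<lambda>I. alt1 D (I @ [i, j]))"
    unfolding alternating_3_iff
  proof (intro allI conjI)
    fix a b c
    have "D c [b, a, i, j] = - D c [a, b, i, j]" "D i [b, a, c, j] = - D i [a, b, c, j]"
      "D j [b, a, c, i] = - D j [a, b, c, i]" by (rule D)+
    then show "alt1 D ([b, a, c] @ [i, j]) = - alt1 D ([a, b, c] @ [i, j])" by simp
    have "D a [c, b, i, j] = - D a [b, c, i, j]" "D i [a, c, b, j] = - D i [a, b, c, j]"
      "D j [a, c, b, i] = - D j [a, b, c, i]" by (rule D)+
    then show "alt1 D ([a, c, b] @ [i, j]) = - alt1 D ([a, b, c] @ [i, j])" by simp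
  qed
  from sum_phi0[OF this] show ?thesis by (simp only: phi_contract_eucl append.simps)
qed

lemmas phi_contract_act = phi_contract_alt1[where D = "\<lambda>p. act (B p) psi0" for B,
    OF act_4_swap[OF psi0_alternating]]

text \<open>The vector \<open>T\<close> with \<open>k\<cdot>\<phi> = T \<lrcorner> \<psi>\<close> for a skew endomorphism \<open>k\<close>.\<close>

definition vec_of :: "(7 \<Rightarrow> 7 \<Rightarrow> real) \<Rightarrow> 7 \<Rightarrow> real" where
  "vec_of k n = - (\<Sum>a\<in>UNIV. \<Sum>b\<in>UNIV. phi0 [n, a, b] * k a b) / 2"

lemma vec_of_values:
  assumes "\<And>i j. k i j = - k j i"
  shows "vec_of k 1 = - k 2 3 - k 4 5 - k 6 0"
    "vec_of k 2 = k 1 3 - k 4 6 + k 5 0"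
    "vec_of k 3 = - k 1 2 + k 4 0 + k 5 6"
    "vec_of k 4 = k 1 5 + k 2 6 - k 3 0"
    "vec_of k 5 = - k 1 4 - k 2 0 - k 3 6"
    "vec_of k 6 = k 1 0 - k 2 4 + k 3 5"
    "vec_of k 0 = - k 1 6 + k 2 5 + k 3 4"
proof -
  have sort: "ix j < ix i \<Longrightarrow> k i j = - k j i" for i j by (rule assms)
  show "vec_of k 1 = - k 2 3 - k 4 5 - k 6 0"
    "vec_of k 2 = k 1 3 - k 4 6 + k 5 0"
    "vec_of k 3 = - k 1 2 + k 4 0 + k 5 6"
    "vec_of k 4 = k 1 5 + k 2 6 - k 3 0"
    "vec_of k 5 = - k 1 4 - k 2 0 - k 3 6"
    "vec_of k 6 = k 1 0 - k 2 4 + k 3 5"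
    "vec_of k 0 = - k 1 6 + k 2 5 + k 3 4"
    by (simp_all add: vec_of_def sum_7 sort)
qed

lemma act_3: "act A T [a, b, c] = (\<Sum>m\<in>UNIV. A a m * T [m, b, c] + A b m * T [a, m, c] + A c m * T [a, b, m])"
  by (simp add: sum.distrib)

lemma act_3_swap:
  assumes T: "alternating 3 T"
  shows "act A T [j, i, k] = - act A T [i, j, k]" "act A T [i, k, j] = - act A T [i, j, k]"
proof -
  show "act A T [j, i, k] = - act A T [i, j, k]"
    unfolding act_3 sum_negf[symmetric]
  proof (rule sum.cong[OF refl])
    fix m
    have "T [m, i, k] = - T [i, m, k]" "T [j, m, k] = - T [m, j, k]" "T [j, i, m] = - T [i, j, m]"
      by (rule alternating_3D[OF T])+
    then show "A j m * T [m, i, k] + A i m * T [j, m, k] + A k m * T [j, i, m]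
      = - (A i m * T [m, j, k] + A j m * T [i, m, k] + A k m * T [i, j, m])" by simp
  qed
  show "act A T [i, k, j] = - act A T [i, j, k]"
    unfolding act_3 sum_negf[symmetric]
  proof (rule sum.cong[OF refl])
    fix m
    have "T [m, k, j] = - T [m, j, k]" "T [i, m, j] = - T [i, j, m]" "T [i, k, m] = - T [i, m, k]"
      by (rule alternating_3D[OF T])+
    then show "A i m * T [m, k, j] + A k m * T [i, m, j] + A j m * T [i, k, m]
      = - (A i m * T [m, j, k] + A j m * T [i, m, k] + A k m * T [i, j, m])" by simp
  qed
qed

lemma act_psi0_sort:
  "ix j < ix i \<Longrightarrow> act A psi0 [i, j, k, l] = - act A psi0 [j, i, k, l]"
  "ix k < ix j \<Longrightarrow> act A psi0 [i, j, k, l] = - act A psi0 [i, k, j, l]"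
  "ix l < ix k \<Longrightarrow> act A psi0 [i, j, k, l] = - act A psi0 [i, j, l, k]"
  "act A psi0 [i, i, k, l] = 0" "act A psi0 [i, k, k, l] = 0" "act A psi0 [i, j, k, k] = 0"
  by (rule act_4_swap[OF psi0_alternating])+
    (use act_4_swap(1)[OF psi0_alternating, of A i i k l] act_4_swap(2)[OF psi0_alternating, of A i k k l]
      act_4_swap(3)[OF psi0_alternating, of A i j k k] in \<open>simp_all del: act.simps\<close>)

lemma act_psi0_values:
    "act A psi0 [1, 2, 3, 4] = A 1 5 + A 2 6 - A 3 0" "act A psi0 [1, 2, 3, 5] = - A 1 4 - A 2 0 - A 3 6"
    "act A psi0 [1, 2, 3, 6] = A 1 0 - A 2 4 + A 3 5" "act A psi0 [1, 2, 3, 0] = - A 1 6 + A 2 5 + A 3 4"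
    "act A psi0 [1, 2, 4, 5] = A 1 3 - A 4 6 + A 5 0" "act A psi0 [1, 2, 4, 6] = A 2 3 + A 4 5 + A 6 0"
    "act A psi0 [1, 2, 4, 0] = A 1 1 + A 2 2 + A 4 4 + A 0 0" "act A psi0 [1, 2, 5, 6] = A 1 1 + A 2 2 + A 5 5 + A 6 6"
    "act A psi0 [1, 2, 5, 0] = - A 2 3 + A 5 4 + A 0 6" "act A psi0 [1, 2, 6, 0] = A 1 3 + A 6 4 - A 0 5"
    "act A psi0 [1, 3, 4, 5] = - A 1 2 + A 4 0 + A 5 6" "act A psi0 [1, 3, 4, 6] = A 1 1 + A 3 3 + A 4 4 + A 6 6"
    "act A psi0 [1, 3, 4, 0] = A 3 2 - A 4 5 + A 0 6" "act A psi0 [1, 3, 5, 6] = A 3 2 + A 5 4 - A 6 0"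
    "act A psi0 [1, 3, 5, 0] = - A 1 1 - A 3 3 - A 5 5 - A 0 0" "act A psi0 [1, 3, 6, 0] = - A 1 2 - A 6 5 - A 0 4"
    "act A psi0 [1, 4, 5, 6] = A 1 0 + A 4 2 - A 5 3" "act A psi0 [1, 4, 5, 0] = - A 1 6 - A 4 3 - A 5 2"
    "act A psi0 [1, 4, 6, 0] = A 1 5 - A 6 2 + A 0 3" "act A psi0 [1, 5, 6, 0] = - A 1 4 + A 6 3 + A 0 2"
    "act A psi0 [2, 3, 4, 5] = - A 2 2 - A 3 3 - A 4 4 - A 5 5" "act A psi0 [2, 3, 4, 6] = A 2 1 + A 4 0 - A 6 5"
    "act A psi0 [2, 3, 4, 0] = - A 3 1 - A 4 6 - A 0 5" "act A psi0 [2, 3, 5, 6] = - A 3 1 + A 5 0 + A 6 4"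
    "act A psi0 [2, 3, 5, 0] = - A 2 1 - A 5 6 + A 0 4" "act A psi0 [2, 3, 6, 0] = - A 2 2 - A 3 3 - A 6 6 - A 0 0"
    "act A psi0 [2, 4, 5, 6] = A 2 0 - A 4 1 - A 6 3" "act A psi0 [2, 4, 5, 0] = - A 2 6 + A 5 1 - A 0 3"
    "act A psi0 [2, 4, 6, 0] = A 2 5 - A 4 3 + A 6 1" "act A psi0 [2, 5, 6, 0] = - A 2 4 - A 5 3 - A 0 1"
    "act A psi0 [3, 4, 5, 6] = A 3 0 + A 5 1 + A 6 2" "act A psi0 [3, 4, 5, 0] = - A 3 6 + A 4 1 + A 0 2"
    "act A psi0 [3, 4, 6, 0] = A 3 5 + A 4 2 - A 0 1" "act A psi0 [3, 5, 6, 0] = - A 3 4 + A 5 2 - A 6 1"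
    "act A psi0 [4, 5, 6, 0] = - A 4 4 - A 5 5 - A 6 6 - A 0 0"
  by (simp_all add: sum_7)

lemmas act_psi0 = act_psi0_sort act_psi0_values

lemma act_phi0_sort:
  "ix j < ix i \<Longrightarrow> act A phi0 [i, j, k] = - act A phi0 [j, i, k]"
  "ix k < ix j \<Longrightarrow> act A phi0 [i, j, k] = - act A phi0 [i, k, j]"
  "act A phi0 [i, i, k] = 0" "act A phi0 [i, k, k] = 0"
  by (rule act_3_swap[OF phi0_alternating])+
    (use act_3_swap(1)[OF phi0_alternating, of A i i k] act_3_swap(2)[OF phi0_alternating, of A i k k]
      in \<open>simp_all del: act.simps\<close>)

lemma act_phi0_values:
    "act A phi0 [1, 2, 3] = A 1 1 + A 2 2 + A 3 3" "act A phi0 [1, 2, 4] = A 1 6 - A 2 5 + A 4 3"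
    "act A phi0 [1, 2, 5] = - A 1 0 + A 2 4 + A 5 3" "act A phi0 [1, 2, 6] = - A 1 4 - A 2 0 + A 6 3"
    "act A phi0 [1, 2, 0] = A 1 5 + A 2 6 + A 0 3" "act A phi0 [1, 3, 4] = - A 1 0 - A 3 5 - A 4 2"
    "act A phi0 [1, 3, 5] = - A 1 6 + A 3 4 - A 5 2" "act A phi0 [1, 3, 6] = A 1 5 - A 3 0 - A 6 2"
    "act A phi0 [1, 3, 0] = A 1 4 + A 3 6 - A 0 2" "act A phi0 [1, 4, 5] = A 1 1 + A 4 4 + A 5 5"
    "act A phi0 [1, 4, 6] = A 1 2 - A 4 0 + A 6 5" "act A phi0 [1, 4, 0] = - A 1 3 + A 4 6 + A 0 5"
    "act A phi0 [1, 5, 6] = - A 1 3 - A 5 0 - A 6 4" "act A phi0 [1, 5, 0] = - A 1 2 + A 5 6 - A 0 4"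
    "act A phi0 [1, 6, 0] = A 1 1 + A 6 6 + A 0 0" "act A phi0 [2, 3, 4] = - A 2 0 - A 3 6 + A 4 1"
    "act A phi0 [2, 3, 5] = - A 2 6 + A 3 0 + A 5 1" "act A phi0 [2, 3, 6] = A 2 5 + A 3 4 + A 6 1"
    "act A phi0 [2, 3, 0] = A 2 4 - A 3 5 + A 0 1" "act A phi0 [2, 4, 5] = A 2 1 + A 4 0 + A 5 6"
    "act A phi0 [2, 4, 6] = A 2 2 + A 4 4 + A 6 6" "act A phi0 [2, 4, 0] = - A 2 3 - A 4 5 + A 0 6"
    "act A phi0 [2, 5, 6] = - A 2 3 + A 5 4 - A 6 0" "act A phi0 [2, 5, 0] = - A 2 2 - A 5 5 - A 0 0"
    "act A phi0 [2, 6, 0] = A 2 1 - A 6 5 - A 0 4" "act A phi0 [3, 4, 5] = A 3 1 + A 4 6 - A 5 0"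
    "act A phi0 [3, 4, 6] = A 3 2 - A 4 5 - A 6 0" "act A phi0 [3, 4, 0] = - A 3 3 - A 4 4 - A 0 0"
    "act A phi0 [3, 5, 6] = - A 3 3 - A 5 5 - A 6 6" "act A phi0 [3, 5, 0] = - A 3 2 - A 5 4 - A 0 6"
    "act A phi0 [3, 6, 0] = A 3 1 - A 6 4 + A 0 5" "act A phi0 [4, 5, 6] = - A 4 3 - A 5 2 + A 6 1"
    "act A phi0 [4, 5, 0] = - A 4 2 + A 5 3 + A 0 1" "act A phi0 [4, 6, 0] = A 4 1 + A 6 3 + A 0 2"
    "act A phi0 [5, 6, 0] = A 5 1 + A 6 2 - A 0 3"
  by (simp_all add: sum_7)

lemmas act_phi0 = act_phi0_sort act_phi0_values

text \<open>On skew tensors this operator has eigenvalue -4 on the 7-dimensional summand and 2 on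
  the 14-dimensional one, and it kills symmetric tensors. Both projections are affine in it.\<close>

definition cpsi :: "(7 \<Rightarrow> 7 \<Rightarrow> real) \<Rightarrow> 7 \<Rightarrow> 7 \<Rightarrow> real" where
  "cpsi \<beta> i j = (\<Sum>k\<in>UNIV. \<Sum>l\<in>UNIV. \<beta> k l * psi0 [k, l, i, j])"

definition vphi :: "(7 \<Rightarrow> real) \<Rightarrow> 7 \<Rightarrow> 7 \<Rightarrow> real" where
  "vphi v i j = (\<Sum>l\<in>UNIV. v l * phi0 [l, i, j])"

lemma cpsi_swap: "cpsi \<beta> j i = - cpsi \<beta> i j"
  unfolding cpsi_def sum_negf[symmetric]
  using alternating_4D(3)[OF psi0_alternating] by (intro sum.cong refl) (metis mult_minus_right)

lemma vphi_swap: "vphi v j i = - vphi v i j"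
  unfolding vphi_def sum_negf[symmetric]
  using alternating_3D(2)[OF phi0_alternating] by (intro sum.cong refl) (metis mult_minus_right)

lemma cpsi_values:
  "ix j < ix i \<Longrightarrow> cpsi \<beta> i j = - cpsi \<beta> j i" "cpsi \<beta> i i = 0"
    "cpsi \<beta> 1 2 = \<beta> 4 0 + \<beta> 5 6 - \<beta> 6 5 - \<beta> 0 4" "cpsi \<beta> 1 3 = \<beta> 4 6 - \<beta> 5 0 - \<beta> 6 4 + \<beta> 0 5"
    "cpsi \<beta> 1 4 = - \<beta> 2 0 - \<beta> 3 6 + \<beta> 6 3 + \<beta> 0 2" "cpsi \<beta> 1 5 = - \<beta> 2 6 + \<beta> 3 0 + \<beta> 6 2 - \<beta> 0 3"
    "cpsi \<beta> 1 6 = \<beta> 2 5 + \<beta> 3 4 - \<beta> 4 3 - \<beta> 5 2" "cpsi \<beta> 1 0 = \<beta> 2 4 - \<beta> 3 5 - \<beta> 4 2 + \<beta> 5 3"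
    "cpsi \<beta> 2 3 = - \<beta> 4 5 + \<beta> 5 4 - \<beta> 6 0 + \<beta> 0 6" "cpsi \<beta> 2 4 = \<beta> 1 0 + \<beta> 3 5 - \<beta> 5 3 - \<beta> 0 1"
    "cpsi \<beta> 2 5 = \<beta> 1 6 - \<beta> 3 4 + \<beta> 4 3 - \<beta> 6 1" "cpsi \<beta> 2 6 = - \<beta> 1 5 + \<beta> 3 0 + \<beta> 5 1 - \<beta> 0 3"
    "cpsi \<beta> 2 0 = - \<beta> 1 4 - \<beta> 3 6 + \<beta> 4 1 + \<beta> 6 3" "cpsi \<beta> 3 4 = \<beta> 1 6 - \<beta> 2 5 + \<beta> 5 2 - \<beta> 6 1"
    "cpsi \<beta> 3 5 = - \<beta> 1 0 + \<beta> 2 4 - \<beta> 4 2 + \<beta> 0 1" "cpsi \<beta> 3 6 = - \<beta> 1 4 - \<beta> 2 0 + \<beta> 4 1 + \<beta> 0 2"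
    "cpsi \<beta> 3 0 = \<beta> 1 5 + \<beta> 2 6 - \<beta> 5 1 - \<beta> 6 2" "cpsi \<beta> 4 5 = - \<beta> 2 3 + \<beta> 3 2 - \<beta> 6 0 + \<beta> 0 6"
    "cpsi \<beta> 4 6 = \<beta> 1 3 - \<beta> 3 1 + \<beta> 5 0 - \<beta> 0 5" "cpsi \<beta> 4 0 = \<beta> 1 2 - \<beta> 2 1 - \<beta> 5 6 + \<beta> 6 5"
    "cpsi \<beta> 5 6 = \<beta> 1 2 - \<beta> 2 1 - \<beta> 4 0 + \<beta> 0 4" "cpsi \<beta> 5 0 = - \<beta> 1 3 + \<beta> 3 1 + \<beta> 4 6 - \<beta> 6 4"
    "cpsi \<beta> 6 0 = - \<beta> 2 3 + \<beta> 3 2 - \<beta> 4 5 + \<beta> 5 4"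
  by (rule cpsi_swap) (use cpsi_swap[of \<beta> i i] in \<open>simp_all add: cpsi_def sum_7\<close>)

lemma vphi_values:
  "ix j < ix i \<Longrightarrow> vphi v i j = - vphi v j i" "vphi v i i = 0"
    "vphi v 1 2 = v 3" "vphi v 1 3 = - v 2" "vphi v 1 4 = v 5" "vphi v 1 5 = - v 4"
    "vphi v 1 6 = v 0" "vphi v 1 0 = - v 6" "vphi v 2 3 = v 1" "vphi v 2 4 = v 6"
    "vphi v 2 5 = - v 0" "vphi v 2 6 = - v 4" "vphi v 2 0 = v 5" "vphi v 3 4 = - v 0"
    "vphi v 3 5 = - v 6" "vphi v 3 6 = v 5" "vphi v 3 0 = v 4" "vphi v 4 5 = v 1"
    "vphi v 4 6 = v 2" "vphi v 4 0 = - v 3" "vphi v 5 6 = - v 3" "vphi v 5 0 = - v 2"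
    "vphi v 6 0 = v 1"
  by (rule vphi_swap) (use vphi_swap[of v i i] in \<open>simp_all add: vphi_def sum_7\<close>)

text \<open>With Y the difference of T and its transpose and Y_7, Y_14 its components, the
  eigenvalues of \<open>cpsi\<close> make this -24 Y_7 - 6 Y_14.\<close>

definition dcurl :: "(7 \<Rightarrow> 7 \<Rightarrow> real) \<Rightarrow> 7 \<Rightarrow> 7 \<Rightarrow> real" where
  "dcurl T i j = - 12 * (T i j - T j i) + 3 * cpsi (\<lambda>k l. T k l - T l k) i j"

text \<open>Linear identities between skew tensors are verified below by computing the 21 entries
  above the diagonal.\<close>

lemma skew_forall_7:
  assumes "\<And>i j. P i j = - P j i" "\<And>i j. Q i j = - Q j (i :: 7) "
    and "P 1 2 = Q 1 2 \<and> P 1 3 = Q 1 3 \<and> P 1 4 = Q 1 4 \<and> P 1 5 = Q 1 5 \<and> P 1 6 = Q 1 6 \<and> P 1 0 = Q 1 0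
      \<and> P 2 3 = Q 2 3 \<and> P 2 4 = Q 2 4 \<and> P 2 5 = Q 2 5 \<and> P 2 6 = Q 2 6 \<and> P 2 0 = Q 2 0
      \<and> P 3 4 = Q 3 4 \<and> P 3 5 = Q 3 5 \<and> P 3 6 = Q 3 6 \<and> P 3 0 = Q 3 0
      \<and> P 4 5 = Q 4 5 \<and> P 4 6 = Q 4 6 \<and> P 4 0 = Q 4 0 \<and> P 5 6 = Q 5 6 \<and> P 5 0 = Q 5 0 \<and> P 6 0 = Q 6 0"
  shows "P i j = (Q i j :: real)"
proof -
  have lt: "\<forall>i j. ix i < ix j \<longrightarrow> P i j = Q i j"
    unfolding forall_7 using assms(3) by simp
  have diag: "P i i = Q i i" using assms(1,2)[of i i] by simp
  show ?thesis
  proof (cases "ix i < ix j")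
    case False
    then have "i = j \<or> ix j < ix i" using inj_ix by (meson injD linorder_neqE_nat)
    then show ?thesis using lt diag assms(1)[of i j] assms(2)[of i j] by auto
  qed (use lt in blast)
qed

lemma phi_contract_act_skew:
  "phi_contract eucl phi0 (alt1 (\<lambda>p. act (B p) psi0)) [i, j] = - phi_contract eucl phi0 (alt1 (\<lambda>p. act (B p) psi0)) [j, i]"
proof -
  have "alt1 (\<lambda>p. act (B p) psi0) [a, b, c, j, i] = - alt1 (\<lambda>p. act (B p) psi0) [a, b, c, i, j]" for a b c i j
    using act_4_swap[OF psi0_alternating, of "B a" b c j i] act_4_swap[OF psi0_alternating, of "B b" a c j i]
      act_4_swap[OF psi0_alternating, of "B c" a b j i]
    by (simp only: alt1.simps)
  from this[of _ _ _ j i] show ?thesis by (simp add: phi_contract_act del: alt1.simps act.simps)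
qed

text \<open>The stabiliser g2 of \<phi> kills \<psi>, so a skew K acts on \<psi> only through its
  7-dimensional part, which \<open>vec_of\<close> records; the identity is then a linear
  check.\<close>

lemma phi_contract_skew:
  assumes K: "\<And>p i j. K p i j = - K p j i"
  shows "phi_contract eucl phi0 (alt1 (\<lambda>p. act (K p) psi0)) [i, j] = dcurl (\<lambda>p. vec_of (K p)) i j"
proof (rule skew_forall_7[where P = "\<lambda>i j. phi_contract eucl phi0 (alt1 (\<lambda>p. act (K p) psi0)) [i, j]"])
  have sort: "ix j < ix i \<Longrightarrow> K p i j = - K p j i" and diag: "K p i i = 0" for p i j
    using K[of p i j] K[of p i i] by simp_all
  show "dcurl (\<lambda>p. vec_of (K p)) i j = - dcurl (\<lambda>p. vec_of (K p)) j i" for i j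
    unfolding dcurl_def by (simp add: cpsi_swap[of _ i j])
  let ?P = "\<lambda>i j. phi_contract eucl phi0 (alt1 (\<lambda>p. act (K p) psi0)) [i, j] = dcurl (\<lambda>p. vec_of (K p)) i j"
  show "?P 1 2 \<and> ?P 1 3 \<and> ?P 1 4 \<and> ?P 1 5 \<and> ?P 1 6 \<and> ?P 1 0
      \<and> ?P 2 3 \<and> ?P 2 4 \<and> ?P 2 5 \<and> ?P 2 6 \<and> ?P 2 0
      \<and> ?P 3 4 \<and> ?P 3 5 \<and> ?P 3 6 \<and> ?P 3 0
      \<and> ?P 4 5 \<and> ?P 4 6 \<and> ?P 4 0 \<and> ?P 5 6 \<and> ?P 5 0 \<and> ?P 6 0"
    unfolding phi_contract_act dcurl_def
    by (intro conjI; simp add: act_psi0 cpsi_values vec_of_values[of "K p" for p, OF K] sort diag del: act.simps)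
qed (rule phi_contract_act_skew)

text \<open>With n in the role of the covariant derivative of h, the four terms are its divergence,
  the gradient of its trace, and its antisymmetrised curl: all first derivatives of h in the theorem
  originate here.\<close>

lemma phi_contract_sym:
  fixes n :: "7 \<Rightarrow> 7 \<Rightarrow> 7 \<Rightarrow> real"
  assumes n: "\<And>p i j. n p i j = n p j i"
  shows "phi_contract eucl phi0 (alt1 (\<lambda>p. act (n p) psi0)) [i, j] =
     6 * (vphi (\<lambda>k. \<Sum>p\<in>UNIV. n p p k) i j - vphi (\<lambda>k. \<Sum>p\<in>UNIV. n k p p) i j
       - (\<Sum>k\<in>UNIV. vphi (n k i) j k) + (\<Sum>k\<in>UNIV. vphi (n k j) i k))"
    (is "?L i j = ?R i j")
proof (rule skew_forall_7[where P = ?L])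
  note sort = n[of _ 2 1] n[of _ 3 1] n[of _ 4 1] n[of _ 5 1] n[of _ 6 1] n[of _ 0 1] n[of _ 3 2] n[of _ 4 2] n[of _ 5 2] n[of _ 6 2] n[of _ 0 2] n[of _ 4 3] n[of _ 5 3] n[of _ 6 3] n[of _ 0 3] n[of _ 5 4] n[of _ 6 4] n[of _ 0 4] n[of _ 6 5] n[of _ 0 5] n[of _ 0 6]
  show "?R i j = - ?R j i" for i j
    by (simp add: vphi_swap[of _ i j])
  let ?P = "\<lambda>i j. ?L i j = ?R i j"
  show "?P 1 2 \<and> ?P 1 3 \<and> ?P 1 4 \<and> ?P 1 5 \<and> ?P 1 6 \<and> ?P 1 0
      \<and> ?P 2 3 \<and> ?P 2 4 \<and> ?P 2 5 \<and> ?P 2 6 \<and> ?P 2 0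
      \<and> ?P 3 4 \<and> ?P 3 5 \<and> ?P 3 6 \<and> ?P 3 0
      \<and> ?P 4 5 \<and> ?P 4 6 \<and> ?P 4 0 \<and> ?P 5 6 \<and> ?P 5 0 \<and> ?P 6 0"
    unfolding phi_contract_act
    by (intro conjI; simp add: act_psi0 vphi_values sort sum_7 del: act.simps)
qed (rule phi_contract_act_skew)

text \<open>On skew tensors this reads x^2 = 8 - 2 x, with roots -4 and 2.\<close>

lemma cpsi_cpsi: "cpsi (cpsi \<beta>) i j = 4 * (\<beta> i j - \<beta> j i) - 2 * cpsi \<beta> i j"
    (is "?L i j = ?R i j")
proof (rule skew_forall_7[where P = ?L])
  show "?R i j = - ?R j i" for i j by (simp add: cpsi_swap[of _ i j])
  let ?P = "\<lambda>i j. ?L i j = ?R i j"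
  show "?P 1 2 \<and> ?P 1 3 \<and> ?P 1 4 \<and> ?P 1 5 \<and> ?P 1 6 \<and> ?P 1 0
      \<and> ?P 2 3 \<and> ?P 2 4 \<and> ?P 2 5 \<and> ?P 2 6 \<and> ?P 2 0
      \<and> ?P 3 4 \<and> ?P 3 5 \<and> ?P 3 6 \<and> ?P 3 0
      \<and> ?P 4 5 \<and> ?P 4 6 \<and> ?P 4 0 \<and> ?P 5 6 \<and> ?P 5 0 \<and> ?P 6 0"
    by (intro conjI; simp add: cpsi_values)
qed (rule cpsi_swap)

lemma cpsi_vphi: "cpsi (vphi v) i j = - 4 * vphi v i j"
    (is "?L i j = ?R i j")
proof (rule skew_forall_7[where P = ?L])
  show "?R i j = - ?R j i" for i j by (simp add: vphi_swap[of _ i j])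
  let ?P = "\<lambda>i j. ?L i j = ?R i j"
  show "?P 1 2 \<and> ?P 1 3 \<and> ?P 1 4 \<and> ?P 1 5 \<and> ?P 1 6 \<and> ?P 1 0
      \<and> ?P 2 3 \<and> ?P 2 4 \<and> ?P 2 5 \<and> ?P 2 6 \<and> ?P 2 0
      \<and> ?P 3 4 \<and> ?P 3 5 \<and> ?P 3 6 \<and> ?P 3 0
      \<and> ?P 4 5 \<and> ?P 4 6 \<and> ?P 4 0 \<and> ?P 5 6 \<and> ?P 5 0 \<and> ?P 6 0"
    by (intro conjI; simp add: cpsi_values vphi_values)
qed (rule cpsi_swap)

text \<open>Equivalently, the 7-part of the antisymmetrised curl is -1/3 of the divergence term
  minus the trace-gradient term. Therefore no curl of h survives in the equation for tau_1, while in
  the one for tau_2 these two terms acquire the factor 1/3.\<close>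

lemma cpsi_curl_sym:
  fixes n :: "7 \<Rightarrow> 7 \<Rightarrow> 7 \<Rightarrow> real"
  assumes n: "\<And>p i j. n p i j = n p j i"
  shows "cpsi (\<lambda>i j. (\<Sum>k\<in>UNIV. vphi (n k i) j k) - (\<Sum>k\<in>UNIV. vphi (n k j) i k)) i j =
     2 * ((\<Sum>k\<in>UNIV. vphi (n k i) j k) - (\<Sum>k\<in>UNIV. vphi (n k j) i k))
     + 2 * (vphi (\<lambda>k. \<Sum>p\<in>UNIV. n p p k) i j - vphi (\<lambda>k. \<Sum>p\<in>UNIV. n k p p) i j)"
    (is "?L i j = ?R i j")
proof (rule skew_forall_7[where P = ?L])
  note sort = n[of _ 2 1] n[of _ 3 1] n[of _ 4 1] n[of _ 5 1] n[of _ 6 1] n[of _ 0 1] n[of _ 3 2] n[of _ 4 2] n[of _ 5 2] n[of _ 6 2] n[of _ 0 2] n[of _ 4 3] n[of _ 5 3] n[of _ 6 3] n[of _ 0 3] n[of _ 5 4] n[of _ 6 4] n[of _ 0 4] n[of _ 6 5] n[of _ 0 5] n[of _ 0 6]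
  show "?R i j = - ?R j i" for i j by (simp add: vphi_swap[of _ i j])
  let ?P = "\<lambda>i j. ?L i j = ?R i j"
  show "?P 1 2 \<and> ?P 1 3 \<and> ?P 1 4 \<and> ?P 1 5 \<and> ?P 1 6 \<and> ?P 1 0
      \<and> ?P 2 3 \<and> ?P 2 4 \<and> ?P 2 5 \<and> ?P 2 6 \<and> ?P 2 0
      \<and> ?P 3 4 \<and> ?P 3 5 \<and> ?P 3 6 \<and> ?P 3 0
      \<and> ?P 4 5 \<and> ?P 4 6 \<and> ?P 4 0 \<and> ?P 5 6 \<and> ?P 5 0 \<and> ?P 6 0"
    by (intro conjI; simp add: cpsi_values vphi_values sort sum_7)
qed (rule cpsi_swap)

definition mm :: "(7 \<Rightarrow> 7 \<Rightarrow> real) \<Rightarrow> (7 \<Rightarrow> 7 \<Rightarrow> real) \<Rightarrow> 7 \<Rightarrow> 7 \<Rightarrow> real" where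
  "mm A B i j = (\<Sum>l\<in>UNIV. A i l * B l j)"


text \<open>The 14-dimensional summand is the Lie algebra g2, which preserves the 7-dimensional one
  under the bracket; so the commutator lies in the eigenspace of -4.\<close>

lemma cpsi_comm_14:
  assumes s: "\<And>i j. s i j = - s j i" and s0: "\<And>k. vec_of s k = 0"
  shows "cpsi (\<lambda>i j. mm (vphi v) s i j - mm s (vphi v) i j) i j = - 4 * (mm (vphi v) s i j - mm s (vphi v) i j)"
    (is "?L i j = ?R i j")
proof (rule skew_forall_7[where P = ?L])
  have sort: "ix j < ix i \<Longrightarrow> s i j = - s j i" and diag: "s i i = 0" for i j
    using s[of i j] s[of i i] by simp_all
  \<comment> \<open>The seven equations \<open>vec_of s k = 0\<close> eliminate seven of the 21
    components; fourteen free ones remain.\<close>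
  have e: "s 6 0 = - s 2 3 - s 4 5" "s 5 0 = s 4 6 - s 1 3" "s 5 6 = s 1 2 - s 4 0"
    "s 3 0 = s 1 5 + s 2 6" "s 3 6 = - s 1 4 - s 2 0" "s 3 5 = s 2 4 - s 1 0" "s 3 4 = s 1 6 - s 2 5"
    using s0[of 1] s0[of 2] s0[of 3] s0[of 4] s0[of 5] s0[of 6] s0[of 0]
    unfolding vec_of_values[of s, OF s] by linarith+
  have "mm (vphi v) s j i = mm s (vphi v) i j" for i j
    unfolding mm_def by (rule sum.cong) (simp_all add: s[of _ i] vphi_swap[of v _ j])
  then show "?R i j = - ?R j i" for i j by simp
  let ?P = "\<lambda>i j. ?L i j = ?R i j"
  show "?P 1 2 \<and> ?P 1 3 \<and> ?P 1 4 \<and> ?P 1 5 \<and> ?P 1 6 \<and> ?P 1 0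
      \<and> ?P 2 3 \<and> ?P 2 4 \<and> ?P 2 5 \<and> ?P 2 6 \<and> ?P 2 0
      \<and> ?P 3 4 \<and> ?P 3 5 \<and> ?P 3 6 \<and> ?P 3 0
      \<and> ?P 4 5 \<and> ?P 4 6 \<and> ?P 4 0 \<and> ?P 5 6 \<and> ?P 5 0 \<and> ?P 6 0"
    by (intro conjI; simp add: cpsi_values vphi_values mm_def sum_7 sort diag; simp add: e algebra_simps)
qed (rule cpsi_swap)

lemma cpsi_linear:
  "cpsi (\<lambda>i j. a i j + b i j) i j = cpsi a i j + cpsi b i j"
  "cpsi (\<lambda>i j. a i j - b i j) i j = cpsi a i j - cpsi b i j"
  "cpsi (\<lambda>i j. r * a i j) i j = r * cpsi a i j"
  "cpsi (\<lambda>i j. - a i j) i j = - cpsi a i j"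
  "cpsi (\<lambda>i j. a i j / r) i j = cpsi a i j / r"
  by (simp_all add: cpsi_def sum.distrib sum_subtractf sum_distrib_left sum_negf sum_divide_distrib algebra_simps)

lemma vec_of_cpsi: "vec_of (cpsi \<beta>) k = 2 * (\<Sum>n\<in>UNIV. \<Sum>m\<in>UNIV. \<beta> n m * phi0 [n, m, k])"
proof -
  have "\<forall>k. vec_of (cpsi \<beta>) k = 2 * (\<Sum>n\<in>UNIV. \<Sum>m\<in>UNIV. \<beta> n m * phi0 [n, m, k])"
    unfolding forall_7 vec_of_values[of "cpsi \<beta>", OF cpsi_swap]
    by (intro conjI; simp add: cpsi_values sum_7)
  then show ?thesis by blast
qed

lemma sum_alternating_3:
  assumes a: "alternating 3 \<alpha>" and b: "alternating 3 \<beta>"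
  shows "(\<Sum>I | length I = 3. \<alpha> I * \<beta> I) = 6 * (\<alpha> [1, 2, 3] * \<beta> [1, 2, 3] + \<alpha> [1, 2, 4] * \<beta> [1, 2, 4] + \<alpha> [1, 2, 5] * \<beta> [1, 2, 5] + \<alpha> [1, 2, 6] * \<beta> [1, 2, 6] +
      \<alpha> [1, 2, 0] * \<beta> [1, 2, 0] + \<alpha> [1, 3, 4] * \<beta> [1, 3, 4] + \<alpha> [1, 3, 5] * \<beta> [1, 3, 5] + \<alpha> [1, 3, 6] * \<beta> [1, 3, 6] +
      \<alpha> [1, 3, 0] * \<beta> [1, 3, 0] + \<alpha> [1, 4, 5] * \<beta> [1, 4, 5] + \<alpha> [1, 4, 6] * \<beta> [1, 4, 6] + \<alpha> [1, 4, 0] * \<beta> [1, 4, 0] +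
      \<alpha> [1, 5, 6] * \<beta> [1, 5, 6] + \<alpha> [1, 5, 0] * \<beta> [1, 5, 0] + \<alpha> [1, 6, 0] * \<beta> [1, 6, 0] + \<alpha> [2, 3, 4] * \<beta> [2, 3, 4] +
      \<alpha> [2, 3, 5] * \<beta> [2, 3, 5] + \<alpha> [2, 3, 6] * \<beta> [2, 3, 6] + \<alpha> [2, 3, 0] * \<beta> [2, 3, 0] + \<alpha> [2, 4, 5] * \<beta> [2, 4, 5] +
      \<alpha> [2, 4, 6] * \<beta> [2, 4, 6] + \<alpha> [2, 4, 0] * \<beta> [2, 4, 0] + \<alpha> [2, 5, 6] * \<beta> [2, 5, 6] + \<alpha> [2, 5, 0] * \<beta> [2, 5, 0] +
      \<alpha> [2, 6, 0] * \<beta> [2, 6, 0] + \<alpha> [3, 4, 5] * \<beta> [3, 4, 5] + \<alpha> [3, 4, 6] * \<beta> [3, 4, 6] + \<alpha> [3, 4, 0] * \<beta> [3, 4, 0] +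
      \<alpha> [3, 5, 6] * \<beta> [3, 5, 6] + \<alpha> [3, 5, 0] * \<beta> [3, 5, 0] + \<alpha> [3, 6, 0] * \<beta> [3, 6, 0] + \<alpha> [4, 5, 6] * \<beta> [4, 5, 6] +
      \<alpha> [4, 5, 0] * \<beta> [4, 5, 0] + \<alpha> [4, 6, 0] * \<beta> [4, 6, 0] + \<alpha> [5, 6, 0] * \<beta> [5, 6, 0])"
proof -
  have sort: "ix j < ix i \<Longrightarrow> \<alpha> [i, j, k] = - \<alpha> [j, i, k]" "ix k < ix j \<Longrightarrow> \<alpha> [i, j, k] = - \<alpha> [i, k, j]"
    "\<alpha> [i, i, k] = 0" "\<alpha> [i, k, k] = 0"
    "ix j < ix i \<Longrightarrow> \<beta> [i, j, k] = - \<beta> [j, i, k]" "ix k < ix j \<Longrightarrow> \<beta> [i, j, k] = - \<beta> [i, k, j]"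
    "\<beta> [i, i, k] = 0" "\<beta> [i, k, k] = 0" for i j k
    by (rule alternating_3D[OF a] alternating_3D[OF b])+
  show ?thesis
    by (simp add: numeral_3_eq_3 sum_lists_Suc sum_lists_0[simplified] sum_7 sort)
qed

lemma hodge_3_eucl_values:
  assumes a: "alternating 3 \<alpha>"
  shows
    "hodge 3 eucl vol0 \<alpha> [1, 2, 3, 4] = - \<alpha> [5, 6, 0]" "hodge 3 eucl vol0 \<alpha> [1, 2, 3, 5] = \<alpha> [4, 6, 0]"
    "hodge 3 eucl vol0 \<alpha> [1, 2, 3, 6] = - \<alpha> [4, 5, 0]" "hodge 3 eucl vol0 \<alpha> [1, 2, 3, 0] = \<alpha> [4, 5, 6]"
    "hodge 3 eucl vol0 \<alpha> [1, 2, 4, 5] = - \<alpha> [3, 6, 0]" "hodge 3 eucl vol0 \<alpha> [1, 2, 4, 6] = \<alpha> [3, 5, 0]"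
    "hodge 3 eucl vol0 \<alpha> [1, 2, 4, 0] = - \<alpha> [3, 5, 6]" "hodge 3 eucl vol0 \<alpha> [1, 2, 5, 6] = - \<alpha> [3, 4, 0]"
    "hodge 3 eucl vol0 \<alpha> [1, 2, 5, 0] = \<alpha> [3, 4, 6]" "hodge 3 eucl vol0 \<alpha> [1, 2, 6, 0] = - \<alpha> [3, 4, 5]"
    "hodge 3 eucl vol0 \<alpha> [1, 3, 4, 5] = \<alpha> [2, 6, 0]" "hodge 3 eucl vol0 \<alpha> [1, 3, 4, 6] = - \<alpha> [2, 5, 0]"
    "hodge 3 eucl vol0 \<alpha> [1, 3, 4, 0] = \<alpha> [2, 5, 6]" "hodge 3 eucl vol0 \<alpha> [1, 3, 5, 6] = \<alpha> [2, 4, 0]"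
    "hodge 3 eucl vol0 \<alpha> [1, 3, 5, 0] = - \<alpha> [2, 4, 6]" "hodge 3 eucl vol0 \<alpha> [1, 3, 6, 0] = \<alpha> [2, 4, 5]"
    "hodge 3 eucl vol0 \<alpha> [1, 4, 5, 6] = - \<alpha> [2, 3, 0]" "hodge 3 eucl vol0 \<alpha> [1, 4, 5, 0] = \<alpha> [2, 3, 6]"
    "hodge 3 eucl vol0 \<alpha> [1, 4, 6, 0] = - \<alpha> [2, 3, 5]" "hodge 3 eucl vol0 \<alpha> [1, 5, 6, 0] = \<alpha> [2, 3, 4]"
    "hodge 3 eucl vol0 \<alpha> [2, 3, 4, 5] = - \<alpha> [1, 6, 0]" "hodge 3 eucl vol0 \<alpha> [2, 3, 4, 6] = \<alpha> [1, 5, 0]"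
    "hodge 3 eucl vol0 \<alpha> [2, 3, 4, 0] = - \<alpha> [1, 5, 6]" "hodge 3 eucl vol0 \<alpha> [2, 3, 5, 6] = - \<alpha> [1, 4, 0]"
    "hodge 3 eucl vol0 \<alpha> [2, 3, 5, 0] = \<alpha> [1, 4, 6]" "hodge 3 eucl vol0 \<alpha> [2, 3, 6, 0] = - \<alpha> [1, 4, 5]"
    "hodge 3 eucl vol0 \<alpha> [2, 4, 5, 6] = \<alpha> [1, 3, 0]" "hodge 3 eucl vol0 \<alpha> [2, 4, 5, 0] = - \<alpha> [1, 3, 6]"
    "hodge 3 eucl vol0 \<alpha> [2, 4, 6, 0] = \<alpha> [1, 3, 5]" "hodge 3 eucl vol0 \<alpha> [2, 5, 6, 0] = - \<alpha> [1, 3, 4]"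
    "hodge 3 eucl vol0 \<alpha> [3, 4, 5, 6] = - \<alpha> [1, 2, 0]" "hodge 3 eucl vol0 \<alpha> [3, 4, 5, 0] = \<alpha> [1, 2, 6]"
    "hodge 3 eucl vol0 \<alpha> [3, 4, 6, 0] = - \<alpha> [1, 2, 5]" "hodge 3 eucl vol0 \<alpha> [3, 5, 6, 0] = \<alpha> [1, 2, 4]"
    "hodge 3 eucl vol0 \<alpha> [4, 5, 6, 0] = - \<alpha> [1, 2, 3]"
proof -
  have b: "alternating 3 (\<lambda>I. vol0 (I @ [i, j, k, l]))" for i j k l
    unfolding alternating_3_iff append.simps
    by (intro allI conjI) (rule alternating_7D[OF vol0_alternating])+
  show 
    "hodge 3 eucl vol0 \<alpha> [1, 2, 3, 4] = - \<alpha> [5, 6, 0]" "hodge 3 eucl vol0 \<alpha> [1, 2, 3, 5] = \<alpha> [4, 6, 0]"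
    "hodge 3 eucl vol0 \<alpha> [1, 2, 3, 6] = - \<alpha> [4, 5, 0]" "hodge 3 eucl vol0 \<alpha> [1, 2, 3, 0] = \<alpha> [4, 5, 6]"
    "hodge 3 eucl vol0 \<alpha> [1, 2, 4, 5] = - \<alpha> [3, 6, 0]" "hodge 3 eucl vol0 \<alpha> [1, 2, 4, 6] = \<alpha> [3, 5, 0]"
    "hodge 3 eucl vol0 \<alpha> [1, 2, 4, 0] = - \<alpha> [3, 5, 6]" "hodge 3 eucl vol0 \<alpha> [1, 2, 5, 6] = - \<alpha> [3, 4, 0]"
    "hodge 3 eucl vol0 \<alpha> [1, 2, 5, 0] = \<alpha> [3, 4, 6]" "hodge 3 eucl vol0 \<alpha> [1, 2, 6, 0] = - \<alpha> [3, 4, 5]"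
    "hodge 3 eucl vol0 \<alpha> [1, 3, 4, 5] = \<alpha> [2, 6, 0]" "hodge 3 eucl vol0 \<alpha> [1, 3, 4, 6] = - \<alpha> [2, 5, 0]"
    "hodge 3 eucl vol0 \<alpha> [1, 3, 4, 0] = \<alpha> [2, 5, 6]" "hodge 3 eucl vol0 \<alpha> [1, 3, 5, 6] = \<alpha> [2, 4, 0]"
    "hodge 3 eucl vol0 \<alpha> [1, 3, 5, 0] = - \<alpha> [2, 4, 6]" "hodge 3 eucl vol0 \<alpha> [1, 3, 6, 0] = \<alpha> [2, 4, 5]"
    "hodge 3 eucl vol0 \<alpha> [1, 4, 5, 6] = - \<alpha> [2, 3, 0]" "hodge 3 eucl vol0 \<alpha> [1, 4, 5, 0] = \<alpha> [2, 3, 6]"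
    "hodge 3 eucl vol0 \<alpha> [1, 4, 6, 0] = - \<alpha> [2, 3, 5]" "hodge 3 eucl vol0 \<alpha> [1, 5, 6, 0] = \<alpha> [2, 3, 4]"
    "hodge 3 eucl vol0 \<alpha> [2, 3, 4, 5] = - \<alpha> [1, 6, 0]" "hodge 3 eucl vol0 \<alpha> [2, 3, 4, 6] = \<alpha> [1, 5, 0]"
    "hodge 3 eucl vol0 \<alpha> [2, 3, 4, 0] = - \<alpha> [1, 5, 6]" "hodge 3 eucl vol0 \<alpha> [2, 3, 5, 6] = - \<alpha> [1, 4, 0]"
    "hodge 3 eucl vol0 \<alpha> [2, 3, 5, 0] = \<alpha> [1, 4, 6]" "hodge 3 eucl vol0 \<alpha> [2, 3, 6, 0] = - \<alpha> [1, 4, 5]"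
    "hodge 3 eucl vol0 \<alpha> [2, 4, 5, 6] = \<alpha> [1, 3, 0]" "hodge 3 eucl vol0 \<alpha> [2, 4, 5, 0] = - \<alpha> [1, 3, 6]"
    "hodge 3 eucl vol0 \<alpha> [2, 4, 6, 0] = \<alpha> [1, 3, 5]" "hodge 3 eucl vol0 \<alpha> [2, 5, 6, 0] = - \<alpha> [1, 3, 4]"
    "hodge 3 eucl vol0 \<alpha> [3, 4, 5, 6] = - \<alpha> [1, 2, 0]" "hodge 3 eucl vol0 \<alpha> [3, 4, 5, 0] = \<alpha> [1, 2, 6]"
    "hodge 3 eucl vol0 \<alpha> [3, 4, 6, 0] = - \<alpha> [1, 2, 5]" "hodge 3 eucl vol0 \<alpha> [3, 5, 6, 0] = \<alpha> [1, 2, 4]"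
    "hodge 3 eucl vol0 \<alpha> [4, 5, 6, 0] = - \<alpha> [1, 2, 3]"
    unfolding hodge_3_eucl[OF a] sum_alternating_3[OF a b] by simp_all
qed

lemma act_phi0_alternating: "alternating 3 (act A phi0)"
  unfolding alternating_3_iff using act_3_swap[OF phi0_alternating] by blast

text \<open>Symmetrised in its two free indices, this contraction of a 4-form with \<psi> detects
  the parts of the form that correspond to symmetric 2-tensors, and by \<open>quad_wedge\<close> it
  annihilates wedges of 1-forms with \<phi>.\<close>

definition quad :: "tensor \<Rightarrow> 7 \<Rightarrow> 7 \<Rightarrow> real" where
  "quad E i q = (\<Sum>j\<in>UNIV. \<Sum>k\<in>UNIV. \<Sum>l\<in>UNIV. psi0 [q, j, k, l] * E [i, j, k, l])"

lemma quad_values: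
  assumes E: "alternating 3 (\<lambda>I. E (i # I))"
  shows
    "quad E i 1 = 6 * (E [i, 2, 4, 0] + E [i, 2, 5, 6] + E [i, 3, 4, 6] - E [i, 3, 5, 0])"
    "quad E i 2 = 6 * (- E [i, 1, 4, 0] - E [i, 1, 5, 6] - E [i, 3, 4, 5] - E [i, 3, 6, 0])"
    "quad E i 3 = 6 * (- E [i, 1, 4, 6] + E [i, 1, 5, 0] + E [i, 2, 4, 5] + E [i, 2, 6, 0])"
    "quad E i 4 = 6 * (E [i, 1, 2, 0] + E [i, 1, 3, 6] - E [i, 2, 3, 5] - E [i, 5, 6, 0])"
    "quad E i 5 = 6 * (E [i, 1, 2, 6] - E [i, 1, 3, 0] + E [i, 2, 3, 4] + E [i, 4, 6, 0])"
    "quad E i 6 = 6 * (- E [i, 1, 2, 5] - E [i, 1, 3, 4] - E [i, 2, 3, 0] - E [i, 4, 5, 0])"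
    "quad E i 0 = 6 * (- E [i, 1, 2, 4] + E [i, 1, 3, 5] + E [i, 2, 3, 6] + E [i, 4, 5, 6])"
proof -
  have sort: "ix k < ix j \<Longrightarrow> E [i, j, k, l] = - E [i, k, j, l]" "ix l < ix k \<Longrightarrow> E [i, j, k, l] = - E [i, j, l, k]" for j k l
    by (rule alternating_3D[OF E])+
  show
    "quad E i 1 = 6 * (E [i, 2, 4, 0] + E [i, 2, 5, 6] + E [i, 3, 4, 6] - E [i, 3, 5, 0])"
    "quad E i 2 = 6 * (- E [i, 1, 4, 0] - E [i, 1, 5, 6] - E [i, 3, 4, 5] - E [i, 3, 6, 0])"
    "quad E i 3 = 6 * (- E [i, 1, 4, 6] + E [i, 1, 5, 0] + E [i, 2, 4, 5] + E [i, 2, 6, 0])"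
    "quad E i 4 = 6 * (E [i, 1, 2, 0] + E [i, 1, 3, 6] - E [i, 2, 3, 5] - E [i, 5, 6, 0])"
    "quad E i 5 = 6 * (E [i, 1, 2, 6] - E [i, 1, 3, 0] + E [i, 2, 3, 4] + E [i, 4, 6, 0])"
    "quad E i 6 = 6 * (- E [i, 1, 2, 5] - E [i, 1, 3, 4] - E [i, 2, 3, 0] - E [i, 4, 5, 0])"
    "quad E i 0 = 6 * (- E [i, 1, 2, 4] + E [i, 1, 3, 5] + E [i, 2, 3, 6] + E [i, 4, 5, 6])"
    by (simp_all add: quad_def sum_7 sort)
qed

lemma alt1_tail_alternating:
  assumes D: "\<And>p. alternating 3 (D p)"
  shows "alternating 3 (\<lambda>I. alt1 D (i # I))"
  unfolding alternating_3_iff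
proof (intro allI conjI)
  fix a b c
  have "D i [b, a, c] = - D i [a, b, c]" "D c [i, b, a] = - D c [i, a, b]" by (rule alternating_3D[OF D])+
  then show "alt1 D [i, b, a, c] = - alt1 D [i, a, b, c]" by simp
  have "D i [a, c, b] = - D i [a, b, c]" "D a [i, c, b] = - D a [i, b, c]" by (rule alternating_3D[OF D])+
  then show "alt1 D [i, a, c, b] = - alt1 D [i, a, b, c]" by simp
qed

lemma alternating_tail:
  assumes T: "alternating 4 T"
  shows "alternating 3 (\<lambda>I. T (i # I))"
  unfolding alternating_3_iff using alternating_4D(2,3)[OF T] by blast

text \<open>This reads the symmetric part of the intrinsic torsion off d\<phi>. The trace enters
  separately, and is recovered from the equation itself in \<open>torsion_sym_part\<close>.\<close>

lemma quad_skew: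
  assumes K: "\<And>p i j. K p i j = - K p j i"
  shows "quad (alt1 (\<lambda>p. act (K p) phi0)) i q + quad (alt1 (\<lambda>p. act (K p) phi0)) q i =
    12 * (vec_of (K i) q + vec_of (K q) i) + (if i = q then 24 * (\<Sum>p\<in>UNIV. vec_of (K p) p) else 0)"
proof -
  have sort: "ix j < ix i \<Longrightarrow> K p i j = - K p j i" and diag: "K p i i = 0" for p i j
    using K[of p i j] K[of p i i] by simp_all
  have "\<forall>i q. quad (alt1 (\<lambda>p. act (K p) phi0)) i q + quad (alt1 (\<lambda>p. act (K p) phi0)) q i =
    12 * (vec_of (K i) q + vec_of (K q) i) + (if i = q then 24 * (\<Sum>p\<in>UNIV. vec_of (K p) p) else 0)"
    unfolding forall_7 quad_values[OF alt1_tail_alternating, OF act_phi0_alternating]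
    by (intro conjI; simp add: sum_7 act_phi0 vec_of_values[of "K p" for p, OF K] sort diag algebra_simps del: act.simps)
  then show ?thesis by blast
qed

lemma quad_psi0: "quad psi0 i q = (if i = q then 24 else 0)"
proof -
  have "\<forall>i q. quad psi0 i q = (if i = q then 24 else 0)"
    unfolding forall_7 quad_values[OF alternating_tail, OF psi0_alternating] by simp
  then show ?thesis by blast
qed

lemma quad_wedge: "quad (alt1 (\<lambda>p J. t p * phi0 J)) i q + quad (alt1 (\<lambda>p J. t p * phi0 J)) q i = 0"
proof -
  have alt: "alternating 3 (\<lambda>J. t p * phi0 J)" for p
    using phi0_alternating unfolding alternating_def by simp
  have "\<forall>i q. quad (alt1 (\<lambda>p J. t p * phi0 J)) i q + quad (alt1 (\<lambda>p J. t p * phi0 J)) q i = 0"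
    unfolding forall_7 quad_values[OF alt1_tail_alternating, of "\<lambda>p J. t p * phi0 J", OF alt]
    by (intro conjI; simp)
  then show ?thesis by blast
qed

lemma quad_hodge:
  assumes t: "\<And>i j. t i j = t j i" and tr: "(\<Sum>i\<in>UNIV. t i i) = 0"
  shows "quad (hodge 3 eucl vol0 (act t phi0)) i q = - 12 * t i q"
proof -
  let ?E = "hodge 3 eucl vol0 (act t phi0)"
  note sort = t[of 2 1] t[of 3 1] t[of 4 1] t[of 5 1] t[of 6 1] t[of 0 1] t[of 3 2] t[of 4 2] t[of 5 2] t[of 6 2]
    t[of 0 2] t[of 4 3] t[of 5 3] t[of 6 3] t[of 0 3] t[of 5 4] t[of 6 4] t[of 0 4] t[of 6 5] t[of 0 5] t[of 0 6]
  have t00: "t 0 0 = - (t 1 1 + t 2 2 + t 3 3 + t 4 4 + t 5 5 + t 6 6)" using tr unfolding sum_7 by linarith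
  have E: "ix j < ix i \<Longrightarrow> ?E [i, j, k, l] = - ?E [j, i, k, l]"
    "ix k < ix j \<Longrightarrow> ?E [i, j, k, l] = - ?E [i, k, j, l]"
    "ix l < ix k \<Longrightarrow> ?E [i, j, k, l] = - ?E [i, j, l, k]"
    "?E [i, i, k, l] = 0" "?E [i, k, k, l] = 0" "?E [i, j, k, k] = 0" for i j k l
    by (rule alternating_4D[OF hodge_alternating[OF vol0_alternating, where k = 3]]; simp)+
  have alt: "alternating 4 ?E" by (rule hodge_alternating[OF vol0_alternating]) simp
  have "\<forall>i q. quad ?E i q = - 12 * t i q"
    unfolding forall_7 quad_values[OF alternating_tail, OF alt]
    by (intro conjI; simp add: sum_7 E hodge_3_eucl_values[OF act_phi0_alternating] act_phi0_values sort t00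
        algebra_simps del: act.simps)
  then show ?thesis by blast
qed

lemma phi_contract_wedge: "phi_contract eucl phi0 (alt1 (\<lambda>p J. t p * psi0 J)) [i, j] = - 12 * vphi t i j"
proof -
  have D: "t p * psi0 [j, i, k, l] = - (t p * psi0 [i, j, k, l])" "t p * psi0 [i, k, j, l] = - (t p * psi0 [i, j, k, l])"
    "t p * psi0 [i, j, l, k] = - (t p * psi0 [i, j, k, l])" for p i j k l
    using alternating_4D(1)[OF psi0_alternating, of j i k l] alternating_4D(2)[OF psi0_alternating, of i k j l]
      alternating_4D(3)[OF psi0_alternating, of i j l k] by simp_all
  have "\<forall>i j. phi_contract eucl phi0 (alt1 (\<lambda>p J. t p * psi0 J)) [i, j] = - 12 * vphi t i j"
    unfolding forall_7 phi_contract_alt1[of "\<lambda>p J. t p * psi0 J", OF D]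
    by (intro conjI; simp add: vphi_values)
  then show ?thesis by blast
qed

text \<open>Three indices pass two others, which takes six transpositions.\<close>

lemma vol0_rotate: "vol0 [a, b, c, d, e, f, g] = vol0 [c, d, e, a, b, f, g]"
proof -
  note s = alternating_7D[OF vol0_alternating]
  show ?thesis
    using s(2)[of a c b d e f g] s(1)[of c a b d e f g] s(3)[of c a d b e f g] s(2)[of c d a b e f g]
      s(4)[of c d a e b f g] s(3)[of c d e a b f g] by linarith
qed

text \<open>Contracting \<phi> into the volume form gives 6 \<psi>, and the Hodge star of a 2-form
  carries 1/2, hence the 3. Bringing the three slots of \<phi> to the front is even.\<close>

lemma phi_contract_hodge:
  "phi_contract eucl phi0 (hodge 2 eucl vol0 t) [i, j] = 3 * cpsi (\<lambda>a b. t [a, b]) i j"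
proof -
  have h: "hodge 2 eucl vol0 t J = (\<Sum>a\<in>UNIV. \<Sum>b\<in>UNIV. t [a, b] * vol0 (a # b # J)) / 2" for J
    unfolding hodge_eq_pb by (simp add: pb_id numeral_2_eq_2 sum_lists_Suc sum_lists_0[simplified])
  have p: "psi0 J = (\<Sum>I | length I = 3. phi0 I * vol0 (I @ J)) / 6" for J
    by (simp add: psi0_def hodge_3_eucl[OF phi0_alternating])
  have v: "vol0 (a # b # I @ [i, j]) = vol0 (I @ [a, b, i, j])" if "length I = 3" for I a b
    using that by (auto simp: numeral_3_eq_3 length_Suc_conv intro: vol0_rotate)
  have "phi_contract eucl phi0 (hodge 2 eucl vol0 t) [i, j]
      = (\<Sum>I | length I = 3. \<Sum>a\<in>UNIV. \<Sum>b\<in>UNIV. phi0 I * (t [a, b] * vol0 (I @ [a, b, i, j]))) / 2"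
    unfolding phi_contract_eucl h sum_divide_distrib sum_distrib_left
    by (intro sum.cong refl) (simp add: v)
  also have "\<dots> = (\<Sum>a\<in>UNIV. \<Sum>b\<in>UNIV. \<Sum>I | length I = 3. phi0 I * (t [a, b] * vol0 (I @ [a, b, i, j]))) / 2"
    by (subst sum_rotate3[symmetric]) (rule refl)
  also have "\<dots> = 3 * cpsi (\<lambda>a b. t [a, b]) i j"
    unfolding cpsi_def p by (simp add: sum_distrib_left sum_divide_distrib mult_ac)
  finally show ?thesis .
qed

text \<open>The kernel of \<open>vec_of\<close> on skew tensors is the 14-dimensional summand, and
  this is its eigenvalue.\<close>

lemma cpsi_14:
  assumes s: "\<And>i j. s i j = - s j i" and s0: "\<And>k. vec_of s k = 0"
  shows "cpsi s i j = 2 * s i j"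
proof (rule skew_forall_7[where P = "cpsi s"])
  have sort: "ix j < ix i \<Longrightarrow> s i j = - s j i" and diag: "s i i = 0" for i j
    using s[of i j] s[of i i] by simp_all
  have e: "s 6 0 = - s 2 3 - s 4 5" "s 5 0 = s 4 6 - s 1 3" "s 5 6 = s 1 2 - s 4 0"
    "s 3 0 = s 1 5 + s 2 6" "s 3 6 = - s 1 4 - s 2 0" "s 3 5 = s 2 4 - s 1 0" "s 3 4 = s 1 6 - s 2 5"
    using s0[of 1] s0[of 2] s0[of 3] s0[of 4] s0[of 5] s0[of 6] s0[of 0]
    unfolding vec_of_values[of s, OF s] by linarith+
  show "2 * s i j = - (2 * s j i)" for i j using s[of i j] by simp
  let ?P = "\<lambda>i j. cpsi s i j = 2 * s i j"
  show "?P 1 2 \<and> ?P 1 3 \<and> ?P 1 4 \<and> ?P 1 5 \<and> ?P 1 6 \<and> ?P 1 0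
      \<and> ?P 2 3 \<and> ?P 2 4 \<and> ?P 2 5 \<and> ?P 2 6 \<and> ?P 2 0
      \<and> ?P 3 4 \<and> ?P 3 5 \<and> ?P 3 6 \<and> ?P 3 0
      \<and> ?P 4 5 \<and> ?P 4 6 \<and> ?P 4 0 \<and> ?P 5 6 \<and> ?P 5 0 \<and> ?P 6 0"
    by (intro conjI; simp add: cpsi_values sort diag; simp add: e)
qed (rule cpsi_swap)

lemma vphi_contract: "vphi (\<lambda>k. \<Sum>a\<in>UNIV. \<Sum>b\<in>UNIV. m a b * phi0 [a, b, k]) i j = m i j - m j i - cpsi m i j"
    (is "?L i j = ?R i j")
proof (rule skew_forall_7[where P = ?L])
  show "?R i j = - ?R j i" for i j by (simp add: cpsi_swap[of _ i j])
  let ?P = "\<lambda>i j. ?L i j = ?R i j"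
  show "?P 1 2 \<and> ?P 1 3 \<and> ?P 1 4 \<and> ?P 1 5 \<and> ?P 1 6 \<and> ?P 1 0
      \<and> ?P 2 3 \<and> ?P 2 4 \<and> ?P 2 5 \<and> ?P 2 6 \<and> ?P 2 0
      \<and> ?P 3 4 \<and> ?P 3 5 \<and> ?P 3 6 \<and> ?P 3 0
      \<and> ?P 4 5 \<and> ?P 4 6 \<and> ?P 4 0 \<and> ?P 5 6 \<and> ?P 5 0 \<and> ?P 6 0"
    by (intro conjI; simp add: vphi_values cpsi_values sum_7)
qed (rule vphi_swap)

text \<open>With \<open>skew_act_phi0\<close>: the endomorphism X \<lrcorner> \<phi> acts on \<phi>
  as -3 X \<lrcorner> \<psi>. This is why the velocity of the flow contains X with the factor
  -1/3.\<close>

lemma vec_of_vphi: "vec_of (vphi v) k = - 3 * v k"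
proof -
  have "\<forall>k. vec_of (vphi v) k = - 3 * v k"
    unfolding forall_7 vec_of_values[of "vphi v", OF vphi_swap] by (simp add: vphi_values)
  then show ?thesis by blast
qed

lemma skew_act_phi0:
  assumes k: "\<And>i j. k i j = - k j i"
  shows "act k phi0 [a, b, c] = (\<Sum>n\<in>UNIV. vec_of k n * psi0 [n, a, b, c])"
proof -
  have sort: "ix j < ix i \<Longrightarrow> k i j = - k j i" and diag: "k i i = 0" for i j
    using k[of i j] k[of i i] by simp_all
  have "\<forall>a b c. act k phi0 [a, b, c] = (\<Sum>n\<in>UNIV. vec_of k n * psi0 [n, a, b, c])"
    unfolding forall_7 by (simp add: sum_7 vec_of_values[of k, OF k] act_phi0 sort diag del: act.simps)
  then show ?thesis by blast
qed

section \<open>Torsion and its variation in an adapted frame\<close>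

lemma phi_contract_linear:
  "phi_contract eucl \<phi> (\<lambda>J. \<beta> J + \<gamma> J) K = phi_contract eucl \<phi> \<beta> K + phi_contract eucl \<phi> \<gamma> K"
  "phi_contract eucl \<phi> (\<lambda>J. r * \<beta> J) K = r * phi_contract eucl \<phi> \<beta> K"
  by (simp_all add: phi_contract_eucl sum.distrib sum_distrib_left algebra_simps)

lemma vec_of_linear:
  "vec_of (\<lambda>i j. a i j + b i j) k = vec_of a k + vec_of b k"
  "vec_of (\<lambda>i j. a i j - b i j) k = vec_of a k - vec_of b k"
  "vec_of (\<lambda>i j. r * a i j) k = r * vec_of a k"
  by (simp_all add: vec_of_def sum.distrib sum_subtractf sum_distrib_left algebra_simps add_divide_distrib diff_divide_distrib)

lemma vec_of_sum: "vec_of (\<lambda>i j. \<Sum>q\<in>S. a q i j) k = (\<Sum>q\<in>S. vec_of (a q) k)"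
  by (induction S rule: infinite_finite_induct) (auto simp: vec_of_linear, simp_all add: vec_of_def)

lemma cpsi_transpose: "cpsi (\<lambda>i j. a j i) i j = - cpsi a i j"
proof -
  have "cpsi (\<lambda>i j. a j i) i j = (\<Sum>l\<in>UNIV. \<Sum>k\<in>UNIV. a l k * psi0 [k, l, i, j])"
    unfolding cpsi_def by (rule sum.swap)
  also have "\<dots> = (\<Sum>l\<in>UNIV. \<Sum>k\<in>UNIV. - (a l k * psi0 [l, k, i, j]))"
    using alternating_4D(1)[OF psi0_alternating] by (intro sum.cong refl) (metis mult_minus_right)
  finally show ?thesis by (simp add: cpsi_def sum_negf)
qed

text \<open>The endomorphism under \<open>act\<close> splits into the symmetric n and a skew
  remainder S, and S counts only through \<open>vec_of\<close>. The 1/3 in front of XT comes from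
  the X-part of the velocity; the 2/3 in front of TX from differentiating \<phi> inside X
  \<lrcorner> \<phi>, where \<open>vec_of_cpsi\<close> contributes a factor 2.\<close>

lemma contract_variation:
  assumes K: "\<And>p i j. K p i j = - K p j i" and n: "\<And>p i j. n p i j = n p j i"
    and T: "\<And>p k. T p k = vec_of (K p) k"
  shows "phi_contract eucl phi0 (alt1 (\<lambda>p. act (\<lambda>i l. n p i l
        - 1 / 3 * (vphi (m p) i l + (\<Sum>r\<in>UNIV. x r * act (K p) phi0 [r, i, l]))
        - (\<Sum>q\<in>UNIV. (h p q - 1 / 3 * vphi x p q) * K q i l)) psi0)) [i, j] =
     6 * (vphi (\<lambda>k. \<Sum>p\<in>UNIV. n p p k) i j - vphi (\<lambda>k. \<Sum>p\<in>UNIV. n k p p) i j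
       - (\<Sum>k\<in>UNIV. vphi (n k i) j k) + (\<Sum>k\<in>UNIV. vphi (n k j) i k))
     + dcurl (\<lambda>p k. m p k - mm h T p k + 1 / 3 * mm (vphi x) T p k + 2 / 3 * mm T (vphi x) p k) i j"
proof -
  define S where "S p i l = - 1 / 3 * vphi (m p) i l + (- 1 / 3) * cpsi (\<lambda>a r. T p a * x r) i l
      - (\<Sum>q\<in>UNIV. (h p q - 1 / 3 * vphi x p q) * K q i l)" for p i l
  \<comment> \<open>K acts on \<phi> as T \<lrcorner> \<psi>, so feeding in x leaves \<psi>
    contracted with T and x.\<close>
  have KX: "(\<Sum>r\<in>UNIV. x r * act (K p) phi0 [r, i, l]) = cpsi (\<lambda>a r. T p a * x r) i l" for p i l
    unfolding skew_act_phi0[of "K p", OF K] cpsi_def T[symmetric] sum_distrib_left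
    by (subst sum.swap) (simp add: mult_ac)
  have B: "n p i l - 1 / 3 * (vphi (m p) i l + (\<Sum>r\<in>UNIV. x r * act (K p) phi0 [r, i, l]))
        - (\<Sum>q\<in>UNIV. (h p q - 1 / 3 * vphi x p q) * K q i l) = n p i l + S p i l" for p i l
    unfolding KX S_def by (simp add: field_simps)
  have S_skew: "S p i l = - S p l i" for p i l
  proof -
    have "(\<Sum>q\<in>UNIV. (h p q - 1 / 3 * vphi x p q) * K q i l) = - (\<Sum>q\<in>UNIV. (h p q - 1 / 3 * vphi x p q) * K q l i)"
      unfolding sum_negf[symmetric] by (rule sum.cong) (simp_all add: K[of _ i l])
    then show ?thesis
      unfolding S_def using vphi_swap[of "m p" i l] cpsi_swap[of "\<lambda>a r. T p a * x r" i l] by simp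
  qed
  have TX: "(\<Sum>a\<in>UNIV. \<Sum>r\<in>UNIV. T p a * x r * phi0 [a, r, k]) = - mm T (vphi x) p k" for p k
  proof -
    have "T p a * x r * phi0 [a, r, k] = - (T p a * (x r * phi0 [r, a, k]))" for a r
      using alternating_3D(1)[OF phi0_alternating, of a r k] by simp
    then show ?thesis by (simp add: mm_def vphi_def sum_distrib_left sum_negf)
  qed
  have S_vec: "vec_of (S p) k = m p k - mm h T p k + 1 / 3 * mm (vphi x) T p k + 2 / 3 * mm T (vphi x) p k" for p k
  proof -
    have "vec_of (S p) k = - 1 / 3 * (- 3 * m p k) + (- 1 / 3) * (2 * - mm T (vphi x) p k)
        - (\<Sum>q\<in>UNIV. (h p q - 1 / 3 * vphi x p q) * T q k)"
      unfolding S_def vec_of_linear vec_of_sum vec_of_vphi vec_of_cpsi TX T[symmetric] ..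
    also have "(\<Sum>q\<in>UNIV. (h p q - 1 / 3 * vphi x p q) * T q k) = mm h T p k - 1 / 3 * mm (vphi x) T p k"
      unfolding mm_def sum_distrib_left sum_subtractf[symmetric] by (rule sum.cong) (simp_all add: algebra_simps)
    finally show ?thesis by simp
  qed
  have a: "act (\<lambda>i l. n p i l + S p i l) psi0 = (\<lambda>J. act (n p) psi0 J + act (S p) psi0 J)" for p
    by (intro ext) (rule act_add_left)
  have b: "alt1 (\<lambda>p. act (\<lambda>i l. n p i l + S p i l) psi0)
      = (\<lambda>I. alt1 (\<lambda>p. act (n p) psi0) I + alt1 (\<lambda>p. act (S p) psi0) I)"
    unfolding a by (intro ext) (rule alt1_add)
  have "phi_contract eucl phi0 (alt1 (\<lambda>p. act (\<lambda>i l. n p i l + S p i l) psi0)) [i, j]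
      = phi_contract eucl phi0 (alt1 (\<lambda>p. act (n p) psi0)) [i, j] + phi_contract eucl phi0 (alt1 (\<lambda>p. act (S p) psi0)) [i, j]"
    unfolding b by (rule phi_contract_linear)
  then show ?thesis
    unfolding B phi_contract_sym[of n, OF n] phi_contract_skew[of S, OF S_skew] S_vec .
qed

text \<open>Applying \<open>cpsi\<close> to the hypothesis gives a second equation in Y and
  \<open>cpsi Y\<close>. In terms of components, -24 Y_7 = -48 t1 and -6 Y_14 = 6 t2.\<close>

lemma torsion_skew_part:
  assumes t2: "\<And>i j. t2 i j = - t2 j i" "\<And>k. vec_of t2 k = 0"
    and T: "\<And>i j. dcurl T i j = - 48 * vphi t1 i j + 6 * t2 i j"
  shows "T i j - T j i = 2 * vphi t1 i j - t2 i j"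
proof -
  define Y where "Y i j = T i j - T j i" for i j
  have 1: "- 12 * Y i j + 3 * cpsi Y i j = - 48 * vphi t1 i j + 6 * t2 i j" for i j
    using T[of i j] unfolding dcurl_def Y_def .
  have "cpsi (\<lambda>i j. - 12 * Y i j + 3 * cpsi Y i j) i j = cpsi (\<lambda>i j. - 48 * vphi t1 i j + 6 * t2 i j) i j"
    unfolding 1 ..
  then have "- 12 * cpsi Y i j + 3 * (4 * (Y i j - Y j i) - 2 * cpsi Y i j) = - 48 * (- 4 * vphi t1 i j) + 6 * (2 * t2 i j)"
    unfolding cpsi_linear cpsi_cpsi cpsi_vphi cpsi_14[of t2, OF t2] .
  moreover have "Y j i = - Y i j" by (simp add: Y_def)
  ultimately have "Y i j = 2 * vphi t1 i j - t2 i j" using 1[of i j] by simp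
  then show ?thesis by (simp add: Y_def)
qed

lemma quad_linear:
  "quad (\<lambda>J. a J + b J) i q = quad a i q + quad b i q" "quad (\<lambda>J. r * a J) i q = r * quad a i q"
  by (simp_all add: quad_def sum.distrib sum_distrib_left algebra_simps)

text \<open>Symmetrising the \<psi>-contraction of d\<phi> removes t1 and leaves an equation for the
  symmetric part of T that still contains its trace; the trace is found by contracting this
  equation.\<close>

lemma torsion_sym_part:
  assumes K: "\<And>p i j. K p i j = - K p j i" and T: "\<And>p k. T p k = vec_of (K p) k"
    and t3: "\<And>i j. t3 i j = t3 j i" "(\<Sum>i\<in>UNIV. t3 i i) = 0"
    and eq: "\<And>J. length J = 4 \<Longrightarrow> alt1 (\<lambda>p. act (K p) phi0) J = t0 * psi0 J
      + 3 * alt1 (\<lambda>p J. t1 p * phi0 J) J + hodge 3 eucl vol0 (act t3 phi0) J"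
  shows "T i j + T j i = (if i = j then t0 / 2 else 0) - 2 * t3 i j"
proof -
  have "quad (alt1 (\<lambda>p. act (K p) phi0)) i j = quad (\<lambda>J. t0 * psi0 J
      + 3 * alt1 (\<lambda>p J. t1 p * phi0 J) J + hodge 3 eucl vol0 (act t3 phi0) J) i j" for i j
    unfolding quad_def by (simp only: eq length_Cons list.size numeral_eq_Suc pred_numeral_simps add_0 add_Suc BitM.simps)
  then have q: "quad (alt1 (\<lambda>p. act (K p) phi0)) i j = t0 * (if i = j then 24 else 0)
      + 3 * quad (alt1 (\<lambda>p J. t1 p * phi0 J)) i j - 12 * t3 i j" for i j
    unfolding quad_linear quad_psi0 quad_hodge[of t3, OF t3] by simp
  have s: "12 * (T i j + T j i) + (if i = j then 24 * (\<Sum>p\<in>UNIV. T p p) else 0)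
      = (if i = j then 48 * t0 else 0) - 24 * t3 i j" for i j
    using quad_skew[of K i j, OF K] quad_wedge[of t1 i j] t3(1)[of i j] unfolding q T[symmetric]
    by (auto split: if_splits)
  \<comment> \<open>Each diagonal equation contains 24 tr T; summing the seven gives (24 + 168) tr T
    = 336 t0, since t3 is traceless.\<close>
  have "(\<Sum>i\<in>UNIV. 12 * (T i i + T i i) + 24 * (\<Sum>p\<in>UNIV. T p p)) = (\<Sum>i\<in>(UNIV::7 set). 48 * t0 - 24 * t3 i i)"
    using s[of i i for i] by simp
  then have "24 * (\<Sum>p\<in>UNIV. T p p) + 168 * (\<Sum>p\<in>UNIV. T p p) = 336 * t0"
    using t3(2) by (simp add: sum.distrib sum_subtractf sum_distrib_left[symmetric])
  then have "(\<Sum>p\<in>UNIV. T p p) = 7 / 4 * t0" by simp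
  then show ?thesis using s[of i j] by (auto split: if_splits)
qed

section \<open>The evolution identities in an adapted frame\<close>

definition p7 :: "(7 \<Rightarrow> 7 \<Rightarrow> real) \<Rightarrow> 7 \<Rightarrow> 7 \<Rightarrow> real" where
  "p7 b i j = b i j / 3 - cpsi b i j / 6"

definition p14 :: "(7 \<Rightarrow> 7 \<Rightarrow> real) \<Rightarrow> 7 \<Rightarrow> 7 \<Rightarrow> real" where
  "p14 b i j = 2 / 3 * b i j + cpsi b i j / 6"

definition cm :: "(7 \<Rightarrow> 7 \<Rightarrow> real) \<Rightarrow> (7 \<Rightarrow> 7 \<Rightarrow> real) \<Rightarrow> 7 \<Rightarrow> 7 \<Rightarrow> real" where
  "cm A B i j = mm A B i j - mm B A i j"

definition ac :: "(7 \<Rightarrow> 7 \<Rightarrow> real) \<Rightarrow> (7 \<Rightarrow> 7 \<Rightarrow> real) \<Rightarrow> 7 \<Rightarrow> 7 \<Rightarrow> real" where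
  "ac A B i j = mm A B i j + mm B A i j"

lemma mm_transpose:
  assumes "\<And>i j. A i j = a * A j i" "\<And>i j. B i j = b * B j i"
  shows "mm A B j i = a * b * mm B A i j"
  unfolding mm_def sum_distrib_left by (rule sum.cong[OF refl]) (subst assms(1), subst assms(2), simp)

text \<open>Here the intrinsic torsion is eliminated: T equals (t0/4) id - t3 + t1 - t2/2, where t1
  and t2 stand for their skew tensors. After this substitution, applying \<open>cpsi\<close> to F
  produces only terms on which its eigenvalues are known or which the right-hand sides also contain,
  and both claims become linear. The weights -1/48 and 1/6 of F undo the constants of
  \<open>torsion_extraction\<close>.\<close>

lemma frame_evolution:
  assumes h: "\<And>i j. h i j = h j i" and n: "\<And>p i j. n p i j = n p j i"
    and t2: "\<And>i j. t2 i j = - t2 j i" "\<And>k. vec_of t2 k = 0" and t3: "\<And>i j. t3 i j = t3 j i"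
    and Ts: "\<And>i j. T i j + T j i = (if i = j then t0 / 2 else 0) - 2 * t3 i j"
    and Ta: "\<And>i j. T i j - T j i = 2 * vphi t1 i j - t2 i j"
    and F: "\<And>i j. F i j = 6 * (vphi (\<lambda>k. \<Sum>p\<in>UNIV. n p p k) i j - vphi (\<lambda>k. \<Sum>p\<in>UNIV. n k p p) i j
       - cu i j + cu j i)
     + dcurl (\<lambda>p k. m p k - mm h T p k + 1 / 3 * mm (vphi x) T p k + 2 / 3 * mm T (vphi x) p k) i j"
    and cu: "\<And>i j. cu i j = (\<Sum>k\<in>UNIV. vphi (n k i) j k)"
  shows "- p7 F i j / 48 + (ac h (vphi t1) i j - 1 / 3 * cm (vphi x) (vphi t1) i j) =
      p7 (\<lambda>i j. 1 / 2 * cm h t3 i j + 1 / 2 * ac h (vphi t1) i j + 1 / 4 * ac h t2 i j) i j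
      + p14 (ac h (vphi t1)) i j + 1 / 4 * t0 * vphi x i j
      + p7 (\<lambda>i j. - 1 / 2 * ac (vphi x) t3 i j - 1 / 2 * cm (vphi x) (vphi t1) i j + 1 / 12 * cm (vphi x) t2 i j) i j
      + p14 (\<lambda>i j. - 1 / 3 * cm (vphi x) (vphi t1) i j) i j
      - 1 / 6 * vphi (\<lambda>k. \<Sum>p\<in>UNIV. n p p k) i j + 1 / 6 * vphi (\<lambda>k. \<Sum>p\<in>UNIV. n k p p) i j
      + 1 / 6 * vphi (\<lambda>k. \<Sum>a\<in>UNIV. \<Sum>b\<in>UNIV. m a b * phi0 [a, b, k]) i j" (is ?c1)
    and "p14 F i j / 6 + (ac h t2 i j - 1 / 3 * cm (vphi x) t2 i j) =
      p7 (ac h t2) i j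
      + p14 (\<lambda>i j. - cm h t3 i j + ac h (vphi t1) i j + 1 / 2 * ac h t2 i j) i j
      + p7 (\<lambda>i j. - 1 / 3 * cm (vphi x) t2 i j) i j
      + p14 (\<lambda>i j. ac (vphi x) t3 i j + 1 / 3 * cm (vphi x) (vphi t1) i j) i j
      - cu i j + cu j i
      - 1 / 3 * vphi (\<lambda>k. \<Sum>p\<in>UNIV. n p p k) i j + 1 / 3 * vphi (\<lambda>k. \<Sum>p\<in>UNIV. n k p p) i j
      - m i j + m j i + 1 / 3 * vphi (\<lambda>k. \<Sum>a\<in>UNIV. \<Sum>b\<in>UNIV. m a b * phi0 [a, b, k]) i j" (is ?c2)
proof -
  define XX where "XX = vphi x"
  define S1 where "S1 = vphi t1"
  define dv where "dv = vphi (\<lambda>k. \<Sum>p\<in>UNIV. n p p k)"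
  define gr where "gr = vphi (\<lambda>k. \<Sum>p\<in>UNIV. n k p p)"
  have XX: "XX i j = - XX j i" and S1: "S1 i j = - S1 j i" for i j
    unfolding XX_def S1_def by (rule vphi_swap)+
  have T: "T i j = (if i = j then t0 / 4 else 0) - t3 i j + S1 i j - t2 i j / 2" for i j
    using Ts[of i j] Ta[of i j] unfolding S1_def by (auto split: if_splits)
  have AT: "A i l * T l j = (if l = j then t0 / 4 * A i j else 0) - A i l * t3 l j + A i l * S1 l j - 1 / 2 * (A i l * t2 l j)"
    and TA: "T i l * A l j = (if l = i then t0 / 4 * A i j else 0) - t3 i l * A l j + S1 i l * A l j - 1 / 2 * (t2 i l * A l j)"
    for A i j l
    unfolding T by (auto simp: algebra_simps)
  have mmT: "mm A T i j = t0 / 4 * A i j - mm A t3 i j + mm A S1 i j - 1 / 2 * mm A t2 i j"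
    "mm T A i j = t0 / 4 * A i j - mm t3 A i j + mm S1 A i j - 1 / 2 * mm t2 A i j" for A i j
    unfolding mm_def AT TA
    by (simp_all add: sum.distrib sum_subtractf sum_distrib_left)
  note tr = mm_transpose[of h 1 t3 1, simplified, OF h t3] mm_transpose[of h 1 S1 "-1", simplified, OF h S1]
    mm_transpose[of h 1 t2 "-1", simplified, OF h t2(1)]
    mm_transpose[of XX "-1" t3 1, simplified, OF XX t3] mm_transpose[of XX "-1" S1 "-1", simplified, OF XX S1]
    mm_transpose[of XX "-1" t2 "-1", simplified, OF XX t2(1)]
    mm_transpose[of t3 1 XX "-1", simplified, OF t3 XX] mm_transpose[of S1 "-1" XX "-1", simplified, OF S1 XX]
    mm_transpose[of t2 "-1" XX "-1", simplified, OF t2(1) XX]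
  \<comment> \<open>The antisymmetrisation of the argument of \<open>dcurl\<close> in F.
    Transposition turns products of two symmetric or two skew factors into commutators and mixed
    products into anticommutators, which gives the pattern of brackets in the theorem.\<close>
  define Y where "Y i j = m i j - m j i + cm h t3 i j - ac h S1 i j + 1 / 2 * ac h t2 i j
      + t0 / 2 * XX i j - ac XX t3 i j - 1 / 3 * cm XX S1 i j + 1 / 6 * cm XX t2 i j" for i j
  have Y: "(m p k - mm h T p k + 1 / 3 * mm XX T p k + 2 / 3 * mm T XX p k)
      - (m k p - mm h T k p + 1 / 3 * mm XX T k p + 2 / 3 * mm T XX k p) = Y p k" for p k
    unfolding Y_def mmT cm_def ac_def using tr[of k p] h[of p k] XX[of p k]
    by (simp add: field_simps)
  have Y_skew: "Y j i = - Y i j" for i j unfolding Y[symmetric] by simp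
  define W where "W i j = cu i j - cu j i" for i j
  have F': "F i j = 6 * (dv i j - gr i j - W i j) - 12 * Y i j + 3 * cpsi Y i j" for i j
    unfolding F dcurl_def XX_def[symmetric] Y dv_def gr_def W_def by simp
  have cW: "cpsi W i j = 2 * W i j + 2 * (dv i j - gr i j)" for i j
  proof -
    have "W = (\<lambda>i j. (\<Sum>k\<in>UNIV. vphi (n k i) j k) - (\<Sum>k\<in>UNIV. vphi (n k j) i k))"
      unfolding W_def cu by (intro ext) simp
    then show ?thesis using cpsi_curl_sym[of n i j, OF n] unfolding dv_def gr_def by simp
  qed
  have cF: "cpsi F i j = 6 * (- 4 * dv i j + 4 * gr i j - cpsi W i j) - 12 * cpsi Y i j + 3 * (8 * Y i j - 2 * cpsi Y i j)"
  proof -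
    have "F = (\<lambda>i j. 6 * (dv i j - gr i j - W i j) - 12 * Y i j + 3 * cpsi Y i j)" by (intro ext) (rule F')
    moreover have "cpsi (cpsi Y) i j = 8 * Y i j - 2 * cpsi Y i j"
      using cpsi_cpsi[of Y i j] Y_skew[of i j] by simp
    moreover have "cpsi dv i j = - 4 * dv i j" "cpsi gr i j = - 4 * gr i j"
      unfolding dv_def gr_def by (rule cpsi_vphi)+
    ultimately show ?thesis by (simp only: cpsi_linear) simp
  qed
  have cY: "cpsi Y i j = 2 * cpsi m i j + cpsi (cm h t3) i j - cpsi (ac h S1) i j + 1 / 2 * cpsi (ac h t2) i j
      + t0 / 2 * (- 4 * XX i j) - cpsi (ac XX t3) i j - 1 / 3 * cpsi (cm XX S1) i j + 1 / 6 * (- 4 * cm XX t2 i j)"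
  proof -
    have "cpsi (cm XX t2) i j = - 4 * cm XX t2 i j"
      using cpsi_comm_14[of t2 x i j, OF t2] unfolding cm_def[abs_def] XX_def .
    moreover have "Y = (\<lambda>i j. m i j - m j i + cm h t3 i j - ac h S1 i j + 1 / 2 * ac h t2 i j
      + t0 / 2 * XX i j - ac XX t3 i j - 1 / 3 * cm XX S1 i j + 1 / 6 * cm XX t2 i j)" by (intro ext) (rule Y_def)
    moreover have "cpsi XX i j = - 4 * XX i j" unfolding XX_def by (rule cpsi_vphi)
    ultimately show ?thesis by (simp only: cpsi_linear cpsi_transpose[of m])
  qed
  \<comment> \<open>The X-commutator with t2 lies in the 7-dimensional summand.\<close>
  have cc: "cpsi (cm XX t2) i j = - 4 * cm XX t2 i j"
    using cpsi_comm_14[of t2 x i j, OF t2] unfolding cm_def[abs_def] XX_def .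
  have m: "vphi (\<lambda>k. \<Sum>a\<in>UNIV. \<Sum>b\<in>UNIV. m a b * phi0 [a, b, k]) i j = m i j - m j i - cpsi m i j"
    by (rule vphi_contract)
  have Yij: "Y i j = m i j - m j i + cm h t3 i j - ac h S1 i j + 1 / 2 * ac h t2 i j
      + t0 / 2 * XX i j - ac XX t3 i j - 1 / 3 * cm XX S1 i j + 1 / 6 * cm XX t2 i j" by (rule Y_def)
  have W': "W i j = cu i j - cu j i" by (rule W_def)
  show ?c1
    unfolding p7_def p14_def m XX_def[symmetric] S1_def[symmetric] dv_def[symmetric] gr_def[symmetric] cpsi_linear
    unfolding cF F' cW cY cc W' Yij by (simp add: field_simps)
  show ?c2
    unfolding p7_def p14_def m XX_def[symmetric] S1_def[symmetric] dv_def[symmetric] gr_def[symmetric] cpsi_linear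
    unfolding cF F' cW cY cc W' Yij by (simp add: field_simps)
qed

subsection \<open>Functions of class \<open>C\<^sup>k\<close>\<close>

lemma Ck_on_cong:
  fixes f g :: "'a::euclidean_space \<Rightarrow> 'b::real_normed_vector"
  assumes "open S" "\<And>x. x \<in> S \<Longrightarrow> f x = g x" "Ck_on k S f"
  shows "Ck_on k S g"
  using assms(2,3)
proof (induction k arbitrary: f g)
  case 0
  then show ?case by (simp cong: continuous_on_cong)
next
  case (Suc k)
  have d: "(g has_derivative frechet_derivative f (at x)) (at x)" if "x \<in> S" for x
    using Suc.prems that has_derivative_transform_within_open[OF _ assms(1) that, of f _ UNIV g]
    by (simp add: frechet_derivative_works)
  then have fd: "frechet_derivative g (at x) = frechet_derivative f (at x)" if "x \<in> S" for x
    using that frechet_derivative_at by metis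
  show ?case
    unfolding Ck_on.simps
  proof (intro conjI ballI)
    show "g differentiable at x" if "x \<in> S" for x using d[OF that] by (rule differentiableI)
    fix b :: 'a assume "b \<in> Basis"
    then have "Ck_on k S (\<lambda>x. frechet_derivative f (at x) b)" using Suc.prems(2) by simp
    then show "Ck_on k S (\<lambda>x. frechet_derivative g (at x) b)"
      by (rule Suc.IH[rotated]) (simp add: fd)
  qed
qed

text \<open>By uniqueness on the open set, any explicit derivative may stand in for the chosen
  \<open>frechet_derivative\<close>.\<close>

lemma Ck_on_SucI:
  assumes S: "open S" and d: "\<And>x. x \<in> S \<Longrightarrow> (f has_derivative f' x) (at x)"
    and c: "\<And>b. b \<in> Basis \<Longrightarrow> Ck_on k S (\<lambda>x. f' x b)"
  shows "Ck_on (Suc k) S f"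
  unfolding Ck_on.simps
proof (intro conjI ballI)
  show "f differentiable at x" if "x \<in> S" for x using d[OF that] by (rule differentiableI)
  show "Ck_on k S (\<lambda>x. frechet_derivative f (at x) b)" if "b \<in> Basis" for b
    by (rule Ck_on_cong[OF S _ c[OF that]]) (metis d frechet_derivative_at)
qed

lemma Ck_on_SucD:
  assumes "Ck_on (Suc k) S f"
  shows "x \<in> S \<Longrightarrow> (f has_derivative frechet_derivative f (at x)) (at x)"
    and "b \<in> Basis \<Longrightarrow> Ck_on k S (\<lambda>x. frechet_derivative f (at x) b)"
  using assms by (simp_all add: frechet_derivative_works)

lemma Ck_on_Suc_imp: "Ck_on (Suc k) S f \<Longrightarrow> Ck_on k S f"
proof (induction k arbitrary: f)
  case 0
  then show ?case
    by (simp, intro differentiable_imp_continuous_on) (simp add: differentiable_on_def differentiable_at_withinI)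
next
  case (Suc k)
  then show ?case by auto
qed

lemma Ck_on_const: "Ck_on k S (\<lambda>x. c)"
  by (induction k arbitrary: c) auto

lemma Ck_on_add:
  assumes "open S" "Ck_on k S f" "Ck_on k S g"
  shows "Ck_on k S (\<lambda>x. f x + g x)"
  using assms(2,3)
proof (induction k arbitrary: f g)
  case 0
  then show ?case by (auto intro: continuous_on_add)
next
  case (Suc k)
  show ?case
    by (rule Ck_on_SucI[OF assms(1)], rule has_derivative_add)
      (auto intro!: Ck_on_SucD[OF Suc.prems(1)] Ck_on_SucD[OF Suc.prems(2)] Suc.IH)
qed

lemma Ck_on_mult:
  fixes f g :: "_ \<Rightarrow> real"
  assumes "open S" "Ck_on k S f" "Ck_on k S g"
  shows "Ck_on k S (\<lambda>x. f x * g x)"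
  using assms(2,3)
proof (induction k arbitrary: f g)
  case 0
  then show ?case by (auto intro: continuous_on_mult)
next
  case (Suc k)
  show ?case
    by (rule Ck_on_SucI[OF assms(1)], rule has_derivative_mult)
      (auto intro!: Ck_on_SucD[OF Suc.prems(1)] Ck_on_SucD[OF Suc.prems(2)] Suc.IH
        Ck_on_add[OF assms(1)] Ck_on_Suc_imp[OF Suc.prems(1)] Ck_on_Suc_imp[OF Suc.prems(2)])
qed

lemma Ck_on_sum:
  assumes "open S" "\<And>i. i \<in> I \<Longrightarrow> Ck_on k S (f i)"
  shows "Ck_on k S (\<lambda>x. \<Sum>i\<in>I. f i x)"
  using assms(2)
  by (induction I rule: infinite_finite_induct) (auto intro: Ck_on_const Ck_on_add[OF assms(1)])

lemma Ck_on_prod: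
  fixes f :: "_ \<Rightarrow> _ \<Rightarrow> real"
  assumes "open S" "\<And>i. i \<in> I \<Longrightarrow> Ck_on k S (f i)"
  shows "Ck_on k S (\<lambda>x. \<Prod>i\<in>I. f i x)"
  using assms(2)
  by (induction I rule: infinite_finite_induct) (auto intro: Ck_on_const Ck_on_mult[OF assms(1)])

text \<open>The derivative is a product of Df with 1/f taken twice, so the induction hypothesis for
  1/f itself closes the step. \<open>Ck_on_odd_root\<close> follows the same pattern.\<close>

lemma Ck_on_inverse:
  fixes f :: "'a::euclidean_space \<Rightarrow> real"
  assumes S: "open S" and f: "Ck_on k S f" and nz: "\<And>x. x \<in> S \<Longrightarrow> f x \<noteq> 0"
  shows "Ck_on k S (\<lambda>x. inverse (f x))"
  using f
proof (induction k)
  case 0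
  then show ?case using nz by (auto intro: continuous_on_inverse)
next
  case (Suc k)
  have i: "Ck_on k S (\<lambda>x. inverse (f x))" by (rule Suc.IH[OF Ck_on_Suc_imp[OF Suc.prems]])
  show ?case
  proof (rule Ck_on_SucI[OF S])
    fix x assume "x \<in> S"
    then show "((\<lambda>x. inverse (f x)) has_derivative
        (\<lambda>b. (-1) * (inverse (f x) * frechet_derivative f (at x) b * inverse (f x)))) (at x)"
      using Deriv.has_derivative_inverse[OF nz Ck_on_SucD(1)[OF Suc.prems]] by simp
  next
    fix b :: 'a assume "b \<in> Basis"
    then show "Ck_on k S (\<lambda>x. (-1) * (inverse (f x) * frechet_derivative f (at x) b * inverse (f x)))"
      by (intro Ck_on_mult[OF S] Ck_on_const i Ck_on_SucD(2)[OF Suc.prems])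
  qed
qed

lemma Ck_on_power:
  fixes f :: "'a::euclidean_space \<Rightarrow> real"
  shows "open S \<Longrightarrow> Ck_on k S f \<Longrightarrow> Ck_on k S (\<lambda>x. f x ^ n)"
  by (induction n) (auto intro: Ck_on_const Ck_on_mult)

lemma Ck_on_odd_root:
  fixes f :: "'a::euclidean_space \<Rightarrow> real"
  assumes S: "open S" and f: "Ck_on k S f" and nz: "\<And>x. x \<in> S \<Longrightarrow> f x \<noteq> 0" and n: "odd n"
  shows "Ck_on k S (\<lambda>x. root n (f x))"
  using f
proof (induction k)
  case 0
  then show ?case by (auto intro: continuous_on_real_root)
next
  case (Suc k)
  have i: "Ck_on k S (\<lambda>x. root n (f x))" by (rule Suc.IH[OF Ck_on_Suc_imp[OF Suc.prems]])
  have n0: "n > 0" using n by (rule odd_pos)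
  show ?case
  proof (rule Ck_on_SucI[OF S])
    fix x assume x: "x \<in> S"
    have "((\<lambda>x. root n (f x)) has_derivative
        (\<lambda>b. frechet_derivative f (at x) b * inverse (real n * root n (f x) ^ (n - Suc 0)))) (at x)"
      using DERIV_compose_FDERIV[OF DERIV_odd_real_root[OF n nz[OF x]] Ck_on_SucD(1)[OF Suc.prems x]] .
    then show "((\<lambda>x. root n (f x)) has_derivative
        (\<lambda>b. frechet_derivative f (at x) b * inverse (real n * root n (f x) ^ (n - Suc 0)))) (at x)" .
  next
    fix b :: 'a assume "b \<in> Basis"
    moreover have "real n * root n (f x) ^ (n - Suc 0) \<noteq> 0" if "x \<in> S" for x
      using n0 nz[OF that] by simp
    ultimately show "Ck_on k S (\<lambda>x. frechet_derivative f (at x) b * inverse (real n * root n (f x) ^ (n - Suc 0)))"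
      by (intro Ck_on_mult[OF S] Ck_on_inverse[OF S] Ck_on_power[OF S] Ck_on_const i Ck_on_SucD(2)[OF Suc.prems])
  qed
qed

lemma Ck_on_det:
  fixes A :: "_ \<Rightarrow> real^'n^'n"
  assumes S: "open S" and A: "\<And>i j. Ck_on k S (\<lambda>x. A x $ i $ j)"
  shows "Ck_on k S (\<lambda>x. det (A x))"
  unfolding det_def by (intro Ck_on_sum[OF S] Ck_on_mult[OF S] Ck_on_const Ck_on_prod[OF S] A)

text \<open>Cramer's rule exhibits the entries of the inverse as quotients of determinants, from
  which their regularity is read off.\<close>

lemma matrix_inv_cramer:
  fixes A :: "real^'n^'n"
  assumes "det A \<noteq> 0"
  shows "matrix_inv A $ k $ l = det (\<chi> i j. if j = k then axis l 1 $ i else A $ i $ j) / det A"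
proof -
  have inv: "invertible A" using assms by (simp add: invertible_det_nz)
  have "A *v (matrix_inv A *v axis l 1) = axis l 1"
    by (simp add: matrix_vector_mul_assoc matrix_inv(1)[OF inv])
  then have "matrix_inv A *v axis l 1 = (\<chi> k. det (\<chi> i j. if j = k then axis l 1 $ i else A $ i $ j) / det A)"
    using cramer[OF assms] by blast
  then have "(matrix_inv A *v axis l 1) $ k = det (\<chi> i j. if j = k then axis l 1 $ i else A $ i $ j) / det A"
    by simp
  then show ?thesis by (simp add: matrix_vector_mult_basis column_def)
qed

lemma Ck_on_matrix_inv:
  fixes A :: "_ \<Rightarrow> real^'n^'n"
  assumes S: "open S" and A: "\<And>i j. Ck_on k S (\<lambda>x. A x $ i $ j)" and nz: "\<And>x. x \<in> S \<Longrightarrow> det (A x) \<noteq> 0"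
  shows "Ck_on k S (\<lambda>x. matrix_inv (A x) $ i $ j)"
proof (rule Ck_on_cong[OF S])
  have "Ck_on k S (\<lambda>x. (\<chi> r s. if s = i then axis j 1 $ r else A x $ r $ s) $ a $ b)" for a b
    by (cases "b = i") (simp_all add: A Ck_on_const)
  then show "Ck_on k S (\<lambda>x. det (\<chi> r s. if s = i then axis j 1 $ r else A x $ r $ s) * inverse (det (A x)))"
    using nz by (intro Ck_on_mult[OF S] Ck_on_inverse[OF S] Ck_on_det[OF S] A)
qed (simp add: matrix_inv_cramer nz divide_inverse)

subsection \<open>Symmetry of second derivatives\<close>

text \<open>The second difference D over a small square equals h^2 times either mixed derivative at
  some interior point, by applying the mean value theorem twice in either order; continuity at the
  corner then excludes a gap.\<close>

lemma mixed_partials_equal: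
  fixes f fa fb fab fba :: "real \<Rightarrow> real \<Rightarrow> real"
  assumes d: "d > 0"
    and fa: "\<And>a b. \<bar>a\<bar> < d \<Longrightarrow> \<bar>b\<bar> < d \<Longrightarrow> ((\<lambda>a. f a b) has_real_derivative fa a b) (at a)"
    and fb: "\<And>a b. \<bar>a\<bar> < d \<Longrightarrow> \<bar>b\<bar> < d \<Longrightarrow> ((\<lambda>b. f a b) has_real_derivative fb a b) (at b)"
    and fab: "\<And>a b. \<bar>a\<bar> < d \<Longrightarrow> \<bar>b\<bar> < d \<Longrightarrow> ((\<lambda>b. fa a b) has_real_derivative fab a b) (at b)"
    and fba: "\<And>a b. \<bar>a\<bar> < d \<Longrightarrow> \<bar>b\<bar> < d \<Longrightarrow> ((\<lambda>a. fb a b) has_real_derivative fba a b) (at a)"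
    and cab: "\<And>e. e > 0 \<Longrightarrow> \<exists>r>0. \<forall>a b. \<bar>a\<bar> < r \<longrightarrow> \<bar>b\<bar> < r \<longrightarrow> \<bar>fab a b - fab 0 0\<bar> < e"
    and cba: "\<And>e. e > 0 \<Longrightarrow> \<exists>r>0. \<forall>a b. \<bar>a\<bar> < r \<longrightarrow> \<bar>b\<bar> < r \<longrightarrow> \<bar>fba a b - fba 0 0\<bar> < e"
  shows "fab 0 0 = fba 0 0"
proof (rule ccontr)
  assume ne: "fab 0 0 \<noteq> fba 0 0"
  \<comment> \<open>Half the gap: two values closer than this to their respective limits cannot
    coincide.\<close>
  define e where "e = \<bar>fab 0 0 - fba 0 0\<bar> / 2"
  have e: "e > 0" using ne by (simp add: e_def)
  obtain r1 where r1: "r1 > 0" "\<And>a b. \<bar>a\<bar> < r1 \<Longrightarrow> \<bar>b\<bar> < r1 \<Longrightarrow> \<bar>fab a b - fab 0 0\<bar> < e"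
    using cab[OF e] by blast
  obtain r2 where r2: "r2 > 0" "\<And>a b. \<bar>a\<bar> < r2 \<Longrightarrow> \<bar>b\<bar> < r2 \<Longrightarrow> \<bar>fba a b - fba 0 0\<bar> < e"
    using cba[OF e] by blast
  define h where "h = min d (min r1 r2) / 2"
  have h: "h > 0" "h < d" "h < r1" "h < r2" using d r1(1) r2(1) by (auto simp: h_def min_def)
  define D where "D = f h h - f h 0 - f 0 h + f 0 0"
  have 1: "\<exists>a b. 0 < a \<and> a < h \<and> 0 < b \<and> b < h \<and> D = h * (h * fab a b)"
  proof -
    have "((\<lambda>a. f a h - f a 0) has_real_derivative fa a h - fa a 0) (at a)" if "0 \<le> a" "a \<le> h" for a
      using that h by (intro DERIV_diff fa) auto
    from MVT2[OF h(1) this] obtain a where a: "0 < a" "a < h" "f h h - f h 0 - (f 0 h - f 0 0) = (h - 0) * (fa a h - fa a 0)"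
      by blast
    have "((\<lambda>b. fa a b) has_real_derivative fab a b) (at b)" if "0 \<le> b" "b \<le> h" for b
      using that h a by (intro fab) auto
    from MVT2[OF h(1) this] obtain b where b: "0 < b" "b < h" "fa a h - fa a 0 = (h - 0) * fab a b" by blast
    have "D = h * (h * fab a b)" using a(3) b(3) by (simp add: D_def)
    then show ?thesis using a b by blast
  qed
  have 2: "\<exists>a b. 0 < a \<and> a < h \<and> 0 < b \<and> b < h \<and> D = h * (h * fba a b)"
  proof -
    have "((\<lambda>b. f h b - f 0 b) has_real_derivative fb h b - fb 0 b) (at b)" if "0 \<le> b" "b \<le> h" for b
      using that h by (intro DERIV_diff fb) auto
    from MVT2[OF h(1) this] obtain b where b: "0 < b" "b < h" "f h h - f 0 h - (f h 0 - f 0 0) = (h - 0) * (fb h b - fb 0 b)"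
      by blast
    have "((\<lambda>a. fb a b) has_real_derivative fba a b) (at a)" if "0 \<le> a" "a \<le> h" for a
      using that h b by (intro fba) auto
    from MVT2[OF h(1) this] obtain a where a: "0 < a" "a < h" "fb h b - fb 0 b = (h - 0) * fba a b" by blast
    have "D = h * (h * fba a b)" using a(3) b(3) by (simp add: D_def)
    then show ?thesis using a b by blast
  qed
  obtain a b where ab: "0 < a" "a < h" "0 < b" "b < h" "D = h * (h * fab a b)" using 1 by blast
  obtain a' b' where ab': "0 < a'" "a' < h" "0 < b'" "b' < h" "D = h * (h * fba a' b')" using 2 by blast
  have "fab a b = fba a' b'" using ab(5) ab'(5) h(1) by simp
  moreover have "\<bar>fab a b - fab 0 0\<bar> < e" using ab h by (intro r1(2)) auto
  moreover have "\<bar>fba a' b' - fba 0 0\<bar> < e" using ab' h by (intro r2(2)) auto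
  ultimately show False unfolding e_def by (smt (verit) field_sum_of_halves)
qed

lemma has_derivative_along:
  fixes F :: "'a::euclidean_space \<Rightarrow> real"
  assumes "(F has_derivative F') (at (q + a *\<^sub>R u))"
  shows "((\<lambda>r. F (q + r *\<^sub>R u)) has_real_derivative F' u) (at a)"
proof -
  have "((\<lambda>r. q + r *\<^sub>R u) has_derivative (\<lambda>h. h *\<^sub>R u)) (at a)"
    by (auto intro!: derivative_eq_intros)
  from diff_chain_at[OF this assms] have "((\<lambda>r. F (q + r *\<^sub>R u)) has_derivative (\<lambda>h. F' (h *\<^sub>R u))) (at a)"
    by (simp add: o_def)
  moreover have "(\<lambda>h. F' (h *\<^sub>R u)) = (*) (F' u)"
    using linear_cmul[OF has_derivative_linear[OF assms]] by (simp add: fun_eq_iff mult.commute)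
  ultimately show ?thesis by (simp add: has_field_derivative_def)
qed

text \<open>The function is restricted to the plane through z spanned by the two basis directions,
  where the scalar statement applies.\<close>

lemma frechet_derivative_commute:
  fixes F :: "'a::euclidean_space \<Rightarrow> real"
  assumes S: "open S" and F: "Ck_on 2 S F" and z: "z \<in> S" and u: "u \<in> Basis" and v: "v \<in> Basis"
  shows "frechet_derivative (\<lambda>w. frechet_derivative F (at w) u) (at z) v
       = frechet_derivative (\<lambda>w. frechet_derivative F (at w) v) (at z) u"
proof -
  have F1: "Ck_on (Suc (Suc 0)) S F" using F by (simp add: numeral_2_eq_2)
  define w where "w a b = z + a *\<^sub>R u + b *\<^sub>R v" for a b
  define Du where "Du w = frechet_derivative F (at w) u" for w
  define Dv where "Dv w = frechet_derivative F (at w) v" for w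
  have Du: "Ck_on (Suc 0) S Du" and Dv: "Ck_on (Suc 0) S Dv"
    unfolding Du_def[abs_def] Dv_def[abs_def] using Ck_on_SucD(2)[OF F1] u v by blast+
  define Duv where "Duv w = frechet_derivative Du (at w) v" for w
  define Dvu where "Dvu w = frechet_derivative Dv (at w) u" for w
  have Duv: "continuous_on S Duv" and Dvu: "continuous_on S Dvu"
    unfolding Duv_def[abs_def] Dvu_def[abs_def] using Ck_on_SucD(2)[OF Du v] Ck_on_SucD(2)[OF Dv u] by simp_all
  obtain d0 where d0: "d0 > 0" "ball z d0 \<subseteq> S" using S z open_contains_ball by blast
  have dist_w: "dist z (w a b) \<le> \<bar>a\<bar> + \<bar>b\<bar>" for a b
  proof -
    have "dist z (w a b) = norm (a *\<^sub>R u + b *\<^sub>R v)" unfolding w_def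
      by (metis add.assoc add_diff_cancel_left' dist_commute dist_norm)
    also have "\<dots> \<le> \<bar>a\<bar> + \<bar>b\<bar>" using norm_triangle_ineq[of "a *\<^sub>R u" "b *\<^sub>R v"] u v by simp
    finally show ?thesis .
  qed
  \<comment> \<open>Basis vectors have norm one, so halving the radius keeps the sum of the two
    displacements inside the ball.\<close>
  have wS: "w a b \<in> S" if "\<bar>a\<bar> < d0 / 2" "\<bar>b\<bar> < d0 / 2" for a b
    using d0 dist_w[of a b] that by (intro subsetD[OF d0(2)]) auto
  have along_u: "((\<lambda>a. G (w a b)) has_real_derivative frechet_derivative G (at (w a b)) u) (at a)"
    if "Ck_on (Suc k) S G" "\<bar>a\<bar> < d0 / 2" "\<bar>b\<bar> < d0 / 2" for G k a b
    using has_derivative_along[of G _ "z + b *\<^sub>R v" a u] Ck_on_SucD(1)[OF that(1) wS[OF that(2,3)]]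
    by (simp add: w_def add_ac)
  have along_v: "((\<lambda>b. G (w a b)) has_real_derivative frechet_derivative G (at (w a b)) v) (at b)"
    if "Ck_on (Suc k) S G" "\<bar>a\<bar> < d0 / 2" "\<bar>b\<bar> < d0 / 2" for G k a b
    using has_derivative_along[of G _ "z + a *\<^sub>R u" b v] Ck_on_SucD(1)[OF that(1) wS[OF that(2,3)]]
    by (simp add: w_def)
  have w0: "w 0 0 = z" by (simp add: w_def)
  have cont: "\<exists>r>0. \<forall>a b. \<bar>a\<bar> < r \<longrightarrow> \<bar>b\<bar> < r \<longrightarrow> \<bar>G (w a b) - G (w 0 0)\<bar> < e"
    if G: "continuous_on S G" and e: "e > 0" for G :: "'a \<Rightarrow> real" and e
  proof -
    have "isCont G z" using G S z continuous_on_eq_continuous_at by blast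
    then obtain r where r: "r > 0" "\<And>w. dist w z < r \<Longrightarrow> dist (G w) (G z) < e"
      using e unfolding continuous_at_eps_delta by blast
    have "\<bar>G (w a b) - G (w 0 0)\<bar> < e" if "\<bar>a\<bar> < r / 2" "\<bar>b\<bar> < r / 2" for a b
    proof -
      have "dist (w a b) z < r" using dist_w[of a b] that by (simp add: dist_commute)
      then show ?thesis using r(2) by (simp add: w0 dist_real_def)
    qed
    then show ?thesis using r(1) half_gt_zero by blast
  qed
  have "Duv (w 0 0) = Dvu (w 0 0)"
  proof (rule mixed_partials_equal[where d = "d0 / 2" and f = "\<lambda>a b. F (w a b)" and fa = "\<lambda>a b. Du (w a b)" and fb = "\<lambda>a b. Dv (w a b)"
      and fab = "\<lambda>a b. Duv (w a b)" and fba = "\<lambda>a b. Dvu (w a b)"])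
    show "((\<lambda>a. F (w a b)) has_real_derivative Du (w a b)) (at a)" if "\<bar>a\<bar> < d0 / 2" "\<bar>b\<bar> < d0 / 2" for a b
      unfolding Du_def by (rule along_u[OF F1 that])
    show "((\<lambda>b. F (w a b)) has_real_derivative Dv (w a b)) (at b)" if "\<bar>a\<bar> < d0 / 2" "\<bar>b\<bar> < d0 / 2" for a b
      unfolding Dv_def by (rule along_v[OF F1 that])
    show "((\<lambda>b. Du (w a b)) has_real_derivative Duv (w a b)) (at b)" if "\<bar>a\<bar> < d0 / 2" "\<bar>b\<bar> < d0 / 2" for a b
      unfolding Duv_def by (rule along_v[OF Du that])
    show "((\<lambda>a. Dv (w a b)) has_real_derivative Dvu (w a b)) (at a)" if "\<bar>a\<bar> < d0 / 2" "\<bar>b\<bar> < d0 / 2" for a b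
      unfolding Dvu_def by (rule along_u[OF Dv that])
  qed (use d0 cont[OF Duv] cont[OF Dvu] in auto)
  then show ?thesis by (simp add: w0 Duv_def Dvu_def Du_def[abs_def] Dv_def[abs_def])
qed

text \<open>Partial derivatives become derivatives along a coordinate line, so the variation lemmas
  for one-parameter families serve in space as well as in time.\<close>

lemma pd_eq_derivative:
  assumes "f differentiable (at x)"
  shows "((\<lambda>r. f (x + r *\<^sub>R axis p 1)) has_real_derivative pd p f x) (at 0)"
  unfolding pd_def using has_derivative_along[of f "frechet_derivative f (at x)" x 0 "axis p 1"] assms
  by (simp add: frechet_derivative_works)

lemma pd_unique:
  assumes "f differentiable (at x)" "((\<lambda>r. f (x + r *\<^sub>R axis p 1)) has_real_derivative D) (at 0)"
  shows "pd p f x = D"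
  using pd_eq_derivative[OF assms(1)] assms(2) by (rule DERIV_unique)

lemma slice_derivative:
  fixes F :: "real \<times> (real^7) \<Rightarrow> real"
  assumes "(F has_derivative F') (at (t, x))"
  shows "((\<lambda>y. F (t, y)) has_derivative (\<lambda>h. F' (0, h))) (at x)"
    and "((\<lambda>s. F (s, x)) has_real_derivative F' (1, 0)) (at t)"
proof -
  have "((\<lambda>y. (t, y)) has_derivative (\<lambda>h. (0, h))) (at x)"
    by (intro has_derivative_Pair) (auto intro!: derivative_intros)
  from diff_chain_at[OF this, of F F'] assms show "((\<lambda>y. F (t, y)) has_derivative (\<lambda>h. F' (0, h))) (at x)"
    by (simp add: o_def)
  show "((\<lambda>s. F (s, x)) has_real_derivative F' (1, 0)) (at t)"
    using has_derivative_along[of F F' "(0, x)" t "(1, 0)"] assms by simp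
qed

text \<open>The time derivative F' is prescribed only at the single time t. It coincides there with
  a slice of the joint derivative of F, which supplies its differentiability in space and, by the
  symmetry of second derivatives, the exchange.\<close>

lemma mixed_derivative:
  fixes F :: "real \<times> (real^7) \<Rightarrow> real"
  assumes T: "open T" "t \<in> T" and U: "open U" "x \<in> U" and F: "Ck_on 2 (T \<times> U) F"
    and F': "\<And>y. y \<in> U \<Longrightarrow> ((\<lambda>s. F (s, y)) has_real_derivative F' y) (at t)"
  shows "F' differentiable (at x)"
    and "((\<lambda>s. pd p (\<lambda>y. F (s, y)) x) has_real_derivative pd p F' x) (at t)"
proof -
  have TU: "open (T \<times> U)" using T U by (simp add: open_Times)
  have F1: "Ck_on (Suc (Suc 0)) (T \<times> U) F" using F by (simp add: numeral_2_eq_2)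
  define u v :: "real \<times> (real^7)" where "u = (1, 0)" and "v = (0, axis p 1)"
  have uv: "u \<in> Basis" "v \<in> Basis" by (auto simp: u_def v_def Basis_prod_def axis_in_Basis_iff)
  define Du where "Du w = frechet_derivative F (at w) u" for w
  define Dv where "Dv w = frechet_derivative F (at w) v" for w
  have Du: "Ck_on (Suc 0) (T \<times> U) Du" and Dv: "Ck_on (Suc 0) (T \<times> U) Dv"
    unfolding Du_def[abs_def] Dv_def[abs_def] using Ck_on_SucD(2)[OF F1] uv by blast+
  have tx: "(t, x) \<in> T \<times> U" using T U by simp
  have Du_F': "Du (t, y) = F' y" if "y \<in> U" for y
    unfolding Du_def u_def using slice_derivative(2)[OF Ck_on_SucD(1)[OF F1]] F'[OF that] T that DERIV_unique by blast
  have dF': "(F' has_derivative (\<lambda>h. frechet_derivative Du (at (t, x)) (0, h))) (at x)"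
    by (rule has_derivative_transform_within_open[OF slice_derivative(1)[OF Ck_on_SucD(1)[OF Du tx]] U])
      (simp add: Du_F')
  then show "F' differentiable (at x)" by (rule differentiableI)
  have pF': "pd p F' x = frechet_derivative Du (at (t, x)) v"
    unfolding pd_def frechet_derivative_at[OF dF', symmetric] v_def ..
  have pF: "Dv (s, x) = pd p (\<lambda>y. F (s, y)) x" if "s \<in> T" for s
  proof -
    have "(s, x) \<in> T \<times> U" using that U by simp
    from frechet_derivative_at[OF slice_derivative(1)[OF Ck_on_SucD(1)[OF F1 this]]]
    show ?thesis unfolding Dv_def v_def pd_def by metis
  qed
  have "((\<lambda>s. Dv (s, x)) has_real_derivative frechet_derivative Dv (at (t, x)) u) (at t)"
    unfolding u_def by (rule slice_derivative(2)[OF Ck_on_SucD(1)[OF Dv tx]])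
  then have "((\<lambda>s. pd p (\<lambda>y. F (s, y)) x) has_real_derivative frechet_derivative Dv (at (t, x)) u) (at t)"
    by (rule has_field_derivative_transform_within_open[OF _ T]) (rule pF)
  moreover have "frechet_derivative Dv (at (t, x)) u = pd p F' x"
    unfolding pF' Du_def[abs_def] Dv_def[abs_def]
    by (rule frechet_derivative_commute[OF TU F tx uv, symmetric])
  ultimately show "((\<lambda>s. pd p (\<lambda>y. F (s, y)) x) has_real_derivative pd p F' x) (at t)" by simp
qed

subsection \<open>First variation of the metric and of \<open>\<psi>\<close>\<close>

declare phi0_sort [simp del] psi0_sort [simp del] vol0_sort [simp del]

lemma phi0_rotate: "phi0 [m, a, b] = phi0 [a, b, m]"
  using alternating_3D(1)[OF phi0_alternating, of m a b] alternating_3D(2)[OF phi0_alternating, of a m b] by simp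

lemma phi0_phi0_one':
  "(\<Sum>m\<in>UNIV. phi0 [m, a, b] * phi0 [m, c, d]) =
     (if a = c \<and> b = d then 1 else 0) - (if a = d \<and> b = c then 1 else 0) - psi0 [a, b, c, d]"
  unfolding phi0_rotate[of _ a b] phi0_rotate[of _ c d] by (rule phi0_phi0_one)

lemma if_conj_mult: "(if Q \<and> R then 1 else 0) = (if Q then 1 else 0) * (if R then 1 else (0::real))"
  by simp

lemma pb2_diff: "pb2 L (\<lambda>P Q. R P Q - S P Q) I J = pb2 L R I J - pb2 L S I J"
  by (simp add: pb2_def pb_diff)

lemma sum_if_mult:
  "(\<Sum>m\<in>UNIV. f m * (x * (if l = m then 1 else 0))) = f (l::7) * (x::real)"
  "(\<Sum>m\<in>UNIV. f m * ((if l = m then 1 else 0) * x)) = f l * x"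
  "(\<Sum>m\<in>UNIV. f m * (x * (if m = l then 1 else 0))) = f l * x"
  using sum_if_eq(2)[of "\<lambda>m. f m * x" l] sum_if_eq(4)[of "\<lambda>m. f m * x" l] by (simp_all only: mult_ac)

context
  fixes L P G V
  assumes frame: "g2_frame L P G V"
begin

lemma frame_phi: "length I = 3 \<Longrightarrow> P I = pb L phi0 I"
  using frame unfolding g2_frame_def by blast

lemma frame_metric: "G [i, j] = (\<Sum>a\<in>UNIV. L $ a $ i * L $ a $ j)"
proof -
  have "G [i, j] = gmat G $ i $ j" by (simp add: gmat_def)
  then show ?thesis using frame by (simp add: g2_frame_def matrix_matrix_mult_def transpose_def)
qed

lemma frame_metric_pb: "G [i, j] = pb L eucl [i, j]"
  unfolding pb.simps eucl_simp sum_if_eq frame_metric ..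

lemma frame_metric_sym: "G [i, j] = G [j, i]"
  by (simp add: frame_metric mult.commute)

lemma frame_phi_phi_one:
  "ctr G (\<lambda>Q R. P Q * P R) [i, j] [k, l] = G [i, k] * G [j, l] - G [i, l] * G [j, k] - hodge 3 G V P [i, j, k, l]"
proof -
  obtain M where "L ** M = mat 1" using frame by (auto simp: g2_frame_def invertible_def)
  then interpret congruence L M eucl G by (rule g2_frame_congruence[OF frame])
  let ?X = "\<lambda>P Q. eucl [P ! 0, Q ! 0] * eucl [P ! 1, Q ! 1] :: real"
  let ?Y = "\<lambda>P Q. eucl [P ! 0, Q ! 1] * eucl [P ! 1, Q ! 0] :: real"
  have c: "ctr eucl (\<lambda>Q R. phi0 Q * phi0 R) [a, b] [c, d] = ?X [a, b] [c, d] - ?Y [a, b] [c, d] - psi0 ([a, b] @ [c, d])" for a b c d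
    unfolding ctr_eucl phi0_phi0_one' if_conj_mult
    by (simp only: nth_Cons_0 nth_Cons_Suc One_nat_def append.simps eucl_simp)
  have "ctr G (\<lambda>Q R. P Q * P R) [i, j] [k, l] = pb2 L (ctr eucl (\<lambda>Q R. phi0 Q * phi0 R)) [i, j] [k, l]"
    by (rule ctr_pb') (simp add: pb2_mult frame_phi)
  also have "\<dots> = pb2 L (\<lambda>P Q. ?X P Q - ?Y P Q - psi0 (P @ Q)) [i, j] [k, l]"
    unfolding pb2_def pb.simps c ..
  also have "\<dots> = pb2 L ?X [i, j] [k, l] - pb2 L ?Y [i, j] [k, l] - pb2 L (\<lambda>P Q. psi0 (P @ Q)) [i, j] [k, l]"
    by (simp only: pb2_diff)
  also have "pb2 L ?X [i, j] [k, l] = G [i, k] * G [j, l]"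
    unfolding pb2_def pb.simps nth_Cons_0 nth_Cons_Suc One_nat_def eucl_simp sum_if_mult frame_metric sum_product
    by (simp only: sum_distrib_left mult_ac)
  also have "pb2 L ?Y [i, j] [k, l] = G [i, l] * G [j, k]"
    unfolding pb2_def pb.simps nth_Cons_0 nth_Cons_Suc One_nat_def eucl_simp sum_if_mult frame_metric sum_product
    by (simp only: sum_distrib_left mult_ac)
  also have "pb2 L (\<lambda>P Q. psi0 (P @ Q)) [i, j] [k, l] = hodge 3 G V P [i, j, k, l]"
    by (simp add: g2_frame_psi[OF frame] pb2_def)
  finally show ?thesis .
qed

lemma frame_phi_phi_two: "ctr G (ctr G (\<lambda>Q R. P Q * P R)) [i] [k] = 6 * G [i, k]"
proof -
  obtain M where "L ** M = mat 1" using frame by (auto simp: g2_frame_def invertible_def)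
  then interpret congruence L M eucl G by (rule g2_frame_congruence[OF frame])
  have c: "ctr eucl (ctr eucl (\<lambda>Q R. phi0 Q * phi0 R)) [a] [c] = 6 * eucl [a, c]" for a c
  proof -
    have "phi0 [m, l, a] * phi0 [m, l, c] = phi0 [a, l, m] * phi0 [c, l, m]" for l m
      using alternating_3D(2)[OF phi0_alternating, of a l m] alternating_3D(2)[OF phi0_alternating, of c l m]
        phi0_rotate[of a m l] phi0_rotate[of c m l] by simp
    then show ?thesis using phi0_phi0_two[of a c] by simp
  qed
  have "ctr G (ctr G (\<lambda>Q R. P Q * P R)) [i] [k] = pb2 L (ctr eucl (ctr eucl (\<lambda>Q R. phi0 Q * phi0 R))) [i] [k]"
    by (intro ctr_pb') (simp add: pb2_mult frame_phi)
  also have "\<dots> = pb2 L (\<lambda>P Q. 6 * eucl [P ! 0, Q ! 0]) [i] [k]"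
    unfolding pb2_def pb.simps c by simp
  also have "\<dots> = 6 * G [i, k]"
    unfolding pb2_def pb.simps nth_Cons_0 nth_Cons_Suc One_nat_def eucl_simp sum_if_mult frame_metric
    by (simp only: sum_distrib_left mult_ac)
  finally show ?thesis .
qed

lemma frame_ginv: "(\<Sum>k\<in>UNIV. ginv G i k * G [k, j]) = (if i = j then 1 else 0)"
proof -
  have "invertible (gmat G)"
    using frame by (simp add: g2_frame_def invertible_det_nz det_mul)
  then have "(matrix_inv (gmat G) ** gmat G) $ i $ j = (mat 1 :: real^7^7) $ i $ j" by (simp add: matrix_inv)
  then show ?thesis by (simp add: matrix_matrix_mult_def ginv_def gmat_def mat_def)
qed

end

lemma act_scale_right: "act A (\<lambda>P. T P * c) J = act A T J * c"
  using act_scale[of A c T J] by (simp add: mult.commute)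

lemma ctr_delta:
  assumes "\<And>l m. ginv g l m = (if l = m then 1 else 0)"
  shows "ctr g R I J = (\<Sum>l\<in>UNIV. R (l # I) (l # J))"
  unfolding ctr_def assms by (simp only: sum_if_eq)

text \<open>Contraction along a curve of metrics, where \<open>E\<close> measures the failure of \<open>g' = A \<cdot> g\<close>.\<close>

lemma ctr_deriv:
  assumes inv0: "\<And>l m. ginv (G t) l m = (if l = m then 1 else 0)"
    and inv: "\<And>l m. ((\<lambda>r. ginv (G r) l m) has_real_derivative - (A l m + A m l) - E l m) (at t)"
    and R: "\<And>P Q. length P = Suc (length I) \<Longrightarrow> length Q = Suc (length J) \<Longrightarrow>
      ((\<lambda>r. R r P Q) has_real_derivative act A (\<lambda>P. R t P Q) P + act A (R t P) Q + U P Q) (at t)"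
  shows "((\<lambda>r. ctr (G r) (R r) I J) has_real_derivative
      act A (\<lambda>P. ctr (G t) (R t) P J) I + act A (ctr (G t) (R t) I) J
      + ((\<Sum>l\<in>UNIV. U (l # I) (l # J)) - (\<Sum>l\<in>UNIV. \<Sum>m\<in>UNIV. E l m * R t (l # I) (m # J)))) (at t)"
proof -
  define R' where "R' P Q = act A (\<lambda>P. R t P Q) P + act A (R t P) Q + U P Q" for P Q
  have d1: "((\<lambda>r. ctr (G r) (R r) I J) has_real_derivative
      (\<Sum>l\<in>UNIV. \<Sum>m\<in>UNIV. (- (A l m + A m l) - E l m) * R t (l # I) (m # J)
        + R' (l # I) (m # J) * ginv (G t) l m)) (at t)"
    unfolding ctr_def R'_def by (intro DERIV_sum DERIV_mult inv R) simp_all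
  have d2: "(\<Sum>l\<in>UNIV. \<Sum>m\<in>UNIV. (- (A l m + A m l) - E l m) * R t (l # I) (m # J)
        + R' (l # I) (m # J) * ginv (G t) l m)
     = (\<Sum>l\<in>UNIV. R' (l # I) (l # J)) - (\<Sum>l\<in>UNIV. \<Sum>m\<in>UNIV. A l m * R t (l # I) (m # J))
       - (\<Sum>l\<in>UNIV. \<Sum>m\<in>UNIV. A m l * R t (l # I) (m # J)) - (\<Sum>l\<in>UNIV. \<Sum>m\<in>UNIV. E l m * R t (l # I) (m # J))"
    unfolding inv0 sum.distrib sum_if_eq by (simp add: sum.distrib sum_subtractf sum_negf algebra_simps)
  have d3: "(\<Sum>l\<in>UNIV. R' (l # I) (l # J)) =
      (\<Sum>l\<in>UNIV. \<Sum>m\<in>UNIV. A l m * R t (m # I) (l # J)) + act A (\<lambda>P. ctr (G t) (R t) P J) I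
      + (\<Sum>l\<in>UNIV. \<Sum>m\<in>UNIV. A l m * R t (l # I) (m # J)) + act A (ctr (G t) (R t) I) J
      + (\<Sum>l\<in>UNIV. U (l # I) (l # J))"
  proof -
    have e: "ctr (G t) (R t) I = (\<lambda>J. \<Sum>l\<in>UNIV. R t (l # I) (l # J))"
      by (rule ext) (rule ctr_delta[OF inv0])
    show ?thesis
      unfolding e by (simp add: R'_def ctr_delta[OF inv0] sum.distrib act_sum)
  qed
  have d4: "(\<Sum>l\<in>UNIV. \<Sum>m\<in>UNIV. A l m * R t (m # I) (l # J)) = (\<Sum>l\<in>UNIV. \<Sum>m\<in>UNIV. A m l * R t (l # I) (m # J))"
    by (rule sum.swap)
  show ?thesis by (rule DERIV_cong[OF d1]) (use d2 d3 d4 in linarith)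
qed

lemma mult_deriv:
  assumes "((\<lambda>r. \<alpha> r P) has_real_derivative act A (\<alpha> t) P + u) (at t)"
    and "((\<lambda>r. \<beta> r Q) has_real_derivative act A (\<beta> t) Q + v) (at t)"
  shows "((\<lambda>r. \<alpha> r P * \<beta> r Q) has_real_derivative
    act A (\<lambda>P. \<alpha> t P * \<beta> t Q) P + act A (\<lambda>Q. \<alpha> t P * \<beta> t Q) Q + (u * \<beta> t Q + \<alpha> t P * v)) (at t)"
  using DERIV_mult[OF assms] by (simp add: act_scale act_scale_right algebra_simps)

text \<open>Differentiating the identity that contracts \<phi> with itself to 6 g gives a linear
  equation for the defect E of g' = act A g, namely 4 E = -2 (tr E) id. Its trace forces tr E = 0,
  hence E = 0. The variation of \<psi> then follows from the single contraction identity, in which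
  the volume form does not occur.\<close>

lemma variation_frame:
  fixes P G V :: "real \<Rightarrow> tensor"
  assumes fr: "\<forall>\<^sub>F r in nhds t. \<exists>L. g2_frame L (P r) (G r) (V r)"
    and P0: "\<And>I. length I = 3 \<Longrightarrow> P t I = phi0 I" and G0: "\<And>i j. G t [i, j] = (if i = j then 1 else 0)"
    and Pd: "\<And>I. length I = 3 \<Longrightarrow> ((\<lambda>r. P r I) has_real_derivative act A phi0 I) (at t)"
    and Gd: "\<And>i j. ((\<lambda>r. G r [i, j]) has_real_derivative G' i j) (at t)"
    and inv: "\<And>i j. ((\<lambda>r. ginv (G r) i j) has_real_derivative Gi i j) (at t)"
  shows "G' i j = A i j + A j i" and "Gi i j = - (A i j + A j i)"
    and "length J = 4 \<Longrightarrow> ((\<lambda>r. hodge 3 (G r) (V r) (P r) J) has_real_derivative act A psi0 J) (at t)"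
proof -
  have ev: "\<forall>\<^sub>F r in nhds t. Q r" if "\<And>r L. g2_frame L (P r) (G r) (V r) \<Longrightarrow> Q r" for Q
    using fr by (rule eventually_mono) (use that in blast)
  have uniq: "D = D'" if "\<forall>\<^sub>F r in nhds t. f r = h r" "(f has_real_derivative D) (at t)" "(h has_real_derivative D') (at t)"
    for f h :: "real \<Rightarrow> real" and D D'
    using that DERIV_cong_ev[of t t f h D D] DERIV_unique by blast
  obtain L where L: "g2_frame L (P t) (G t) (V t)" using fr eventually_nhds_x_imp_x by fastforce
  have inv0: "ginv (G t) l m = (if l = m then 1 else 0)" for l m
    using frame_ginv[OF L, of l m] by (simp add: G0 if_distrib cong: if_cong)
  have Gi: "Gi i j = - G' i j" for i j
  proof -
    have "0 = (\<Sum>k\<in>UNIV. Gi i k * G t [k, j] + G' k j * ginv (G t) i k)"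
      by (rule uniq[of "\<lambda>r. if i = j then 1 else 0" "\<lambda>r. \<Sum>k\<in>UNIV. ginv (G r) i k * G r [k, j]"])
        (auto intro!: ev DERIV_sum DERIV_mult inv Gd simp: frame_ginv)
    then show ?thesis
      unfolding G0 inv0 sum.distrib sum_if_eq by simp
  qed
  define E where "E i j = G' i j - A i j - A j i" for i j
  have inv': "((\<lambda>r. ginv (G r) l m) has_real_derivative - (A l m + A m l) - E l m) (at t)" for l m
    using inv[of l m] by (simp add: Gi E_def algebra_simps)
  have E_sym: "E i j = E j i" for i j
  proof -
    have "G' i j = G' j i" by (rule uniq[OF _ Gd Gd]) (rule ev, rule frame_metric_sym)
    then show ?thesis by (simp add: E_def)
  qed
  have actP: "act A (P t) I = act A phi0 I" if "length I = 3" for I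
    by (rule act_cong) (simp add: P0 that)
  have PP: "((\<lambda>r. P r Q * P r R) has_real_derivative
    act A (\<lambda>Q. P t Q * P t R) Q + act A (\<lambda>R. P t Q * P t R) R + 0) (at t)" if "length Q = 3" "length R = 3" for Q R
    using mult_deriv[of P Q A t 0 P R 0] Pd that by (simp add: actP)
  define R1 where "R1 r = ctr (G r) (\<lambda>Q R. P r Q * P r R)" for r
  define U1 where "U1 I J = - (\<Sum>l\<in>UNIV. \<Sum>m\<in>UNIV. E l m * (P t (l # I) * P t (m # J)))" for I J
  have R1: "((\<lambda>r. R1 r I J) has_real_derivative act A (\<lambda>P. R1 t P J) I + act A (R1 t I) J + U1 I J) (at t)"
    if "length I = 2" "length J = 2" for I J
  proof -
    have "length Q = 3 \<and> length R = 3" if "length Q = Suc (length I)" "length R = Suc (length J)" for Q R :: "7 list"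
      using that \<open>length I = 2\<close> \<open>length J = 2\<close> by simp
    then have "((\<lambda>r. P r Q * P r R) has_real_derivative
      act A (\<lambda>Q. P t Q * P t R) Q + act A (\<lambda>R. P t Q * P t R) R + (\<lambda>_ _. 0) Q R) (at t)"
      if "length Q = Suc (length I)" "length R = Suc (length J)" for Q R
      using PP that by blast
    from ctr_deriv[where R = "\<lambda>r Q R. P r Q * P r R" and U = "\<lambda>_ _. 0", OF inv0 inv' this]
    show ?thesis unfolding R1_def U1_def by (simp only: sum.neutral_const diff_0)
  qed
  have R1t: "R1 t [a, b] [c, d] = (if a = c \<and> b = d then 1 else 0) - (if a = d \<and> b = c then 1 else 0) - psi0 [a, b, c, d]" for a b c d
    unfolding R1_def ctr_delta[OF inv0] by (simp add: P0 phi0_phi0_one')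
  have "6 * G' i k = act A (\<lambda>P. ctr (G t) (R1 t) P [k]) [i] + act A (ctr (G t) (R1 t) [i]) [k]
      + ((\<Sum>l\<in>UNIV. U1 [l, i] [l, k]) - (\<Sum>l\<in>UNIV. \<Sum>m\<in>UNIV. E l m * R1 t [l, i] [m, k]))" for i k
  proof (rule uniq)
    show "\<forall>\<^sub>F r in nhds t. 6 * G r [i, k] = ctr (G r) (R1 r) [i] [k]"
      unfolding R1_def by (rule ev) (simp only: frame_phi_phi_two)
    show "((\<lambda>r. 6 * G r [i, k]) has_real_derivative 6 * G' i k) (at t)"
      by (rule DERIV_cmult[OF Gd])
    show "((\<lambda>r. ctr (G r) (R1 r) [i] [k]) has_real_derivative act A (\<lambda>P. ctr (G t) (R1 t) P [k]) [i] + act A (ctr (G t) (R1 t) [i]) [k]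
      + ((\<Sum>l\<in>UNIV. U1 [l, i] [l, k]) - (\<Sum>l\<in>UNIV. \<Sum>m\<in>UNIV. E l m * R1 t [l, i] [m, k]))) (at t)"
      by (rule ctr_deriv[OF inv0 inv' R1]) simp_all
  qed
  moreover have c6: "ctr (G t) (R1 t) [a] [b] = 6 * (if a = b then 1 else 0)" for a b
    unfolding R1_def frame_phi_phi_two[OF L] G0 ..
  moreover have "act A (\<lambda>P. ctr (G t) (R1 t) P [k]) [i] = 6 * A i k" "act A (ctr (G t) (R1 t) [i]) [k] = 6 * A k i" for i k
    unfolding act.simps c6 sum_if_mult by simp_all
  \<comment> \<open>E is symmetric while \<psi> is skew in the two slots contracted with it, so only
    the two delta terms survive.\<close>
  moreover have ER: "(\<Sum>l\<in>UNIV. \<Sum>m\<in>UNIV. E l m * R1 t [l, i] [m, k]) = (if i = k then (\<Sum>l\<in>UNIV. E l l) else 0) - E i k" for i k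
  proof -
    have "(\<Sum>l\<in>UNIV. \<Sum>m\<in>UNIV. E l m * psi0 [l, i, m, k]) = (\<Sum>l\<in>UNIV. \<Sum>m\<in>UNIV. - (E l m * psi0 [l, i, m, k]))"
    proof (subst sum.swap, intro sum.cong refl)
      fix l m
      have "psi0 [m, i, l, k] = - psi0 [l, i, m, k]"
        using alternating_4D(1)[OF psi0_alternating, of m i l k] alternating_4D(2)[OF psi0_alternating, of i m l k]
          alternating_4D(1)[OF psi0_alternating, of i l m k] by simp
      then show "E m l * psi0 [m, i, l, k] = - (E l m * psi0 [l, i, m, k])" by (simp add: E_sym[of m l])
    qed
    then have "(\<Sum>l\<in>UNIV. \<Sum>m\<in>UNIV. E l m * psi0 [l, i, m, k]) = 0" by (simp add: sum_negf)
    moreover have "(\<Sum>l\<in>UNIV. \<Sum>m\<in>UNIV. E l m * (if l = m \<and> i = k then 1 else 0)) = (if i = k then (\<Sum>l\<in>UNIV. E l l) else 0)"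
      by (cases "i = k") (simp_all only: simp_thms sum_if_eq if_True if_False mult_zero_right sum.neutral_const)
    moreover have "(\<Sum>l\<in>UNIV. \<Sum>m\<in>UNIV. E l m * (if l = k \<and> i = m then 1 else 0)) = E i k"
    proof -
      have "(\<Sum>l\<in>UNIV. \<Sum>m\<in>UNIV. E l m * (if l = k \<and> i = m then 1 else 0)) = (\<Sum>l\<in>UNIV. if l = k then E l i else 0)"
      proof (intro sum.cong refl)
        fix l
        show "(\<Sum>m\<in>UNIV. E l m * (if l = k \<and> i = m then 1 else 0)) = (if l = k then E l i else 0)"
          by (cases "l = k") (simp_all only: simp_thms sum_if_eq if_True if_False mult_zero_right sum.neutral_const)
      qed
      then show ?thesis by (simp add: E_sym[of k])
    qed
    ultimately show ?thesis
      unfolding R1t right_diff_distrib sum_subtractf by simp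
  qed
  moreover have "(\<Sum>l\<in>UNIV. U1 [l, i] [l, k]) = - (\<Sum>l\<in>UNIV. \<Sum>m\<in>UNIV. E l m * R1 t [l, i] [m, k])" for i k
  proof -
    \<comment> \<open>The defect enters through both contracted slots; exchanging the two slots of
      each \<phi> shows that the contributions are equal, whence the factor 2 below.\<close>
    have "(\<Sum>l\<in>UNIV. U1 [l, i] [l, k]) = - (\<Sum>l\<in>UNIV. \<Sum>a\<in>UNIV. \<Sum>b\<in>UNIV. E a b * (P t [a, l, i] * P t [b, l, k]))"
      by (simp add: U1_def sum_negf)
    also have "(\<Sum>l\<in>UNIV. \<Sum>a\<in>UNIV. \<Sum>b\<in>UNIV. E a b * (P t [a, l, i] * P t [b, l, k]))
       = (\<Sum>a\<in>UNIV. \<Sum>b\<in>UNIV. \<Sum>l\<in>UNIV. E a b * (P t [a, l, i] * P t [b, l, k]))"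
      by (rule sum_rotate3[symmetric])
    also have "\<dots> = (\<Sum>a\<in>UNIV. \<Sum>b\<in>UNIV. E a b * R1 t [a, i] [b, k])"
    proof (intro sum.cong refl)
      fix a b
      have "P t [a, l, i] * P t [b, l, k] = P t [l, a, i] * P t [l, b, k]" for l
        using alternating_3D(1)[OF phi0_alternating, of l a i] alternating_3D(1)[OF phi0_alternating, of l b k]
        by (simp add: P0)
      then show "(\<Sum>l\<in>UNIV. E a b * (P t [a, l, i] * P t [b, l, k])) = E a b * R1 t [a, i] [b, k]"
        unfolding R1_def ctr_delta[OF inv0] by (simp add: sum_distrib_left)
    qed
    finally show ?thesis .
  qed
  ultimately have "6 * G' i k = 6 * (A i k + A k i) - 2 * ((if i = k then (\<Sum>l\<in>UNIV. E l l) else 0) - E i k)" for i k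
    by simp
  then have E1: "4 * E i k = - 2 * (if i = k then (\<Sum>l\<in>UNIV. E l l) else 0)" for i k
    by (simp add: E_def algebra_simps)
  have "(\<Sum>i\<in>UNIV. 4 * E i i) = (\<Sum>i\<in>(UNIV::7 set). - 2 * (\<Sum>l\<in>UNIV. E l l))"
    by (rule sum.cong[OF refl]) (simp add: E1)
  \<comment> \<open>The identity has trace 7, so 4 tr E = -14 tr E.\<close>
  then have "4 * (\<Sum>i\<in>UNIV. E i i) = - 14 * (\<Sum>l\<in>UNIV. E l l)"
    by (simp add: sum_distrib_left[symmetric])
  then have "(\<Sum>i\<in>UNIV. E i i) = 0" by simp
  then have E0: "E i k = 0" for i k using E1[of i k] by (simp split: if_splits)
  show G': "G' i j = A i j + A j i" for i j using E0[of i j] by (simp add: E_def)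
  show "Gi i j = - (A i j + A j i)" by (simp add: Gi G')
  assume "length J = 4"
  then obtain a b c d where J: "J = [a, b, c, d]" by (auto simp: length_Suc_conv numeral_eq_Suc)
  have psi: "\<forall>\<^sub>F r in nhds t. hodge 3 (G r) (V r) (P r) J = G r [a, c] * G r [b, d] - G r [a, d] * G r [b, c] - R1 r [a, b] [c, d]"
    unfolding R1_def J
  proof (rule ev)
    fix r L assume "g2_frame L (P r) (G r) (V r)"
    from frame_phi_phi_one[OF this, of a b c d]
    show "hodge 3 (G r) (V r) (P r) [a, b, c, d] = G r [a, c] * G r [b, d] - G r [a, d] * G r [b, c]
        - ctr (G r) (\<lambda>Q R. P r Q * P r R) [a, b] [c, d]" by simp
  qed
  have "((\<lambda>r. G r [a, c] * G r [b, d] - G r [a, d] * G r [b, c] - R1 r [a, b] [c, d]) has_real_derivative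
     (G' a c * G t [b, d] + G' b d * G t [a, c]) - (G' a d * G t [b, c] + G' b c * G t [a, d])
     - (act A (\<lambda>P. R1 t P [c, d]) [a, b] + act A (R1 t [a, b]) [c, d] + U1 [a, b] [c, d])) (at t)"
    by (intro DERIV_diff DERIV_mult Gd R1) simp_all
  also have "(G' a c * G t [b, d] + G' b d * G t [a, c]) - (G' a d * G t [b, c] + G' b c * G t [a, d])
     - (act A (\<lambda>P. R1 t P [c, d]) [a, b] + act A (R1 t [a, b]) [c, d] + U1 [a, b] [c, d]) = act A psi0 J"
  proof -
    have delta: "(\<Sum>m\<in>UNIV. A x m * (if m = y \<and> Q then 1 else 0)) = (if Q then A x y else 0)"
      "(\<Sum>m\<in>UNIV. A x m * (if Q \<and> m = y then 1 else 0)) = (if Q then A x y else 0)"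
      "(\<Sum>m\<in>UNIV. A x m * (if y = m \<and> Q then 1 else 0)) = (if Q then A x y else 0)"
      "(\<Sum>m\<in>UNIV. A x m * (if Q \<and> y = m then 1 else 0)) = (if Q then A x y else 0)" for x y Q
      by (cases Q; simp only: simp_thms sum_if_eq if_True if_False mult_zero_right sum.neutral_const; simp)+
    have "U1 [a, b] [c, d] = 0" by (simp add: U1_def E0)
    then show ?thesis
      unfolding J G' G0 act.simps R1t right_diff_distrib sum_subtractf delta by (simp add: algebra_simps)
  qed
  finally show "((\<lambda>r. hodge 3 (G r) (V r) (P r) J) has_real_derivative act A psi0 J) (at t)"
    using DERIV_cong_ev[OF refl psi refl] by blast
qed

section \<open>Variation in arbitrary coordinates\<close>

lemma pb_deriv:
  assumes "\<And>I. length I = length J \<Longrightarrow> ((\<lambda>r. T r I) has_real_derivative D I) (at t)"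
  shows "((\<lambda>r. pb L (T r) J) has_real_derivative pb L D J) (at t)"
  using assms
proof (induction J arbitrary: T D)
  case (Cons x J)
  have "((\<lambda>r. pb L (\<lambda>P. T r (a # P)) J) has_real_derivative pb L (\<lambda>P. D (a # P)) J) (at t)" for a
    by (rule Cons.IH) (simp add: Cons.prems)
  then show ?case unfolding pb.simps by (intro DERIV_sum DERIV_cmult)
qed simp

lemma gmat_pb: "gmat (pb M G) = transpose M ** gmat G ** M"
  unfolding vec_eq_iff gmat_def matrix_matrix_mult_def transpose_def
  by (simp add: sum_distrib_left sum_distrib_right mult_ac) (intro allI, subst sum.swap, simp add: mult_ac)

lemma g2_frame_pb:
  assumes f: "g2_frame L P G V" and M: "invertible M"
  shows "g2_frame (L ** M) (pb M P) (pb M G) (pb M V)"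
  unfolding g2_frame_def
proof (intro conjI allI impI)
  show "invertible (L ** M)" using f M by (simp add: g2_frame_def invertible_mult)
  show "gmat (pb M G) = transpose (L ** M) ** (L ** M)"
    using f by (simp add: g2_frame_def gmat_pb matrix_transpose_mul matrix_mul_assoc)
  show "pb M P I = pb (L ** M) phi0 I" if "length I = 3" for I
  proof -
    have "pb M P I = pb M (pb L phi0) I" using f that by (intro pb_cong) (simp add: g2_frame_def)
    then show ?thesis by (simp only: pb_pb)
  qed
  show "pb M V I = pb (L ** M) vol0 I" if "length I = 7" for I
  proof -
    have "pb M V I = pb M (pb L vol0) I" using f that by (intro pb_cong) (simp add: g2_frame_def)
    then show ?thesis by (simp only: pb_pb)
  qed
qed

lemma conj_by_conj_by:
  assumes "L ** M = mat 1"
  shows "conj_by L M (conj_by M L A) = A"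
proof (intro ext)
  fix b c
  define B where "B = (\<chi> i m. A i m)"
  have c: "conj_by M L A i m = (transpose M ** B ** transpose L) $ i $ m"
    if "B = (\<chi> i m. A i m)" for M L :: "real^7^7" and A :: "7 \<Rightarrow> 7 \<Rightarrow> real" and i m B
    unfolding that conj_by_def matrix_matrix_mult_def transpose_def
    by (simp add: sum_distrib_right) (rule sum.swap)
  have "conj_by L M (conj_by M L A) b c = (transpose L ** (transpose M ** B ** transpose L) ** transpose M) $ b $ c"
    by (rule c) (simp add: vec_eq_iff c[OF B_def])
  also have "transpose L ** (transpose M ** B ** transpose L) ** transpose M
      = (transpose L ** transpose M) ** B ** (transpose L ** transpose M)"
    by (simp only: matrix_mul_assoc)
  also have "transpose L ** transpose M = mat 1"
    using assms by (metis matrix_left_right_inverse matrix_transpose_mul transpose_mat)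
  finally show "conj_by L M (conj_by M L A) b c = A b c" by (simp add: B_def)
qed

lemma frame_invertible:
  assumes "g2_frame L P G V"
  shows "invertible (gmat G)"
  using assms by (simp add: g2_frame_def invertible_det_nz det_mul)

lemma frame_ginv_right:
  assumes f: "g2_frame L P G V"
  shows "(\<Sum>k\<in>UNIV. G [i, k] * ginv G k j) = (if i = j then 1 else 0)"
proof -
  have "(gmat G ** matrix_inv (gmat G)) $ i $ j = (mat 1 :: real^7^7) $ i $ j"
    using frame_invertible[OF f] by (simp add: matrix_inv)
  then show ?thesis by (simp add: matrix_matrix_mult_def ginv_def gmat_def mat_def)
qed

text \<open>Differentiating the product of inverse metric and metric gives the derivative after
  multiplication by g; the inverse metric on the right removes this factor.\<close>

lemma ginv_deriv:
  assumes fr: "\<forall>\<^sub>F r in nhds t. \<exists>L. g2_frame L (P r) (G r) (V r)"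
    and Gact: "\<And>i j. ((\<lambda>r. G r [i, j]) has_real_derivative act A (G t) [i, j]) (at t)"
    and inv: "\<And>i j. ((\<lambda>r. ginv (G r) i j) has_real_derivative Gi i j) (at t)"
  shows "((\<lambda>r. ginv (G r) i j) has_real_derivative - (\<Sum>k\<in>UNIV. A k i * ginv (G t) k j + A k j * ginv (G t) i k)) (at t)"
proof -
  obtain L where L: "g2_frame L (P t) (G t) (V t)" using fr eventually_nhds_x_imp_x by fastforce
  have e: "(\<Sum>k\<in>UNIV. Gi i k * G t [k, l] + act A (G t) [k, l] * ginv (G t) i k) = 0" for l
  proof -
    have ev: "\<forall>\<^sub>F r in nhds t. (\<Sum>k\<in>UNIV. ginv (G r) i k * G r [k, l]) = (if i = l then 1 else 0)"
      using fr by (rule eventually_mono) (use frame_ginv in blast)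
    have "((\<lambda>r. \<Sum>k\<in>UNIV. ginv (G r) i k * G r [k, l]) has_real_derivative
        (\<Sum>k\<in>UNIV. Gi i k * G t [k, l] + act A (G t) [k, l] * ginv (G t) i k)) (at t)"
      by (intro DERIV_sum DERIV_mult inv Gact)
    then have "((\<lambda>r. if i = l then 1 else 0) has_real_derivative
        (\<Sum>k\<in>UNIV. Gi i k * G t [k, l] + act A (G t) [k, l] * ginv (G t) i k)) (at t)"
      using DERIV_cong_ev[OF refl ev refl] by blast
    then show ?thesis by (rule DERIV_unique) simp
  qed
  have e': "(\<Sum>k\<in>UNIV. Gi i k * G t [k, l]) = - (\<Sum>k\<in>UNIV. act A (G t) [k, l] * ginv (G t) i k)" for l
    using e[of l] by (simp only: sum.distrib eq_neg_iff_add_eq_0)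
  have "Gi i j = (\<Sum>k\<in>UNIV. Gi i k * (\<Sum>l\<in>UNIV. G t [k, l] * ginv (G t) l j))"
    unfolding frame_ginv_right[OF L] sum_if_eq ..
  also have "\<dots> = (\<Sum>l\<in>UNIV. (\<Sum>k\<in>UNIV. Gi i k * G t [k, l]) * ginv (G t) l j)"
    unfolding sum_distrib_left sum_distrib_right by (subst sum.swap) (simp add: mult_ac)
  also have "\<dots> = (\<Sum>l\<in>UNIV. - (\<Sum>k\<in>UNIV. act A (G t) [k, l] * ginv (G t) i k) * ginv (G t) l j)"
    unfolding e' ..
  also have "\<dots> = - (\<Sum>l\<in>UNIV. (\<Sum>k\<in>UNIV. (\<Sum>m\<in>UNIV. A k m * G t [m, l]) * ginv (G t) i k) * ginv (G t) l j)
      - (\<Sum>l\<in>UNIV. (\<Sum>k\<in>UNIV. (\<Sum>m\<in>UNIV. A l m * G t [k, m]) * ginv (G t) i k) * ginv (G t) l j)"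
    by (simp add: sum_negf sum.distrib distrib_right left_diff_distrib sum_subtractf)
  also have "(\<Sum>l\<in>UNIV. (\<Sum>k\<in>UNIV. (\<Sum>m\<in>UNIV. A k m * G t [m, l]) * ginv (G t) i k) * ginv (G t) l j)
      = (\<Sum>k\<in>UNIV. \<Sum>m\<in>UNIV. A k m * ginv (G t) i k * (\<Sum>l\<in>UNIV. G t [m, l] * ginv (G t) l j))"
    unfolding sum_distrib_left sum_distrib_right
    by (subst sum_rotate3[symmetric]) (simp only: mult_ac)
  also have "\<dots> = (\<Sum>k\<in>UNIV. A k j * ginv (G t) i k)"
    unfolding frame_ginv_right[OF L] sum_if_eq ..
  also have "(\<Sum>l\<in>UNIV. (\<Sum>k\<in>UNIV. (\<Sum>m\<in>UNIV. A l m * G t [k, m]) * ginv (G t) i k) * ginv (G t) l j)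
      = (\<Sum>l\<in>UNIV. \<Sum>m\<in>UNIV. A l m * ginv (G t) l j * (\<Sum>k\<in>UNIV. ginv (G t) i k * G t [k, m]))"
    unfolding sum_distrib_left sum_distrib_right
    by (rule sum.cong[OF refl], subst sum.swap) (simp only: mult_ac)
  also have "\<dots> = (\<Sum>l\<in>UNIV. A l i * ginv (G t) l j)"
    unfolding frame_ginv[OF L] sum_if_eq ..
  finally have "Gi i j = - (\<Sum>k\<in>UNIV. A k i * ginv (G t) k j + A k j * ginv (G t) i k)"
    by (simp add: sum.distrib)
  then show ?thesis using inv[of i j] by simp
qed

text \<open>Coordinates are changed by the constant matrix that standardises the structure at the
  one time t. At neighbouring times only the existence of some frame is used, so no differentiable
  choice of frames is involved.\<close>

lemma variation:
  fixes P G V :: "real \<Rightarrow> tensor"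
  assumes fr: "\<forall>\<^sub>F r in nhds t. \<exists>L. g2_frame L (P r) (G r) (V r)"
    and Pd: "\<And>I. length I = 3 \<Longrightarrow> ((\<lambda>r. P r I) has_real_derivative act A (P t) I) (at t)"
    and Gd: "\<And>i j. ((\<lambda>r. G r [i, j]) has_real_derivative G' i j) (at t)"
    and inv: "\<And>i j. ((\<lambda>r. ginv (G r) i j) has_real_derivative Gi i j) (at t)"
  shows "((\<lambda>r. G r [i, j]) has_real_derivative act A (G t) [i, j]) (at t)"
    and "length J = 4 \<Longrightarrow> ((\<lambda>r. hodge 3 (G r) (V r) (P r) J) has_real_derivative
           act A (hodge 3 (G t) (V t) (P t)) J) (at t)"
    and "((\<lambda>r. ginv (G r) i j) has_real_derivative - (\<Sum>k\<in>UNIV. A k i * ginv (G t) k j + A k j * ginv (G t) i k)) (at t)"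
proof -
  obtain L where L: "g2_frame L (P t) (G t) (V t)" using fr eventually_nhds_x_imp_x by fastforce
  then obtain M where L_M: "L ** M = mat 1" by (auto simp: g2_frame_def invertible_def)
  then have M_L: "M ** L = mat 1" by (simp add: matrix_left_right_inverse)
  then have M: "invertible M" using L_M unfolding invertible_def by blast
  define B where "B = conj_by M L A"
  have fr': "\<forall>\<^sub>F r in nhds t. \<exists>L. g2_frame L (pb M (P r)) (pb M (G r)) (pb M (V r))"
    using fr by (rule eventually_mono) (use g2_frame_pb M in blast)
  have P0: "pb M (P t) I = phi0 I" if "length I = 3" for I
  proof -
    have "pb M (P t) I = pb M (pb L phi0) I" using L that by (intro pb_cong) (simp add: g2_frame_def)
    then show ?thesis by (simp add: pb_inverse[OF L_M])
  qed
  have G0: "pb M (G t) [i, j] = (if i = j then 1 else 0)" for i j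
  proof -
    have "G t I = pb L eucl I" if "length I = length [i, j]" for I
      using that frame_metric_pb[OF L] by (auto simp: length_Suc_conv)
    then have "pb M (G t) [i, j] = pb M (pb L eucl) [i, j]" by (rule pb_cong)
    then show ?thesis unfolding pb_inverse[OF L_M] by simp
  qed
  have Pd': "((\<lambda>r. pb M (P r) I) has_real_derivative act B phi0 I) (at t)" if "length I = 3" for I
  proof -
    have "((\<lambda>r. pb M (P r) I) has_real_derivative pb M (act A (P t)) I) (at t)"
      by (rule pb_deriv) (simp add: Pd that)
    moreover have "pb M (act A (P t)) I = act B phi0 I"
      unfolding pb_act[OF M_L] B_def by (rule act_cong) (simp add: P0 that)
    ultimately show ?thesis by simp
  qed
  have Gd': "((\<lambda>r. pb M (G r) [i, j]) has_real_derivative pb M (\<lambda>I. G' (I ! 0) (I ! 1)) [i, j]) (at t)" for i j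
  proof (rule pb_deriv)
    fix I :: "7 list" assume "length I = length [i, j]"
    then obtain a b where "I = [a, b]" by (auto simp: length_Suc_conv)
    then show "((\<lambda>r. G r I) has_real_derivative G' (I ! 0) (I ! 1)) (at t)" using Gd by simp
  qed
  have ginv_hat: "ginv (pb M (G r)) a b = (\<Sum>l\<in>UNIV. \<Sum>m\<in>UNIV. L $ a $ l * ginv (G r) l m * L $ b $ m)"
    if fr: "g2_frame L' (P r) (G r) (V r)" for r L' a b
  proof -
    have "matrix_inv (gmat (pb M (G r))) = L ** matrix_inv (gmat (G r)) ** transpose L"
      unfolding gmat_pb by (rule matrix_inv_congruence[OF frame_invertible[OF fr] M_L])
    then show ?thesis unfolding ginv_def
      by (simp add: matrix_matrix_mult_def transpose_def sum_distrib_right) (rule sum.swap)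
  qed
  have inv': "((\<lambda>r. ginv (pb M (G r)) a b) has_real_derivative
      (\<Sum>l\<in>UNIV. \<Sum>m\<in>UNIV. L $ a $ l * Gi l m * L $ b $ m)) (at t)" for a b
  proof -
    have ev: "\<forall>\<^sub>F r in nhds t. ginv (pb M (G r)) a b = (\<Sum>l\<in>UNIV. \<Sum>m\<in>UNIV. L $ a $ l * ginv (G r) l m * L $ b $ m)"
      using fr by (rule eventually_mono) (use ginv_hat in blast)
    have "((\<lambda>r. \<Sum>l\<in>UNIV. \<Sum>m\<in>UNIV. L $ a $ l * ginv (G r) l m * L $ b $ m) has_real_derivative
      (\<Sum>l\<in>UNIV. \<Sum>m\<in>UNIV. L $ a $ l * Gi l m * L $ b $ m)) (at t)"
      by (intro DERIV_sum DERIV_cmult DERIV_cmult_right inv)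
    then show ?thesis using DERIV_cong_ev[OF refl ev refl] by blast
  qed
  note v = variation_frame[where P = "\<lambda>r. pb M (P r)" and G = "\<lambda>r. pb M (G r)" and V = "\<lambda>r. pb M (V r)" and A = B and t = t]
  have v1: "pb M (\<lambda>I. G' (I ! 0) (I ! 1)) [a, b] = B a b + B b a" for a b
    by (rule v(1)[OF fr' P0 G0 Pd' Gd' inv'])
  have v3: "((\<lambda>r. hodge 3 (pb M (G r)) (pb M (V r)) (pb M (P r)) I) has_real_derivative act B psi0 I) (at t)"
    if "length I = 4" for I
    by (rule v(3)[OF fr' P0 G0 Pd' Gd' inv' that])
  have transport: "((\<lambda>r. f r J) has_real_derivative act A T J) (at t)"
    if d: "\<And>I. length I = length J \<Longrightarrow> ((\<lambda>r. pb M (f r) I) has_real_derivative act B S I) (at t)"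
      and T: "\<And>I. length I = length J \<Longrightarrow> T I = pb L S I" for f :: "real \<Rightarrow> tensor" and T S J
  proof -
    have "((\<lambda>r. pb L (pb M (f r)) J) has_real_derivative pb L (act B S) J) (at t)"
      by (rule pb_deriv) (rule d)
    moreover have "pb L (act B S) J = act A T J"
      unfolding pb_act[OF L_M] B_def conj_by_conj_by[OF L_M] by (rule act_cong) (simp add: T)
    ultimately show ?thesis by (simp add: pb_inverse[OF M_L])
  qed
  show Gact: "((\<lambda>r. G r [i, j]) has_real_derivative act A (G t) [i, j]) (at t)" for i j
  proof (rule transport[where S = eucl])
    fix I :: "7 list" assume "length I = length [i, j]"
    then obtain a b where I: "I = [a, b]" by (auto simp: length_Suc_conv)
    show "G t I = pb L eucl I" unfolding I by (rule frame_metric_pb[OF L])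
    have "act B eucl [a, b] = B a b + B b a"
      unfolding act.simps eucl_simp sum_if_eq by simp
    then have "pb M (\<lambda>I. G' (I ! 0) (I ! 1)) [a, b] = act B eucl [a, b]"
      using v1[of a b] by simp
    then show "((\<lambda>r. pb M (G r) I) has_real_derivative act B eucl I) (at t)"
      using Gd'[of a b] unfolding I by (simp only:)
  qed
  show "((\<lambda>r. hodge 3 (G r) (V r) (P r) J) has_real_derivative act A (hodge 3 (G t) (V t) (P t)) J) (at t)"
    if J: "length J = 4"
  proof (rule transport[where S = psi0])
    fix I :: "7 list" assume "length I = length J"
    then have I: "length I = 4" using J by simp
    show "hodge 3 (G t) (V t) (P t) I = pb L psi0 I" by (rule g2_frame_psi[OF L I])
    have h: "hodge 3 (pb M (G r)) (pb M (V r)) (pb M (P r)) I = pb M (hodge 3 (G r) (V r) (P r)) I"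
      if "g2_frame L' (P r) (G r) (V r)" for r L'
      by (rule hodge_pb[OF gmat_pb frame_invertible[OF that] M_L]) (simp_all add: I)
    have ev: "\<forall>\<^sub>F r in nhds t. hodge 3 (pb M (G r)) (pb M (V r)) (pb M (P r)) I = pb M (hodge 3 (G r) (V r) (P r)) I"
      using fr by (rule eventually_mono) (use h in blast)
    show "((\<lambda>r. pb M (hodge 3 (G r) (V r) (P r)) I) has_real_derivative act B psi0 I) (at t)"
      using v3[OF I] DERIV_cong_ev[OF refl ev refl] by blast
  qed
  show "((\<lambda>r. ginv (G r) i j) has_real_derivative - (\<Sum>k\<in>UNIV. A k i * ginv (G t) k j + A k j * ginv (G t) i k)) (at t)"
    by (rule ginv_deriv[OF fr Gact inv])
qed

text \<open>Infinitesimally, the GL(7)-orbit of \<open>phi0\<close> is open in the 3-forms. The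
  witness is an explicit right inverse: v is the contraction of w with \<open>phi0\<close> in two
  slots, and A rescales its trace, traceless symmetric and skew parts by -1/9, -1/2 and
  -1/6.\<close>

lemma alternating_3_act:
  assumes w: "alternating 3 w"
  shows "\<exists>A. \<forall>I. length I = 3 \<longrightarrow> w I = act A phi0 I"
proof -
  define v where "v i = vec_of (\<lambda>j k. w [i, j, k])" for i
  define A where "A i j = - v i j / 3 - v j i / 6 + (if i = j then (v 1 1 + v 2 2 + v 3 3 + v 4 4 + v 5 5 + v 6 6 + v 0 0) / 18 else 0)" for i j
  have sort: "ix j < ix i \<Longrightarrow> w [i, j, k] = - w [j, i, k]" "ix k < ix j \<Longrightarrow> w [i, j, k] = - w [i, k, j]"
    "w [i, i, k] = 0" "w [i, k, k] = 0" for i j k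
    by (rule alternating_3D[OF w])+
  have vv: "v i 1 = - w [i, 2, 3] - w [i, 4, 5] - w [i, 6, 0]" "v i 2 = w [i, 1, 3] - w [i, 4, 6] + w [i, 5, 0]"
    "v i 3 = - w [i, 1, 2] + w [i, 4, 0] + w [i, 5, 6]" "v i 4 = w [i, 1, 5] + w [i, 2, 6] - w [i, 3, 0]"
    "v i 5 = - w [i, 1, 4] - w [i, 2, 0] - w [i, 3, 6]" "v i 6 = w [i, 1, 0] - w [i, 2, 4] + w [i, 3, 5]"
    "v i 0 = - w [i, 1, 6] + w [i, 2, 5] + w [i, 3, 4]" for i
    unfolding v_def by (rule vec_of_values, rule alternating_3D(2)[OF w])+
  have *: "\<forall>a b c. ix a < ix b \<longrightarrow> ix b < ix c \<longrightarrow> w [a, b, c] = act A phi0 [a, b, c]"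
    unfolding forall_7 ix_simps
    by (intro conjI impI; (linarith | simp only: act_phi0_values A_def; simp add: vv sort field_simps))
  have "w I = act A phi0 I" if I: "length I = 3" for I
  proof (rule alternating_eqI[OF w act_phi0_alternating _ I])
    fix J :: "7 list" assume "length J = 3" "sorted_wrt (\<lambda>a b. ix a < ix b) J"
    then obtain a b c where "J = [a, b, c]" "ix a < ix b" "ix b < ix c"
      by (auto simp: length_Suc_conv numeral_3_eq_3)
    then show "w J = act A phi0 J" using * by blast
  qed
  then show ?thesis by blast
qed

section \<open>Extracting the torsion forms from the exterior derivative of \<psi>\<close>

lemma sum_swap_4: "(\<Sum>i\<in>A. \<Sum>j\<in>B. \<Sum>l\<in>C. \<Sum>m\<in>D. f i j l m) = (\<Sum>j\<in>B. \<Sum>m\<in>D. \<Sum>i\<in>A. \<Sum>l\<in>C. f i j l m)"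
proof -
  have "(\<Sum>i\<in>A. \<Sum>j\<in>B. \<Sum>l\<in>C. \<Sum>m\<in>D. f i j l m) = (\<Sum>j\<in>B. \<Sum>i\<in>A. \<Sum>l\<in>C. \<Sum>m\<in>D. f i j l m)"
    by (rule sum.swap)
  also have "\<dots> = (\<Sum>j\<in>B. \<Sum>m\<in>D. \<Sum>i\<in>A. \<Sum>l\<in>C. f i j l m)"
    by (rule sum.cong[OF refl], rule sum_rotate3)
  finally show ?thesis .
qed

lemma contract_two: "(\<Sum>i\<in>UNIV. \<Sum>j\<in>UNIV. \<Sum>l\<in>UNIV. \<Sum>m\<in>UNIV. \<beta> (i # j # I) * ginv g i l * ginv g j m * \<phi> (l # m # K))
    = ctr g (ctr g (\<lambda>U W. \<beta> U * \<phi> W)) I K"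
  unfolding ctr_def sum_distrib_left by (subst sum_swap_4) (simp only: mult_ac)

lemma (in congruence) contract_two_pb:
  assumes "\<And>U. length U = 2 + length I \<Longrightarrow> \<beta>' U = pb L \<beta> U" "\<And>W. length W = 2 + length K \<Longrightarrow> \<phi>' W = pb L \<phi> W"
  shows "ctr g' (ctr g' (\<lambda>U W. \<beta>' U * \<phi>' W)) I K = pb2 L (ctr g (ctr g (\<lambda>U W. \<beta> U * \<phi> W))) I K"
  by (intro ctr_pb') (simp add: pb2_mult assms)

lemma covector_skew_eucl: "covector_skew eucl phi0 \<alpha> [i, j] = vphi (\<lambda>k. \<alpha> [k]) i j"
  by (simp add: covector_skew_ctr vphi_def)

lemma pi_eucl: "pi7 eucl psi0 \<beta> [i, j] = p7 (\<lambda>a b. \<beta> [a, b]) i j" "pi14 eucl psi0 \<beta> [i, j] = p14 (\<lambda>a b. \<beta> [a, b]) i j"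
  by (simp_all add: pi7_def pi14_def p7_def p14_def contract_psi_eucl cpsi_def)

lemma comm_eucl: "comm eucl A B [i, j] = cm (\<lambda>a b. A [a, b]) (\<lambda>a b. B [a, b]) i j"
    "acomm eucl A B [i, j] = ac (\<lambda>a b. A [a, b]) (\<lambda>a b. B [a, b]) i j"
  by (simp_all add: comm_ctr acomm_ctr cm_def ac_def mm_def)

lemma wedge1_pb:
  assumes "\<And>p. \<tau> [p] = pb L \<tau>' [p]" "\<And>J. Suc (length J) = length I \<Longrightarrow> S J = pb L S' J"
  shows "wedge 1 \<tau> S I = pb L (alt1 (\<lambda>p J. \<tau>' [p] * S' J)) I"
proof -
  have "wedge 1 \<tau> S I = shuffle 1 (pb L \<tau>') (pb L S') I"
    unfolding wedge_eq_shuffle using assms by (intro shuffle_cong) (auto simp: length_Suc_conv)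
  also have "\<dots> = pb L (shuffle 1 \<tau>' S') I" by (rule shuffle_pb)
  also have "\<dots> = pb L (alt1 (\<lambda>p J. \<tau>' [p] * S' J)) I"
    by (rule pb_cong) (rule wedge1_eq_alt1[unfolded wedge_eq_shuffle])
  finally show ?thesis .
qed

lemma p7_combination:
  assumes s: "\<And>i j. s i j = - s j i" and s0: "\<And>k. vec_of s k = 0"
  shows "p7 (\<lambda>a b. - 48 * vphi v a b + 6 * s a b) i j = - 48 * vphi v i j"
    "p14 (\<lambda>a b. - 48 * vphi v a b + 6 * s a b) i j = 6 * s i j"
  unfolding p7_def p14_def cpsi_linear cpsi_vphi cpsi_14[OF s s0] by (simp_all add: field_simps)

lemma vec_of_zero_if:
  assumes "\<And>k. (\<Sum>l\<in>UNIV. \<Sum>i\<in>UNIV. s i l * phi0 [i, l, k]) = 0"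
  shows "vec_of s n = 0"
proof -
  have "(\<Sum>a\<in>UNIV. \<Sum>b\<in>UNIV. phi0 [n, a, b] * s a b) = (\<Sum>b\<in>UNIV. \<Sum>a\<in>UNIV. s a b * phi0 [a, b, n])"
    by (subst sum.swap) (simp only: phi0_rotate[of n] mult.commute)
  then show ?thesis by (simp add: vec_of_def assms)
qed

context congruence
begin

lemma hat: "T J = pb L (pb M T) J"
  by (simp add: pb_inverse[OF M_L])

lemma pb_eq_zero: 
  assumes "\<And>I. length I = length J \<Longrightarrow> pb L T I = 0"
  shows "T J = 0"
proof -
  have "T J = pb M (pb L T) J" by (simp add: pb_inverse[OF L_M])
  also have "\<dots> = pb M (\<lambda>I. 0) J" by (rule pb_cong) (simp add: assms)
  finally show ?thesis by (simp add: pb_zero)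
qed

end

lemma frame_contract_zero:
  assumes frame: "g2_frame L P G V" and L_M: "L ** M = mat 1"
    and c: "\<And>k. ctr G (ctr G (\<lambda>U W. \<tau>2 U * P W)) [] [k] = 0"
  shows "vec_of (\<lambda>a b. pb M \<tau>2 [a, b]) k = 0"
proof (rule vec_of_zero_if)
  interpret congruence L M eucl G by (rule g2_frame_congruence[OF frame L_M])
  fix k
  have "ctr eucl (ctr eucl (\<lambda>U W. pb M \<tau>2 U * phi0 W)) [] [k] = 0"
  proof (rule pb_eq_zero)
    fix I :: "7 list" assume "length I = length [k]"
    then obtain b where I: "I = [b]" by (auto simp: length_Suc_conv)
    have "ctr G (ctr G (\<lambda>U W. \<tau>2 U * P W)) [] [b] = pb2 L (ctr eucl (ctr eucl (\<lambda>U W. pb M \<tau>2 U * phi0 W))) [] [b]"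
      by (rule contract_two_pb) (simp_all add: hat[symmetric] frame_phi[OF frame])
    then show "pb L (ctr eucl (ctr eucl (\<lambda>U W. pb M \<tau>2 U * phi0 W)) []) I = 0"
      using c[of b] by (simp add: I pb2_def)
  qed
  then show "(\<Sum>l\<in>UNIV. \<Sum>i\<in>UNIV. pb M \<tau>2 [i, l] * phi0 [i, l, k]) = 0" by simp
qed

lemma pb_skew:
  assumes "\<And>i j. T [i, j] = - T [j, i]"
  shows "pb M T [i, j] = - pb M T [j, i]"
proof -
  have "pb M T [i, j] = (\<Sum>a\<in>UNIV. \<Sum>b\<in>UNIV. M $ b $ i * (M $ a $ j * T [b, a]))"
    by (simp add: sum_distrib_left) (rule sum.swap)
  also have "\<dots> = - pb M T [j, i]"
    by (subst assms) (simp add: sum_distrib_left sum_negf mult_ac)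
  finally show ?thesis .
qed

lemma pb_symmetric:
  assumes "\<And>i j. T [i, j] = T [j, i]"
  shows "pb M T [i, j] = pb M T [j, i]"
proof -
  have "pb M T [i, j] = (\<Sum>a\<in>UNIV. \<Sum>b\<in>UNIV. M $ b $ i * (M $ a $ j * T [b, a]))"
    by (simp add: sum_distrib_left) (rule sum.swap)
  also have "\<dots> = pb M T [j, i]"
    by (subst assms) (simp add: sum_distrib_left mult_ac)
  finally show ?thesis .
qed

text \<open>In the frame, t \<and> \<psi> contracts to -12 times the skew tensor of t and enters
  with coefficient 4, giving -48. The Hodge star of the 14-part contracts to 3 \<open>cpsi\<close>,
  which is 3 times the eigenvalue 2, giving 6.\<close>

lemma torsion_extraction:
  assumes frame: "g2_frame L P G V" and sk: "\<And>i j. \<tau>2 [i, j] = - \<tau>2 [j, i]"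
    and c: "\<And>k. ctr G (ctr G (\<lambda>U W. \<tau>2 U * P W)) [] [k] = 0"
    and \<beta>: "\<And>I. length I = 5 \<Longrightarrow> \<beta> I = 4 * wedge 1 \<tau>1 (hodge 3 G V P) I + hodge 2 G V \<tau>2 I"
  shows "pi7 G (hodge 3 G V P) (phi_contract G P \<beta>) [i, j] = - 48 * covector_skew G P \<tau>1 [i, j]"
    and "pi14 G (hodge 3 G V P) (phi_contract G P \<beta>) [i, j] = 6 * \<tau>2 [i, j]"
    and "phi_contract G P \<beta> [i, j] = - 48 * covector_skew G P \<tau>1 [i, j] + 6 * \<tau>2 [i, j]"
proof -
  from frame obtain M where L_M: "L ** M = mat 1" by (auto simp: g2_frame_def invertible_def)
  interpret congruence L M eucl G by (rule g2_frame_congruence[OF frame L_M])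
  define s where "s a b = pb M \<tau>2 [a, b]" for a b
  define v where "v k = pb M \<tau>1 [k]" for k
  define \<beta>' where "\<beta>' I = 4 * alt1 (\<lambda>p J. v p * psi0 J) I + hodge 2 eucl vol0 (pb M \<tau>2) I" for I
  have \<beta>': "\<beta> I = pb L \<beta>' I" if I: "length I = 5" for I
  proof -
    have "wedge 1 \<tau>1 (hodge 3 G V P) I = pb L (alt1 (\<lambda>p J. v p * psi0 J)) I"
      unfolding v_def by (rule wedge1_pb) (simp_all add: hat[symmetric] g2_frame_psi[OF frame] I del: pb.simps)
    moreover have "hodge 2 G V \<tau>2 I = pb L (hodge 2 eucl vol0 (pb M \<tau>2)) I"
      using frame by (intro hodge_pb[OF g' G L_M]) (simp_all add: I g2_frame_def hat[symmetric])
    ultimately show ?thesis by (simp add: \<beta>[OF I] \<beta>'_def[abs_def] pb_add pb_scale)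
  qed
  have F: "phi_contract G P \<beta> [a, b] = pb L (phi_contract eucl phi0 \<beta>') [a, b]" for a b
    by (rule phi_contract_pb) (simp_all add: \<beta>' frame_phi[OF frame])
  have sk': "s a b = - s b a" for a b unfolding s_def by (rule pb_skew[of \<tau>2, OF sk])
  have s0: "vec_of s k = 0" for k unfolding s_def[abs_def] by (rule frame_contract_zero[OF frame L_M c])
  have F': "phi_contract eucl phi0 \<beta>' [a, b] = - 48 * vphi v a b + 6 * s a b" for a b
    unfolding \<beta>'_def[abs_def] phi_contract_linear phi_contract_wedge phi_contract_hodge
    unfolding s_def[symmetric] cpsi_14[OF sk' s0] by simp
  have psi: "hodge 3 G V P I = pb L psi0 I" if "length I = 4" for I by (rule g2_frame_psi[OF frame that])
  have "pi7 G (hodge 3 G V P) (phi_contract G P \<beta>) [i, j] = pb L (pi7 eucl psi0 (phi_contract eucl phi0 \<beta>')) [i, j]"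
    by (rule pi_pb[OF psi F])
  also have "\<dots> = pb L (\<lambda>I. - 48 * covector_skew eucl phi0 (pb M \<tau>1) I) [i, j]"
  proof (rule pb_cong)
    fix I :: "7 list" assume "length I = length [i, j]"
    then obtain a b where I: "I = [a, b]" by (auto simp: length_Suc_conv)
    show "pi7 eucl psi0 (phi_contract eucl phi0 \<beta>') I = - 48 * covector_skew eucl phi0 (pb M \<tau>1) I"
      unfolding I pi_eucl F' p7_combination[OF sk' s0] covector_skew_eucl v_def ..
  qed
  also have "\<dots> = - 48 * pb L (covector_skew eucl phi0 (pb M \<tau>1)) [i, j]" by (rule pb_scale)
  also have "pb L (covector_skew eucl phi0 (pb M \<tau>1)) [i, j] = covector_skew G P \<tau>1 [i, j]"
    by (rule covector_skew_pb[symmetric]) (simp_all add: frame_phi[OF frame] hat[symmetric] del: pb.simps)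
  finally show a: "pi7 G (hodge 3 G V P) (phi_contract G P \<beta>) [i, j] = - 48 * covector_skew G P \<tau>1 [i, j]" .
  have "pi14 G (hodge 3 G V P) (phi_contract G P \<beta>) [i, j] = pb L (pi14 eucl psi0 (phi_contract eucl phi0 \<beta>')) [i, j]"
    by (rule pi_pb[OF psi F])
  also have "\<dots> = pb L (\<lambda>I. 6 * pb M \<tau>2 I) [i, j]"
  proof (rule pb_cong)
    fix I :: "7 list" assume "length I = length [i, j]"
    then obtain a b where I: "I = [a, b]" by (auto simp: length_Suc_conv)
    show "pi14 eucl psi0 (phi_contract eucl phi0 \<beta>') I = 6 * pb M \<tau>2 I"
      unfolding I pi_eucl F' p7_combination[OF sk' s0] unfolding s_def ..
  qed
  also have "\<dots> = 6 * \<tau>2 [i, j]" by (simp only: pb_scale hat[symmetric])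
  finally show b: "pi14 G (hodge 3 G V P) (phi_contract G P \<beta>) [i, j] = 6 * \<tau>2 [i, j]" .
  show "phi_contract G P \<beta> [i, j] = - 48 * covector_skew G P \<tau>1 [i, j] + 6 * \<tau>2 [i, j]"
    using a b by (simp add: pi7_def pi14_def)
qed

subsection \<open>Contractions along a curve\<close>

text \<open>The derivative of the inverse metric cancels exactly what A contributes in the two
  contracted slots, so contraction intertwines the derivations, and an inhomogeneous term U is
  simply contracted.\<close>

lemma ctr_deriv_act:
  assumes inv: "\<And>l m. ((\<lambda>r. ginv (G r) l m) has_real_derivative - (\<Sum>k\<in>UNIV. A k l * ginv (G t) k m + A k m * ginv (G t) l k)) (at t)"
    and R: "\<And>P Q. length P = Suc (length I) \<Longrightarrow> length Q = Suc (length J) \<Longrightarrow>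
      ((\<lambda>r. R r P Q) has_real_derivative act A (\<lambda>P. R t P Q) P + act A (R t P) Q + U P Q) (at t)"
  shows "((\<lambda>r. ctr (G r) (R r) I J) has_real_derivative
      act A (\<lambda>P. ctr (G t) (R t) P J) I + act A (ctr (G t) (R t) I) J + ctr (G t) U I J) (at t)"
proof -
  define g where "g = ginv (G t)"
  define S where "S a b = R t (a # I) (b # J)" for a b
  define X where "X a b = act A (\<lambda>P. R t (a # P) (b # J)) I + act A (\<lambda>Q. R t (a # I) (b # Q)) J + U (a # I) (b # J)" for a b
  have d1: "((\<lambda>r. ctr (G r) (R r) I J) has_real_derivative
      (\<Sum>l\<in>UNIV. \<Sum>m\<in>UNIV. - (\<Sum>k\<in>UNIV. A k l * g k m + A k m * g l k) * S l m
        + ((\<Sum>k\<in>UNIV. A l k * S k m) + (\<Sum>k\<in>UNIV. A m k * S l k) + X l m) * g l m)) (at t)"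
    unfolding ctr_def
  proof (intro DERIV_sum)
    fix l m
    have "((\<lambda>r. R r (l # I) (m # J)) has_real_derivative (\<Sum>k\<in>UNIV. A l k * S k m) + (\<Sum>k\<in>UNIV. A m k * S l k) + X l m) (at t)"
      by (rule DERIV_cong[OF R]) (simp_all add: S_def X_def)
    from DERIV_mult[OF inv this]
    show "((\<lambda>r. ginv (G r) l m * R r (l # I) (m # J)) has_real_derivative
        - (\<Sum>k\<in>UNIV. A k l * g k m + A k m * g l k) * S l m
        + ((\<Sum>k\<in>UNIV. A l k * S k m) + (\<Sum>k\<in>UNIV. A m k * S l k) + X l m) * g l m) (at t)"
      unfolding g_def S_def .
  qed
  have a1: "(\<Sum>l\<in>UNIV. \<Sum>m\<in>UNIV. (\<Sum>k\<in>UNIV. A k l * g k m) * S l m) = (\<Sum>l\<in>UNIV. \<Sum>m\<in>UNIV. (\<Sum>k\<in>UNIV. A l k * S k m) * g l m)"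
  proof -
    have "(\<Sum>l\<in>UNIV. \<Sum>m\<in>UNIV. (\<Sum>k\<in>UNIV. A k l * g k m) * S l m) = (\<Sum>k\<in>UNIV. \<Sum>l\<in>UNIV. \<Sum>m\<in>UNIV. A k l * g k m * S l m)"
      unfolding sum_distrib_right by (rule sum_rotate3)
    also have "\<dots> = (\<Sum>k\<in>UNIV. \<Sum>m\<in>UNIV. (\<Sum>l\<in>UNIV. A k l * S l m) * g k m)"
      unfolding sum_distrib_right by (rule sum.cong[OF refl], subst sum.swap) (simp only: mult_ac)
    finally show ?thesis .
  qed
  have a2: "(\<Sum>l\<in>UNIV. \<Sum>m\<in>UNIV. (\<Sum>k\<in>UNIV. A k m * g l k) * S l m) = (\<Sum>l\<in>UNIV. \<Sum>m\<in>UNIV. (\<Sum>k\<in>UNIV. A m k * S l k) * g l m)"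
    unfolding sum_distrib_right by (rule sum.cong[OF refl], subst sum.swap) (simp only: mult_ac)
  have a3: "(\<Sum>l\<in>UNIV. \<Sum>m\<in>UNIV. X l m * g l m) =
      act A (\<lambda>P. ctr (G t) (R t) P J) I + act A (ctr (G t) (R t) I) J + ctr (G t) U I J"
  proof -
    have e: "ctr (G t) (R t) I = (\<lambda>J. \<Sum>l\<in>UNIV. \<Sum>m\<in>UNIV. g l m * R t (l # I) (m # J))"
      by (simp add: fun_eq_iff ctr_def g_def)
    have "X l m * g l m = g l m * act A (\<lambda>P. R t (l # P) (m # J)) I + g l m * act A (\<lambda>Q. R t (l # I) (m # Q)) J
        + g l m * U (l # I) (m # J)" for l m
      unfolding X_def by (simp add: distrib_left mult.commute)
    then show ?thesis unfolding e ctr_def g_def[symmetric] act_sum act_scale by (simp only: sum.distrib)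
  qed
  show ?thesis
    by (rule DERIV_cong[OF d1]) (use a1 a2 a3 in \<open>simp add: sum.distrib distrib_right sum_subtractf sum_negf left_diff_distrib\<close>)
qed

context
  fixes G :: "real \<Rightarrow> tensor" and A :: "7 \<Rightarrow> 7 \<Rightarrow> real" and t :: real
  assumes inv: "\<And>l m. ((\<lambda>r. ginv (G r) l m) has_real_derivative - (\<Sum>k\<in>UNIV. A k l * ginv (G t) k m + A k m * ginv (G t) l k)) (at t)"
begin

lemma phi_contract_deriv:
  assumes P: "\<And>I. length I = 3 \<Longrightarrow> ((\<lambda>r. P r I) has_real_derivative act A (P t) I) (at t)"
    and \<beta>: "\<And>I. length I = 3 + length J \<Longrightarrow> ((\<lambda>r. \<beta> r I) has_real_derivative act A (\<beta> t) I + \<Omega> I) (at t)"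
  shows "((\<lambda>r. phi_contract (G r) (P r) (\<beta> r) J) has_real_derivative
    act A (phi_contract (G t) (P t) (\<beta> t)) J + phi_contract (G t) (P t) \<Omega> J) (at t)"
proof -
  have 0: "((\<lambda>r. P r U * \<beta> r W) has_real_derivative
      act A (\<lambda>U. P t U * \<beta> t W) U + act A (\<lambda>W. P t U * \<beta> t W) W + P t U * \<Omega> W) (at t)"
    if "length U = 3" "length W = 3 + length J" for U W
    using mult_deriv[of P U A t 0 \<beta> W "\<Omega> W"] P[OF that(1)] \<beta>[OF that(2)] by simp
  have "((\<lambda>r. ctr (G r) (ctr (G r) (ctr (G r) (\<lambda>U W. P r U * \<beta> r W))) [] J) has_real_derivative
    act A (\<lambda>U. ctr (G t) (ctr (G t) (ctr (G t) (\<lambda>U W. P t U * \<beta> t W))) U J) []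
    + act A (ctr (G t) (ctr (G t) (ctr (G t) (\<lambda>U W. P t U * \<beta> t W))) []) J
    + ctr (G t) (ctr (G t) (ctr (G t) (\<lambda>U W. P t U * \<Omega> W))) [] J) (at t)"
    by (rule ctr_deriv_act[OF inv], rule ctr_deriv_act[OF inv], rule ctr_deriv_act[OF inv], rule 0) auto
  then show ?thesis by (simp add: phi_contract_def[abs_def])
qed

lemma contract_psi_deriv:
  assumes \<psi>: "\<And>I. length I = 4 \<Longrightarrow> ((\<lambda>r. \<psi> r I) has_real_derivative act A (\<psi> t) I) (at t)"
    and \<beta>: "\<And>I. length I = 2 \<Longrightarrow> ((\<lambda>r. \<beta> r I) has_real_derivative act A (\<beta> t) I + \<Omega> I) (at t)"
  shows "((\<lambda>r. contract_psi (G r) (\<psi> r) (\<beta> r) [a, b]) has_real_derivative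
    act A (contract_psi (G t) (\<psi> t) (\<beta> t)) [a, b] + contract_psi (G t) (\<psi> t) \<Omega> [a, b]) (at t)"
proof -
  have 0: "((\<lambda>r. \<beta> r U * \<psi> r W) has_real_derivative
      act A (\<lambda>U. \<beta> t U * \<psi> t W) U + act A (\<lambda>W. \<beta> t U * \<psi> t W) W + \<Omega> U * \<psi> t W) (at t)"
    if "length U = 2" "length W = 4" for U W
    using mult_deriv[of \<beta> U A t "\<Omega> U" \<psi> W 0] \<psi>[OF that(2)] \<beta>[OF that(1)] by simp
  have "((\<lambda>r. ctr (G r) (ctr (G r) (\<lambda>U W. \<beta> r U * \<psi> r W)) [] [a, b]) has_real_derivative
    act A (\<lambda>U. ctr (G t) (ctr (G t) (\<lambda>U W. \<beta> t U * \<psi> t W)) U [a, b]) []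
    + act A (ctr (G t) (ctr (G t) (\<lambda>U W. \<beta> t U * \<psi> t W)) []) [a, b]
    + ctr (G t) (ctr (G t) (\<lambda>U W. \<Omega> U * \<psi> t W)) [] [a, b]) (at t)"
    by (rule ctr_deriv_act[OF inv], rule ctr_deriv_act[OF inv], rule 0) auto
  moreover have "act A (contract_psi (G t) (\<psi> t) (\<beta> t)) [a, b] = act A (ctr (G t) (ctr (G t) (\<lambda>U W. \<beta> t U * \<psi> t W)) []) [a, b]"
    by (rule act_cong) (auto simp: length_Suc_conv contract_psi_ctr)
  ultimately show ?thesis by (simp add: contract_psi_ctr del: act.simps(2))
qed

lemma pi_deriv:
  assumes \<psi>: "\<And>I. length I = 4 \<Longrightarrow> ((\<lambda>r. \<psi> r I) has_real_derivative act A (\<psi> t) I) (at t)"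
    and \<beta>: "\<And>I. length I = 2 \<Longrightarrow> ((\<lambda>r. \<beta> r I) has_real_derivative act A (\<beta> t) I + \<Omega> I) (at t)"
  shows "((\<lambda>r. pi7 (G r) (\<psi> r) (\<beta> r) [a, b]) has_real_derivative
      act A (pi7 (G t) (\<psi> t) (\<beta> t)) [a, b] + pi7 (G t) (\<psi> t) \<Omega> [a, b]) (at t)"
    and "((\<lambda>r. pi14 (G r) (\<psi> r) (\<beta> r) [a, b]) has_real_derivative
      act A (pi14 (G t) (\<psi> t) (\<beta> t)) [a, b] + pi14 (G t) (\<psi> t) \<Omega> [a, b]) (at t)"
proof -
  have c: "((\<lambda>r. contract_psi (G r) (\<psi> r) (\<beta> r) [a, b]) has_real_derivative
    act A (contract_psi (G t) (\<psi> t) (\<beta> t)) [a, b] + contract_psi (G t) (\<psi> t) \<Omega> [a, b]) (at t)"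
    by (rule contract_psi_deriv[OF \<psi> \<beta>])
  have b: "((\<lambda>r. \<beta> r [a, b]) has_real_derivative act A (\<beta> t) [a, b] + \<Omega> [a, b]) (at t)"
    by (rule \<beta>) simp
  have "act A (pi7 (G t) (\<psi> t) (\<beta> t)) [a, b]
      = act A (\<lambda>I. 1 / 3 * \<beta> t I + (- 1 / 6) * contract_psi (G t) (\<psi> t) (\<beta> t) I) [a, b]"
    by (rule act_cong) (simp add: pi7_def)
  then have e: "act A (pi7 (G t) (\<psi> t) (\<beta> t)) [a, b]
      = 1 / 3 * act A (\<beta> t) [a, b] + (- 1 / 6) * act A (contract_psi (G t) (\<psi> t) (\<beta> t)) [a, b]"
    by (simp only: act_add act_scale)
  show "((\<lambda>r. pi7 (G r) (\<psi> r) (\<beta> r) [a, b]) has_real_derivative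
      act A (pi7 (G t) (\<psi> t) (\<beta> t)) [a, b] + pi7 (G t) (\<psi> t) \<Omega> [a, b]) (at t)"
    unfolding pi7_def[of "G _" "\<psi> _" "\<beta> _" "[a, b]"] pi7_def[of "G t" "\<psi> t" \<Omega> "[a, b]"]
    by (rule DERIV_cong[OF DERIV_diff[OF DERIV_cmult[OF b] DERIV_cmult[OF c]]]) (unfold e, simp add: algebra_simps del: act.simps(2))
  have "act A (pi14 (G t) (\<psi> t) (\<beta> t)) [a, b]
      = act A (\<lambda>I. 2 / 3 * \<beta> t I + (1 / 6) * contract_psi (G t) (\<psi> t) (\<beta> t) I) [a, b]"
    by (rule act_cong) (simp add: pi14_def)
  then have e: "act A (pi14 (G t) (\<psi> t) (\<beta> t)) [a, b]
      = 2 / 3 * act A (\<beta> t) [a, b] + (1 / 6) * act A (contract_psi (G t) (\<psi> t) (\<beta> t)) [a, b]"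
    by (simp only: act_add act_scale)
  show "((\<lambda>r. pi14 (G r) (\<psi> r) (\<beta> r) [a, b]) has_real_derivative
      act A (pi14 (G t) (\<psi> t) (\<beta> t)) [a, b] + pi14 (G t) (\<psi> t) \<Omega> [a, b]) (at t)"
    unfolding pi14_def[of "G _" "\<psi> _" "\<beta> _" "[a, b]"] pi14_def[of "G t" "\<psi> t" \<Omega> "[a, b]"]
    by (rule DERIV_cong[OF DERIV_add[OF DERIV_cmult[OF b] DERIV_cmult[OF c]]]) (unfold e, simp add: algebra_simps del: act.simps(2))
qed

end

lemma up_eucl: "up eucl a i m = a [i, m]"
  unfolding up_def ginv_eucl sum_if_eq ..

lemma conj_by_linear:
  "conj_by M L (\<lambda>i m. A i m - B i m) b c = conj_by M L A b c - conj_by M L B b c"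
  "conj_by M L (\<lambda>i m. r * A i m) b c = r * conj_by M L A b c"
  "conj_by M L (\<lambda>i m. \<Sum>k\<in>S. C k i m) b c = (\<Sum>k\<in>S. conj_by M L (C k) b c)"
proof -
  show "conj_by M L (\<lambda>i m. A i m - B i m) b c = conj_by M L A b c - conj_by M L B b c"
    by (simp add: conj_by_def algebra_simps sum_subtractf)
  show "conj_by M L (\<lambda>i m. r * A i m) b c = r * conj_by M L A b c"
    by (simp add: conj_by_def sum_distrib_left mult_ac)
  show "conj_by M L (\<lambda>i m. \<Sum>k\<in>S. C k i m) b c = (\<Sum>k\<in>S. conj_by M L (C k) b c)"
    unfolding conj_by_def sum_distrib_left sum_distrib_right
    by (subst sum_rotate3) rule
qed

lemma conj_by_mult:
  assumes M_L: "M ** L = mat 1"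
  shows "(\<Sum>r\<in>UNIV. conj_by M L A p r * M $ q $ r) = (\<Sum>a\<in>UNIV. M $ a $ p * A a q)"
proof -
  have "(\<Sum>r\<in>UNIV. conj_by M L A p r * M $ q $ r)
      = (\<Sum>a\<in>UNIV. \<Sum>m\<in>UNIV. M $ a $ p * A a m * (\<Sum>r\<in>UNIV. M $ q $ r * L $ r $ m))"
    unfolding conj_by_def sum_distrib_left sum_distrib_right
    by (subst sum_rotate3[symmetric]) (simp only: mult_ac)
  also have "\<dots> = (\<Sum>a\<in>UNIV. \<Sum>m\<in>UNIV. M $ a $ p * A a m * (mat 1 :: real^7^7) $ q $ m)"
    unfolding M_L[symmetric] matrix_matrix_mult_def by simp
  also have "\<dots> = (\<Sum>a\<in>UNIV. M $ a $ p * A a q)"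
    by (simp add: sum_mult_mat mult.commute[of _ "mat 1 $ _ $ _"])
  finally show ?thesis .
qed

text \<open>A family of endomorphisms indexed by a direction: the direction is pulled back as a
  further covariant index.\<close>

definition conjd :: "real^7^7 \<Rightarrow> real^7^7 \<Rightarrow> (7 \<Rightarrow> 7 \<Rightarrow> 7 \<Rightarrow> real) \<Rightarrow> 7 \<Rightarrow> 7 \<Rightarrow> 7 \<Rightarrow> real" where
  "conjd M L B p i m = (\<Sum>a\<in>UNIV. M $ a $ p * conj_by M L (B a) i m)"

lemma alt1_act_pb:
  assumes L_M: "L ** M = mat 1" and T: "\<And>I. Suc (length I) = length J \<Longrightarrow> T I = pb L T' I"
  shows "alt1 (\<lambda>p. act (B p) T) J = pb L (alt1 (\<lambda>p. act (conjd M L B p) T')) J"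
proof -
  have M_L: "M ** L = mat 1" using L_M by (simp add: matrix_left_right_inverse)
  have "alt1 (\<lambda>p. act (B p) T) J = pb L (pb M (alt1 (\<lambda>p. act (B p) T))) J"
    by (simp add: pb_inverse[OF M_L])
  also have "\<dots> = pb L (alt1 (\<lambda>p. act (conjd M L B p) T')) J"
  proof (rule pb_cong)
    fix I :: "7 list" assume I: "length I = length J"
    have "pb M (alt1 (\<lambda>p. act (B p) T)) I = alt1 (pbd M (\<lambda>p. act (B p) T)) I" by (rule pb_alt1)
    also have "\<dots> = alt1 (\<lambda>p. act (conjd M L B p) T') I"
    proof (rule alt1_cong)
      fix p and K :: "7 list" assume K: "Suc (length K) = length I"
      have e: "pb M T Q = T' Q" if Q: "length Q = length K" for Q
      proof -
        have "pb M T Q = pb M (pb L T') Q" by (rule pb_cong, rule T) (simp add: Q K I)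
        then show ?thesis by (simp add: pb_inverse[OF L_M])
      qed
      have "pb M (act (B a) T) K = act (conj_by M L (B a)) T' K" for a
        unfolding pb_act[OF M_L] by (rule act_cong) (rule e)
      then show "pbd M (\<lambda>p. act (B p) T) p K = act (conjd M L B p) T' K"
        unfolding pbd_def conjd_def[abs_def] act_sum_left act_scale_left by simp
    qed
    finally show "pb M (alt1 (\<lambda>p. act (B p) T)) I = alt1 (\<lambda>p. act (conjd M L B p) T') I" .
  qed
  finally show ?thesis .
qed

lemma frame_ginv_sym:
  assumes frame: "g2_frame L P G V"
  shows "ginv G i j = ginv G j i"
proof -
  have "ginv G i j = (\<Sum>k\<in>UNIV. \<Sum>l\<in>UNIV. ginv G i k * G [k, l] * ginv G j l)" for i j
  proof -
    have "(\<Sum>k\<in>UNIV. \<Sum>l\<in>UNIV. ginv G i k * G [k, l] * ginv G j l) = (\<Sum>k\<in>UNIV. ginv G i k * (\<Sum>l\<in>UNIV. ginv G j l * G [l, k]))"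
      by (simp add: sum_distrib_left mult_ac frame_metric_sym[OF frame, of _ k for k])
    also have "\<dots> = ginv G i j" unfolding frame_ginv[OF frame] sum_if_eq ..
    finally show ?thesis by simp
  qed note e = this
  show ?thesis
    by (subst e[of i], subst e[of j], subst sum.swap) (simp only: mult_ac frame_metric_sym[OF frame, of _ k for k])
qed

lemma sym_to_3form_act:
  assumes frame: "g2_frame L P G V" and I: "length I = 3"
  shows "sym_to_3form G \<phi> h I = act (up G h) \<phi> I"
proof -
  have r: "raise1 G h l i = up G h i l" for l i
    unfolding raise1_def up_def by (subst frame_ginv_sym[OF frame]) (simp add: mult.commute)
  from I obtain a b c where "I = [a, b, c]" by (auto simp: length_Suc_conv numeral_eq_Suc)
  then show ?thesis by (simp add: sym_to_3form_def r sum.distrib)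
qed

context congruence
begin

text \<open>A 2-tensor in the chart together with its expression in the frame. The rules below
  follow the syntax of an expression, so a whole right-hand side is carried to the frame by rule
  application, and an identity of chart tensors reduces to one of frame components.\<close>

definition rel :: "tensor \<Rightarrow> tensor \<Rightarrow> bool" where
  "rel T T' \<longleftrightarrow> (\<forall>a b. T [a, b] = pb L T' [a, b])"

lemma relD: "rel T T' \<Longrightarrow> T [a, b] = pb L T' [a, b]" unfolding rel_def by blast
lemma relI: "(\<And>a b. T [a, b] = pb L T' [a, b]) \<Longrightarrow> rel T T'" unfolding rel_def by blast

lemma rel_intros:
  "rel S S' \<Longrightarrow> rel T T' \<Longrightarrow> rel (\<lambda>I. S I + T I) (\<lambda>I. S' I + T' I)"
  "rel S S' \<Longrightarrow> rel T T' \<Longrightarrow> rel (\<lambda>I. S I - T I) (\<lambda>I. S' I - T' I)"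
  "rel S S' \<Longrightarrow> rel (\<lambda>I. r * S I) (\<lambda>I. r * S' I)"
  "rel S S' \<Longrightarrow> rel (\<lambda>I. - S I) (\<lambda>I. - S' I)"
  "rel S S' \<Longrightarrow> rel T T' \<Longrightarrow> rel (\<lambda>I. comm g' S T I) (\<lambda>I. comm g S' T' I)"
  "rel S S' \<Longrightarrow> rel T T' \<Longrightarrow> rel (\<lambda>I. acomm g' S T I) (\<lambda>I. acomm g S' T' I)"
  unfolding rel_def by (simp_all only: pb_add pb_diff pb_scale pb_uminus comm_pb simp_thms)

lemma rel_pi:
  assumes "\<And>I. length I = 4 \<Longrightarrow> \<psi>' I = pb L \<psi> I" "rel S S'"
  shows "rel (\<lambda>I. pi7 g' \<psi>' S I) (\<lambda>I. pi7 g \<psi> S' I)" "rel (\<lambda>I. pi14 g' \<psi>' S I) (\<lambda>I. pi14 g \<psi> S' I)"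
  using assms(2) unfolding rel_def by (auto intro!: pi_pb assms(1) simp del: pb.simps)

lemma rel_covector_skew:
  assumes "\<And>I. length I = 3 \<Longrightarrow> \<phi>' I = pb L \<phi> I" "\<And>k. \<alpha>' [k] = pb L \<alpha> [k]"
  shows "rel (\<lambda>I. covector_skew g' \<phi>' \<alpha>' I) (\<lambda>I. covector_skew g \<phi> \<alpha> I)"
  by (rule relI) (rule covector_skew_pb[OF assms])

lemma rel_transpose: "rel T T' \<Longrightarrow> rel (\<lambda>I. T (rev I)) (\<lambda>I. T' (rev I))"
  unfolding rel_def by (simp only: pb_rev2) simp

lemma rel_hat: "rel T (pb M T)"
  by (rule relI) (rule hat)

lemma rel_eqI:
  assumes "rel S S'" "rel T T'" "\<And>a b. S' [a, b] = T' [a, b]"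
  shows "S [i, j] = T [i, j]"
proof -
  have "pb L S' [i, j] = pb L T' [i, j]"
    by (rule pb_cong) (use assms(3) in \<open>auto simp: length_Suc_conv\<close>)
  then show ?thesis using assms unfolding rel_def by metis
qed

lemma rel_cancel:
  assumes "rel T S" "rel T S'"
  shows "S [i, j] = S' [i, j]"
proof -
  have "S [i, j] - S' [i, j] = 0"
  proof (rule pb_eq_zero[of "[i, j]" "\<lambda>I. S I - S' I"])
    fix I :: "7 list" assume "length I = length [i, j]"
    then obtain a b where I: "I = [a, b]" by (auto simp: length_Suc_conv)
    show "pb L (\<lambda>I. S I - S' I) I = 0"
      unfolding pb_diff I using relD[OF assms(1), of a b] relD[OF assms(2), of a b] by simp
  qed
  then show ?thesis by simp
qed

end

subsection \<open>The evolution equations at a point\<close>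

text \<open>The symmetric part of the velocity acts on 2-tensors by anticommutators and its skew
  part by commutators. This is the contribution to the evolution that comes from naturality
  alone.\<close>

lemma act_frame:
  assumes h: "\<And>i j. h i j = h j i" and A: "\<And>i j. A i j = h i j - 1 / 3 * vphi x i j"
  shows "act A S [a, b] = ac h (\<lambda>i j. S [i, j]) a b - 1 / 3 * cm (vphi x) (\<lambda>i j. S [i, j]) a b"
proof -
  have "act A S [a, b] = (\<Sum>m\<in>UNIV. A a m * S [m, b]) + (\<Sum>m\<in>UNIV. S [a, m] * A b m)" by (simp add: mult.commute)
  also have "(\<Sum>m\<in>UNIV. A a m * S [m, b]) = mm h (\<lambda>i j. S [i, j]) a b - 1 / 3 * mm (vphi x) (\<lambda>i j. S [i, j]) a b"
    unfolding A mm_def by (simp add: sum_distrib_left sum_subtractf algebra_simps)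
  also have "(\<Sum>m\<in>UNIV. S [a, m] * A b m) = mm (\<lambda>i j. S [i, j]) h a b + 1 / 3 * mm (\<lambda>i j. S [i, j]) (vphi x) a b"
    unfolding A mm_def h[of b] vphi_swap[of x b] by (simp add: sum_distrib_left sum.distrib algebra_simps)
  finally show ?thesis by (simp add: ac_def cm_def algebra_simps)
qed

definition velocity :: "tensor \<Rightarrow> tensor \<Rightarrow> tensor \<Rightarrow> real^7 \<Rightarrow> 7 \<Rightarrow> 7 \<Rightarrow> real" where
  "velocity P G h X = up G (\<lambda>I. h I - 1 / 3 * interior X P I)"

text \<open>The covariant derivative of the velocity by the Leibniz rule, with \<open>nh\<close> and
  \<open>DX\<close> standing for those of h and X, and with \<nabla>_p \<phi> = act K_p
  \<phi>.\<close>

definition velocity_deriv :: "tensor \<Rightarrow> tensor \<Rightarrow> real^7 \<Rightarrow> (7 \<Rightarrow> tensor) \<Rightarrow> (7 \<Rightarrow> real^7) \<Rightarrow> (7 \<Rightarrow> 7 \<Rightarrow> 7 \<Rightarrow> real) \<Rightarrow>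
    7 \<Rightarrow> 7 \<Rightarrow> 7 \<Rightarrow> real" where
  "velocity_deriv P G X nh DX K p = up G (\<lambda>I. nh p I - 1 / 3 * (interior (DX p) P I + interior X (act (K p) P) I))"

definition div_covector :: "tensor \<Rightarrow> (7 \<Rightarrow> tensor) \<Rightarrow> tensor" where
  "div_covector G nh I = (\<Sum>p\<in>UNIV. \<Sum>q\<in>UNIV. ginv G p q * nh p (q # I))"

definition trace_covector :: "tensor \<Rightarrow> (7 \<Rightarrow> tensor) \<Rightarrow> tensor" where
  "trace_covector G nh I = trace_g G (nh (I ! 0))"

definition nabla_lower :: "tensor \<Rightarrow> (7 \<Rightarrow> real^7) \<Rightarrow> tensor" where
  "nabla_lower G DX I = (\<Sum>k\<in>UNIV. G [I ! 1, k] * DX (I ! 0) $ k)"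

definition curl_covector :: "tensor \<Rightarrow> tensor \<Rightarrow> (7 \<Rightarrow> real^7) \<Rightarrow> tensor" where
  "curl_covector P G DX I = ctr G (ctr G (\<lambda>U W. nabla_lower G DX U * P W)) [] I"

text \<open>The head of the first list is the direction of differentiation; contracting the two
  first slots with \<phi> leaves one index of h and one of \<phi>.\<close>

definition curl_tensor :: "tensor \<Rightarrow> tensor \<Rightarrow> (7 \<Rightarrow> tensor) \<Rightarrow> tensor" where
  "curl_tensor P G nh I = ctr G (ctr G (\<lambda>U W. nh (hd U) (tl U) * P W)) [I ! 0] [I ! 1]"

text \<open>The \<phi>-contraction of the inhomogeneous term in the time derivative of
  d\<psi>.\<close>

definition variation_form :: "tensor \<Rightarrow> tensor \<Rightarrow> tensor \<Rightarrow> tensor \<Rightarrow> real^7 \<Rightarrow> (7 \<Rightarrow> tensor) \<Rightarrow> (7 \<Rightarrow> real^7) \<Rightarrow>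
    (7 \<Rightarrow> 7 \<Rightarrow> 7 \<Rightarrow> real) \<Rightarrow> tensor" where
  "variation_form P G V h X nh DX K = phi_contract G P (alt1 (\<lambda>p. act (\<lambda>i m. velocity_deriv P G X nh DX K p i m
     - (\<Sum>q\<in>UNIV. velocity P G h X p q * K q i m)) (hodge 3 G V P)))"

context
  fixes L M :: "real^7^7" and P G V h \<tau>1 \<tau>2 \<tau>3 :: tensor and X :: "real^7" and nh :: "7 \<Rightarrow> tensor"
    and DX :: "7 \<Rightarrow> real^7" and K :: "7 \<Rightarrow> 7 \<Rightarrow> 7 \<Rightarrow> real" and t0 :: real
  assumes frame: "g2_frame L P G V" and L_M: "L ** M = mat 1"
begin

interpretation congruence L M eucl G by (rule g2_frame_congruence[OF frame L_M])

lemma interior_hat: "pb M (interior u P) [b, c] = vphi (\<lambda>k. (L *v u) $ k) b c"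
proof -
  have "pb M (interior u P) [b, c] = pb M (pb L (interior (L *v u) phi0)) [b, c]"
    by (rule pb_cong) (rule interior_pb, simp add: frame_phi[OF frame])
  then show ?thesis unfolding pb_inverse[OF L_M] by (simp add: interior_def vphi_def)
qed

lemma act_hat:
  assumes "\<And>I. length I = length J \<Longrightarrow> S I = pb L S' I"
  shows "act A S J = pb L (act (conj_by M L A) S') J"
  unfolding pb_act[OF L_M] conj_by_conj_by[OF L_M] by (rule act_cong) (rule assms)

lemma up_hat: "conj_by M L (up G a) b c = pb M a [b, c]"
  using up_pb[of a "pb M a" b c, OF hat] by (simp only: up_eucl)

lemma skew_hat:
  assumes "\<And>i j. act C G [i, j] = 0"
  shows "conj_by M L C i j = - conj_by M L C j i"
proof -
  have e: "act C G [i, j] = pb L (act (conj_by M L C) eucl) [i, j]" for i j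
    by (rule act_hat) (auto simp: length_Suc_conv frame_metric_pb[OF frame] simp del: pb.simps)
  have "act (conj_by M L C) eucl [i, j] = 0"
  proof (rule pb_eq_zero)
    fix I :: "7 list" assume "length I = length [i, j]"
    then obtain a b where I: "I = [a, b]" by (auto simp: length_Suc_conv)
    show "pb L (act (conj_by M L C) eucl) I = 0" unfolding I e[symmetric] by (rule assms)
  qed
  moreover have "act (conj_by M L C) eucl [i, j] = conj_by M L C i j + conj_by M L C j i"
    unfolding act.simps eucl_simp sum_if_eq by simp
  ultimately show ?thesis by simp
qed

abbreviation (input) "xh \<equiv> \<lambda>k. (L *v X) $ k"
abbreviation (input) "hh \<equiv> \<lambda>i j. pb M h [i, j]"
abbreviation (input) "nhh \<equiv> \<lambda>p i j. pbd M nh p [i, j]"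
abbreviation (input) "mh \<equiv> \<lambda>p k. \<Sum>a\<in>UNIV. M $ a $ p * (L *v DX a) $ k"

lemma velocity_hat: "conj_by M L (velocity P G h X) p r = hh p r - 1 / 3 * vphi xh p r"
  unfolding velocity_def up_hat pb_diff pb_scale interior_hat ..

text \<open>The right-hand side has the shape required by \<open>contract_variation\<close>. The
  index summed between velocity and K goes through since M and L cancel there, by
  \<open>conj_by_mult\<close>.\<close>

lemma velocity_deriv_hat:
  "conjd M L (\<lambda>p i m. (velocity_deriv P G X nh DX K) p i m - (\<Sum>q\<in>UNIV. (velocity P G h X) p q * K q i m)) p i l =
     nhh p i l - 1 / 3 * (vphi (mh p) i l + (\<Sum>r\<in>UNIV. xh r * act (conjd M L K p) phi0 [r, i, l]))
     - (\<Sum>q\<in>UNIV. (hh p q - 1 / 3 * vphi xh p q) * conjd M L K q i l)"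
proof -
  have K: "pb M (interior X (act (K a) P)) [i, l] = (\<Sum>r\<in>UNIV. xh r * act (conj_by M L (K a)) phi0 [r, i, l])" for a
  proof -
    have "pb M (interior X (act (K a) P)) [i, l] = pb M (pb L (interior (L *v X) (act (conj_by M L (K a)) phi0))) [i, l]"
      by (rule pb_cong) (rule interior_pb, rule act_hat, simp add: frame_phi[OF frame])
    then show ?thesis unfolding pb_inverse[OF L_M] interior_def .
  qed
  have 1: "(\<Sum>a\<in>UNIV. M $ a $ p * vphi (\<lambda>k. (L *v DX a) $ k) i l) = vphi (mh p) i l"
    unfolding vphi_def sum_distrib_left sum_distrib_right by (subst sum.swap) (simp only: mult_ac)
  have 2: "(\<Sum>a\<in>UNIV. M $ a $ p * (\<Sum>r\<in>UNIV. xh r * act (conj_by M L (K a)) phi0 [r, i, l]))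
      = (\<Sum>r\<in>UNIV. xh r * act (conjd M L K p) phi0 [r, i, l])"
    unfolding conjd_def[abs_def] act_sum_left act_scale_left sum_distrib_left
    by (subst sum.swap) (simp only: mult_ac)
  have 3: "(\<Sum>a\<in>UNIV. M $ a $ p * (\<Sum>q\<in>UNIV. (velocity P G h X) a q * conj_by M L (K q) i l))
      = (\<Sum>r\<in>UNIV. conj_by M L (velocity P G h X) p r * conjd M L K r i l)"
  proof -
    have "(\<Sum>a\<in>UNIV. M $ a $ p * (\<Sum>q\<in>UNIV. (velocity P G h X) a q * conj_by M L (K q) i l))
        = (\<Sum>q\<in>UNIV. (\<Sum>a\<in>UNIV. M $ a $ p * (velocity P G h X) a q) * conj_by M L (K q) i l)"
      unfolding sum_distrib_left sum_distrib_right by (subst sum.swap) (simp only: mult_ac)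
    also have "\<dots> = (\<Sum>r\<in>UNIV. conj_by M L (velocity P G h X) p r * conjd M L K r i l)"
      unfolding conj_by_mult[OF M_L, symmetric] conjd_def sum_distrib_left sum_distrib_right
      by (subst sum.swap) (simp only: mult_ac)
    finally show ?thesis .
  qed
  have "conj_by M L (\<lambda>i m. (velocity_deriv P G X nh DX K) a i m - (\<Sum>q\<in>UNIV. (velocity P G h X) a q * K q i m)) i l
     = pb M (nh a) [i, l] - 1 / 3 * (vphi (\<lambda>k. (L *v DX a) $ k) i l
         + (\<Sum>r\<in>UNIV. xh r * act (conj_by M L (K a)) phi0 [r, i, l]))
       - (\<Sum>q\<in>UNIV. (velocity P G h X) a q * conj_by M L (K q) i l)" for a
    unfolding conj_by_linear velocity_deriv_def up_hat pb_diff pb_scale pb_add interior_hat K ..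
  then have "conjd M L (\<lambda>p i m. (velocity_deriv P G X nh DX K) p i m - (\<Sum>q\<in>UNIV. (velocity P G h X) p q * K q i m)) p i l
     = (\<Sum>a\<in>UNIV. M $ a $ p * pb M (nh a) [i, l]) - 1 / 3 * ((\<Sum>a\<in>UNIV. M $ a $ p * vphi (\<lambda>k. (L *v DX a) $ k) i l)
         + (\<Sum>a\<in>UNIV. M $ a $ p * (\<Sum>r\<in>UNIV. xh r * act (conj_by M L (K a)) phi0 [r, i, l])))
       - (\<Sum>a\<in>UNIV. M $ a $ p * (\<Sum>q\<in>UNIV. (velocity P G h X) a q * conj_by M L (K q) i l))"
    unfolding conjd_def by (simp add: right_diff_distrib distrib_left sum.distrib sum_subtractf sum_distrib_left mult.left_commute del: pb.simps act.simps)
  then show ?thesis unfolding 1 2 3 velocity_hat pbd_def .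
qed

lemma pbd_hat: "pbd L (pbd M nh) p J = nh p J"
proof -
  have "pbd L (pbd M nh) p J = (\<Sum>a\<in>UNIV. L $ a $ p * (\<Sum>b\<in>UNIV. M $ b $ a * nh b J))"
    unfolding pbd_def[abs_def] pb_sum pb_scale pb_inverse[OF M_L] ..
  also have "\<dots> = (\<Sum>b\<in>UNIV. (\<Sum>a\<in>UNIV. M $ b $ a * L $ a $ p) * nh b J)"
    unfolding sum_distrib_left sum_distrib_right by (subst sum.swap) (simp only: mult_ac)
  also have "\<dots> = (\<Sum>b\<in>UNIV. (mat 1 :: real^7^7) $ b $ p * nh b J)"
    unfolding M_L[symmetric] matrix_matrix_mult_def by simp
  finally show ?thesis unfolding sum_mult_mat .
qed

lemma nh_list: "pb L (\<lambda>I. pbd M nh (hd I) (tl I)) (p # J) = nh p J"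
  using pbd_hat[of p J] by (simp add: pbd_def[of L])

lemma div_covector_hat: "(div_covector G nh) [k] = pb L (\<lambda>I. \<Sum>p\<in>UNIV. pbd M nh p (p # I)) [k]"
proof -
  have "ctr G (\<lambda>U W. nh (hd (U @ W)) (tl (U @ W))) [] [k] = pb2 L (ctr eucl (\<lambda>U W. pbd M nh (hd (U @ W)) (tl (U @ W)))) [] [k]"
  proof (rule ctr_pb')
    fix U W :: "7 list" assume "length U = Suc (length ([] :: 7 list))" "length W = Suc (length [k])"
    then obtain p where U: "U = [p]" by (auto simp: length_Suc_conv)
    show "nh (hd (U @ W)) (tl (U @ W)) = pb2 L (\<lambda>U W. pbd M nh (hd (U @ W)) (tl (U @ W))) U W"
      unfolding pb2_def pb_append[of L "\<lambda>I. pbd M nh (hd I) (tl I)", symmetric] U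
      by (simp add: nh_list del: pb.simps)
  qed
  then show ?thesis by (simp add: pb2_def ctr_def[of G] div_covector_def)
qed

lemma trace_covector_hat: "(trace_covector G nh) [k] = pb L (\<lambda>I. \<Sum>i\<in>UNIV. pbd M nh (I ! 0) [i, i]) [k]"
proof -
  have "trace_g G (nh k) = trace_g eucl (\<lambda>I. \<Sum>a\<in>UNIV. L $ a $ k * pbd M nh a I)"
  proof (rule trace_pb)
    fix i j
    show "nh k [i, j] = pb L (\<lambda>I. \<Sum>a\<in>UNIV. L $ a $ k * pbd M nh a I) [i, j]"
      unfolding pb_sum pb_scale pbd_def[of L "pbd M nh", symmetric] pbd_hat ..
  qed
  also have "\<dots> = (\<Sum>a\<in>UNIV. L $ a $ k * (\<Sum>i\<in>UNIV. pbd M nh a [i, i]))"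
    unfolding trace_ctr ctr_eucl append.simps sum_distrib_left by (rule sum.swap)
  finally show ?thesis by (simp add: trace_covector_def)
qed

lemma nabla_lower_hat: "(nabla_lower G DX) [p, q] = pb L (\<lambda>I. mh (I ! 0) (I ! 1)) [p, q]"
proof -
  have "pb L (\<lambda>I. mh (I ! 0) (I ! 1)) [p, q] = (\<Sum>b\<in>UNIV. L $ b $ p * (\<Sum>c\<in>UNIV. L $ c $ q * mh b c))" by simp
  also have "\<dots> = (\<Sum>b\<in>UNIV. L $ b $ p * (\<Sum>a\<in>UNIV. M $ a $ b * (\<Sum>c\<in>UNIV. L $ c $ q * (L *v DX a) $ c)))"
    unfolding sum_distrib_left by (rule sum.cong[OF refl], subst sum.swap) (simp only: mult_ac)
  also have "\<dots> = (\<Sum>a\<in>UNIV. (\<Sum>b\<in>UNIV. M $ a $ b * L $ b $ p) * (\<Sum>c\<in>UNIV. L $ c $ q * (L *v DX a) $ c))"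
    unfolding sum_distrib_right sum_distrib_left[where r = "L $ _ $ p"] by (subst sum.swap) (simp only: mult_ac)
  also have "\<dots> = (\<Sum>a\<in>UNIV. (mat 1 :: real^7^7) $ a $ p * (\<Sum>c\<in>UNIV. L $ c $ q * (L *v DX a) $ c))"
    unfolding M_L[symmetric] matrix_matrix_mult_def by simp
  also have "\<dots> = (\<Sum>c\<in>UNIV. L $ c $ q * (L *v DX p) $ c)" unfolding sum_mult_mat ..
  also have "\<dots> = (nabla_lower G DX) [p, q]"
    unfolding nabla_lower_def frame_metric[OF frame] matrix_vector_mult_def sum_distrib_left sum_distrib_right
    by (subst sum.swap) (simp add: sum_distrib_left mult_ac)
  finally show ?thesis ..
qed

lemma curl_covector_hat: "(curl_covector P G DX) [k] = pb L (ctr eucl (ctr eucl (\<lambda>U W. mh (U ! 0) (U ! 1) * phi0 W)) []) [k]"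
proof -
  have "(curl_covector P G DX) [k] = pb2 L (ctr eucl (ctr eucl (\<lambda>U W. mh (U ! 0) (U ! 1) * phi0 W))) [] [k]"
    unfolding curl_covector_def
  proof (rule contract_two_pb)
    fix U :: "7 list" assume "length U = 2 + length ([] :: 7 list)"
    then obtain a b where "U = [a, b]" by (auto simp: length_Suc_conv numeral_eq_Suc)
    then show "(nabla_lower G DX) U = pb L (\<lambda>U. mh (U ! 0) (U ! 1)) U" using nabla_lower_hat by simp
  qed (simp add: frame_phi[OF frame])
  then show ?thesis by (simp add: pb2_def)
qed

lemma curl_tensor_hat: "rel (curl_tensor P G nh) (\<lambda>I. ctr eucl (ctr eucl (\<lambda>U W. pbd M nh (hd U) (tl U) * phi0 W)) [I ! 0] [I ! 1])"
proof (rule relI)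
  fix a b
  have "(curl_tensor P G nh) [a, b] = pb2 L (ctr eucl (ctr eucl (\<lambda>U W. pbd M nh (hd U) (tl U) * phi0 W))) [a] [b]"
    unfolding curl_tensor_def nth_Cons_0 nth_Cons_Suc One_nat_def
  proof (rule contract_two_pb)
    fix U :: "7 list" assume "length U = 2 + length [a]"
    then obtain p J where "U = p # J" by (cases U) auto
    then show "nh (hd U) (tl U) = pb L (\<lambda>U. pbd M nh (hd U) (tl U)) U" by (simp add: nh_list del: pb.simps)
  qed (simp add: frame_phi[OF frame])
  then show "(curl_tensor P G nh) [a, b] = pb L (\<lambda>I. ctr eucl (ctr eucl (\<lambda>U W. pbd M nh (hd U) (tl U) * phi0 W)) [I ! 0] [I ! 1]) [a, b]"
    by (simp add: pb2_def)
qed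

lemma rel_act: "rel S S' \<Longrightarrow> rel (\<lambda>I. act A S I) (\<lambda>I. act (conj_by M L A) S' I)"
  by (rule relI) (rule act_hat, auto simp: length_Suc_conv rel_def simp del: pb.simps)

text \<open>Purely algebraic: \<open>nh\<close>, \<open>DX\<close> and K are arbitrary arrays
  subject to the stated symmetries and to the two torsion equations, and nothing is differentiated.
  The torsion equations fix the parts of K that matter.\<close>

lemma frame_torsion_evolution:
  assumes Ksk: "\<And>p i j. act (K p) G [i, j] = 0"
    and h: "\<And>i j. h [i, j] = h [j, i]" and nh: "\<And>p i j. nh p [i, j] = nh p [j, i]"
    and sk: "\<And>i j. \<tau>2 [i, j] = - \<tau>2 [j, i]" and c: "\<And>k. ctr G (ctr G (\<lambda>U W. \<tau>2 U * P W)) [] [k] = 0"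
    and t3: "\<And>i j. \<tau>3 [i, j] = \<tau>3 [j, i]" and tr: "trace_g G \<tau>3 = 0"
    and E1: "\<forall>J. length J = 4 \<longrightarrow> alt1 (\<lambda>p. act (K p) P) J =
        t0 * hodge 3 G V P J + 3 * wedge 1 \<tau>1 P J + hodge 3 G V (sym_to_3form G P \<tau>3) J"
    and E2: "\<forall>J. length J = 5 \<longrightarrow> alt1 (\<lambda>p. act (K p) (hodge 3 G V P)) J =
        4 * wedge 1 \<tau>1 (hodge 3 G V P) J + hodge 2 G V \<tau>2 J"
  shows "act (velocity P G h X) (covector_skew G P \<tau>1) [i, j] - 1 / 48 * pi7 G (hodge 3 G V P) (variation_form P G V h X nh DX K) [i, j] =
      pi7 G (hodge 3 G V P) (\<lambda>I. 1 / 2 * comm G h \<tau>3 I + 1 / 2 * acomm G h (covector_skew G P \<tau>1) I + 1 / 4 * acomm G h \<tau>2 I) [i, j]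
      + pi14 G (hodge 3 G V P) (acomm G h (covector_skew G P \<tau>1)) [i, j]
      + 1 / 4 * t0 * interior X P [i, j]
      + pi7 G (hodge 3 G V P) (\<lambda>I. - 1 / 2 * acomm G (interior X P) \<tau>3 I - 1 / 2 * comm G (interior X P) (covector_skew G P \<tau>1) I
                           + 1 / 12 * comm G (interior X P) \<tau>2 I) [i, j]
      + pi14 G (hodge 3 G V P) (\<lambda>I. - 1 / 3 * comm G (interior X P) (covector_skew G P \<tau>1) I) [i, j]
      - 1 / 6 * covector_skew G P (div_covector G nh) [i, j] + 1 / 6 * covector_skew G P (trace_covector G nh) [i, j]
      + 1 / 6 * covector_skew G P (curl_covector P G DX) [i, j]"
    and "act (velocity P G h X) \<tau>2 [i, j] + 1 / 6 * pi14 G (hodge 3 G V P) (variation_form P G V h X nh DX K) [i, j] =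
      pi7 G (hodge 3 G V P) (acomm G h \<tau>2) [i, j]
      + pi14 G (hodge 3 G V P) (\<lambda>I. - comm G h \<tau>3 I + acomm G h (covector_skew G P \<tau>1) I + 1 / 2 * acomm G h \<tau>2 I) [i, j]
      + pi7 G (hodge 3 G V P) (\<lambda>I. - 1 / 3 * comm G (interior X P) \<tau>2 I) [i, j]
      + pi14 G (hodge 3 G V P) (\<lambda>I. acomm G (interior X P) \<tau>3 I + 1 / 3 * comm G (interior X P) (covector_skew G P \<tau>1) I) [i, j]
      - (curl_tensor P G nh) [i, j] + (curl_tensor P G nh) [j, i]
      - 1 / 3 * covector_skew G P (div_covector G nh) [i, j] + 1 / 3 * covector_skew G P (trace_covector G nh) [i, j]
      - (nabla_lower G DX) [i, j] + (nabla_lower G DX) [j, i] + 1 / 3 * covector_skew G P (curl_covector P G DX) [i, j]"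
proof -
  note E1 = E1[rule_format] and E2 = E2[rule_format]
  define Kh where "Kh = conjd M L K"
  define T where "T p k = vec_of (Kh p) k" for p k
  define v where "v k = pb M \<tau>1 [k]" for k
  define s where "s i j = pb M \<tau>2 [i, j]" for i j
  define t where "t i j = pb M \<tau>3 [i, j]" for i j
  define H where "H i j = pb M h [i, j]" for i j
  define x where "x k = (L *v X) $ k" for k
  define n where "n p i j = pbd M nh p [i, j]" for p i j
  define m where "m p k = (\<Sum>a\<in>UNIV. M $ a $ p * (L *v DX a) $ k)" for p k
  define Fh where "Fh = phi_contract eucl phi0 (alt1 (\<lambda>p. act (conjd M L (\<lambda>p i m. (velocity_deriv P G X nh DX K) p i m - (\<Sum>q\<in>UNIV. (velocity P G h X) p q * K q i m)) p) psi0))"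
  have psi: "hodge 3 G V P I = pb L psi0 I" if "length I = 4" for I by (rule g2_frame_psi[OF frame that])
  have Kh: "Kh p i j = - Kh p j i" for p i j
    unfolding Kh_def conjd_def by (subst skew_hat[OF Ksk]) (simp add: sum_negf)
  have H: "H i j = H j i" for i j unfolding H_def by (rule pb_symmetric[of h, OF h])
  have n: "n p i j = n p j i" for p i j
    unfolding n_def pbd_def by (subst pb_symmetric[of "nh _", OF nh]) rule
  have s: "s i j = - s j i" for i j unfolding s_def by (rule pb_skew[of \<tau>2, OF sk])
  have s0: "vec_of s k = 0" for k unfolding s_def[abs_def] by (rule frame_contract_zero[OF frame L_M c])
  have t: "t i j = t j i" for i j unfolding t_def by (rule pb_symmetric[of \<tau>3, OF t3])
  have t_tr: "(\<Sum>i\<in>UNIV. t i i) = 0"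
    using tr trace_pb[of \<tau>3 "pb M \<tau>3", OF hat] by (simp add: trace_ctr t_def)
  have S1: "rel (\<lambda>I. covector_skew G P \<tau>1 I) (\<lambda>I. covector_skew eucl phi0 (pb M \<tau>1) I)"
    by (rule rel_covector_skew) (simp_all add: frame_phi[OF frame] hat[symmetric] del: pb.simps)
  have S1v: "covector_skew eucl phi0 (pb M \<tau>1) [i, j] = vphi v i j" for i j
    by (simp add: covector_skew_eucl v_def[abs_def] del: pb.simps)
  \<comment> \<open>The \<phi>-contraction of d\<psi> is evaluated twice, through K and through the
    torsion forms, and the two frame expressions are compared.\<close>
  have "dcurl T i j = - 48 * vphi v i j + 6 * s i j" for i j
  proof -
    have "rel (\<lambda>I. phi_contract G P (alt1 (\<lambda>p. act (K p) (hodge 3 G V P))) I)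
        (\<lambda>I. phi_contract eucl phi0 (alt1 (\<lambda>p. act (Kh p) psi0)) I)"
      unfolding Kh_def
      by (rule relI, rule phi_contract_pb) (simp_all add: frame_phi[OF frame] alt1_act_pb[OF L_M, of _ "hodge 3 G V P" psi0] psi)
    moreover have "rel (\<lambda>I. phi_contract G P (alt1 (\<lambda>p. act (K p) (hodge 3 G V P))) I)
        (\<lambda>I. - 48 * covector_skew eucl phi0 (pb M \<tau>1) I + 6 * pb M \<tau>2 I)"
    proof -
      have "rel (\<lambda>I. - 48 * covector_skew G P \<tau>1 I + 6 * \<tau>2 I)
          (\<lambda>I. - 48 * covector_skew eucl phi0 (pb M \<tau>1) I + 6 * pb M \<tau>2 I)"
        by (intro rel_intros(1,3) S1 rel_hat)
      moreover have "phi_contract G P (alt1 (\<lambda>p. act (K p) (hodge 3 G V P))) [i, j]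
          = - 48 * covector_skew G P \<tau>1 [i, j] + 6 * \<tau>2 [i, j]" for i j
        by (rule torsion_extraction(3)[OF frame sk c E2])
      ultimately show ?thesis unfolding rel_def by (simp only: simp_thms)
    qed
    ultimately have "phi_contract eucl phi0 (alt1 (\<lambda>p. act (Kh p) psi0)) [i, j]
        = - 48 * covector_skew eucl phi0 (pb M \<tau>1) [i, j] + 6 * pb M \<tau>2 [i, j]" by (rule rel_cancel)
    then show ?thesis unfolding phi_contract_skew[OF Kh] S1v s_def[symmetric] T_def[abs_def] by (simp only:)
  qed
  then have Ta: "T i j - T j i = 2 * vphi v i j - s i j" for i j by (rule torsion_skew_part[OF s s0])
  \<comment> \<open>The equation for d\<phi> is carried to the frame by showing that the difference
    of its two sides has vanishing pullback.\<close>
  have "alt1 (\<lambda>p. act (Kh p) phi0) J = t0 * psi0 J + 3 * alt1 (\<lambda>p J. v p * phi0 J) J + hodge 3 eucl vol0 (act t phi0) J"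
    if J: "length J = 4" for J
  proof -
    define D where "D I = alt1 (\<lambda>p. act (Kh p) phi0) I
      - (t0 * psi0 I + 3 * alt1 (\<lambda>p J. v p * phi0 J) I + hodge 3 eucl vol0 (act t phi0) I)" for I
    have "D J = 0"
    proof (rule pb_eq_zero)
      fix I :: "7 list" assume "length I = length J"
      then have I: "length I = 4" using J by simp
      have 1: "alt1 (\<lambda>p. act (K p) P) I = pb L (alt1 (\<lambda>p. act (Kh p) phi0)) I"
        unfolding Kh_def by (rule alt1_act_pb[OF L_M]) (simp add: I frame_phi[OF frame])
      have 2: "wedge 1 \<tau>1 P I = pb L (alt1 (\<lambda>p J. v p * phi0 J)) I"
        unfolding v_def by (rule wedge1_pb) (simp_all add: hat[symmetric] frame_phi[OF frame] I del: pb.simps)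
      have 3: "hodge 3 G V (sym_to_3form G P \<tau>3) I = pb L (hodge 3 eucl vol0 (act t phi0)) I"
      proof (rule hodge_pb[OF g' G L_M])
        fix Q :: "7 list" assume Q: "length Q = 3"
        have t': "conj_by M L (up G \<tau>3) = t" by (intro ext) (simp only: up_hat t_def)
        have "sym_to_3form G P \<tau>3 Q = act (up G \<tau>3) P Q" by (rule sym_to_3form_act[OF frame Q])
        also have "\<dots> = pb L (act (conj_by M L (up G \<tau>3)) phi0) Q" by (rule act_hat) (simp add: Q frame_phi[OF frame])
        finally show "sym_to_3form G P \<tau>3 Q = pb L (act t phi0) Q" unfolding t' .
      qed (use frame in \<open>simp_all add: I g2_frame_def\<close>)
      show "pb L D I = 0"
        using E1[OF I] unfolding D_def[abs_def] pb_diff pb_add pb_scale 1 2 3 psi[OF I] by simp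
    qed
    then show ?thesis unfolding D_def by simp
  qed
  then have Ts: "T i j + T j i = (if i = j then t0 / 2 else 0) - 2 * t i j" for i j
    by (rule torsion_sym_part[where K = Kh and T = T and ?t3.0 = t, OF Kh T_def t t_tr])
  have F: "Fh [i, j] = 6 * (vphi (\<lambda>k. \<Sum>p\<in>UNIV. n p p k) i j - vphi (\<lambda>k. \<Sum>p\<in>UNIV. n k p p) i j
       - (\<Sum>k\<in>UNIV. vphi (n k i) j k) + (\<Sum>k\<in>UNIV. vphi (n k j) i k))
     + dcurl (\<lambda>p k. m p k - mm H T p k + 1 / 3 * mm (vphi x) T p k + 2 / 3 * mm T (vphi x) p k) i j" for i j
    unfolding Fh_def velocity_deriv_hat[abs_def]
    using contract_variation[where K = Kh and n = n and T = T and m = m and x = x and h = H, OF Kh n T_def, of i j]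
    unfolding Kh_def n_def[abs_def] m_def[abs_def] x_def[abs_def] H_def[abs_def] by (simp only:)
  note ev = frame_evolution[where h = H and n = n and ?t2.0 = s and ?t3.0 = t and T = T and ?t1.0 = v and x = x and m = m and ?t0.0 = t0
      and F = "\<lambda>i j. Fh [i, j]", OF H n s s0 t Ts Ta F refl]
  have Fr: "rel (\<lambda>I. (variation_form P G V h X nh DX K) I) (\<lambda>I. Fh I)"
    unfolding variation_form_def Fh_def
    by (rule relI, rule phi_contract_pb) (simp_all add: frame_phi[OF frame] alt1_act_pb[OF L_M, of _ "hodge 3 G V P" psi0] psi)
  have XX: "rel (\<lambda>I. interior X P I) (\<lambda>I. pb M (interior X P) I)" by (rule rel_hat)
  have XXv: "pb M (interior X P) [i, j] = vphi x i j" for i j unfolding interior_hat x_def ..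
  have dv: "rel (\<lambda>I. covector_skew G P (div_covector G nh) I) (\<lambda>I. covector_skew eucl phi0 (\<lambda>I. \<Sum>p\<in>UNIV. pbd M nh p (p # I)) I)"
    by (rule rel_covector_skew) (simp_all add: frame_phi[OF frame] div_covector_hat del: pb.simps)
  have gr: "rel (\<lambda>I. covector_skew G P (trace_covector G nh) I) (\<lambda>I. covector_skew eucl phi0 (\<lambda>I. \<Sum>i\<in>UNIV. pbd M nh (I ! 0) [i, i]) I)"
    by (rule rel_covector_skew) (simp_all add: frame_phi[OF frame] trace_covector_hat del: pb.simps)
  have cx: "rel (\<lambda>I. covector_skew G P (curl_covector P G DX) I) (\<lambda>I. covector_skew eucl phi0 (ctr eucl (ctr eucl (\<lambda>U W. m (U ! 0) (U ! 1) * phi0 W)) []) I)"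
    unfolding m_def by (rule rel_covector_skew) (simp_all only: frame_phi[OF frame] curl_covector_hat)
  have nX: "rel (\<lambda>I. (nabla_lower G DX) I) (\<lambda>I. m (I ! 0) (I ! 1))"
    unfolding m_def by (rule relI) (rule nabla_lower_hat)
  have cxv: "ctr eucl (ctr eucl (\<lambda>U W. m (U ! 0) (U ! 1) * phi0 W)) [] [k] = (\<Sum>a\<in>UNIV. \<Sum>b\<in>UNIV. m a b * phi0 [a, b, k])" for k
    unfolding ctr_eucl by (subst sum.swap) simp
  define cu where "cu = (\<lambda>I. ctr eucl (ctr eucl (\<lambda>U W. pbd M nh (hd U) (tl U) * phi0 W)) [I ! 0] [I ! 1])"
  have cuv: "cu [i, j] = (\<Sum>k\<in>UNIV. vphi (n k i) j k)" for i j
  proof -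
    have "cu [i, j] = (\<Sum>l\<in>UNIV. \<Sum>k\<in>UNIV. n k l i * phi0 [k, l, j])" by (simp add: cu_def n_def)
    also have "\<dots> = (\<Sum>k\<in>UNIV. \<Sum>l\<in>UNIV. n k i l * phi0 [l, j, k])"
      by (subst sum.swap) (simp only: n[of _ _ i] phi0_rotate)
    finally show ?thesis by (simp add: vphi_def)
  qed
  have cur: "rel (\<lambda>I. (curl_tensor P G nh) I) (\<lambda>I. cu I)" using curl_tensor_hat unfolding cu_def .
  have xe: "x = (\<lambda>k. (L *v X) $ k)" by (rule ext) (rule x_def)
  have velo: "act (conj_by M L (velocity P G h X)) S [i, j] = ac H (\<lambda>i j. S [i, j]) i j - 1 / 3 * cm (vphi x) (\<lambda>i j. S [i, j]) i j" for S i j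
    by (rule act_frame[OF H]) (simp only: velocity_hat H_def xe)
  have nth1: "(a # b # J) ! 1 = b" for a b :: 7 and J by simp
  note frame_simps = velo pi_eucl comm_eucl v_def[symmetric] XXv cxv cuv covector_skew_eucl H_def[symmetric] s_def[symmetric]
    t_def[symmetric] n_def[symmetric] nth_Cons_0 nth1 rev.simps append.simps
  have pis: "rel S S' \<Longrightarrow> rel (\<lambda>I. pi7 G (hodge 3 G V P) S I) (\<lambda>I. pi7 eucl psi0 S' I)"
    "rel S S' \<Longrightarrow> rel (\<lambda>I. pi14 G (hodge 3 G V P) S I) (\<lambda>I. pi14 eucl psi0 S' I)" for S S'
    by (rule rel_pi, erule psi, assumption)+
  note rels = rel_intros pis rel_act S1 XX dv gr cx nX cur Fr rel_hat[of h] rel_hat[of \<tau>2] rel_hat[of \<tau>3]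
    rel_transpose[OF nX] rel_transpose[OF cur]
  \<comment> \<open>Both sides are written as functions of the index list, so that the rules for
    \<open>rel\<close> can decompose them.\<close>
  have "(\<lambda>I. act (velocity P G h X) (covector_skew G P \<tau>1) I
        - 1 / 48 * pi7 G (hodge 3 G V P) (variation_form P G V h X nh DX K) I) [i, j] =
      (\<lambda>I. pi7 G (hodge 3 G V P) (\<lambda>I. 1 / 2 * comm G h \<tau>3 I
        + 1 / 2 * acomm G h (covector_skew G P \<tau>1) I
        + 1 / 4 * acomm G h \<tau>2 I) I
        + pi14 G (hodge 3 G V P) (acomm G h (covector_skew G P \<tau>1)) I
        + 1 / 4 * t0 * interior X P I
        + pi7 G (hodge 3 G V P) (\<lambda>I. - 1 / 2 * acomm G (interior X P) \<tau>3 I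
        - 1 / 2 * comm G (interior X P) (covector_skew G P \<tau>1) I
        + 1 / 12 * comm G (interior X P) \<tau>2 I) I
        + pi14 G (hodge 3 G V P) (\<lambda>I. - 1 / 3 * comm G (interior X P) (covector_skew G P \<tau>1) I) I
        - 1 / 6 * covector_skew G P (div_covector G nh) I
        + 1 / 6 * covector_skew G P (trace_covector G nh) I
        + 1 / 6 * covector_skew G P (curl_covector P G DX) I) [i, j]"
    apply (rule rel_eqI[where S = "\<lambda>I. act (velocity P G h X) (covector_skew G P \<tau>1) I - 1 / 48 * pi7 G (hodge 3 G V P) (variation_form P G V h X nh DX K) I"
      and T = "\<lambda>I. pi7 G (hodge 3 G V P) (\<lambda>I. 1 / 2 * comm G h \<tau>3 I
        + 1 / 2 * acomm G h (covector_skew G P \<tau>1) I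
        + 1 / 4 * acomm G h \<tau>2 I) I
        + pi14 G (hodge 3 G V P) (acomm G h (covector_skew G P \<tau>1)) I
        + 1 / 4 * t0 * interior X P I
        + pi7 G (hodge 3 G V P) (\<lambda>I. - 1 / 2 * acomm G (interior X P) \<tau>3 I
        - 1 / 2 * comm G (interior X P) (covector_skew G P \<tau>1) I
        + 1 / 12 * comm G (interior X P) \<tau>2 I) I
        + pi14 G (hodge 3 G V P) (\<lambda>I. - 1 / 3 * comm G (interior X P) (covector_skew G P \<tau>1) I) I
        - 1 / 6 * covector_skew G P (div_covector G nh) I
        + 1 / 6 * covector_skew G P (trace_covector G nh) I
        + 1 / 6 * covector_skew G P (curl_covector P G DX) I"])
      apply (rule rels)+
    apply (simp only: frame_simps)
    subgoal for a b using ev(1)[of a b] by linarith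
    done
  then show "act (velocity P G h X) (covector_skew G P \<tau>1) [i, j] - 1 / 48 * pi7 G (hodge 3 G V P) (variation_form P G V h X nh DX K) [i, j] =       pi7 G (hodge 3 G V P) (\<lambda>I. 1 / 2 * comm G h \<tau>3 I
        + 1 / 2 * acomm G h (covector_skew G P \<tau>1) I
        + 1 / 4 * acomm G h \<tau>2 I) [i, j]
      + pi14 G (hodge 3 G V P) (acomm G h (covector_skew G P \<tau>1)) [i, j]
      + 1 / 4 * t0 * interior X P [i, j]
      + pi7 G (hodge 3 G V P) (\<lambda>I. - 1 / 2 * acomm G (interior X P) \<tau>3 I - 1 / 2 * comm G (interior X P) (covector_skew G P \<tau>1) I
                           + 1 / 12 * comm G (interior X P) \<tau>2 I) [i, j]
      + pi14 G (hodge 3 G V P) (\<lambda>I. - 1 / 3 * comm G (interior X P) (covector_skew G P \<tau>1) I) [i, j]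
      - 1 / 6 * covector_skew G P (div_covector G nh) [i, j] + 1 / 6 * covector_skew G P (trace_covector G nh) [i, j]
      + 1 / 6 * covector_skew G P (curl_covector P G DX) [i, j]" by (simp only: rev.simps append.simps)
  have "(\<lambda>I. act (velocity P G h X) \<tau>2 I
        + 1 / 6 * pi14 G (hodge 3 G V P) (variation_form P G V h X nh DX K) I) [i, j] =
      (\<lambda>I. pi7 G (hodge 3 G V P) (acomm G h \<tau>2) I
        + pi14 G (hodge 3 G V P) (\<lambda>I. - comm G h \<tau>3 I
        + acomm G h (covector_skew G P \<tau>1) I
        + 1 / 2 * acomm G h \<tau>2 I) I
        + pi7 G (hodge 3 G V P) (\<lambda>I. - 1 / 3 * comm G (interior X P) \<tau>2 I) I
        + pi14 G (hodge 3 G V P) (\<lambda>I. acomm G (interior X P) \<tau>3 I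
        + 1 / 3 * comm G (interior X P) (covector_skew G P \<tau>1) I) I
        - (curl_tensor P G nh) I
        + (curl_tensor P G nh) (rev I) - 1 / 3 * covector_skew G P (div_covector G nh) I
        + 1 / 3 * covector_skew G P (trace_covector G nh) I
        - (nabla_lower G DX) I
        + (nabla_lower G DX) (rev I) + 1 / 3 * covector_skew G P (curl_covector P G DX) I) [i, j]"
    apply (rule rel_eqI[where S = "\<lambda>I. act (velocity P G h X) \<tau>2 I + 1 / 6 * pi14 G (hodge 3 G V P) (variation_form P G V h X nh DX K) I"
      and T = "\<lambda>I. pi7 G (hodge 3 G V P) (acomm G h \<tau>2) I
        + pi14 G (hodge 3 G V P) (\<lambda>I. - comm G h \<tau>3 I
        + acomm G h (covector_skew G P \<tau>1) I
        + 1 / 2 * acomm G h \<tau>2 I) I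
        + pi7 G (hodge 3 G V P) (\<lambda>I. - 1 / 3 * comm G (interior X P) \<tau>2 I) I
        + pi14 G (hodge 3 G V P) (\<lambda>I. acomm G (interior X P) \<tau>3 I
        + 1 / 3 * comm G (interior X P) (covector_skew G P \<tau>1) I) I
        - (curl_tensor P G nh) I
        + (curl_tensor P G nh) (rev I) - 1 / 3 * covector_skew G P (div_covector G nh) I
        + 1 / 3 * covector_skew G P (trace_covector G nh) I
        - (nabla_lower G DX) I
        + (nabla_lower G DX) (rev I) + 1 / 3 * covector_skew G P (curl_covector P G DX) I"])
      apply (rule rels)+
    apply (simp only: frame_simps)
    subgoal for a b using ev(2)[of a b] by linarith
    done
  then show "act (velocity P G h X) \<tau>2 [i, j] + 1 / 6 * pi14 G (hodge 3 G V P) (variation_form P G V h X nh DX K) [i, j] =       pi7 G (hodge 3 G V P) (acomm G h \<tau>2) [i, j]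
      + pi14 G (hodge 3 G V P) (\<lambda>I. - comm G h \<tau>3 I + acomm G h (covector_skew G P \<tau>1) I + 1 / 2 * acomm G h \<tau>2 I) [i, j]
      + pi7 G (hodge 3 G V P) (\<lambda>I. - 1 / 3 * comm G (interior X P) \<tau>2 I) [i, j]
      + pi14 G (hodge 3 G V P) (\<lambda>I. acomm G (interior X P) \<tau>3 I + 1 / 3 * comm G (interior X P) (covector_skew G P \<tau>1) I) [i, j]
      - (curl_tensor P G nh) [i, j] + (curl_tensor P G nh) [j, i]
      - 1 / 3 * covector_skew G P (div_covector G nh) [i, j] + 1 / 3 * covector_skew G P (trace_covector G nh) [i, j]
      - (nabla_lower G DX) [i, j] + (nabla_lower G DX) [j, i] + 1 / 3 * covector_skew G P (curl_covector P G DX) [i, j]" by (simp only: rev.simps append.simps)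
qed

end

subsection \<open>Smoothness of the metric and of \<open>\<psi>\<close>\<close>

lemma Ck_on_shuffle:
  assumes W: "open W"
  shows "(\<And>P. length P = k \<Longrightarrow> Ck_on n W (\<lambda>z. \<alpha> z P)) \<Longrightarrow>
    (\<And>Q. length Q + k = length I \<Longrightarrow> Ck_on n W (\<lambda>z. \<beta> z Q)) \<Longrightarrow> Ck_on n W (\<lambda>z. shuffle k (\<alpha> z) (\<beta> z) I)"
proof (induction I arbitrary: k \<alpha> \<beta>)
  case Nil
  then show ?case by (cases k) (auto intro!: Ck_on_mult[OF W] Ck_on_const)
next
  case (Cons x I)
  show ?case
  proof (cases k)
    case 0
    then show ?thesis using Cons.prems by (auto intro!: Ck_on_mult[OF W])
  next
    case (Suc m)
    have "Ck_on n W (\<lambda>z. shuffle m (\<lambda>P. \<alpha> z (x # P)) (\<beta> z) I)"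
      using Cons.prems by (intro Cons.IH) (auto simp: Suc)
    moreover have "Ck_on n W (\<lambda>z. shuffle (Suc m) (\<alpha> z) (\<lambda>P. \<beta> z (x # P)) I)"
      using Cons.prems by (intro Cons.IH) (auto simp: Suc)
    ultimately show ?thesis
      unfolding Suc shuffle.simps by (intro Ck_on_add[OF W] Ck_on_mult[OF W] Ck_on_const)
  qed
qed

lemma interior_axis: "interior (axis i 1) T J = T (i # J)"
proof -
  have "interior (axis i 1) T J = (\<Sum>k\<in>UNIV. (if i = k then 1 else 0) * T (k # J))"
    unfolding interior_def by (rule sum.cong) (auto simp: axis_def)
  then show ?thesis unfolding sum_if_eq .
qed

lemma frame_volume:
  assumes "g2_frame L P G V"
  shows "(V idl)\<^sup>2 = det (gmat G)" "V idl \<noteq> 0"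
proof -
  have "V idl = pb L vol0 idl" using assms by (simp add: g2_frame_def idl_facts)
  then have v: "V idl = - det L" by (simp add: pb_top_form[OF vol0_alternating] vol0_idl)
  have L: "det L \<noteq> 0" "gmat G = transpose L ** L" using assms by (simp_all add: g2_frame_def invertible_det_nz)
  show "(V idl)\<^sup>2 = det (gmat G)" "V idl \<noteq> 0" using L by (simp_all add: v det_mul power2_eq_square)
qed

text \<open>The defining relation gives B = -6 vol g with B polynomial in \<phi>. Taking
  determinants and using vol^2 = det g isolates the ninth power of vol; being odd and nonzero, it
  has a root as regular as \<phi>. Division yields g, Cramer's rule its inverse, and the Hodge
  formula \<psi>.\<close>

lemma Ck_on_G2:
  fixes P G V :: "'a::euclidean_space \<Rightarrow> tensor"
  assumes W: "open W" and fr: "\<And>z. z \<in> W \<Longrightarrow> \<exists>L. g2_frame L (P z) (G z) (V z)"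
    and P: "\<And>I. length I = 3 \<Longrightarrow> Ck_on n W (\<lambda>z. P z I)" and V: "\<And>z. z \<in> W \<Longrightarrow> alternating 7 (V z)"
    and rel: "\<And>z u v I. z \<in> W \<Longrightarrow> length I = 7 \<Longrightarrow>
      wedge 4 (wedge 2 (interior u (P z)) (interior v (P z))) (P z) I = - 6 * (u \<bullet> (gmat (G z) *v v)) * V z I"
  shows "Ck_on n W (\<lambda>z. G z [i, j])" and "Ck_on n W (\<lambda>z. ginv (G z) i j)"
    and "length J = 4 \<Longrightarrow> Ck_on n W (\<lambda>z. hodge 3 (G z) (V z) (P z) J)"
proof -
  define B where "B z i j = shuffle 4 (shuffle 2 (\<lambda>J. P z (i # J)) (\<lambda>J. P z (j # J))) (P z) idl" for z i j
  have B: "Ck_on n W (\<lambda>z. B z i j)" for i j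
    unfolding B_def by (intro Ck_on_shuffle[OF W] P) (simp_all add: idl_facts)
  have vol: "(V z idl)\<^sup>2 = det (gmat (G z))" "V z idl \<noteq> 0" if z: "z \<in> W" for z
    using fr[OF z] frame_volume by blast+
  have BG: "B z i j = - 6 * V z idl * G z [i, j]" if z: "z \<in> W" for z i j
  proof -
    have "(\<Sum>k\<in>UNIV. axis i 1 $ k * (\<Sum>l\<in>UNIV. G z [k, l] * axis j (1::real) $ l)) = (\<Sum>k\<in>UNIV. (if i = k then 1 else 0) * (\<Sum>l\<in>UNIV. G z [k, l] * (if j = l then 1 else 0)))"
      by (intro sum.cong refl arg_cong2[of _ _ _ _ "(*)"]) (auto simp: axis_def)
    then have "axis i 1 \<bullet> (gmat (G z) *v axis j 1) = G z [i, j]"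
      unfolding sum_if_eq by (simp add: inner_vec_def matrix_vector_mult_def gmat_def)
    then show ?thesis
      using rel[OF z, of idl "axis i 1" "axis j 1"] unfolding B_def wedge_eq_shuffle interior_axis[abs_def]
      by (simp add: idl_facts)
  qed
  \<comment> \<open>Seven rows contribute (-6 vol)^7, and det g = vol^2 raises the exponent of vol
    to nine.\<close>
  have detB: "det (\<chi> i j. B z i j) = (- 6) ^ 7 * V z idl ^ 9" if z: "z \<in> W" for z
  proof -
    have "(\<chi> i j. B z i j) = (\<chi> i. (- 6 * V z idl) *s gmat (G z) $ i)"
      by (simp add: vec_eq_iff BG[OF z] gmat_def)
    then have "det (\<chi> i j. B z i j) = (- 6 * V z idl) ^ 7 * det (gmat (G z))"
      by (simp only: det_rows_mul) (simp add: vec_lambda_eta)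
    then show ?thesis unfolding vol(1)[OF z, symmetric] power_mult_distrib by (simp add: power_add[symmetric])
  qed
  have "Ck_on n W (\<lambda>z. root 9 (det (\<chi> i j. B z i j) * (1 / (- 6) ^ 7)))"
  proof (rule Ck_on_odd_root[OF W])
    show "Ck_on n W (\<lambda>z. det (\<chi> i j. B z i j) * (1 / (- 6) ^ 7))"
      by (intro Ck_on_mult[OF W] Ck_on_det[OF W] Ck_on_const) (simp add: B)
    show "det (\<chi> i j. B z i j) * (1 / (- 6) ^ 7) \<noteq> 0" if "z \<in> W" for z
      using vol(2)[OF that] by (simp add: detB[OF that])
  qed simp
  then have vC: "Ck_on n W (\<lambda>z. V z idl)"
    by (rule Ck_on_cong[OF W, rotated]) (simp add: detB odd_real_root_power_cancel)
  have gC: "Ck_on n W (\<lambda>z. G z [i, j])" for i j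
  proof (rule Ck_on_cong[OF W])
    show "Ck_on n W (\<lambda>z. (- 1 / 6) * (inverse (V z idl) * B z i j))"
      by (intro Ck_on_mult[OF W] Ck_on_const Ck_on_inverse[OF W] vC B vol)
    show "(- 1 / 6) * (inverse (V z idl) * B z i j) = G z [i, j]" if "z \<in> W" for z
      using vol(2)[OF that] by (simp add: BG[OF that])
  qed
  have iC: "Ck_on n W (\<lambda>z. ginv (G z) i j)" for i j
    unfolding ginv_def
  proof (rule Ck_on_matrix_inv[OF W])
    show "Ck_on n W (\<lambda>z. gmat (G z) $ i $ j)" for i j by (simp add: gmat_def gC)
    show "det (gmat (G z)) \<noteq> 0" if "z \<in> W" for z using vol[OF that] by (metis zero_eq_power2)
  qed
  show "Ck_on n W (\<lambda>z. G z [i, j])" "Ck_on n W (\<lambda>z. ginv (G z) i j)" by (rule gC, rule iC)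
  show "Ck_on n W (\<lambda>z. hodge 3 (G z) (V z) (P z) J)" if J: "length J = 4"
  proof (rule Ck_on_cong[OF W])
    show "Ck_on n W (\<lambda>z. (1 / fact 3) * (\<Sum>I | length I = 3. \<Sum>K | length K = 3.
        (\<Prod>n<3. ginv (G z) (I ! n) (K ! n)) * P z K * (V z idl * - vol0 (I @ J))))"
      by (intro Ck_on_mult[OF W] Ck_on_sum[OF W] Ck_on_prod[OF W] Ck_on_const iC P vC) simp
    show "(1 / fact 3) * (\<Sum>I | length I = 3. \<Sum>K | length K = 3.
        (\<Prod>n<3. ginv (G z) (I ! n) (K ! n)) * P z K * (V z idl * - vol0 (I @ J))) = hodge 3 (G z) (V z) (P z) J"
      if z: "z \<in> W" for z
      unfolding hodge_def
    proof (intro arg_cong2[of _ _ _ _ "(*)"] sum.cong refl)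
      fix I assume "I \<in> {I :: 7 list. length I = 3}"
      then show "V z idl * - vol0 (I @ J) = V z (I @ J)"
        using alternating_7_eq[OF V[OF z], of "I @ J"] J by simp
    qed
  qed
qed

section \<open>Derivations, skew-symmetrisation and symmetric connections\<close>

text \<open>The derivation also acts on the slot occupied by the direction of differentiation. This
  extra term is the origin of the correction -A_p^q K_q in the variation of d\<psi>.\<close>

lemma act_alt1: "act A (alt1 D) I = alt1 (\<lambda>p J. (\<Sum>q\<in>UNIV. A p q * D q J) + act A (D p) J) I"
proof (induction I arbitrary: D)
  case (Cons x I)
  have "act A (alt1 D) (x # I) = (\<Sum>m\<in>UNIV. A x m * D m I) - (\<Sum>m\<in>UNIV. A x m * alt1 (\<lambda>p J. D p (m # J)) I)
      + act A (D x) I - act A (alt1 (\<lambda>p J. D p (x # J))) I"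
    using act_add[of A "D x" "\<lambda>I. - 1 * alt1 (\<lambda>p J. D p (x # J)) I" I] act_scale[of A "- 1"]
    by (simp add: right_diff_distrib sum_subtractf)
  also have "(\<Sum>m\<in>UNIV. A x m * alt1 (\<lambda>p J. D p (m # J)) I) = alt1 (\<lambda>p J. \<Sum>m\<in>UNIV. A x m * D p (m # J)) I"
    by (simp only: alt1_sum alt1_scale)
  finally show ?case
    unfolding Cons.IH alt1.simps act.simps by (simp add: alt1_add)
qed simp

text \<open>Actions on different slots commute, so only the matrix commutator on a common slot is
  left: \<open>act\<close> represents the Lie algebra of endomorphisms.\<close>

lemma act_commutator:
  "act C (act A T) J - act A (act C T) J = act (\<lambda>i m. (\<Sum>k\<in>UNIV. C i k * A k m) - (\<Sum>k\<in>UNIV. A i k * C k m)) T J"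
proof (induction J arbitrary: T)
  case (Cons x J)
  have e: "act C (act A T) (x # J) = (\<Sum>k\<in>UNIV. (\<Sum>m\<in>UNIV. C x m * A m k) * T (k # J))
      + (\<Sum>m\<in>UNIV. C x m * act A (\<lambda>P. T (m # P)) J) + (\<Sum>k\<in>UNIV. A x k * act C (\<lambda>P. T (k # P)) J)
      + act C (act A (\<lambda>P. T (x # P))) J" for C A
  proof -
    have "(\<Sum>m\<in>UNIV. C x m * (\<Sum>k\<in>UNIV. A m k * T (k # J))) = (\<Sum>k\<in>UNIV. (\<Sum>m\<in>UNIV. C x m * A m k) * T (k # J))"
      unfolding sum_distrib_left sum_distrib_right by (subst sum.swap) (simp only: mult_ac)
    then show ?thesis by (simp add: distrib_left sum.distrib act_add act_sum act_scale)
  qed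
  show ?case
    using Cons.IH[of "\<lambda>P. T (x # P)"] unfolding e by (simp add: left_diff_distrib sum_subtractf)
qed simp

text \<open>Skew-symmetrisation pairs the direction p with the slot on which \<Gamma> acts, and the
  symmetric pair cancels. Thus a torsion-free connection drops out of the exterior derivative of a
  form.\<close>

lemma alt1_act_symmetric:
  assumes \<Gamma>: "\<And>p i m. \<Gamma> p i m = \<Gamma> i p m"
  shows "alternating 3 T \<Longrightarrow> length J = 4 \<Longrightarrow> alt1 (\<lambda>p. act (\<Gamma> p) T) J = 0"
    and "alternating 4 T \<Longrightarrow> length J = 5 \<Longrightarrow> alt1 (\<lambda>p. act (\<Gamma> p) T) J = 0"
proof -
  show "alt1 (\<lambda>p. act (\<Gamma> p) T) J = 0" if T: "alternating 3 T" and "length J = 4"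
  proof -
    from that(2) obtain a b c d where J: "J = [a, b, c, d]" by (auto simp: length_Suc_conv numeral_eq_Suc)
    have T': "T [p, m, q] = - T [m, p, q]" "T [p, q, m] = T [m, p, q]" for p q m
      using alternating_3D(1,2)[OF T] by metis+
    have "alt1 (\<lambda>p. act (\<Gamma> p) T) J = (\<Sum>m\<in>UNIV.
        (\<Gamma> a b m * T [m, c, d] + \<Gamma> a c m * T [b, m, d] + \<Gamma> a d m * T [b, c, m])
      - (\<Gamma> b a m * T [m, c, d] + \<Gamma> b c m * T [a, m, d] + \<Gamma> b d m * T [a, c, m])
      + (\<Gamma> c a m * T [m, b, d] + \<Gamma> c b m * T [a, m, d] + \<Gamma> c d m * T [a, b, m])
      - (\<Gamma> d a m * T [m, b, c] + \<Gamma> d b m * T [a, m, c] + \<Gamma> d c m * T [a, b, m]))"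
      unfolding J by (simp add: sum.distrib sum_subtractf)
    also have "\<dots> = 0"
    proof (rule sum.neutral, rule ballI)
      fix m
      have "T [p, m, q] = - T [m, p, q]" "T [p, q, m] = T [m, p, q]" for p q
        by (rule T')+
      moreover have "\<Gamma> b a m = \<Gamma> a b m" "\<Gamma> c a m = \<Gamma> a c m" "\<Gamma> d a m = \<Gamma> a d m" "\<Gamma> c b m = \<Gamma> b c m"
        "\<Gamma> d b m = \<Gamma> b d m" "\<Gamma> d c m = \<Gamma> c d m"
        by (rule \<Gamma>)+
      ultimately show "(\<Gamma> a b m * T [m, c, d] + \<Gamma> a c m * T [b, m, d] + \<Gamma> a d m * T [b, c, m])
      - (\<Gamma> b a m * T [m, c, d] + \<Gamma> b c m * T [a, m, d] + \<Gamma> b d m * T [a, c, m])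
      + (\<Gamma> c a m * T [m, b, d] + \<Gamma> c b m * T [a, m, d] + \<Gamma> c d m * T [a, b, m])
      - (\<Gamma> d a m * T [m, b, c] + \<Gamma> d b m * T [a, m, c] + \<Gamma> d c m * T [a, b, m]) = 0"
        by (simp only:; simp add: algebra_simps)
    qed
    finally show ?thesis .
  qed
  show "alt1 (\<lambda>p. act (\<Gamma> p) T) J = 0" if T: "alternating 4 T" and "length J = 5"
  proof -
    from that(2) obtain a b c d e where J: "J = [a, b, c, d, e]" by (auto simp: length_Suc_conv numeral_eq_Suc)
    have T': "T [p, m, q, r] = - T [m, p, q, r]" "T [p, q, m, r] = T [m, p, q, r]" "T [p, q, r, m] = - T [m, p, q, r]" for p q r m
      using alternating_4D(1-3)[OF T] by (metis add.inverse_inverse)+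
    have "alt1 (\<lambda>p. act (\<Gamma> p) T) J = (\<Sum>m\<in>UNIV.
        (\<Gamma> a b m * T [m, c, d, e] + \<Gamma> a c m * T [b, m, d, e] + \<Gamma> a d m * T [b, c, m, e] + \<Gamma> a e m * T [b, c, d, m])
      - (\<Gamma> b a m * T [m, c, d, e] + \<Gamma> b c m * T [a, m, d, e] + \<Gamma> b d m * T [a, c, m, e] + \<Gamma> b e m * T [a, c, d, m])
      + (\<Gamma> c a m * T [m, b, d, e] + \<Gamma> c b m * T [a, m, d, e] + \<Gamma> c d m * T [a, b, m, e] + \<Gamma> c e m * T [a, b, d, m])
      - (\<Gamma> d a m * T [m, b, c, e] + \<Gamma> d b m * T [a, m, c, e] + \<Gamma> d c m * T [a, b, m, e] + \<Gamma> d e m * T [a, b, c, m])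
      + (\<Gamma> e a m * T [m, b, c, d] + \<Gamma> e b m * T [a, m, c, d] + \<Gamma> e c m * T [a, b, m, d] + \<Gamma> e d m * T [a, b, c, m]))"
      unfolding J by (simp add: sum.distrib sum_subtractf)
    also have "\<dots> = 0"
    proof (rule sum.neutral, rule ballI)
      fix m
      have "T [p, m, q, r] = - T [m, p, q, r]" "T [p, q, m, r] = T [m, p, q, r]" "T [p, q, r, m] = - T [m, p, q, r]" for p q r
        by (rule T')+
      moreover have "\<Gamma> b a m = \<Gamma> a b m" "\<Gamma> c a m = \<Gamma> a c m" "\<Gamma> d a m = \<Gamma> a d m" "\<Gamma> e a m = \<Gamma> a e m" "\<Gamma> c b m = \<Gamma> b c m"
        "\<Gamma> d b m = \<Gamma> b d m" "\<Gamma> e b m = \<Gamma> b e m" "\<Gamma> d c m = \<Gamma> c d m" "\<Gamma> e c m = \<Gamma> c e m" "\<Gamma> e d m = \<Gamma> d e m"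
        by (rule \<Gamma>)+
      ultimately show "(\<Gamma> a b m * T [m, c, d, e] + \<Gamma> a c m * T [b, m, d, e] + \<Gamma> a d m * T [b, c, m, e] + \<Gamma> a e m * T [b, c, d, m])
      - (\<Gamma> b a m * T [m, c, d, e] + \<Gamma> b c m * T [a, m, d, e] + \<Gamma> b d m * T [a, c, m, e] + \<Gamma> b e m * T [a, c, d, m])
      + (\<Gamma> c a m * T [m, b, d, e] + \<Gamma> c b m * T [a, m, d, e] + \<Gamma> c d m * T [a, b, m, e] + \<Gamma> c e m * T [a, b, d, m])
      - (\<Gamma> d a m * T [m, b, c, e] + \<Gamma> d b m * T [a, m, c, e] + \<Gamma> d c m * T [a, b, m, e] + \<Gamma> d e m * T [a, b, c, m])
      + (\<Gamma> e a m * T [m, b, c, d] + \<Gamma> e b m * T [a, m, c, d] + \<Gamma> e c m * T [a, b, m, d] + \<Gamma> e d m * T [a, b, c, m]) = 0"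
        by (simp only:; simp add: algebra_simps)
    qed
    finally show ?thesis .
  qed
qed

lemma act_deriv:
  assumes "\<And>i m. ((\<lambda>r. A r i m) has_real_derivative A' i m) (at t)"
    and "\<And>I. length I = length J \<Longrightarrow> ((\<lambda>r. T r I) has_real_derivative T' I) (at t)"
  shows "((\<lambda>r. act (A r) (T r) J) has_real_derivative act A' (T t) J + act (A t) T' J) (at t)"
  using assms(2)
proof (induction J arbitrary: T T')
  case (Cons x J)
  have "((\<lambda>r. \<Sum>m\<in>UNIV. A r x m * T r (m # J)) has_real_derivative
      (\<Sum>m\<in>UNIV. A' x m * T t (m # J) + T' (m # J) * A t x m)) (at t)"
    by (intro DERIV_sum DERIV_mult assms(1) Cons.prems) simp
  from DERIV_add[OF this Cons.IH[of "\<lambda>r P. T r (x # P)" "\<lambda>P. T' (x # P)"]] Cons.prems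
  show ?case by (simp add: sum.distrib algebra_simps)
qed simp

lemma nabla_eq_act: "nabla g T x p I = pd p (\<lambda>y. T y I) x - act (\<lambda>i m. christoffel g x m p i) (T x) I"
proof -
  have "(\<Sum>n<length I. \<Sum>m\<in>UNIV. C (I ! n) m * S (I[n := m])) = act C S I" for C and S :: tensor
    by (induction I arbitrary: S) (auto simp: sum.lessThan_Suc_shift simp del: sum.lessThan_Suc)
  then show ?thesis by (simp add: nabla_def)
qed

subsection \<open>The intrinsic torsion in a chart\<close>

lemma pd_cong:
  assumes "open U" "x \<in> U" "f differentiable (at x)" "\<And>y. y \<in> U \<Longrightarrow> f y = g y"
  shows "pd p f x = pd p g x"
proof -
  have "(g has_derivative frechet_derivative f (at x)) (at x)"
    using assms frechet_derivative_works[of f "at x"]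
    by (intro has_derivative_transform_within_open[of f _ x UNIV U g]) auto
  from frechet_derivative_at[OF this] show ?thesis by (simp add: pd_def)
qed

text \<open>The h-terms are \<open>act\<close> of h by definition; in the frame X \<lrcorner> \<phi>
  acts as -3 X \<lrcorner> \<psi>, so the factor -1/3 reproduces the X-term of the flow.\<close>

lemma flow_eq_act:
  assumes frame: "g2_frame L P G V"
  shows "(\<Sum>l\<in>UNIV. raise1 G h l i * P [l, j, k] + raise1 G h l j * P [i, l, k] + raise1 G h l k * P [i, j, l]
      + X $ l * hodge 3 G V P [l, i, j, k]) = act (up G (\<lambda>I. h I - 1 / 3 * interior X P I)) P [i, j, k]"
proof -
  from frame obtain M where L_M: "L ** M = mat 1" by (auto simp: g2_frame_def invertible_def)
  have r: "raise1 G h l i = up G h i l" for l i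
    unfolding raise1_def up_def by (subst frame_ginv_sym[OF frame]) (simp add: mult.commute)
  have u: "up G (\<lambda>I. h I - 1 / 3 * interior X P I) i m = up G h i m - (1 / 3) * up G (interior X P) i m" for i m
    unfolding up_def by (simp add: left_diff_distrib sum_subtractf sum_distrib_left)
  have "act (up G (interior X P)) P [i, j, k] = pb L (act (conj_by M L (up G (interior X P))) phi0) [i, j, k]"
    by (rule act_hat[OF frame L_M]) (simp add: frame_phi[OF frame])
  also have "\<dots> = pb L (\<lambda>I. - 3 * interior (L *v X) psi0 I) [i, j, k]"
  proof (rule pb_cong)
    fix I :: "7 list" assume "length I = length [i, j, k]"
    then obtain a b c where I: "I = [a, b, c]" by (auto simp: length_Suc_conv)
    have "conj_by M L (up G (interior X P)) = vphi (\<lambda>n. (L *v X) $ n)"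
      by (intro ext) (simp only: up_hat[OF frame L_M] interior_hat[OF frame L_M])
    then have "act (conj_by M L (up G (interior X P))) phi0 [a, b, c]
        = (\<Sum>n\<in>UNIV. vec_of (vphi (\<lambda>n. (L *v X) $ n)) n * psi0 [n, a, b, c])"
      by (simp only:) (rule skew_act_phi0, rule vphi_swap)
    then show "act (conj_by M L (up G (interior X P))) phi0 I = - 3 * interior (L *v X) psi0 I"
      unfolding I vec_of_vphi interior_def by (simp add: sum_distrib_left mult.assoc)
  qed
  also have "\<dots> = - 3 * pb L (interior (L *v X) psi0) [i, j, k]" by (rule pb_scale)
  also have "pb L (interior (L *v X) psi0) [i, j, k] = interior X (hodge 3 G V P) [i, j, k]"
    by (rule interior_pb[symmetric]) (simp add: g2_frame_psi[OF frame])
  finally have "act (up G (interior X P)) P [i, j, k] = - 3 * (\<Sum>l\<in>UNIV. X $ l * hodge 3 G V P [l, i, j, k])"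
    by (simp only: interior_def[of X "hodge 3 G V P"])
  then have "act (up G (\<lambda>I. h I - 1 / 3 * interior X P I)) P [i, j, k]
      = act (up G h) P [i, j, k] + (\<Sum>l\<in>UNIV. X $ l * hodge 3 G V P [l, i, j, k])"
    unfolding u[abs_def] act_diff_left act_scale_left by simp
  then show ?thesis by (simp add: r sum.distrib)
qed

text \<open>Frames are available on a neighbourhood but derivatives are taken only at x; short
  coordinate segments through x stay inside U.\<close>

locale local_G2 =
  fixes U :: "(real^7) set" and x :: "real^7" and P G V :: "real^7 \<Rightarrow> tensor"
  assumes U: "open U" "x \<in> U" and frames: "\<And>y. y \<in> U \<Longrightarrow> \<exists>L. g2_frame L (P y) (G y) (V y)"
    and alt: "\<And>y. y \<in> U \<Longrightarrow> alternating 3 (P y)"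
    and P_diff: "\<And>I. length I = 3 \<Longrightarrow> (\<lambda>y. P y I) differentiable (at x)"
    and G_diff: "\<And>i j. (\<lambda>y. G y [i, j]) differentiable (at x)"
    and ginv_diff: "\<And>i j. (\<lambda>y. ginv (G y) i j) differentiable (at x)"
    and psi_diff: "\<And>I. length I = 4 \<Longrightarrow> (\<lambda>y. hodge 3 (G y) (V y) (P y) I) differentiable (at x)"
begin

definition \<Gamma> :: "7 \<Rightarrow> 7 \<Rightarrow> 7 \<Rightarrow> real" where
  "\<Gamma> p i m = christoffel G x m p i"

abbreviation (input) "\<Psi> \<equiv> \<lambda>y. hodge 3 (G y) (V y) (P y)"

lemma eventually_along: "\<forall>\<^sub>F r in nhds (0::real). x + r *\<^sub>R axis p 1 \<in> U"
proof -
  have "((\<lambda>r::real. x + r *\<^sub>R axis p 1) \<longlongrightarrow> x + 0 *\<^sub>R axis p 1) (nhds 0)"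
    by (intro tendsto_add tendsto_const tendsto_scaleR filterlim_ident)
  then show ?thesis using U topological_tendstoD by fastforce
qed

lemma frames_along: "\<forall>\<^sub>F r in nhds 0. \<exists>L. g2_frame L (P (x + r *\<^sub>R axis p 1)) (G (x + r *\<^sub>R axis p 1)) (V (x + r *\<^sub>R axis p 1))"
  using eventually_along by (rule eventually_mono) (rule frames)

lemma \<Gamma>_symmetric: "\<Gamma> p i m = \<Gamma> i p m"
proof -
  have "pd l (\<lambda>y. G y [p, i]) x = pd l (\<lambda>y. G y [i, p]) x" for l p i
    by (rule pd_cong[OF U G_diff]) (use frames frame_metric_sym in blast)
  then show ?thesis unfolding \<Gamma>_def christoffel_def by (simp only: add.commute)
qed

text \<open>Lowering the upper index of the Christoffel symbol removes the inverse metric, and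
  adding the expression with i and j exchanged cancels every derivative except the one in direction
  p.\<close>

lemma pd_metric: "pd p (\<lambda>y. G y [i, j]) x = act (\<Gamma> p) (G x) [i, j]"
proof -
  obtain L where L: "g2_frame L (P x) (G x) (V x)" using frames[OF U(2)] by blast
  have s: "pd l (\<lambda>y. G y [p, i]) x = pd l (\<lambda>y. G y [i, p]) x" for l p i
    by (rule pd_cong[OF U G_diff]) (use frames frame_metric_sym in blast)
  have "(\<Sum>m\<in>UNIV. \<Gamma> p i m * G x [m, j]) = 1 / 2 * (pd p (\<lambda>y. G y [i, j]) x + pd i (\<lambda>y. G y [p, j]) x - pd j (\<lambda>y. G y [p, i]) x)" for i j
  proof -
    have "(\<Sum>m\<in>UNIV. \<Gamma> p i m * G x [m, j]) = (\<Sum>l\<in>UNIV. (1 / 2 * (pd p (\<lambda>y. G y [i, l]) x + pd i (\<lambda>y. G y [p, l]) x - pd l (\<lambda>y. G y [p, i]) x))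
        * (\<Sum>m\<in>UNIV. ginv (G x) l m * G x [m, j]))"
      unfolding \<Gamma>_def christoffel_def sum_distrib_left sum_distrib_right
      by (subst sum.swap) (simp only: frame_ginv_sym[OF L, of _ m for m] mult_ac)
    then show ?thesis unfolding frame_ginv[OF L] sum_if_eq .
  qed note e = this
  have "act (\<Gamma> p) (G x) [i, j] = (\<Sum>m\<in>UNIV. \<Gamma> p i m * G x [m, j]) + (\<Sum>m\<in>UNIV. \<Gamma> p j m * G x [m, i])"
    by (simp add: frame_metric_sym[OF L, of i])
  then show ?thesis unfolding e using s[of p j i] by (simp add: field_simps)
qed

lemma metric_along: "((\<lambda>r. G (x + r *\<^sub>R axis p 1) [i, j]) has_real_derivative act (\<Gamma> p) (G x) [i, j]) (at 0)"
  using pd_eq_derivative[OF G_diff] unfolding pd_metric .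

lemma pd_ginv: "pd p (\<lambda>y. ginv (G y) i j) x = - (\<Sum>k\<in>UNIV. \<Gamma> p k i * ginv (G x) k j + \<Gamma> p k j * ginv (G x) i k)"
proof (rule pd_unique[OF ginv_diff])
  show "((\<lambda>r. ginv (G (x + r *\<^sub>R axis p 1)) i j) has_real_derivative
      - (\<Sum>k\<in>UNIV. \<Gamma> p k i * ginv (G x) k j + \<Gamma> p k j * ginv (G x) i k)) (at 0)"
    using ginv_deriv[OF frames_along, of p "\<Gamma> p"] metric_along pd_eq_derivative[OF ginv_diff] by fastforce
qed

text \<open>The partial derivatives of \<phi> are again 3-forms, so they equal
  \<open>act (C p)\<close> of \<phi> for some C. By the variation lemma along coordinate lines, the
  same C differentiates g and \<psi>. Since \<Gamma> also differentiates g, the difference of C and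
  \<Gamma> annihilates the metric.\<close>

lemma torsion_connection:
  "\<exists>K. (\<forall>p I. length I = 3 \<longrightarrow> pd p (\<lambda>y. P y I) x = act (K p) (P x) I + act (\<Gamma> p) (P x) I) \<and>
       (\<forall>p I. length I = 4 \<longrightarrow> pd p (\<lambda>y. \<Psi> y I) x = act (K p) (\<Psi> x) I + act (\<Gamma> p) (\<Psi> x) I) \<and>
       (\<forall>p i j. act (K p) (G x) [i, j] = 0)"
proof -
  obtain L where L: "g2_frame L (P x) (G x) (V x)" using frames[OF U(2)] by blast
  then obtain M where L_M: "L ** M = mat 1" by (auto simp: g2_frame_def invertible_def)
  then have M_L: "M ** L = mat 1" by (simp add: matrix_left_right_inverse)
  have "\<exists>A. \<forall>I. length I = 3 \<longrightarrow> pd p (\<lambda>y. P y I) x = act A (P x) I" for p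
  proof -
    define w where "w I = pd p (\<lambda>y. P y I) x" for I
    have "alternating 3 w"
      unfolding alternating_def
    proof (intro allI impI, elim conjE)
      fix I :: "7 list" and m n :: nat assume I: "length I = 3" and mn: "m < n" "n < 3"
      show "w (I[m := I ! n, n := I ! m]) = - w I"
        unfolding w_def
      proof (rule pd_unique)
        show "(\<lambda>y. P y (I[m := I ! n, n := I ! m])) differentiable at x" by (rule P_diff) (simp add: I)
        have ev: "\<forall>\<^sub>F r in nhds 0. P (x + r *\<^sub>R axis p 1) (I[m := I ! n, n := I ! m]) = - P (x + r *\<^sub>R axis p 1) I"
          using eventually_along by (rule eventually_mono) (use alt I mn in \<open>auto simp: alternating_def\<close>)
        show "((\<lambda>r. P (x + r *\<^sub>R axis p 1) (I[m := I ! n, n := I ! m])) has_real_derivative - pd p (\<lambda>y. P y I) x) (at 0)"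
          using DERIV_minus[OF pd_eq_derivative[OF P_diff[OF I], of p]] DERIV_cong_ev[OF refl ev refl] by blast
      qed
    qed
    then have "alternating 3 (pb M w)" by (rule pb_alternating)
    then obtain A where A: "pb M w I = act A phi0 I" if "length I = 3" for I
      using alternating_3_act by blast
    have "w I = act (conj_by L M A) (P x) I" if I: "length I = 3" for I
    proof -
      have "w I = pb L (pb M w) I" by (simp add: pb_inverse[OF M_L])
      also have "\<dots> = pb L (act A phi0) I" by (rule pb_cong) (simp add: A I)
      also have "\<dots> = act (conj_by L M A) (P x) I"
        unfolding pb_act[OF L_M] by (rule act_cong) (simp add: I frame_phi[OF L])
      finally show ?thesis .
    qed
    then show ?thesis unfolding w_def by blast
  qed
  then obtain C where C: "pd p (\<lambda>y. P y I) x = act (C p) (P x) I" if "length I = 3" for p I by metis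
  \<comment> \<open>The base point is kept as \<open>x + 0 *\<^sub>R axis p 1\<close>, the form in
    which \<open>variation\<close> at parameter 0 expects it.\<close>
  have along: "((\<lambda>r. P (x + r *\<^sub>R axis p 1) I) has_real_derivative act (C p) (P (x + 0 *\<^sub>R axis p 1)) I) (at 0)"
    if "length I = 3" for p I
    using pd_eq_derivative[OF P_diff[OF that], of p] C[OF that, of p] by simp
  have G': "act (C p) (G x) [i, j] = act (\<Gamma> p) (G x) [i, j]" for p i j
  proof -
    have "((\<lambda>r. G (x + r *\<^sub>R axis p 1) [i, j]) has_real_derivative act (C p) (G (x + 0 *\<^sub>R axis p 1)) [i, j]) (at 0)"
      by (rule variation(1)[OF frames_along along metric_along pd_eq_derivative[OF ginv_diff]])
    then show ?thesis using DERIV_unique[OF metric_along] by fastforce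
  qed
  have Psi': "pd p (\<lambda>y. \<Psi> y I) x = act (C p) (\<Psi> x) I" if I: "length I = 4" for p I
  proof (rule pd_unique[OF psi_diff[OF I]])
    have "((\<lambda>r. \<Psi> (x + r *\<^sub>R axis p 1) I) has_real_derivative act (C p) (\<Psi> (x + 0 *\<^sub>R axis p 1)) I) (at 0)"
      by (rule variation(2)[OF frames_along along metric_along pd_eq_derivative[OF ginv_diff] I])
    then show "((\<lambda>r. \<Psi> (x + r *\<^sub>R axis p 1) I) has_real_derivative act (C p) (\<Psi> x) I) (at 0)" by simp
  qed
  show ?thesis
    by (rule exI[of _ "\<lambda>p i m. C p i m - \<Gamma> p i m"]) (simp add: act_diff_left C G' Psi' del: act.simps(2))
qed

end

lemma alt1_deriv:
  assumes "\<And>p J. Suc (length J) = length I \<Longrightarrow> ((\<lambda>r. D r p J) has_real_derivative D' p J) (at t)"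
  shows "((\<lambda>r. alt1 (D r) I) has_real_derivative alt1 D' I) (at t)"
  using assms
proof (induction I arbitrary: D D')
  case (Cons x I)
  show ?case
    unfolding alt1.simps by (intro DERIV_diff Cons.prems Cons.IH) auto
qed simp

locale local_flow = local_G2 +
  fixes h :: "real^7 \<Rightarrow> tensor" and X :: "real^7 \<Rightarrow> real^7" and K :: "7 \<Rightarrow> 7 \<Rightarrow> 7 \<Rightarrow> real"
  assumes h_diff: "\<And>i j. (\<lambda>y. h y [i, j]) differentiable (at x)"
    and X_diff: "\<And>n. (\<lambda>y. X y $ n) differentiable (at x)"
    and pd_P: "\<And>p I. length I = 3 \<Longrightarrow> pd p (\<lambda>y. P y I) x = act (K p) (P x) I + act (\<Gamma> p) (P x) I"
    and pd_psi: "\<And>p I. length I = 4 \<Longrightarrow> pd p (\<lambda>y. hodge 3 (G y) (V y) (P y) I) x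
        = act (K p) (hodge 3 (G x) (V x) (P x)) I + act (\<Gamma> p) (hodge 3 (G x) (V x) (P x)) I"
    and V_alt: "alternating 7 (V x)"
begin

text \<open>The covariant derivative of X with its vector index up; \<open>nabla_lower_X\<close>
  relates it to \<open>nabla\<close> of the lowered field.\<close>

definition DX :: "7 \<Rightarrow> real^7" where
  "DX p = (\<chi> n. pd p (\<lambda>y. X y $ n) x + (\<Sum>k\<in>UNIV. X x $ k * \<Gamma> p k n))"

abbreviation (input) "vt \<equiv> \<lambda>y I. h y I - 1 / 3 * interior (X y) (P y) I"
abbreviation (input) "A \<equiv> \<lambda>y. velocity (P y) (G y) (h y) (X y)"
abbreviation (input) "nvt \<equiv> \<lambda>p I. nabla G h x p I - 1 / 3 * (interior (DX p) (P x) I + interior (X x) (act (K p) (P x)) I)"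

lemma nabla_act: "nabla G T x p I = pd p (\<lambda>y. T y I) x - act (\<Gamma> p) (T x) I"
  unfolding nabla_eq_act \<Gamma>_def[abs_def] ..

lemma along: "f differentiable (at x) \<Longrightarrow> ((\<lambda>r. f (x + r *\<^sub>R axis p 1)) has_real_derivative pd p f x) (at 0)"
  by (rule pd_eq_derivative)

lemma vt_along:
  "((\<lambda>r. vt (x + r *\<^sub>R axis p 1) [i, l]) has_real_derivative nvt p [i, l] + act (\<Gamma> p) (vt x) [i, l]) (at 0)"
proof -
  have 1: "((\<lambda>r. \<Sum>n\<in>UNIV. X (x + r *\<^sub>R axis p 1) $ n * P (x + r *\<^sub>R axis p 1) [n, i, l]) has_real_derivative
      (\<Sum>n\<in>UNIV. pd p (\<lambda>y. X y $ n) x * P x [n, i, l]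
        + (act (K p) (P x) [n, i, l] + act (\<Gamma> p) (P x) [n, i, l]) * X x $ n)) (at 0)"
  proof (intro DERIV_sum)
    fix n
    show "((\<lambda>r. X (x + r *\<^sub>R axis p 1) $ n * P (x + r *\<^sub>R axis p 1) [n, i, l]) has_real_derivative
      pd p (\<lambda>y. X y $ n) x * P x [n, i, l]
        + (act (K p) (P x) [n, i, l] + act (\<Gamma> p) (P x) [n, i, l]) * X x $ n) (at 0)"
      using DERIV_mult[OF along[OF X_diff[of n], of p] along[OF P_diff[of "[n, i, l]"], of p]]
      by (simp add: pd_P del: act.simps(2))
  qed
  have 2: "(\<Sum>n\<in>UNIV. pd p (\<lambda>y. X y $ n) x * P x [n, i, l]
        + (act (K p) (P x) [n, i, l] + act (\<Gamma> p) (P x) [n, i, l]) * X x $ n)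
      = interior (DX p) (P x) [i, l] + interior (X x) (act (K p) (P x)) [i, l] + act (\<Gamma> p) (interior (X x) (P x)) [i, l]"
  proof -
    have a: "act (\<Gamma> p) (P x) [n, i, l] = (\<Sum>k\<in>UNIV. \<Gamma> p n k * P x [k, i, l]) + act (\<Gamma> p) (\<lambda>Q. P x (n # Q)) [i, l]" for n
      by simp
    have b: "act (\<Gamma> p) (interior (X x) (P x)) [i, l] = (\<Sum>n\<in>UNIV. X x $ n * act (\<Gamma> p) (\<lambda>Q. P x (n # Q)) [i, l])"
      unfolding interior_def[abs_def] act_sum act_scale ..
    have c: "interior (DX p) (P x) [i, l] = (\<Sum>n\<in>UNIV. pd p (\<lambda>y. X y $ n) x * P x [n, i, l])
        + (\<Sum>n\<in>UNIV. (\<Sum>k\<in>UNIV. \<Gamma> p n k * P x [k, i, l]) * X x $ n)"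
    proof -
      have "(\<Sum>n\<in>UNIV. (\<Sum>k\<in>UNIV. X x $ k * \<Gamma> p k n) * P x [n, i, l]) = (\<Sum>n\<in>UNIV. (\<Sum>k\<in>UNIV. \<Gamma> p n k * P x [k, i, l]) * X x $ n)"
        unfolding sum_distrib_right by (subst sum.swap) (simp only: mult_ac)
      then show ?thesis by (simp add: interior_def DX_def distrib_right sum.distrib)
    qed
    have d: "interior (X x) (act (K p) (P x)) [i, l] = (\<Sum>n\<in>UNIV. act (K p) (P x) [n, i, l] * X x $ n)"
      unfolding interior_def by (simp only: mult.commute)
    have e: "(\<Sum>n\<in>UNIV. act (\<Gamma> p) (\<lambda>Q. P x (n # Q)) [i, l] * X x $ n) = (\<Sum>n\<in>UNIV. X x $ n * act (\<Gamma> p) (\<lambda>Q. P x (n # Q)) [i, l])"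
      by (simp only: mult.commute)
    show ?thesis unfolding a b c d by (simp add: distrib_right sum.distrib e del: act.simps(2))
  qed
  have 3: "act (\<Gamma> p) (vt x) [i, l] = act (\<Gamma> p) (h x) [i, l] - 1 / 3 * act (\<Gamma> p) (interior (X x) (P x)) [i, l]"
    using act_add[of "\<Gamma> p" "h x" "\<lambda>I. (- 1 / 3) * interior (X x) (P x) I" "[i, l]"]
    unfolding act_scale by (simp del: act.simps(2))
  have "((\<lambda>r. h (x + r *\<^sub>R axis p 1) [i, l]
        - 1 / 3 * (\<Sum>n\<in>UNIV. X (x + r *\<^sub>R axis p 1) $ n * P (x + r *\<^sub>R axis p 1) [n, i, l])) has_real_derivative
      pd p (\<lambda>y. h y [i, l]) x - 1 / 3 * (interior (DX p) (P x) [i, l] + interior (X x) (act (K p) (P x)) [i, l] + act (\<Gamma> p) (interior (X x) (P x)) [i, l])) (at 0)"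
    by (intro DERIV_diff DERIV_cmult along h_diff 1[unfolded 2])
  moreover have "pd p (\<lambda>y. h y [i, l]) x - 1 / 3 * (interior (DX p) (P x) [i, l] + interior (X x) (act (K p) (P x)) [i, l] + act (\<Gamma> p) (interior (X x) (P x)) [i, l])
      = nvt p [i, l] + act (\<Gamma> p) (vt x) [i, l]"
    unfolding 3 nabla_act by (simp add: algebra_simps del: act.simps(2))
  ultimately show ?thesis by (simp only: interior_def[of "X (_ + _)"])
qed

text \<open>With one index down and one up, the connection terms of the partial derivative form the
  commutator of \<Gamma>_p with the velocity.\<close>

lemma velocity_along:
  "((\<lambda>r. A (x + r *\<^sub>R axis p 1) i m) has_real_derivative velocity_deriv (P x) (G x) (X x) (nabla G h x) DX K p i m
     + ((\<Sum>k\<in>UNIV. \<Gamma> p i k * A x k m) - (\<Sum>k\<in>UNIV. A x i k * \<Gamma> p k m))) (at 0)"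
proof -
  define a where "a = vt x"
  define g where "g = ginv (G x)"
  have 1: "((\<lambda>r. A (x + r *\<^sub>R axis p 1) i m) has_real_derivative
      (\<Sum>l\<in>UNIV. (nvt p [i, l] + act (\<Gamma> p) a [i, l]) * g l m
        + - (\<Sum>k\<in>UNIV. \<Gamma> p k l * g k m + \<Gamma> p k m * g l k) * a [i, l])) (at 0)"
    unfolding velocity_def up_def
  proof (intro DERIV_sum)
    fix l
    show "((\<lambda>r. vt (x + r *\<^sub>R axis p 1) [i, l] * ginv (G (x + r *\<^sub>R axis p 1)) l m) has_real_derivative
       (nvt p [i, l] + act (\<Gamma> p) a [i, l]) * g l m + - (\<Sum>k\<in>UNIV. \<Gamma> p k l * g k m + \<Gamma> p k m * g l k) * a [i, l]) (at 0)"
      using DERIV_mult[OF vt_along[of p i l] along[OF ginv_diff[of l m], of p]]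
      unfolding pd_ginv a_def g_def by (simp del: act.simps(2))
  qed
  have "(\<Sum>l\<in>UNIV. (nvt p [i, l] + act (\<Gamma> p) a [i, l]) * g l m
        + - (\<Sum>k\<in>UNIV. \<Gamma> p k l * g k m + \<Gamma> p k m * g l k) * a [i, l])
     = (\<Sum>l\<in>UNIV. nvt p [i, l] * g l m) + (\<Sum>l\<in>UNIV. (\<Sum>k\<in>UNIV. \<Gamma> p i k * a [k, l]) * g l m)
       + (\<Sum>l\<in>UNIV. (\<Sum>k\<in>UNIV. \<Gamma> p l k * a [i, k]) * g l m)
       - (\<Sum>l\<in>UNIV. (\<Sum>k\<in>UNIV. \<Gamma> p k l * g k m) * a [i, l]) - (\<Sum>l\<in>UNIV. (\<Sum>k\<in>UNIV. \<Gamma> p k m * g l k) * a [i, l])"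
  proof -
    have "(N + act (\<Gamma> p) a [i, l]) * g l m + - (\<Sum>k\<in>UNIV. \<Gamma> p k l * g k m + \<Gamma> p k m * g l k) * a [i, l]
       = N * g l m + (\<Sum>k\<in>UNIV. \<Gamma> p i k * a [k, l]) * g l m + (\<Sum>k\<in>UNIV. \<Gamma> p l k * a [i, k]) * g l m
        - (\<Sum>k\<in>UNIV. \<Gamma> p k l * g k m) * a [i, l] - (\<Sum>k\<in>UNIV. \<Gamma> p k m * g l k) * a [i, l]" for l N
      by (simp add: sum.distrib distrib_right left_diff_distrib)
    then show ?thesis by (simp only: sum.distrib sum_subtractf)
  qed
  moreover have "(\<Sum>l\<in>UNIV. (\<Sum>k\<in>UNIV. \<Gamma> p l k * a [i, k]) * g l m) = (\<Sum>l\<in>UNIV. (\<Sum>k\<in>UNIV. \<Gamma> p k l * g k m) * a [i, l])"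
    unfolding sum_distrib_right by (subst sum.swap) (simp only: mult_ac)
  moreover have "(\<Sum>l\<in>UNIV. (\<Sum>k\<in>UNIV. \<Gamma> p i k * a [k, l]) * g l m) = (\<Sum>k\<in>UNIV. \<Gamma> p i k * A x k m)"
    unfolding velocity_def up_def a_def[symmetric] g_def[symmetric] sum_distrib_right sum_distrib_left
    by (subst sum.swap) (simp only: mult_ac)
  moreover have "(\<Sum>l\<in>UNIV. (\<Sum>k\<in>UNIV. \<Gamma> p k m * g l k) * a [i, l]) = (\<Sum>k\<in>UNIV. A x i k * \<Gamma> p k m)"
    unfolding velocity_def up_def a_def[symmetric] g_def[symmetric] sum_distrib_right sum_distrib_left
    by (subst sum.swap) (simp only: mult_ac)
  moreover have "(\<Sum>l\<in>UNIV. nvt p [i, l] * g l m) = velocity_deriv (P x) (G x) (X x) (nabla G h x) DX K p i m"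
    unfolding velocity_deriv_def up_def g_def ..
  ultimately show ?thesis using 1 by (simp add: add_diff_eq)
qed

lemma psi_alternating: "alternating 4 (\<Psi> x)"
  by (rule hodge_alternating[OF V_alt]) simp

lemma dpsi: "length I = 5 \<Longrightarrow> alt1 (\<lambda>p J. pd p (\<lambda>y. \<Psi> y J) x) I = alt1 (\<lambda>p. act (K p) (\<Psi> x)) I"
proof -
  assume I: "length I = 5"
  have "alt1 (\<lambda>p J. pd p (\<lambda>y. \<Psi> y J) x) I = alt1 (\<lambda>p J. act (K p) (\<Psi> x) J + act (\<Gamma> p) (\<Psi> x) J) I"
    by (rule alt1_cong) (simp add: I pd_psi)
  then show ?thesis unfolding alt1_add alt1_act_symmetric(2)[of \<Gamma>, OF \<Gamma>_symmetric psi_alternating I] by simp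
qed

lemma dphi: "length I = 4 \<Longrightarrow> alt1 (\<lambda>p J. pd p (\<lambda>y. P y J) x) I = alt1 (\<lambda>p. act (K p) (P x)) I"
proof -
  assume I: "length I = 4"
  have "alt1 (\<lambda>p J. pd p (\<lambda>y. P y J) x) I = alt1 (\<lambda>p J. act (K p) (P x) J + act (\<Gamma> p) (P x) J) I"
    by (rule alt1_cong) (simp add: I pd_P)
  then show ?thesis unfolding alt1_add alt1_act_symmetric(1)[of \<Gamma>, OF \<Gamma>_symmetric alt[OF U(2)] I] by simp
qed

text \<open>The commutator of \<Gamma> with the velocity and the derivation of the \<Gamma>-part of
  \<partial>\<psi> combine to \<open>act (\<Gamma> p)\<close> of the 4-form \<open>act B S\<close>,
  which skew-symmetrisation removes. Commuting \<open>act B\<close> with the skew-symmetrisation of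
  the K-part produces the correction by velocity times K.\<close>

lemma dpsi_variation:
  assumes diff: "\<And>J. length J = 4 \<Longrightarrow> (\<lambda>y. act (A y) (\<Psi> y) J) differentiable (at x)" and I: "length I = 5"
  shows "alt1 (\<lambda>p J. pd p (\<lambda>y. act (A y) (\<Psi> y) J) x) I = act (A x) (alt1 (\<lambda>p. act (K p) (\<Psi> x))) I
    + alt1 (\<lambda>p. act (\<lambda>i m. velocity_deriv (P x) (G x) (X x) (nabla G h x) DX K p i m - (\<Sum>q\<in>UNIV. A x p q * K q i m)) (\<Psi> x)) I"
proof -
  define B where "B = A x"
  define S where "S = \<Psi> x"
  define N where "N = velocity_deriv (P x) (G x) (X x) (nabla G h x) DX K"
  have pdA: "pd p (\<lambda>y. act (A y) (\<Psi> y) J) x = act (N p) S J + (act (\<Gamma> p) (act B S) J - act B (act (\<Gamma> p) S) J)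
      + (act B (act (K p) S) J + act B (act (\<Gamma> p) S) J)" if J: "length J = 4" for p J
  proof (rule pd_unique[OF diff[OF J]])
    have "((\<lambda>r. act (A (x + r *\<^sub>R axis p 1)) (\<Psi> (x + r *\<^sub>R axis p 1)) J) has_real_derivative
        act (\<lambda>i m. N p i m + ((\<Sum>k\<in>UNIV. \<Gamma> p i k * B k m) - (\<Sum>k\<in>UNIV. B i k * \<Gamma> p k m))) (\<Psi> (x + 0 *\<^sub>R axis p 1)) J
        + act (A (x + 0 *\<^sub>R axis p 1)) (\<lambda>I. act (K p) S I + act (\<Gamma> p) S I) J) (at 0)"
    proof (rule act_deriv)
      show "((\<lambda>r. A (x + r *\<^sub>R axis p 1) i m) has_real_derivative N p i m + ((\<Sum>k\<in>UNIV. \<Gamma> p i k * B k m) - (\<Sum>k\<in>UNIV. B i k * \<Gamma> p k m))) (at 0)" for i m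
        using velocity_along[of p i m] unfolding N_def B_def .
      fix I :: "7 list" assume "length I = length J"
      then show "((\<lambda>r. \<Psi> (x + r *\<^sub>R axis p 1) I) has_real_derivative act (K p) S I + act (\<Gamma> p) S I) (at 0)"
        using along[OF psi_diff[of I], of p] pd_psi[of I p] J by (simp add: S_def)
    qed
    moreover have "act (\<lambda>i m. N p i m + ((\<Sum>k\<in>UNIV. \<Gamma> p i k * B k m) - (\<Sum>k\<in>UNIV. B i k * \<Gamma> p k m))) S J
        = act (N p) S J + (act (\<Gamma> p) (act B S) J - act B (act (\<Gamma> p) S) J)"
      unfolding act_add_left act_commutator ..
    ultimately show "((\<lambda>r. act (A (x + r *\<^sub>R axis p 1)) (\<Psi> (x + r *\<^sub>R axis p 1)) J) has_real_derivative
        act (N p) S J + (act (\<Gamma> p) (act B S) J - act B (act (\<Gamma> p) S) J)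
      + (act B (act (K p) S) J + act B (act (\<Gamma> p) S) J)) (at 0)"
      unfolding act_add by (simp add: S_def B_def)
  qed
  \<comment> \<open>\<open>act B S\<close> has to be a form for the symmetric connection to drop
    out.\<close>
  have alt_act: "alternating 4 (act B S)"
    unfolding alternating_def
  proof (intro allI impI, elim conjE)
    fix J :: "7 list" and m n :: nat assume J: "length J = 4" and mn: "m < n" "n < 4"
    from J obtain a b c d where J': "J = [a, b, c, d]" by (auto simp: length_Suc_conv numeral_eq_Suc)
    note sw = act_4_swap[OF psi_alternating[folded S_def], of B]
    have s1: "act B S [d, b, c, a] = - act B S [a, b, c, d]" "act B S [c, b, a, d] = - act B S [a, b, c, d]"
        "act B S [a, d, c, b] = - act B S [a, b, c, d]" for a b c d
      by (metis sw add.inverse_inverse)+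
    from mn consider "m = 0 \<and> n = 1" | "m = 0 \<and> n = 2" | "m = 0 \<and> n = 3" | "m = 1 \<and> n = 2" | "m = 1 \<and> n = 3" | "m = 2 \<and> n = 3"
      by linarith
    then show "act B S (J[m := J ! n, n := J ! m]) = - act B S J"
      by cases (simp_all add: J' numeral_eq_Suc del: act.simps, (rule sw s1)+)
  qed
  have "alt1 (\<lambda>p J. pd p (\<lambda>y. act (A y) (\<Psi> y) J) x) I
      = alt1 (\<lambda>p J. act (N p) S J + act (\<Gamma> p) (act B S) J + act B (act (K p) S) J) I"
    by (rule alt1_cong) (simp add: pdA I)
  also have "\<dots> = alt1 (\<lambda>p. act (N p) S) I + alt1 (\<lambda>p. act B (act (K p) S)) I"
    unfolding alt1_add alt1_act_symmetric(2)[of \<Gamma>, OF \<Gamma>_symmetric alt_act I] by simp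
  finally have e1: "alt1 (\<lambda>p J. pd p (\<lambda>y. act (A y) (\<Psi> y) J) x) I = alt1 (\<lambda>p. act (N p) S) I + alt1 (\<lambda>p. act B (act (K p) S)) I" .
  have e2: "act B (alt1 (\<lambda>p. act (K p) S)) I = alt1 (\<lambda>p J. \<Sum>q\<in>UNIV. B p q * act (K q) S J) I + alt1 (\<lambda>p. act B (act (K p) S)) I"
    unfolding act_alt1 alt1_add ..
  have "alt1 (\<lambda>p. act (\<lambda>i m. N p i m - (\<Sum>q\<in>UNIV. B p q * K q i m)) S) I
      = alt1 (\<lambda>p J. act (N p) S J + - 1 * (\<Sum>q\<in>UNIV. B p q * act (K q) S J)) I"
    unfolding act_diff_left act_sum_left act_scale_left by simp
  also have "\<dots> = alt1 (\<lambda>p. act (N p) S) I - alt1 (\<lambda>p J. \<Sum>q\<in>UNIV. B p q * act (K q) S J) I"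
    unfolding alt1_add alt1_scale by simp
  finally show ?thesis using e1 e2 unfolding B_def S_def N_def by simp
qed

text \<open>Metric compatibility: the connection terms of the metric turn the partial derivatives of
  X into \<open>DX\<close> and cancel against the connection term of the lowered index.\<close>

lemma nabla_lower_X: "nabla G (\<lambda>y. lower (G y) (X y)) x p [q] = (\<Sum>k\<in>UNIV. G x [q, k] * DX p $ k)"
proof -
  have "pd p (\<lambda>y. lower (G y) (X y) [q]) x = (\<Sum>k\<in>UNIV. act (\<Gamma> p) (G x) [q, k] * X x $ k + pd p (\<lambda>y. X y $ k) x * G x [q, k])"
  proof (rule pd_unique)
    show "(\<lambda>y. lower (G y) (X y) [q]) differentiable at x"
      by (simp add: lower_def G_diff X_diff)
    show "((\<lambda>r. lower (G (x + r *\<^sub>R axis p 1)) (X (x + r *\<^sub>R axis p 1)) [q]) has_real_derivative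
        (\<Sum>k\<in>UNIV. act (\<Gamma> p) (G x) [q, k] * X x $ k + pd p (\<lambda>y. X y $ k) x * G x [q, k])) (at 0)"
      unfolding lower_def nth_Cons_0
    proof (intro DERIV_sum)
      fix k
      show "((\<lambda>r. G (x + r *\<^sub>R axis p 1) [q, k] * X (x + r *\<^sub>R axis p 1) $ k) has_real_derivative
          act (\<Gamma> p) (G x) [q, k] * X x $ k + pd p (\<lambda>y. X y $ k) x * G x [q, k]) (at 0)"
        using DERIV_mult[OF metric_along[of p q k] along[OF X_diff[of k], of p]] by (simp del: act.simps(2))
    qed
  qed
  also have "\<dots> = (\<Sum>k\<in>UNIV. (\<Sum>m\<in>UNIV. \<Gamma> p q m * G x [m, k]) * X x $ k)
      + (\<Sum>k\<in>UNIV. (\<Sum>m\<in>UNIV. \<Gamma> p k m * G x [q, m]) * X x $ k) + (\<Sum>k\<in>UNIV. pd p (\<lambda>y. X y $ k) x * G x [q, k])"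
    by (simp add: distrib_right sum.distrib)
  also have "(\<Sum>k\<in>UNIV. (\<Sum>m\<in>UNIV. \<Gamma> p q m * G x [m, k]) * X x $ k) = act (\<Gamma> p) (lower (G x) (X x)) [q]"
    by (simp add: lower_def sum_distrib_left sum_distrib_right mult.assoc) (rule sum.swap)
  also have "(\<Sum>k\<in>UNIV. (\<Sum>m\<in>UNIV. \<Gamma> p k m * G x [q, m]) * X x $ k) = (\<Sum>m\<in>UNIV. G x [q, m] * (\<Sum>k\<in>UNIV. X x $ k * \<Gamma> p k m))"
    unfolding sum_distrib_left sum_distrib_right by (subst sum.swap) (simp only: mult_ac)
  finally show ?thesis
    unfolding nabla_act by (simp add: DX_def distrib_left sum.distrib mult.commute)
qed

lemma nabla_trace: "nabla G (\<lambda>y I. trace_g (G y) (h y)) x p [] = trace_g (G x) (nabla G h x p)"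
proof -
  define g where "g = ginv (G x)"
  have "pd p (\<lambda>y. trace_g (G y) (h y)) x = (\<Sum>i\<in>UNIV. \<Sum>j\<in>UNIV.
      - (\<Sum>k\<in>UNIV. \<Gamma> p k i * g k j + \<Gamma> p k j * g i k) * h x [i, j] + (nabla G h x p [i, j] + act (\<Gamma> p) (h x) [i, j]) * g i j)"
  proof (rule pd_unique)
    show "(\<lambda>y. trace_g (G y) (h y)) differentiable at x"
      by (simp add: trace_g_def ginv_diff h_diff)
    show "((\<lambda>r. trace_g (G (x + r *\<^sub>R axis p 1)) (h (x + r *\<^sub>R axis p 1))) has_real_derivative
        (\<Sum>i\<in>UNIV. \<Sum>j\<in>UNIV. - (\<Sum>k\<in>UNIV. \<Gamma> p k i * g k j + \<Gamma> p k j * g i k) * h x [i, j]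
          + (nabla G h x p [i, j] + act (\<Gamma> p) (h x) [i, j]) * g i j)) (at 0)"
      unfolding trace_g_def
    proof (intro DERIV_sum)
      fix i j
      show "((\<lambda>r. ginv (G (x + r *\<^sub>R axis p 1)) i j * h (x + r *\<^sub>R axis p 1) [i, j]) has_real_derivative
        - (\<Sum>k\<in>UNIV. \<Gamma> p k i * g k j + \<Gamma> p k j * g i k) * h x [i, j]
          + (nabla G h x p [i, j] + act (\<Gamma> p) (h x) [i, j]) * g i j) (at 0)"
        using DERIV_mult[OF along[OF ginv_diff[of i j], of p] along[OF h_diff[of i j], of p]]
        unfolding pd_ginv nabla_act g_def by (simp del: act.simps(2))
    qed
  qed
  also have "\<dots> = (\<Sum>i\<in>UNIV. \<Sum>j\<in>UNIV. nabla G h x p [i, j] * g i j)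
      + (\<Sum>i\<in>UNIV. \<Sum>j\<in>UNIV. (\<Sum>k\<in>UNIV. \<Gamma> p i k * h x [k, j]) * g i j) + (\<Sum>i\<in>UNIV. \<Sum>j\<in>UNIV. (\<Sum>k\<in>UNIV. \<Gamma> p j k * h x [i, k]) * g i j)
      - (\<Sum>i\<in>UNIV. \<Sum>j\<in>UNIV. (\<Sum>k\<in>UNIV. \<Gamma> p k i * g k j) * h x [i, j]) - (\<Sum>i\<in>UNIV. \<Sum>j\<in>UNIV. (\<Sum>k\<in>UNIV. \<Gamma> p k j * g i k) * h x [i, j])"
  proof -
    have "- (\<Sum>k\<in>UNIV. \<Gamma> p k i * g k j + \<Gamma> p k j * g i k) * h x [i, j] + (N + act (\<Gamma> p) (h x) [i, j]) * g i j
      = N * g i j + (\<Sum>k\<in>UNIV. \<Gamma> p i k * h x [k, j]) * g i j + (\<Sum>k\<in>UNIV. \<Gamma> p j k * h x [i, k]) * g i j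
        - (\<Sum>k\<in>UNIV. \<Gamma> p k i * g k j) * h x [i, j] - (\<Sum>k\<in>UNIV. \<Gamma> p k j * g i k) * h x [i, j]" for i j N
      by (simp add: sum.distrib distrib_right left_diff_distrib)
    then show ?thesis by (simp only: sum.distrib sum_subtractf)
  qed
  also have "(\<Sum>i\<in>UNIV. \<Sum>j\<in>UNIV. (\<Sum>k\<in>UNIV. \<Gamma> p i k * h x [k, j]) * g i j) = (\<Sum>i\<in>UNIV. \<Sum>j\<in>UNIV. (\<Sum>k\<in>UNIV. \<Gamma> p k i * g k j) * h x [i, j])"
    unfolding sum_distrib_right
    by (subst sum_rotate3) (rule sum.cong[OF refl], subst sum.swap, simp only: mult_ac)
  also have "(\<Sum>i\<in>UNIV. \<Sum>j\<in>UNIV. (\<Sum>k\<in>UNIV. \<Gamma> p j k * h x [i, k]) * g i j) = (\<Sum>i\<in>UNIV. \<Sum>j\<in>UNIV. (\<Sum>k\<in>UNIV. \<Gamma> p k j * g i k) * h x [i, j])"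
    unfolding sum_distrib_right by (rule sum.cong[OF refl], subst sum.swap) (simp only: mult_ac)
  finally show ?thesis
    unfolding nabla_act[of "\<lambda>y I. trace_g (G y) (h y)"] by (simp add: trace_g_def g_def mult.commute)
qed

end

section \<open>The evolution equations on the manifold\<close>

lemma sum_rotate5: "(\<Sum>p\<in>P. \<Sum>l\<in>A. \<Sum>m\<in>B. \<Sum>a\<in>C. \<Sum>b\<in>D. f p l m a b) = (\<Sum>b\<in>D. \<Sum>p\<in>P. \<Sum>l\<in>A. \<Sum>m\<in>B. \<Sum>a\<in>C. f p l m a b)"
proof -
  have "(\<Sum>p\<in>P. \<Sum>l\<in>A. \<Sum>m\<in>B. \<Sum>a\<in>C. \<Sum>b\<in>D. f p l m a b) = (\<Sum>p\<in>P. \<Sum>b\<in>D. \<Sum>l\<in>A. \<Sum>m\<in>B. \<Sum>a\<in>C. f p l m a b)"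
    by (rule sum.cong[OF refl], rule sum_rotate4)
  also have "\<dots> = (\<Sum>b\<in>D. \<Sum>p\<in>P. \<Sum>l\<in>A. \<Sum>m\<in>B. \<Sum>a\<in>C. f p l m a b)" by (rule sum.swap)
  finally show ?thesis .
qed

theorem proposition3p11:
  fixes M :: "'m topology"
    and \<A> :: "'m chart set"
    and T :: "real set"
    and \<phi> g vol h \<tau>0 \<tau>1 \<tau>2 \<tau>3 :: "real \<Rightarrow> 'm field"
    and X :: "real \<Rightarrow> 'm vfield"
    and c :: "'m chart" and x :: "real^7" and t :: real and i j :: 7
  assumes manifold: "smooth_manifold7 M \<A>"
    and interval: "open T" "is_interval T"
    and family: "smooth_G2_family \<A> T \<phi>"
    and metric: "\<And>t. t \<in> T \<Longrightarrow> G2_metric_volume \<A> (\<phi> t) (g t) (vol t)"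
    and torsion: "\<And>t. t \<in> T \<Longrightarrow>
          torsion_forms \<A> (\<phi> t) (g t) (vol t) (\<tau>0 t) (\<tau>1 t) (\<tau>2 t) (\<tau>3 t)"
    and h: "\<And>t. t \<in> T \<Longrightarrow> symmetric_field \<A> (h t)"
    and X: "\<And>t. t \<in> T \<Longrightarrow> vector_field \<A> (X t)"
    and flow: "G2_flow \<A> T \<phi> g vol h X"
    and t: "t \<in> T" and c: "c \<in> \<A>" and x: "x \<in> chart_image c"
  shows
    "let G = g t c x;
         P = \<phi> t c x;
         \<psi> = hodge 3 G (vol t c x) P;
         H = h t c x;
         S1 = covector_skew G P (\<tau>1 t c x);
         S2 = \<tau>2 t c x;
         S3 = \<tau>3 t c x;
         XX = vector_skew P (X t c x);
         nh = nabla (g t c) (h t c) x;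
         nX = (\<lambda>p q. nabla (g t c) (\<lambda>y. lower (g t c y) (X t c y)) x p [q]);
         ntr = (\<lambda>k. nabla (g t c) (\<lambda>y I. trace_g (g t c y) (h t c y)) x k []);
         div_h = (\<Sum>p\<in>UNIV. \<Sum>q\<in>UNIV. \<Sum>k\<in>UNIV. \<Sum>l\<in>UNIV.
                    ginv G p q * nh p [q, k] * ginv G k l * P [l, i, j]);
         grad_tr = (\<Sum>k\<in>UNIV. \<Sum>l\<in>UNIV. ntr k * ginv G k l * P [l, i, j]);
         curl_X = (\<Sum>p\<in>UNIV. \<Sum>q\<in>UNIV. \<Sum>a\<in>UNIV. \<Sum>b\<in>UNIV. \<Sum>k\<in>UNIV. \<Sum>l\<in>UNIV.
                    nX p q * ginv G p a * ginv G q b * P [a, b, k] * ginv G k l * P [l, i, j]);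
         curl_h = (\<lambda>m n. \<Sum>k\<in>UNIV. \<Sum>l\<in>UNIV. \<Sum>a\<in>UNIV. \<Sum>b\<in>UNIV.
                    nh k [l, m] * ginv G k a * ginv G l b * P [a, b, n])
     in
       ((\<lambda>s. covector_skew (g s c x) (\<phi> s c x) (\<tau>1 s c x) [i, j]) has_real_derivative
          pi7 G \<psi> (\<lambda>I. 1/2 * comm G H S3 I + 1/2 * acomm G H S1 I + 1/4 * acomm G H S2 I) [i, j]
          + pi14 G \<psi> (acomm G H S1) [i, j]
          + 1/4 * \<tau>0 t c x [] * XX [i, j]
          + pi7 G \<psi> (\<lambda>I. - 1/2 * acomm G XX S3 I - 1/2 * comm G XX S1 I
                           + 1/12 * comm G XX S2 I) [i, j]
          + pi14 G \<psi> (\<lambda>I. - 1/3 * comm G XX S1 I) [i, j]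
          - 1/6 * div_h + 1/6 * grad_tr + 1/6 * curl_X) (at t)
     \<and> ((\<lambda>s. \<tau>2 s c x [i, j]) has_real_derivative
          pi7 G \<psi> (acomm G H S2) [i, j]
          + pi14 G \<psi> (\<lambda>I. - comm G H S3 I + acomm G H S1 I + 1/2 * acomm G H S2 I) [i, j]
          + pi7 G \<psi> (\<lambda>I. - 1/3 * comm G XX S2 I) [i, j]
          + pi14 G \<psi> (\<lambda>I. acomm G XX S3 I + 1/3 * comm G XX S1 I) [i, j]
          - curl_h i j + curl_h j i
          - 1/3 * div_h + 1/3 * grad_tr
          - nX i j + nX j i + 1/3 * curl_X) (at t)"
proof -
  define U where "U = chart_image c"
  have U: "open U" "x \<in> U" using manifold c x by (auto simp: smooth_manifold7_def U_def)
  have W: "open (T \<times> U)" using interval(1) U(1) by (rule open_Times)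
  have metric': "symmetric2 (g s c y)" "alternating 7 (vol s c y)" "(vol s c y idl)\<^sup>2 = det (gmat (g s c y))"
    "length I = 7 \<Longrightarrow> wedge 4 (wedge 2 (interior u (\<phi> s c y)) (interior v (\<phi> s c y))) (\<phi> s c y) I
      = - 6 * (u \<bullet> (gmat (g s c y) *v v)) * vol s c y I" if "s \<in> T" "y \<in> U" for s y u v I
    using metric[OF that(1)] c that(2)
    unfolding G2_metric_volume_def symmetric_field_def form_field_def U_def idl_facts(6) by blast+
  have phi: "alternating 3 (\<phi> s c y)" "\<exists>L. invertible L \<and> (\<forall>I. length I = 3 \<longrightarrow> \<phi> s c y I = pullback 3 L phi0 I)"
    if "s \<in> T" "y \<in> U" for s y
    using family c that unfolding smooth_G2_family_def G2_structure_def form_field_def U_def by blast+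
  have frames: "\<exists>L. g2_frame L (\<phi> s c y) (g s c y) (vol s c y)" if sy: "s \<in> T" "y \<in> U" for s y
  proof -
    obtain L where L: "invertible L" "\<And>I. length I = 3 \<Longrightarrow> \<phi> s c y I = pullback 3 L phi0 I"
      using phi(2)[OF sy] by blast
    have "g2_frame L (\<phi> s c y) (g s c y) (vol s c y)"
      by (rule g2_frameI[OF L metric'(2,3)[OF sy] metric'(4)[OF sy]])
    then show ?thesis ..
  qed
  have phiC: "Ck_on 2 (T \<times> U) (\<lambda>z. \<phi> (fst z) c (snd z) I)" if "length I = 3" for I
    using family c that by (simp add: smooth_G2_family_def smooth_on_def U_def case_prod_unfold)
  have fr: "\<exists>L. g2_frame L (\<phi> (fst z) c (snd z)) (g (fst z) c (snd z)) (vol (fst z) c (snd z))" if "z \<in> T \<times> U" for z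
    using that frames by auto
  have al: "alternating 7 (vol (fst z) c (snd z))" if "z \<in> T \<times> U" for z
    using that metric'(2) by auto
  have re: "wedge 4 (wedge 2 (interior u (\<phi> (fst z) c (snd z))) (interior v (\<phi> (fst z) c (snd z)))) (\<phi> (fst z) c (snd z)) I
      = - 6 * (u \<bullet> (gmat (g (fst z) c (snd z)) *v v)) * vol (fst z) c (snd z) I" if "z \<in> T \<times> U" "length I = 7" for z u v I
    using that metric'(4) by auto
  define psi where "psi s y = hodge 3 (g s c y) (vol s c y) (\<phi> s c y)" for s y
  \<comment> \<open>Class C^2 jointly in time and space is what the exchange of derivatives
    requires; it is inherited from \<phi>.\<close>
  have gC: "Ck_on 2 (T \<times> U) (\<lambda>z. g (fst z) c (snd z) [i, j])" for i j
    by (rule Ck_on_G2(1)[OF W fr phiC al re])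
  have giC: "Ck_on 2 (T \<times> U) (\<lambda>z. ginv (g (fst z) c (snd z)) i j)" for i j
    by (rule Ck_on_G2(2)[OF W fr phiC al re])
  have psiC: "Ck_on 2 (T \<times> U) (\<lambda>z. psi (fst z) (snd z) J)" if "length J = 4" for J
    unfolding psi_def by (rule Ck_on_G2(3)[OF W fr phiC al re that])
  have deriv: "(F has_derivative frechet_derivative F (at (t, y))) (at (t, y))" if "Ck_on 2 (T \<times> U) F" "y \<in> U"
    for F :: "real \<times> (real^7) \<Rightarrow> real" and y
    using Ck_on_SucD(1)[of 1 "T \<times> U" F "(t, y)"] that t by (simp add: numeral_2_eq_2)
  have diff: "(\<lambda>y. F (t, y)) differentiable (at x)" if "Ck_on 2 (T \<times> U) F" for F :: "real \<times> (real^7) \<Rightarrow> real"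
    using slice_derivative(1)[OF deriv[OF that U(2)]] unfolding differentiable_def by blast
  have timed: "((\<lambda>s. F (s, y)) has_real_derivative frechet_derivative F (at (t, y)) (1, 0)) (at t)"
    if "Ck_on 2 (T \<times> U) F" "y \<in> U" for F :: "real \<times> (real^7) \<Rightarrow> real" and y
    by (rule slice_derivative(2)[OF deriv[OF that]])
  interpret G: local_G2 U x "\<phi> t c" "g t c" "vol t c"
  proof
    show "open U" "x \<in> U" by (rule U)+
    show "\<exists>L. g2_frame L (\<phi> t c y) (g t c y) (vol t c y)" "alternating 3 (\<phi> t c y)" if "y \<in> U" for y
      using frames phi(1) t that by blast+
    show "(\<lambda>y. \<phi> t c y I) differentiable (at x)" if "length I = 3" for I using diff[OF phiC[OF that]] by simp
    show "(\<lambda>y. g t c y [i, j]) differentiable (at x)" for i j using diff[OF gC] by simp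
    show "(\<lambda>y. ginv (g t c y) i j) differentiable (at x)" for i j using diff[OF giC] by simp
    show "(\<lambda>y. hodge 3 (g t c y) (vol t c y) (\<phi> t c y) I) differentiable (at x)" if "length I = 4" for I
      using diff[OF psiC[OF that]] by (simp add: psi_def)
  qed
  have h_sym: "h t c y [i, j] = h t c y [j, i]" if "y \<in> U" for y i j
    using h[OF t] c that unfolding symmetric_field_def symmetric2_def U_def by blast
  have "smooth_on U (\<lambda>y. h t c y I)" if "length I = 2" for I
    using h[OF t] c that unfolding symmetric_field_def tensor_field_def U_def by blast
  then have "Ck_on (Suc 0) U (\<lambda>y. h t c y [i, j])" for i j
    unfolding smooth_on_def by (simp del: Ck_on.simps)
  then have h_diff: "(\<lambda>y. h t c y [i, j]) differentiable (at x)" for i j using U(2) by simp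
  have "smooth_on U (X t c)"
    using X[OF t] c unfolding vector_field_def U_def by blast
  then have "Ck_on (Suc 0) U (X t c)" unfolding smooth_on_def by blast
  then have "X t c differentiable (at x)" using U(2) by simp
  then have X_diff: "(\<lambda>y. X t c y $ n) differentiable (at x)" for n
    unfolding differentiable_def using bounded_linear.has_derivative[OF bounded_linear_vec_nth] by blast
  obtain K where K: "\<And>p I. length I = 3 \<Longrightarrow> pd p (\<lambda>y. \<phi> t c y I) x = act (K p) (\<phi> t c x) I + act (G.\<Gamma> p) (\<phi> t c x) I"
    "\<And>p I. length I = 4 \<Longrightarrow> pd p (\<lambda>y. hodge 3 (g t c y) (vol t c y) (\<phi> t c y) I) x
      = act (K p) (hodge 3 (g t c x) (vol t c x) (\<phi> t c x)) I + act (G.\<Gamma> p) (hodge 3 (g t c x) (vol t c x) (\<phi> t c x)) I"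
    "\<And>p i j. act (K p) (g t c x) [i, j] = 0"
    using G.torsion_connection by blast
  interpret F: local_flow U x "\<phi> t c" "g t c" "vol t c" "h t c" "X t c" K
    by standard (fact h_diff X_diff K(1) K(2) metric'(2)[OF t U(2)])+
  define A where "A y = velocity (\<phi> t c y) (g t c y) (h t c y) (X t c y)" for y
  have inT: "\<forall>\<^sub>F s in nhds t. s \<in> T" using interval(1) t by (rule eventually_nhds_in_open)
  have fr_ev: "\<forall>\<^sub>F s in nhds t. \<exists>L. g2_frame L (\<phi> s c y) (g s c y) (vol s c y)" if "y \<in> U" for y
    using inT by (rule eventually_mono) (rule frames[OF _ that])
  have phi': "((\<lambda>s. \<phi> s c y I) has_real_derivative act (A y) (\<phi> t c y) I) (at t)" if y: "y \<in> U" and I: "length I = 3" for y I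
  proof -
    obtain L where L: "g2_frame L (\<phi> t c y) (g t c y) (vol t c y)" using frames[OF t y] ..
    from I obtain i j k where I': "I = [i, j, k]" by (auto simp: length_Suc_conv numeral_eq_Suc)
    show ?thesis
      using flow t c y unfolding G2_flow_def U_def I' A_def velocity_def flow_eq_act[OF L, symmetric] by blast
  qed
  have g_t: "((\<lambda>s. g s c y [i, j]) has_real_derivative frechet_derivative (\<lambda>z. g (fst z) c (snd z) [i, j]) (at (t, y)) (1, 0)) (at t)"
    "((\<lambda>s. ginv (g s c y) i j) has_real_derivative frechet_derivative (\<lambda>z. ginv (g (fst z) c (snd z)) i j) (at (t, y)) (1, 0)) (at t)"
    if "y \<in> U" for y i j
    using timed[OF gC that] timed[OF giC that] by simp_all
  have psi': "((\<lambda>s. psi s y J) has_real_derivative act (A y) (psi t y) J) (at t)" if y: "y \<in> U" and J: "length J = 4" for y J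
    unfolding psi_def by (rule variation(2)[OF fr_ev[OF y] phi'[OF y] g_t[OF y] J])
  have ginv': "((\<lambda>s. ginv (g s c x) l m) has_real_derivative
      - (\<Sum>k\<in>UNIV. A x k l * ginv (g t c x) k m + A x k m * ginv (g t c x) l k)) (at t)" for l m
    by (rule variation(3)[OF fr_ev[OF U(2)] phi'[OF U(2)] g_t[OF U(2)]])
  define \<beta> where "\<beta> s = alt1 (\<lambda>p J. pd p (\<lambda>y. psi s y J) x)" for s
  define \<Omega> where "\<Omega> = alt1 (\<lambda>p. act (\<lambda>i m. velocity_deriv (\<phi> t c x) (g t c x) (X t c x) (nabla (g t c) (h t c) x) F.DX K p i m
    - (\<Sum>q\<in>UNIV. A x p q * K q i m)) (psi t x))"
  \<comment> \<open>The formula for the time derivative of \<psi> holds throughout U at the time t,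
    so it may be differentiated in space; this also yields the differentiability of
    \<open>act (A y) (psi t y) J\<close> at x.\<close>
  have mixed: "(\<lambda>y. act (A y) (psi t y) J) differentiable (at x)"
    "((\<lambda>s. pd p (\<lambda>y. psi s y J) x) has_real_derivative pd p (\<lambda>y. act (A y) (psi t y) J) x) (at t)" if "length J = 4" for J p
    using mixed_derivative[OF interval(1) t U psiC[OF that], of "\<lambda>y. act (A y) (psi t y) J"] psi'[OF _ that] by simp_all
  have \<beta>': "((\<lambda>s. \<beta> s I) has_real_derivative act (A x) (\<beta> t) I + \<Omega> I) (at t)" if I: "length I = 5" for I
  proof -
    have "((\<lambda>s. \<beta> s I) has_real_derivative alt1 (\<lambda>p J. pd p (\<lambda>y. act (A y) (psi t y) J) x) I) (at t)"
      unfolding \<beta>_def by (rule alt1_deriv, rule mixed(2)) (simp add: I)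
    also have "alt1 (\<lambda>p J. pd p (\<lambda>y. act (A y) (psi t y) J) x) I = act (A x) (alt1 (\<lambda>p. act (K p) (psi t x))) I + \<Omega> I"
      unfolding \<Omega>_def A_def psi_def
      by (rule F.dpsi_variation[OF _ I]) (use mixed(1) in \<open>simp add: A_def psi_def\<close>)
    also have "act (A x) (alt1 (\<lambda>p. act (K p) (psi t x))) I = act (A x) (\<beta> t) I"
      unfolding \<beta>_def psi_def by (rule act_cong) (simp add: F.dpsi I)
    finally show ?thesis .
  qed
  have tors: "\<tau>2 s c x [a, b] = - \<tau>2 s c x [b, a]"
    "ctr (g s c x) (ctr (g s c x) (\<lambda>U W. \<tau>2 s c x U * \<phi> s c x W)) [] [k] = 0"
    "length I = 5 \<Longrightarrow> \<beta> s I = 4 * wedge 1 (\<tau>1 s c x) (psi s x) I + hodge 2 (g s c x) (vol s c x) (\<tau>2 s c x) I"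
    if s: "s \<in> T" for s a b k I
  proof -
    have x': "x \<in> chart_image c" using x .
    have f: "form_field \<A> 2 (\<tau>2 s)"
      and r: "(\<Sum>i\<in>UNIV. \<Sum>j\<in>UNIV. \<Sum>a\<in>UNIV. \<Sum>b\<in>UNIV.
             \<tau>2 s c x [i, j] * ginv (g s c x) i a * ginv (g s c x) j b * \<phi> s c x [a, b, k]) = 0"
      and e: "length I = 5 \<Longrightarrow> extd (\<lambda>y. hodge 3 (g s c y) (vol s c y) (\<phi> s c y)) x I =
             4 * wedge 1 (\<tau>1 s c x) (hodge 3 (g s c x) (vol s c x) (\<phi> s c x)) I
             + hodge 2 (g s c x) (vol s c x) (\<tau>2 s c x) I"
      using torsion[OF s] c x' unfolding torsion_forms_def by blast+
    have "alternating 2 (\<tau>2 s c x)" using f c x' unfolding form_field_def by blast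
    from alternatingD[OF this, of "[b, a]" 0 1] show "\<tau>2 s c x [a, b] = - \<tau>2 s c x [b, a]" by simp
    show "ctr (g s c x) (ctr (g s c x) (\<lambda>U W. \<tau>2 s c x U * \<phi> s c x W)) [] [k] = 0"
      using r unfolding contract_two[where I = "[]" and K = "[k]"] .
    show "length I = 5 \<Longrightarrow> \<beta> s I = 4 * wedge 1 (\<tau>1 s c x) (psi s x) I + hodge 2 (g s c x) (vol s c x) (\<tau>2 s c x) I"
      using e unfolding \<beta>_def psi_def extd_eq_alt1 .
  qed
  \<comment> \<open>Valid at every time in T, not just at t: the torsion forms thereby become
    functions of time that are known to be differentiable.\<close>
  have recover: "pi7 (g s c x) (psi s x) (phi_contract (g s c x) (\<phi> s c x) (\<beta> s)) [a, b] = - 48 * covector_skew (g s c x) (\<phi> s c x) (\<tau>1 s c x) [a, b]"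
    "pi14 (g s c x) (psi s x) (phi_contract (g s c x) (\<phi> s c x) (\<beta> s)) [a, b] = 6 * \<tau>2 s c x [a, b]" if s: "s \<in> T" for s a b
  proof -
    obtain L where L: "g2_frame L (\<phi> s c x) (g s c x) (vol s c x)" using frames[OF s U(2)] ..
    have e: "\<And>I. length I = 5 \<Longrightarrow> \<beta> s I = 4 * wedge 1 (\<tau>1 s c x) (hodge 3 (g s c x) (vol s c x) (\<phi> s c x)) I
        + hodge 2 (g s c x) (vol s c x) (\<tau>2 s c x) I"
      using tors(3)[OF s] unfolding psi_def .
    show "pi7 (g s c x) (psi s x) (phi_contract (g s c x) (\<phi> s c x) (\<beta> s)) [a, b] = - 48 * covector_skew (g s c x) (\<phi> s c x) (\<tau>1 s c x) [a, b]"
      unfolding psi_def by (rule torsion_extraction(1)[OF L tors(1,2)[OF s] e])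
    show "pi14 (g s c x) (psi s x) (phi_contract (g s c x) (\<phi> s c x) (\<beta> s)) [a, b] = 6 * \<tau>2 s c x [a, b]"
      unfolding psi_def by (rule torsion_extraction(2)[OF L tors(1,2)[OF s] e])
  qed
  define \<Phi> where "\<Phi> = phi_contract (g t c x) (\<phi> t c x) \<Omega>"
  have contr: "((\<lambda>s. phi_contract (g s c x) (\<phi> s c x) (\<beta> s) J) has_real_derivative
      act (A x) (phi_contract (g t c x) (\<phi> t c x) (\<beta> t)) J + \<Phi> J) (at t)" if "length J = 2" for J
    unfolding \<Phi>_def by (rule phi_contract_deriv[OF ginv' phi'[OF U(2)] \<beta>']) (simp_all add: that)
  have d1: "((\<lambda>s. covector_skew (g s c x) (\<phi> s c x) (\<tau>1 s c x) [i, j]) has_real_derivative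
      act (A x) (covector_skew (g t c x) (\<phi> t c x) (\<tau>1 t c x)) [i, j] - 1 / 48 * pi7 (g t c x) (psi t x) \<Phi> [i, j]) (at t)"
  proof -
    have d: "((\<lambda>s. pi7 (g s c x) (psi s x) (phi_contract (g s c x) (\<phi> s c x) (\<beta> s)) [i, j]) has_real_derivative
        act (A x) (pi7 (g t c x) (psi t x) (phi_contract (g t c x) (\<phi> t c x) (\<beta> t))) [i, j] + pi7 (g t c x) (psi t x) \<Phi> [i, j]) (at t)"
      by (rule pi_deriv(1)[OF ginv' psi'[OF U(2)] contr])
    have e: "act (A x) (pi7 (g t c x) (psi t x) (phi_contract (g t c x) (\<phi> t c x) (\<beta> t))) [i, j]
        = act (A x) (\<lambda>I. - 48 * covector_skew (g t c x) (\<phi> t c x) (\<tau>1 t c x) I) [i, j]"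
      by (rule act_cong) (auto simp: length_Suc_conv recover[OF t])
    \<comment> \<open>The equality near t transfers the derivative of the projected contraction to
      tau_1; its homogeneous part recombines into the derivation of tau_1 itself.\<close>
    have ev: "\<forall>\<^sub>F s in nhds t. covector_skew (g s c x) (\<phi> s c x) (\<tau>1 s c x) [i, j]
        = (- 1 / 48) * pi7 (g s c x) (psi s x) (phi_contract (g s c x) (\<phi> s c x) (\<beta> s)) [i, j]"
      using inT by (rule eventually_mono) (simp add: recover)
    show ?thesis
      using DERIV_cong_ev[OF refl ev refl] DERIV_cmult[OF d, of "- 1 / 48"] unfolding e act_scale
      by (simp add: algebra_simps del: act.simps)
  qed
  have d2: "((\<lambda>s. \<tau>2 s c x [i, j]) has_real_derivative
      act (A x) (\<tau>2 t c x) [i, j] + 1 / 6 * pi14 (g t c x) (psi t x) \<Phi> [i, j]) (at t)"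
  proof -
    have d: "((\<lambda>s. pi14 (g s c x) (psi s x) (phi_contract (g s c x) (\<phi> s c x) (\<beta> s)) [i, j]) has_real_derivative
        act (A x) (pi14 (g t c x) (psi t x) (phi_contract (g t c x) (\<phi> t c x) (\<beta> t))) [i, j] + pi14 (g t c x) (psi t x) \<Phi> [i, j]) (at t)"
      by (rule pi_deriv(2)[OF ginv' psi'[OF U(2)] contr])
    have e: "act (A x) (pi14 (g t c x) (psi t x) (phi_contract (g t c x) (\<phi> t c x) (\<beta> t))) [i, j]
        = act (A x) (\<lambda>I. 6 * \<tau>2 t c x I) [i, j]"
      by (rule act_cong) (auto simp: length_Suc_conv recover[OF t])
    have ev: "\<forall>\<^sub>F s in nhds t. \<tau>2 s c x [i, j]
        = (1 / 6) * pi14 (g s c x) (psi s x) (phi_contract (g s c x) (\<phi> s c x) (\<beta> s)) [i, j]"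
      using inT by (rule eventually_mono) (simp add: recover)
    show ?thesis
      using DERIV_cong_ev[OF refl ev refl] DERIV_cmult[OF d, of "1 / 6"] unfolding e act_scale
      by (simp add: algebra_simps del: act.simps)
  qed
  obtain L where L: "g2_frame L (\<phi> t c x) (g t c x) (vol t c x)" using frames[OF t U(2)] ..
  then obtain M where L_M: "L ** M = mat 1" by (auto simp: g2_frame_def invertible_def)
  let ?G = "g t c x" and ?P = "\<phi> t c x" and ?X = "X t c x"
  define nh where "nh = nabla (g t c) (h t c) x"
  have nh_sym: "nh p [i, j] = nh p [j, i]" for p i j
  proof -
    have "pd p (\<lambda>y. h t c y [i, j]) x = pd p (\<lambda>y. h t c y [j, i]) x"
      by (rule pd_cong[OF U h_diff h_sym])
    moreover have "act (G.\<Gamma> p) (h t c x) [i, j] = act (G.\<Gamma> p) (h t c x) [j, i]"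
      by (simp add: h_sym[OF U(2), of i] h_sym[OF U(2), of _ j for j])
    ultimately show ?thesis unfolding nh_def F.nabla_act by simp
  qed
  have tors3: "\<tau>3 t c x [i, j] = \<tau>3 t c x [j, i]" "trace_g ?G (\<tau>3 t c x) = 0"
    "length J = 4 \<Longrightarrow> extd (\<phi> t c) x J = \<tau>0 t c x [] * hodge 3 ?G (vol t c x) ?P J + 3 * wedge 1 (\<tau>1 t c x) ?P J
      + hodge 3 ?G (vol t c x) (sym_to_3form ?G ?P (\<tau>3 t c x)) J" for i j J
    using torsion[OF t] c x unfolding torsion_forms_def symmetric_field_def symmetric2_def by blast+
  have E1: "\<forall>J. length J = 4 \<longrightarrow> alt1 (\<lambda>p. act (K p) ?P) J = \<tau>0 t c x [] * hodge 3 ?G (vol t c x) ?P J + 3 * wedge 1 (\<tau>1 t c x) ?P J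
      + hodge 3 ?G (vol t c x) (sym_to_3form ?G ?P (\<tau>3 t c x)) J"
    using tors3(3) by (simp add: extd_eq_alt1 F.dphi)
  have E2: "\<forall>J. length J = 5 \<longrightarrow> alt1 (\<lambda>p. act (K p) (hodge 3 ?G (vol t c x) ?P)) J = 4 * wedge 1 (\<tau>1 t c x) (hodge 3 ?G (vol t c x) ?P) J
      + hodge 2 ?G (vol t c x) (\<tau>2 t c x) J"
    using tors(3)[OF t] by (simp add: \<beta>_def psi_def F.dpsi)
  note evolution = frame_torsion_evolution[where L = L and M = M and P = ?P and G = ?G and V = "vol t c x" and h = "h t c x" and nh = nh and K = K
    and ?\<tau>1.0 = "\<tau>1 t c x" and ?\<tau>2.0 = "\<tau>2 t c x" and ?\<tau>3.0 = "\<tau>3 t c x" and ?t0.0 = "\<tau>0 t c x []"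
    and X = ?X and DX = F.DX and i = i and j = j, OF L L_M K(3) h_sym[OF U(2)] nh_sym tors(1,2)[OF t] tors3(1,2) E1 E2]
  have \<Phi>: "\<Phi> = variation_form ?P ?G (vol t c x) (h t c x) ?X nh F.DX K"
    unfolding \<Phi>_def \<Omega>_def variation_form_def A_def psi_def nh_def ..
  have XX: "comm ?G (interior ?X ?P) B = comm ?G (vector_skew ?P ?X) B" "acomm ?G (interior ?X ?P) B = acomm ?G (vector_skew ?P ?X) B"
    "interior ?X ?P [a, b] = vector_skew ?P ?X [a, b]" for B a b
    by (simp_all add: fun_eq_iff comm_def acomm_def vector_skew_def interior_def)
  have lower: "nabla_lower ?G F.DX [a, b] = nabla (g t c) (\<lambda>y. lower (g t c y) (X t c y)) x a [b]" for a b
    unfolding F.nabla_lower_X nabla_lower_def by simp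
  have div: "covector_skew ?G ?P (div_covector ?G nh) [i, j] = (\<Sum>p\<in>UNIV. \<Sum>q\<in>UNIV. \<Sum>k\<in>UNIV. \<Sum>l\<in>UNIV.
      ginv ?G p q * nh p [q, k] * ginv ?G k l * ?P [l, i, j])"
    unfolding covector_skew_def div_covector_def sum_distrib_right nth_Cons_0 nth_Cons_Suc One_nat_def
    by (subst (2) sum_rotate4, subst (2) sum_rotate4) rule
  have trc: "covector_skew ?G ?P (trace_covector ?G nh) [i, j] = (\<Sum>k\<in>UNIV. \<Sum>l\<in>UNIV.
      nabla (g t c) (\<lambda>y I. trace_g (g t c y) (h t c y)) x k [] * ginv ?G k l * ?P [l, i, j])"
    by (simp add: covector_skew_def trace_covector_def F.nabla_trace nh_def)
  have curl: "covector_skew ?G ?P (curl_covector ?P ?G F.DX) [i, j] = (\<Sum>p\<in>UNIV. \<Sum>q\<in>UNIV. \<Sum>a\<in>UNIV. \<Sum>b\<in>UNIV. \<Sum>k\<in>UNIV. \<Sum>l\<in>UNIV.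
      nabla (g t c) (\<lambda>y. lower (g t c y) (X t c y)) x p [q] * ginv ?G p a * ginv ?G q b * ?P [a, b, k] * ginv ?G k l * ?P [l, i, j])"
    unfolding covector_skew_def curl_covector_def contract_two[where I = "[]" and K = "[_]", symmetric] lower
      \<comment> \<open>The summation variables p, q, a, b have to be moved outside k and l to match
        the stated order of the sums.\<close>
      sum_distrib_right nth_Cons_0 nth_Cons_Suc One_nat_def
    by (subst sum_rotate5) (rule sum.cong[OF refl], rule sum_rotate5[symmetric])
  have curlh: "curl_tensor ?P ?G nh [a, b] = (\<Sum>k\<in>UNIV. \<Sum>l\<in>UNIV. \<Sum>p\<in>UNIV. \<Sum>q\<in>UNIV.
      nh k [l, a] * ginv ?G k p * ginv ?G l q * ?P [p, q, b])" for a b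
    unfolding curl_tensor_def
    using contract_two[where I = "[a]" and K = "[b]" and \<beta> = "\<lambda>U. nh (hd U) (tl U)" and g = ?G and \<phi> = ?P] by simp
  note d1' = d1[unfolded psi_def \<Phi> A_def evolution(1)] and d2' = d2[unfolded psi_def \<Phi> A_def evolution(2)]
  show ?thesis
    unfolding Let_def
    using d1'[unfolded XX div trc curl lower, unfolded nh_def] d2'[unfolded XX div trc curl curlh lower, unfolded nh_def]
    by (intro conjI)
qed

end
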